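(* Let $K$ be a field, $Q$ a finite quiver with vertex set $I$, $<$ a total ordering on the arrows of the double $\overline{Q}$, $q\in(K^* )^I$, and $\Lambda^q=\Lambda^q(Q,<)$ the multiplicative preprojective algebra. There is a rigid simple representation of $\Lambda^q$ of dimension vector $\alpha$ if and only if $\alpha$ is a positive real root, $q^\alpha=1$, and there is no decomposition $\alpha=\beta+\gamma+\cdots$ as a sum of two or more positive roots with $q^\beta=q^\gamma=\cdots=1$.
   Context: Arrows $a$ have head $h(a)$ and tail $t(a)$. The path algebra $KQ$ has as basis the paths $a_1\cdots a_n$ with $t(a_i)=h(a_{i+1})$ together with trivial paths $e_v$ ($v\in I$). The double $\overline{Q}$ is obtained from $Q$ by adjoining a reverse arrow $a^*$ for each arrow $a\in Q$; $(a^* )^*=a$; $\epsilon(a)=1$ if $a\in Q$ and $\epsilon(a)=-1$ if $a^*\in Q$. With $a_1<a_2<\dots<a_n$ the arrows of $\overline{Q}$, $\Lambda^q$ is the target of the universal $K$-algebra homomorphism $K\overline{Q}\to R$ such that $1+aa^*$ is invertible in $R$ for all $a\in\overline{Q}$ and $(1+a_1a_1^* )^{\epsilon(a_1)}\cdots(1+a_na_n^* )^{\epsilon(a_n)}=\sum_{v\in I}q_ve_v$ in $R$. Representations of $\Lambda^q$ are left $\Lambda^q$-modules; the dimension vector of a finite-dimensional representation $X$ has $v$-component $\dim_Ke_vX$. A finite-dimensional simple representation $X$ is rigid if $\operatorname{Ext}^1_{\Lambda^q}(X,X)=0$. For $\alpha\in\mathbb{Z}^I$, $q^\alpha=\prod_{v\in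 I}q_v^{\alpha_v}$. Roots of $Q$: put $(\alpha,\beta)=2\sum_{v\in I}\alpha_v\beta_v-\sum_{a\in Q}(\alpha_{h(a)}\beta_{t(a)}+\alpha_{t(a)}\beta_{h(a)})$ on $\mathbb{Z}^I$. A vertex $v$ is loopfree if no arrow has head and tail both equal to $v$. Let $\epsilon_v$ be the coordinate vectors. For loopfree $v$ put $s_v(\alpha)=\alpha-(\alpha,\epsilon_v)\epsilon_v$; the Weyl group $W\subseteq\mathrm{Aut}(\mathbb{Z}^I)$ is generated by the $s_v$. Real roots are the images under elements of $W$ of the $\epsilon_v$ with $v$ loopfree. The fundamental region is the set of nonzero $\alpha\in\mathbb{N}^I$ with connected support and $(\alpha,\epsilon_v)\le0$ for all $v$; imaginary roots are the elements of its closure under $W$ and change of sign. A root is a real or imaginary root; it is positive if it lies in $\mathbb{N}^I$. *)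

theory Defs
  imports
    "HOL-Library.Poly_Mapping"
    "HOL-Algebra.QuotRing"
    "Jordan_Normal_Form.VS_Connect"
    "Graph_Theory.Digraph_Component"
begin

hide_const (open) Multiset.mult

section \<open>Algebras over a field\<close>

text \<open>
  HOL-Algebra's \<open>algebra\<close> locale is commutative, so unital associative algebras over a field are
  introduced here. They are carried by its \<open>module\<close> record, whose ring fields hold the multiplication.
\<close>
locale K_algebra = ring A + vectorspace "class_ring :: 'k ring" A
  for A :: "('k::field, 'a) module" (structure) +
  assumes smult_mult_left: "x \<in> carrier A \<Longrightarrow> y \<in> carrier A \<Longrightarrow> (c \<odot> x) \<otimes> y = c \<odot> (x \<otimes> y)"
    and smult_mult_right: "x \<in> carrier A \<Longrightarrow> y \<in> carrier A \<Longrightarrow> x \<otimes> (c \<odot> y) = c \<odot> (x \<otimes> y)"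

definition algebra_hom :: "('k::field, 'a) module \<Rightarrow> ('k, 'b) module \<Rightarrow> ('a \<Rightarrow> 'b) set" where
  "algebra_hom A B = {f \<in> Ring.ring_hom A B. \<forall>c. \<forall>x\<in>carrier A. f (c \<odot>\<^bsub>A\<^esub> x) = c \<odot>\<^bsub>B\<^esub> f x}"

text \<open>
  \<open>A Quot J\<close> is a plain ring; the scalar action of \<open>c\<close> on it is multiplication by the class of
  \<open>c \<cdot> 1\<close>.
\<close>
definition quot_algebra :: "('k::field, 'a) module \<Rightarrow> 'a set \<Rightarrow> ('k, 'a set) module" where
  "quot_algebra A J = ring.extend (A Quot J)
     (module.fields (\<lambda>c X. (J +>\<^bsub>A\<^esub> (c \<odot>\<^bsub>A\<^esub> \<one>\<^bsub>A\<^esub>)) \<otimes>\<^bsub>A Quot J\<^esub> X))"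


section \<open>Path algebras\<close>

text \<open>
  A quiver is a \<open>pre_digraph\<close> (loops and parallel arrows are allowed). The path
  \<open>a\<^sub>1 \<dots> a\<^sub>n\<close> with \<open>t(a\<^sub>i) = h(a\<^sub>i\<^sub>+\<^sub>1)\<close> is encoded as the pair of its head \<open>h(a\<^sub>1)\<close> and the list
  \<open>[a\<^sub>1, \<dots>, a\<^sub>n]\<close>; the trivial path \<open>e\<^sub>v\<close> is \<open>(v, [])\<close>. Paths compose as functions do: the
  product \<open>p r\<close> is nonzero iff the tail of \<open>p\<close> is the head of \<open>r\<close>.
\<close>

type_synonym ('v, 'a) path = "'v \<times> 'a list"

type_synonym ('v, 'a, 'k) path_sum = "('v, 'a) path \<Rightarrow>\<^sub>0 'k"

definition path_tail :: "('v, 'a) pre_digraph \<Rightarrow> ('v, 'a) path \<Rightarrow> 'v" where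
  "path_tail G p = (if snd p = [] then fst p else tail G (last (snd p)))"

definition paths :: "('v, 'a) pre_digraph \<Rightarrow> ('v, 'a) path set" where
  "paths G = {(v, as). v \<in> verts G \<and> set as \<subseteq> arcs G \<and> (as \<noteq> [] \<longrightarrow> v = head G (hd as)) \<and>
     successively (\<lambda>a b. tail G a = head G b) as}"

definition path_algebra :: "('v, 'a) pre_digraph \<Rightarrow> ('k::field, ('v, 'a, 'k) path_sum) module" where
  "path_algebra G =
     \<lparr>carrier = {f. Poly_Mapping.keys f \<subseteq> paths G},
      mult = (\<lambda>f g. \<Sum>p\<in>Poly_Mapping.keys f. \<Sum>r\<in>Poly_Mapping.keys g.
        if path_tail G p = fst r
        then Poly_Mapping.single (fst p, snd p @ snd r) (Poly_Mapping.lookup f p * Poly_Mapping.lookup g r) else 0),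
      one = (\<Sum>v\<in>verts G. Poly_Mapping.single (v, []) 1),
      zero = 0,
      add = (+),
      smult = (\<lambda>c. Poly_Mapping.map ((*) c))\<rparr>"

definition vertex_elem :: "'v \<Rightarrow> ('v, 'a, 'k::field) path_sum" where
  "vertex_elem v = Poly_Mapping.single (v, []) 1"

definition arrow_elem :: "('v, 'a) pre_digraph \<Rightarrow> 'a \<Rightarrow> ('v, 'a, 'k::field) path_sum" where
  "arrow_elem G a = Poly_Mapping.single (head G a, [a]) 1"


section \<open>Universal localization\<close>

text \<open>
  The free algebra on a set \<open>L\<close> of letters is the path algebra of the quiver with one vertex and
  the set \<open>L\<close> of loops.
\<close>
definition bouquet :: "'l set \<Rightarrow> (unit, 'l) pre_digraph" where
  "bouquet L = \<lparr>verts = {()}, arcs = L, tail = (\<lambda>_. ()), head = (\<lambda>_. ())\<rparr>"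

definition free_algebra :: "'l set \<Rightarrow> ('k::field, (unit, 'l, 'k) path_sum) module" where
  "free_algebra L = path_algebra (bouquet L)"

definition letter :: "'l \<Rightarrow> (unit, 'l, 'k::field) path_sum" where
  "letter l = Poly_Mapping.single ((), [l]) 1"

text \<open>
  The algebra obtained from \<open>A\<close> by universally inverting the elements of \<open>S\<close> is presented by a
  letter \<open>Inl x\<close> for each element \<open>x\<close> of \<open>A\<close>, a formal inverse \<open>Inr s\<close> for each \<open>s \<in> S\<close>, the
  relations making \<open>x \<mapsto> Inl x\<close> an algebra homomorphism, and those making \<open>Inr s\<close> a two-sided inverse
  of \<open>Inl s\<close>. Its universal property is \<open>loc_universal\<close> and \<open>loc_unique\<close> below.
\<close>
definition loc_free :: "('k::field, 'a) module \<Rightarrow> 'a set \<Rightarrow> ('k, (unit, 'a + 'a, 'k) path_sum) module" where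
  "loc_free A S = free_algebra (Inl ` carrier A \<union> Inr ` S)"

definition loc_relations :: "('k::field, 'a) module \<Rightarrow> 'a set \<Rightarrow> (unit, 'a + 'a, 'k) path_sum set" where
  "loc_relations A S = (let F = loc_free A S; \<iota> = (\<lambda>x. letter (Inl x)); \<sigma> = (\<lambda>s. letter (Inr s)) in
       {\<iota> (x \<oplus>\<^bsub>A\<^esub> y) \<ominus>\<^bsub>F\<^esub> (\<iota> x \<oplus>\<^bsub>F\<^esub> \<iota> y) | x y. x \<in> carrier A \<and> y \<in> carrier A}
     \<union> {\<iota> (x \<otimes>\<^bsub>A\<^esub> y) \<ominus>\<^bsub>F\<^esub> (\<iota> x \<otimes>\<^bsub>F\<^esub> \<iota> y) | x y. x \<in> carrier A \<and> y \<in> carrier A}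
     \<union> {\<iota> (c \<odot>\<^bsub>A\<^esub> x) \<ominus>\<^bsub>F\<^esub> (c \<odot>\<^bsub>F\<^esub> \<iota> x) | c x. x \<in> carrier A}
     \<union> {\<iota> \<one>\<^bsub>A\<^esub> \<ominus>\<^bsub>F\<^esub> \<one>\<^bsub>F\<^esub>}
     \<union> {(\<iota> s \<otimes>\<^bsub>F\<^esub> \<sigma> s) \<ominus>\<^bsub>F\<^esub> \<one>\<^bsub>F\<^esub> | s. s \<in> S}
     \<union> {(\<sigma> s \<otimes>\<^bsub>F\<^esub> \<iota> s) \<ominus>\<^bsub>F\<^esub> \<one>\<^bsub>F\<^esub> | s. s \<in> S})"

definition loc_ideal :: "('k::field, 'a) module \<Rightarrow> 'a set \<Rightarrow> (unit, 'a + 'a, 'k) path_sum set" where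
  "loc_ideal A S = Idl\<^bsub>loc_free A S\<^esub> (loc_relations A S)"

definition localization ::
  "('k::field, 'a) module \<Rightarrow> 'a set \<Rightarrow> ('k, (unit, 'a + 'a, 'k) path_sum set) module" where
  "localization A S = quot_algebra (loc_free A S) (loc_ideal A S)"

definition loc_map ::
  "('k::field, 'a) module \<Rightarrow> 'a set \<Rightarrow> 'a \<Rightarrow> (unit, 'a + 'a, 'k) path_sum set" where
  "loc_map A S x = loc_ideal A S +>\<^bsub>loc_free A S\<^esub> letter (Inl x)"


section \<open>Multiplicative preprojective algebras\<close>

text \<open>\<open>Rev a\<close> is the reverse arrow \<open>a\<^sup>*\<close> of an arrow \<open>a\<close> of the original quiver.\<close>

datatype 'a darrow = Orig 'a | Rev 'a

fun star :: "'a darrow \<Rightarrow> 'a darrow" where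
  "star (Orig a) = Rev a"
| "star (Rev a) = Orig a"

fun eps :: "'a darrow \<Rightarrow> int" where
  "eps (Orig a) = 1"
| "eps (Rev a) = - 1"

definition double :: "('v, 'a) pre_digraph \<Rightarrow> ('v, 'a darrow) pre_digraph" where
  "double Q = \<lparr>verts = verts Q, arcs = Orig ` arcs Q \<union> Rev ` arcs Q,
     tail = (\<lambda>b. case b of Orig a \<Rightarrow> tail Q a | Rev a \<Rightarrow> head Q a),
     head = (\<lambda>b. case b of Orig a \<Rightarrow> head Q a | Rev a \<Rightarrow> tail Q a)\<rparr>"

text \<open>The increasing list of the elements of \<open>B\<close>; see \<open>enumeration_ex1\<close> below.\<close>
definition enumeration :: "'b set \<Rightarrow> 'b rel \<Rightarrow> 'b list" where
  "enumeration B lt = (THE bs. set bs = B \<and> sorted_wrt (\<lambda>a b. (a, b) \<in> lt) bs)"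

abbreviation double_algebra ::
  "('v, 'a) pre_digraph \<Rightarrow> ('k::field, ('v, 'a darrow, 'k) path_sum) module" where
  "double_algebra Q \<equiv> path_algebra (double Q)"

definition one_plus :: "('v, 'a) pre_digraph \<Rightarrow> 'a darrow \<Rightarrow> ('v, 'a darrow, 'k::field) path_sum" where
  "one_plus Q a = \<one>\<^bsub>double_algebra Q\<^esub> \<oplus>\<^bsub>double_algebra Q\<^esub>
     (arrow_elem (double Q) a \<otimes>\<^bsub>double_algebra Q\<^esub> arrow_elem (double Q) (star a))"

definition mpa_lhs :: "('v, 'a) pre_digraph \<Rightarrow> 'a darrow rel \<Rightarrow> ('k::field, 'b) module \<Rightarrow>
    (('v, 'a darrow, 'k) path_sum \<Rightarrow> 'b) \<Rightarrow> 'b" where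
  "mpa_lhs Q lt R f =
     foldr (\<lambda>a x. (f (one_plus Q a) [^]\<^bsub>R\<^esub> eps a) \<otimes>\<^bsub>R\<^esub> x) (enumeration (arcs (double Q)) lt) \<one>\<^bsub>R\<^esub>"

definition mpa_rhs :: "('v, 'a) pre_digraph \<Rightarrow> ('v \<Rightarrow> 'k::field) \<Rightarrow> ('v, 'a darrow, 'k) path_sum" where
  "mpa_rhs Q q = (\<Sum>v\<in>verts Q. Poly_Mapping.single (v, []) (q v))"

text \<open>
  The property of a homomorphism from the path algebra of the double to \<open>R\<close> with respect to which
  the multiplicative preprojective algebra is universal.
\<close>
definition mpa_hom :: "('v, 'a) pre_digraph \<Rightarrow> 'a darrow rel \<Rightarrow> ('v \<Rightarrow> 'k::field) \<Rightarrow>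
    ('k, 'b) module \<Rightarrow> (('v, 'a darrow, 'k) path_sum \<Rightarrow> 'b) \<Rightarrow> bool" where
  "mpa_hom Q lt q R f \<longleftrightarrow> f \<in> algebra_hom (double_algebra Q) R \<and>
     (\<forall>a\<in>arcs (double Q). f (one_plus Q a) \<in> Units R) \<and>
     mpa_lhs Q lt R f = f (mpa_rhs Q q)"

type_synonym ('v, 'a, 'k) loc_elem =
  "(unit, ('v, 'a darrow, 'k) path_sum + ('v, 'a darrow, 'k) path_sum, 'k) path_sum set"

type_synonym ('v, 'a, 'k) mpa_elem = "('v, 'a, 'k) loc_elem set"

text \<open>
  \<open>mpa Q lt q\<close> is the multiplicative preprojective algebra: the elements \<open>1 + a a\<^sup>*\<close> are inverted
  universally, and the two-sided ideal generated by the difference of the two sides of the defining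
  relation is factored out. Theorems \<open>mpa_hom_mpa\<close>, \<open>mpa_universal\<close> and \<open>mpa_unique\<close> below show
  that \<open>mpa_map Q lt q\<close> is the universal homomorphism satisfying \<open>mpa_hom\<close>.
\<close>
definition mpa_loc :: "('v, 'a) pre_digraph \<Rightarrow> ('k::field, ('v, 'a, 'k) loc_elem) module" where
  "mpa_loc Q = localization (double_algebra Q) (one_plus Q ` arcs (double Q))"

definition mpa_loc_map ::
  "('v, 'a) pre_digraph \<Rightarrow> ('v, 'a darrow, 'k) path_sum \<Rightarrow> ('v, 'a, 'k::field) loc_elem" where
  "mpa_loc_map Q = loc_map (double_algebra Q) (one_plus Q ` arcs (double Q))"

definition mpa_ideal ::
  "('v, 'a) pre_digraph \<Rightarrow> 'a darrow rel \<Rightarrow> ('v \<Rightarrow> 'k) \<Rightarrow> ('v, 'a, 'k::field) loc_elem set" where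
  "mpa_ideal Q lt q = Idl\<^bsub>mpa_loc Q\<^esub>
     {mpa_lhs Q lt (mpa_loc Q) (mpa_loc_map Q) \<ominus>\<^bsub>mpa_loc Q\<^esub> mpa_loc_map Q (mpa_rhs Q q)}"

definition mpa :: "('v, 'a) pre_digraph \<Rightarrow> 'a darrow rel \<Rightarrow> ('v \<Rightarrow> 'k::field) \<Rightarrow>
    ('k, ('v, 'a, 'k) mpa_elem) module" where
  "mpa Q lt q = quot_algebra (mpa_loc Q) (mpa_ideal Q lt q)"

definition mpa_map :: "('v, 'a) pre_digraph \<Rightarrow> 'a darrow rel \<Rightarrow> ('v \<Rightarrow> 'k::field) \<Rightarrow>
    ('v, 'a darrow, 'k) path_sum \<Rightarrow> ('v, 'a, 'k) mpa_elem" where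
  "mpa_map Q lt q x = mpa_ideal Q lt q +>\<^bsub>mpa_loc Q\<^esub> mpa_loc_map Q x"


section \<open>Modules over non-commutative rings\<close>

text \<open>The \<open>module\<close> locale of HOL-Algebra requires a commutative base ring.\<close>

locale left_module = R?: ring R + M?: abelian_group M
  for R :: "('r, 's) ring_scheme" (structure) and M :: "('r, 'm) module" (structure) +
  assumes smult_closed: "\<lbrakk>a \<in> carrier R; x \<in> carrier M\<rbrakk> \<Longrightarrow> a \<odot>\<^bsub>M\<^esub> x \<in> carrier M"
    and smult_l_distr: "\<lbrakk>a \<in> carrier R; b \<in> carrier R; x \<in> carrier M\<rbrakk> \<Longrightarrow>
      (a \<oplus>\<^bsub>R\<^esub> b) \<odot>\<^bsub>M\<^esub> x = a \<odot>\<^bsub>M\<^esub> x \<oplus>\<^bsub>M\<^esub> b \<odot>\<^bsub>M\<^esub> x"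
    and smult_r_distr: "\<lbrakk>a \<in> carrier R; x \<in> carrier M; y \<in> carrier M\<rbrakk> \<Longrightarrow>
      a \<odot>\<^bsub>M\<^esub> (x \<oplus>\<^bsub>M\<^esub> y) = a \<odot>\<^bsub>M\<^esub> x \<oplus>\<^bsub>M\<^esub> a \<odot>\<^bsub>M\<^esub> y"
    and smult_assoc: "\<lbrakk>a \<in> carrier R; b \<in> carrier R; x \<in> carrier M\<rbrakk> \<Longrightarrow>
      (a \<otimes>\<^bsub>R\<^esub> b) \<odot>\<^bsub>M\<^esub> x = a \<odot>\<^bsub>M\<^esub> (b \<odot>\<^bsub>M\<^esub> x)"
    and smult_one: "x \<in> carrier M \<Longrightarrow> \<one>\<^bsub>R\<^esub> \<odot>\<^bsub>M\<^esub> x = x"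

definition left_module_hom ::
  "('r, 's) ring_scheme \<Rightarrow> ('r, 'm) module \<Rightarrow> ('r, 'n) module \<Rightarrow> ('m \<Rightarrow> 'n) set" where
  "left_module_hom R M N = {f \<in> carrier M \<rightarrow> carrier N.
     (\<forall>x\<in>carrier M. \<forall>y\<in>carrier M. f (x \<oplus>\<^bsub>M\<^esub> y) = f x \<oplus>\<^bsub>N\<^esub> f y) \<and>
     (\<forall>a\<in>carrier R. \<forall>x\<in>carrier M. f (a \<odot>\<^bsub>M\<^esub> x) = a \<odot>\<^bsub>N\<^esub> f x)}"

definition simple_module :: "('r, 's) ring_scheme \<Rightarrow> ('r, 'm) module \<Rightarrow> bool" where
  "simple_module R M \<longleftrightarrow> left_module R M \<and> carrier M \<noteq> {\<zero>\<^bsub>M\<^esub>} \<and>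
     (\<forall>N. Module.submodule N R M \<longrightarrow> N = {\<zero>\<^bsub>M\<^esub>} \<or> N = carrier M)"

definition direct_sum :: "('r, 'm) module \<Rightarrow> ('r, 'n) module \<Rightarrow> ('r, 'm \<times> 'n) module" where
  "direct_sum M N = \<lparr>carrier = carrier M \<times> carrier N, mult = undefined, one = undefined,
     zero = (\<zero>\<^bsub>M\<^esub>, \<zero>\<^bsub>N\<^esub>), add = (\<lambda>(x, y) (x', y'). (x \<oplus>\<^bsub>M\<^esub> x', y \<oplus>\<^bsub>N\<^esub> y')),
     smult = (\<lambda>a (x, y). (a \<odot>\<^bsub>M\<^esub> x, a \<odot>\<^bsub>N\<^esub> y))\<rparr>"

text \<open>
  \<open>Ext1 R M N\<close> is the set of Yoneda classes of extensions \<open>0 \<rightarrow> N \<rightarrow> E \<rightarrow> M \<rightarrow> 0\<close>, and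
  \<open>Ext1_zero R M N\<close> is the class of the split one. Taking the carrier of \<open>E\<close> in the type
  \<open>'n \<times> 'm\<close> loses nothing: a set-theoretic section of \<open>E \<rightarrow> M\<close> identifies \<open>E\<close> with
  \<open>carrier N \<times> carrier M\<close>.
\<close>
type_synonym ('r, 'm, 'n) extension = "('r, 'n \<times> 'm) module \<times> ('n \<Rightarrow> 'n \<times> 'm) \<times> ('n \<times> 'm \<Rightarrow> 'm)"

definition extensions ::
  "('r, 's) ring_scheme \<Rightarrow> ('r, 'm) module \<Rightarrow> ('r, 'n) module \<Rightarrow> ('r, 'm, 'n) extension set" where
  "extensions R M N = {(E, i, p). left_module R E \<and>
     i \<in> left_module_hom R N E \<and> p \<in> left_module_hom R E M \<and>
     inj_on i (carrier N) \<and> p ` carrier E = carrier M \<and>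
     i ` carrier N = {x \<in> carrier E. p x = \<zero>\<^bsub>M\<^esub>}}"

definition ext_equiv ::
  "('r, 's) ring_scheme \<Rightarrow> ('r, 'm) module \<Rightarrow> ('r, 'n) module \<Rightarrow> ('r, 'm, 'n) extension rel" where
  "ext_equiv R M N = {((E, i, p), (E', i', p')).
     (E, i, p) \<in> extensions R M N \<and> (E', i', p') \<in> extensions R M N \<and>
     (\<exists>f \<in> left_module_hom R E E'. bij_betw f (carrier E) (carrier E') \<and>
        (\<forall>x\<in>carrier N. f (i x) = i' x) \<and> (\<forall>x\<in>carrier E. p' (f x) = p x))}"

definition Ext1 ::
  "('r, 's) ring_scheme \<Rightarrow> ('r, 'm) module \<Rightarrow> ('r, 'n) module \<Rightarrow> ('r, 'm, 'n) extension set set" where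
  "Ext1 R M N = extensions R M N // ext_equiv R M N"

definition Ext1_zero ::
  "('r, 's) ring_scheme \<Rightarrow> ('r, 'm) module \<Rightarrow> ('r, 'n) module \<Rightarrow> ('r, 'm, 'n) extension set" where
  "Ext1_zero R M N = ext_equiv R M N `` {(direct_sum N M, \<lambda>y. (y, \<zero>\<^bsub>M\<^esub>), snd)}"


section \<open>Representations\<close>

text \<open>The underlying vector space over the base field of a module over an algebra.\<close>

definition base_field_space :: "('k, 'r) module \<Rightarrow> ('r, 'm) module \<Rightarrow> ('k::field, 'm) module" where
  "base_field_space \<Lambda> X = ring.extend (ring.truncate X)
     (module.fields (\<lambda>c x. (c \<odot>\<^bsub>\<Lambda>\<^esub> \<one>\<^bsub>\<Lambda>\<^esub>) \<odot>\<^bsub>X\<^esub> x))"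

definition finite_dim_module :: "('k::field, 'r) module \<Rightarrow> ('r, 'm) module \<Rightarrow> bool" where
  "finite_dim_module \<Lambda> X \<longleftrightarrow> left_module \<Lambda> X \<and>
     vectorspace.fin_dim (class_ring :: 'k ring) (base_field_space \<Lambda> X)"

text \<open>
  Rigidity means that \<open>Ext\<^sup>1(X, X)\<close> is zero, i.e. that the split class is its only element.
  A finite-dimensional module over a \<open>'k\<close>-algebra is isomorphic to one whose carrier is a subset of
  \<open>nat \<Rightarrow> 'k\<close>, so quantifying over modules carried by that type covers all representations.
\<close>
definition rigid_simple :: "('k::field, 'r) module \<Rightarrow> ('r, 'm) module \<Rightarrow> bool" where
  "rigid_simple \<Lambda> X \<longleftrightarrow> finite_dim_module \<Lambda> X \<and> simple_module \<Lambda> X \<and> Ext1 \<Lambda> X X = {Ext1_zero \<Lambda> X X}"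

text \<open>The entry at a vertex \<open>v\<close> is the dimension of \<open>e\<^sub>v X\<close>; see \<open>root_lattice\<close> for the zero elsewhere.\<close>
definition dimension_vector :: "('v, 'a) pre_digraph \<Rightarrow> 'a darrow rel \<Rightarrow> ('v \<Rightarrow> 'k::field) \<Rightarrow>
    (('v, 'a, 'k) mpa_elem, 'm) module \<Rightarrow> 'v \<Rightarrow> int" where
  "dimension_vector Q lt q X v = (if v \<in> verts Q then
     int (vectorspace.dim (class_ring :: 'k ring) ((base_field_space (mpa Q lt q) X)
       \<lparr>carrier := (\<lambda>x. mpa_map Q lt q (vertex_elem v) \<odot>\<^bsub>X\<^esub> x) ` carrier X\<rparr>)) else 0)"


section \<open>Roots\<close>

text \<open>\<open>\<int>\<^sup>I\<close> consists of the integer functions vanishing outside the vertex set \<open>I\<close>.\<close>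

definition root_lattice :: "('v, 'a) pre_digraph \<Rightarrow> ('v \<Rightarrow> int) set" where
  "root_lattice Q = {\<alpha>. \<forall>v. v \<notin> verts Q \<longrightarrow> \<alpha> v = 0}"

definition sym_form :: "('v, 'a) pre_digraph \<Rightarrow> ('v \<Rightarrow> int) \<Rightarrow> ('v \<Rightarrow> int) \<Rightarrow> int" where
  "sym_form Q \<alpha> \<beta> = 2 * (\<Sum>v\<in>verts Q. \<alpha> v * \<beta> v)
     - (\<Sum>a\<in>arcs Q. \<alpha> (head Q a) * \<beta> (tail Q a) + \<alpha> (tail Q a) * \<beta> (head Q a))"

definition coord :: "'v \<Rightarrow> 'v \<Rightarrow> int" where
  "coord v = (\<lambda>w. if w = v then 1 else 0)"

definition loopfree :: "('v, 'a) pre_digraph \<Rightarrow> 'v \<Rightarrow> bool" where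
  "loopfree Q v \<longleftrightarrow> v \<in> verts Q \<and> \<not> (\<exists>a\<in>arcs Q. head Q a = v \<and> tail Q a = v)"

definition reflection :: "('v, 'a) pre_digraph \<Rightarrow> 'v \<Rightarrow> ('v \<Rightarrow> int) \<Rightarrow> ('v \<Rightarrow> int)" where
  "reflection Q v \<alpha> = (\<lambda>w. \<alpha> w - sym_form Q \<alpha> (coord v) * coord v w)"

text \<open>
  The reflections are involutions (\<open>reflection_involution\<close> below), so closing under composition with
  them yields the generated group.
\<close>
inductive_set weyl_group :: "('v, 'a) pre_digraph \<Rightarrow> (('v \<Rightarrow> int) \<Rightarrow> ('v \<Rightarrow> int)) set"
  for Q where
  weyl_id: "id \<in> weyl_group Q"
| weyl_step: "w \<in> weyl_group Q \<Longrightarrow> loopfree Q v \<Longrightarrow> reflection Q v \<circ> w \<in> weyl_group Q"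

definition real_roots :: "('v, 'a) pre_digraph \<Rightarrow> ('v \<Rightarrow> int) set" where
  "real_roots Q = {w (coord v) | w v. w \<in> weyl_group Q \<and> loopfree Q v}"

definition fundamental_region :: "('v, 'a) pre_digraph \<Rightarrow> ('v \<Rightarrow> int) set" where
  "fundamental_region Q = {\<alpha> \<in> root_lattice Q. (\<forall>v\<in>verts Q. 0 \<le> \<alpha> v) \<and> \<alpha> \<noteq> (\<lambda>_. 0) \<and>
     connected (Q \<restriction> {v \<in> verts Q. \<alpha> v \<noteq> 0}) \<and> (\<forall>v\<in>verts Q. sym_form Q \<alpha> (coord v) \<le> 0)}"

inductive_set imaginary_roots :: "('v, 'a) pre_digraph \<Rightarrow> ('v \<Rightarrow> int) set"
  for Q where
  fundamental: "\<alpha> \<in> fundamental_region Q \<Longrightarrow> \<alpha> \<in> imaginary_roots Q"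
| weyl: "\<alpha> \<in> imaginary_roots Q \<Longrightarrow> w \<in> weyl_group Q \<Longrightarrow> w \<alpha> \<in> imaginary_roots Q"
| sign: "\<alpha> \<in> imaginary_roots Q \<Longrightarrow> - \<alpha> \<in> imaginary_roots Q"

definition positive :: "('v, 'a) pre_digraph \<Rightarrow> ('v \<Rightarrow> int) \<Rightarrow> bool" where
  "positive Q \<alpha> \<longleftrightarrow> \<alpha> \<in> root_lattice Q \<and> (\<forall>v\<in>verts Q. 0 \<le> \<alpha> v)"

definition positive_roots :: "('v, 'a) pre_digraph \<Rightarrow> ('v \<Rightarrow> int) set" where
  "positive_roots Q = {\<alpha> \<in> real_roots Q \<union> imaginary_roots Q. positive Q \<alpha>}"

definition q_power :: "('v, 'a) pre_digraph \<Rightarrow> ('v \<Rightarrow> 'k::field) \<Rightarrow> ('v \<Rightarrow> int) \<Rightarrow> 'k" where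
  "q_power Q q \<alpha> = (\<Prod>v\<in>verts Q. q v powi \<alpha> v)"


section \<open>The path algebra is an algebra\<close>

lemma pm_sum: "(\<Sum>p\<in>Poly_Mapping.keys f. Poly_Mapping.single p (Poly_Mapping.lookup f p)) = f"
  by (rule poly_mapping_eqI) (auto simp: lookup_sum lookup_single when_def in_keys_iff)

definition path_mult ::
  "('v, 'a) pre_digraph \<Rightarrow> ('v, 'a) path \<Rightarrow> ('v, 'a) path \<Rightarrow> 'k::field \<Rightarrow> ('v, 'a, 'k) path_sum" where
  "path_mult G p r c = (if path_tail G p = fst r then Poly_Mapping.single (fst p, snd p @ snd r) c else 0)"

lemma path_mult_add: "path_mult G p r (c + d) = path_mult G p r c + path_mult G p r (d :: 'k::field)"
  by (simp add: path_mult_def single_add)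
lemma path_mult_0: "path_mult G p r (0 :: 'k::field) = 0"
  by (simp add: path_mult_def)

lemma pa_mult: fixes G f g shows "f \<otimes>\<^bsub>path_algebra G\<^esub> g = (\<Sum>p\<in>Poly_Mapping.keys f. \<Sum>r\<in>Poly_Mapping.keys g.
   path_mult G p r (Poly_Mapping.lookup f p * Poly_Mapping.lookup g r))"
  by (simp add: path_algebra_def path_mult_def)

lemma pa_mult_super:
  fixes G f g P R
  assumes "finite P" "finite R" "Poly_Mapping.keys f \<subseteq> P" "Poly_Mapping.keys g \<subseteq> R"
  shows "f \<otimes>\<^bsub>path_algebra G\<^esub> g = (\<Sum>p\<in>P. \<Sum>r\<in>R.
   path_mult G p r (Poly_Mapping.lookup f p * Poly_Mapping.lookup g r))"
proof -
  have 1: "(\<Sum>r\<in>Poly_Mapping.keys g. path_mult G p r (Poly_Mapping.lookup f p * Poly_Mapping.lookup g r))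
    = (\<Sum>r\<in>R. path_mult G p r (Poly_Mapping.lookup f p * Poly_Mapping.lookup g r))" for p
    by (rule sum.mono_neutral_left) (use assms in \<open>auto simp: path_mult_0 in_keys_iff\<close>)
  show ?thesis unfolding pa_mult 1
    by (rule sum.mono_neutral_left) (use assms in \<open>auto simp: path_mult_0 in_keys_iff\<close>)
qed

lemma pa_add: "f \<oplus>\<^bsub>path_algebra G\<^esub> g = f + g" by (simp add: path_algebra_def)
lemma pa_zero: "\<zero>\<^bsub>path_algebra G\<^esub> = 0" by (simp add: path_algebra_def)
lemma pa_carrier: "f \<in> carrier (path_algebra G) \<longleftrightarrow> Poly_Mapping.keys f \<subseteq> paths G" by (simp add: path_algebra_def)
lemma pa_one: "\<one>\<^bsub>path_algebra G\<^esub> = (\<Sum>v\<in>verts G. Poly_Mapping.single (v, []) 1)" by (simp add: path_algebra_def)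
lemma pa_smult: "c \<odot>\<^bsub>path_algebra G\<^esub> f = Poly_Mapping.map ((*) c) f" by (simp add: path_algebra_def)
lemma lookup_smult: "Poly_Mapping.lookup (Poly_Mapping.map ((*) c) f) p = c * Poly_Mapping.lookup f (p :: 'p) " for c :: "'k::field"
  by (simp add: Poly_Mapping.map.rep_eq when_def)

lemma pa_l_distr: "(f + g) \<otimes>\<^bsub>path_algebra G\<^esub> h = f \<otimes>\<^bsub>path_algebra G\<^esub> h + g \<otimes>\<^bsub>path_algebra G\<^esub> h"
proof -
  let ?P = "Poly_Mapping.keys f \<union> Poly_Mapping.keys g" and ?R = "Poly_Mapping.keys h"
  have *: "finite ?P" "finite ?R" by auto
  have k: "Poly_Mapping.keys (f + g) \<subseteq> ?P" by (rule keys_add)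
  show ?thesis
    using pa_mult_super[OF *, of "f + g" h] pa_mult_super[OF *, of f h] pa_mult_super[OF *, of g h] k
    by (simp add: lookup_add distrib_right path_mult_add sum.distrib)
qed

lemma pa_r_distr: "h \<otimes>\<^bsub>path_algebra G\<^esub> (f + g) = h \<otimes>\<^bsub>path_algebra G\<^esub> f + h \<otimes>\<^bsub>path_algebra G\<^esub> g"
proof -
  let ?P = "Poly_Mapping.keys f \<union> Poly_Mapping.keys g" and ?R = "Poly_Mapping.keys h"
  have *: "finite ?R" "finite ?P" by auto
  have k: "Poly_Mapping.keys (f + g) \<subseteq> ?P" by (rule keys_add)
  show ?thesis
    using pa_mult_super[OF *, of h "f + g"] pa_mult_super[OF *, of h f] pa_mult_super[OF *, of h g] k
    by (simp add: lookup_add distrib_left path_mult_add sum.distrib)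
qed

lemma pa_mult_0: "0 \<otimes>\<^bsub>path_algebra G\<^esub> h = 0" "h \<otimes>\<^bsub>path_algebra G\<^esub> 0 = 0" by (simp_all add: pa_mult)

lemma pa_sum_l: "(\<Sum>i\<in>I. f i) \<otimes>\<^bsub>path_algebra G\<^esub> h = (\<Sum>i\<in>I. f i \<otimes>\<^bsub>path_algebra G\<^esub> h)"
  by (induct I rule: infinite_finite_induct) (auto simp: pa_mult_0 pa_l_distr)
lemma pa_sum_r: "h \<otimes>\<^bsub>path_algebra G\<^esub> (\<Sum>i\<in>I. f i) = (\<Sum>i\<in>I. h \<otimes>\<^bsub>path_algebra G\<^esub> f i)"
  by (induct I rule: infinite_finite_induct) (auto simp: pa_mult_0 pa_r_distr)

lemma pa_single: "Poly_Mapping.single p c \<otimes>\<^bsub>path_algebra G\<^esub> Poly_Mapping.single r d = path_mult G p r (c * d)"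
  by (auto simp: pa_mult path_mult_0)

lemma path_tail_append: "path_tail G p = fst r \<Longrightarrow> path_tail G (fst p, snd p @ snd r) = path_tail G r"
  by (auto simp: path_tail_def)

lemma pa_assoc: "(f \<otimes>\<^bsub>path_algebra G\<^esub> g) \<otimes>\<^bsub>path_algebra G\<^esub> h = f \<otimes>\<^bsub>path_algebra G\<^esub> (g \<otimes>\<^bsub>path_algebra G\<^esub> h)"
proof -
  have s: "(Poly_Mapping.single p a \<otimes>\<^bsub>path_algebra G\<^esub> Poly_Mapping.single q b) \<otimes>\<^bsub>path_algebra G\<^esub> Poly_Mapping.single r c
    = Poly_Mapping.single p a \<otimes>\<^bsub>path_algebra G\<^esub> (Poly_Mapping.single q b \<otimes>\<^bsub>path_algebra G\<^esub> Poly_Mapping.single r c)"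
    for p q r a b c
    by (auto simp: pa_single path_mult_def pa_mult_0 path_tail_append mult.assoc)
  show ?thesis
    apply (subst (1 2) pm_sum[of f, symmetric])
    apply (subst (1 2) pm_sum[of g, symmetric])
    apply (subst (1 2) pm_sum[of h, symmetric])
    by (simp only: pa_sum_l pa_sum_r s)
qed

lemma paths_append: "p \<in> paths G \<Longrightarrow> r \<in> paths G \<Longrightarrow> path_tail G p = fst r \<Longrightarrow> (fst p, snd p @ snd r) \<in> paths G"
  by (cases p; cases r) (auto simp: paths_def path_tail_def successively_append_iff hd_append split: if_splits)

lemma keys_sum_sub: "(\<And>i. i \<in> I \<Longrightarrow> Poly_Mapping.keys (f i) \<subseteq> S) \<Longrightarrow> Poly_Mapping.keys (sum f I) \<subseteq> S"
  by (induct I rule: infinite_finite_induct) (auto dest!: subsetD[OF keys_add])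

lemma pa_closed: "Poly_Mapping.keys f \<subseteq> paths G \<Longrightarrow> Poly_Mapping.keys g \<subseteq> paths G \<Longrightarrow> Poly_Mapping.keys (f \<otimes>\<^bsub>path_algebra G\<^esub> g) \<subseteq> paths G"
  unfolding pa_mult
  by (intro keys_sum_sub) (auto simp: path_mult_def intro: paths_append split: if_splits)

lemma pa_smult_mult:
  "(c \<odot>\<^bsub>path_algebra G\<^esub> f) \<otimes>\<^bsub>path_algebra G\<^esub> g = c \<odot>\<^bsub>path_algebra G\<^esub> (f \<otimes>\<^bsub>path_algebra G\<^esub> g)" (is ?A)
  "f \<otimes>\<^bsub>path_algebra G\<^esub> (c \<odot>\<^bsub>path_algebra G\<^esub> g) = c \<odot>\<^bsub>path_algebra G\<^esub> (f \<otimes>\<^bsub>path_algebra G\<^esub> g)" (is ?B)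
proof -
  have k: "Poly_Mapping.keys (c \<odot>\<^bsub>path_algebra G\<^esub> f) \<subseteq> Poly_Mapping.keys f" for f
    by (auto simp: pa_smult in_keys_iff lookup_smult)
  have m: "path_mult G p r (c * d) = c \<odot>\<^bsub>path_algebra G\<^esub> path_mult G p r d" for p r d
    by (rule poly_mapping_eqI) (auto simp: pa_smult lookup_smult path_mult_def lookup_single when_def)
  have sum: "c \<odot>\<^bsub>path_algebra G\<^esub> (sum F I) = (\<Sum>i\<in>I. c \<odot>\<^bsub>path_algebra G\<^esub> F i)" for F :: "'i \<Rightarrow> _" and I
    by (rule poly_mapping_eqI) (simp add: pa_smult lookup_smult lookup_sum sum_distrib_left)
  have fin: "finite (Poly_Mapping.keys f)" for f :: "_ \<Rightarrow>\<^sub>0 _::zero" by auto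
  show ?A
    using pa_mult_super[where G=G and f="c \<odot>\<^bsub>path_algebra G\<^esub> f" and g=g, OF fin fin k order.refl]
    by (simp add: pa_mult[of G f g] sum m[symmetric]) (simp add: pa_smult lookup_smult mult_ac)
  show ?B
    using pa_mult_super[where G=G and g="c \<odot>\<^bsub>path_algebra G\<^esub> g" and f=f, OF fin fin order.refl k]
    by (simp add: pa_mult[of G f g] sum m[symmetric]) (simp add: pa_smult lookup_smult mult_ac)
qed

lemma path_algebra:
  assumes "finite (verts G)" "wf_digraph G"
  shows "K_algebra (path_algebra G :: ('k::field, ('v, 'a, 'k) path_sum) module)"
proof -
  interpret wf_digraph G by fact
  let ?A = "path_algebra G :: ('k::field, ('v,'a,'k) path_sum) module"
  have tv: "p \<in> paths G \<Longrightarrow> fst p \<in> verts G \<and> path_tail G p \<in> verts G" for p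
    by (auto simp: paths_def path_tail_def dest!: subsetD[OF _ last_in_set])
  have one1: "\<one>\<^bsub>?A\<^esub> \<otimes>\<^bsub>?A\<^esub> f = f" if "Poly_Mapping.keys f \<subseteq> paths G" for f
  proof -
    have "\<one>\<^bsub>?A\<^esub> \<otimes>\<^bsub>?A\<^esub> Poly_Mapping.single p c = Poly_Mapping.single p c" if "p \<in> paths G" for p c
      using tv[OF that] assms by (simp add: pa_one pa_sum_l pa_single path_mult_def path_tail_def if_distrib cong: if_cong)
    then show ?thesis
      apply (subst (2) pm_sum[of f, symmetric], subst pm_sum[of f, symmetric])
      unfolding pa_sum_r by (rule sum.cong) (use that in auto)
  qed
  have one2: "f \<otimes>\<^bsub>?A\<^esub> \<one>\<^bsub>?A\<^esub> = f" if "Poly_Mapping.keys f \<subseteq> paths G" for f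
  proof -
    have "Poly_Mapping.single p c \<otimes>\<^bsub>?A\<^esub> \<one>\<^bsub>?A\<^esub> = Poly_Mapping.single p c" if "p \<in> paths G" for p c
      using tv[OF that] assms by (simp add: pa_one pa_sum_r pa_single path_mult_def if_distrib cong: if_cong)
    then show ?thesis
      apply (subst (2) pm_sum[of f, symmetric], subst pm_sum[of f, symmetric])
      unfolding pa_sum_l by (rule sum.cong) (use that in auto)
  qed
  have onec: "Poly_Mapping.keys \<one>\<^bsub>?A\<^esub> \<subseteq> paths G"
    unfolding pa_one by (rule keys_sum_sub) (auto simp: paths_def)
  have ks: "Poly_Mapping.keys (c \<odot>\<^bsub>?A\<^esub> f) \<subseteq> Poly_Mapping.keys f" for c f
    by (auto simp: pa_smult in_keys_iff lookup_smult)
  have ring: "ring ?A"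
  proof (rule ringI)
    show "abelian_group ?A"
    proof (rule abelian_groupI)
      fix x assume "x \<in> carrier ?A"
      then show "\<exists>y\<in>carrier ?A. y \<oplus>\<^bsub>?A\<^esub> x = \<zero>\<^bsub>?A\<^esub>"
        by (intro bexI[of _ "- x"]) (auto simp: pa_add pa_zero pa_carrier in_keys_iff)
    qed (auto simp: pa_add pa_zero pa_carrier add_ac dest!: subsetD[OF keys_add])
    show "Group.monoid ?A"
      by (rule Group.monoidI; unfold pa_carrier) (simp_all only: pa_closed onec one1 one2 pa_assoc)
  qed (auto simp: pa_add pa_l_distr pa_r_distr)
  interpret ring ?A by fact
  have "vectorspace (class_ring :: 'k ring) ?A"
    apply (intro vectorspace.intro Module.moduleI)
    using class_field.field_axioms class_cring.cring_axioms abelian_group_axioms subset_trans[OF ks]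
    by (auto simp: pa_carrier pa_add intro!: poly_mapping_eqI simp: pa_smult lookup_smult lookup_add algebra_simps)
  then show ?thesis
    by (intro K_algebra.intro ring K_algebra_axioms.intro) (auto simp: pa_smult_mult)
qed


section \<open>Universal properties\<close>

lemma ring_cong:
  assumes "ring R" "carrier S = carrier R" "mult S = mult R" "one S = one R" "zero S = zero R" "add S = add R"
  shows "ring S"
proof -
  interpret ring R by fact
  show ?thesis
  proof (rule ringI)
    show "abelian_group S"
      by (rule abelian_groupI; unfold assms(2-)) (simp_all add: a_ac add.l_inv_ex)
    show "Group.monoid S"
      by (rule Group.monoidI; unfold assms(2-)) (simp_all add: m_assoc)
  qed (unfold assms(2-), simp_all add: l_distr r_distr)
qed

lemma (in K_algebra) smult_simps:
  shows smult_closed': "x \<in> carrier A \<Longrightarrow> c \<odot> x \<in> carrier A"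
  and smult_l_distr': "x \<in> carrier A \<Longrightarrow> (c + d) \<odot> x = c \<odot> x \<oplus> d \<odot> x"
  and smult_r_distr': "x \<in> carrier A \<Longrightarrow> y \<in> carrier A \<Longrightarrow> c \<odot> (x \<oplus> y) = c \<odot> x \<oplus> c \<odot> y"
  and smult_assoc': "x \<in> carrier A \<Longrightarrow> (c * d) \<odot> x = c \<odot> (d \<odot> x)"
  and smult_one': "x \<in> carrier A \<Longrightarrow> 1 \<odot> x = x"
  using smult_closed[of c x] smult_l_distr[of c d x] smult_r_distr[of c x y] smult_assoc1[of c d x] smult_one[of x]
  by auto

lemma (in K_algebra) smult_via_one: "x \<in> carrier A \<Longrightarrow> c \<odot> x = (c \<odot> \<one>) \<otimes> x"
  by (simp add: smult_mult_left)

lemma K_algebraI: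
  assumes "ring A"
   and "\<And>c x. x \<in> carrier A \<Longrightarrow> c \<odot>\<^bsub>A\<^esub> x \<in> carrier A"
   and "\<And>c d x. x \<in> carrier A \<Longrightarrow> (c + d) \<odot>\<^bsub>A\<^esub> x = c \<odot>\<^bsub>A\<^esub> x \<oplus>\<^bsub>A\<^esub> d \<odot>\<^bsub>A\<^esub> x"
   and "\<And>c x y. x \<in> carrier A \<Longrightarrow> y \<in> carrier A \<Longrightarrow> c \<odot>\<^bsub>A\<^esub> (x \<oplus>\<^bsub>A\<^esub> y) = c \<odot>\<^bsub>A\<^esub> x \<oplus>\<^bsub>A\<^esub> c \<odot>\<^bsub>A\<^esub> y"
   and "\<And>c d x. x \<in> carrier A \<Longrightarrow> (c * d) \<odot>\<^bsub>A\<^esub> x = c \<odot>\<^bsub>A\<^esub> (d \<odot>\<^bsub>A\<^esub> x)"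
   and "\<And>x. x \<in> carrier A \<Longrightarrow> 1 \<odot>\<^bsub>A\<^esub> x = x"
   and "\<And>c x y. x \<in> carrier A \<Longrightarrow> y \<in> carrier A \<Longrightarrow> (c \<odot>\<^bsub>A\<^esub> x) \<otimes>\<^bsub>A\<^esub> y = c \<odot>\<^bsub>A\<^esub> (x \<otimes>\<^bsub>A\<^esub> y)"
   and "\<And>c x y. x \<in> carrier A \<Longrightarrow> y \<in> carrier A \<Longrightarrow> x \<otimes>\<^bsub>A\<^esub> (c \<odot>\<^bsub>A\<^esub> y) = c \<odot>\<^bsub>A\<^esub> (x \<otimes>\<^bsub>A\<^esub> y)"
  shows "K_algebra (A :: ('k::field, 'a) module)"
proof -
  interpret ring A by fact
  have "vectorspace (class_ring :: 'k ring) A"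
    by (intro vectorspace.intro Module.moduleI)
      (use assms class_field.field_axioms class_cring.cring_axioms abelian_group_axioms in auto)
  then show ?thesis
    by (intro K_algebra.intro K_algebra_axioms.intro) (use assms in auto)
qed

lemma quot_fields:
  "carrier (quot_algebra A J) = carrier (A Quot J)" "mult (quot_algebra A J) = mult (A Quot J)"
  "one (quot_algebra A J) = one (A Quot J)" "zero (quot_algebra A J) = zero (A Quot J)"
  "add (quot_algebra A J) = add (A Quot J)"
  "c \<odot>\<^bsub>quot_algebra A J\<^esub> X = (J +>\<^bsub>A\<^esub> (c \<odot>\<^bsub>A\<^esub> \<one>\<^bsub>A\<^esub>)) \<otimes>\<^bsub>A Quot J\<^esub> X"
  by (simp_all add: quot_algebra_def ring.extend_def module.fields_def)

lemma quot_elem: "X \<in> carrier (quot_algebra A J) \<longleftrightarrow> (\<exists>x\<in>carrier A. X = J +>\<^bsub>A\<^esub> x)"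
  by (auto simp: quot_fields FactRing_def A_RCOSETS_def' a_r_coset_def')

lemma quot_algebra_hom:
  assumes "K_algebra A" "ideal J A"
  shows "ring (quot_algebra A J)" "K_algebra (quot_algebra A J)" "(\<lambda>x. J +>\<^bsub>A\<^esub> x) \<in> algebra_hom A (quot_algebra A J)"
proof -
  interpret A: K_algebra A by fact
  interpret J: ideal J A by fact
  show r: "ring (quot_algebra A J)"
    by (rule ring_cong[OF J.quotient_is_ring]) (auto simp: quot_fields)
  let ?\<pi> = "\<lambda>x. J +>\<^bsub>A\<^esub> x"
  have h: "?\<pi> \<in> Ring.ring_hom A (quot_algebra A J)"
    using J.rcos_ring_hom by (auto simp: Ring.ring_hom_def quot_fields)
  have sm: "c \<odot>\<^bsub>quot_algebra A J\<^esub> ?\<pi> x = ?\<pi> (c \<odot>\<^bsub>A\<^esub> x)" if "x \<in> carrier A" for c x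
    using that ring_hom_mult[OF h, of "c \<odot>\<^bsub>A\<^esub> \<one>\<^bsub>A\<^esub>" x] A.smult_via_one[OF that, of c]
    by (simp add: quot_fields A.smult_closed')
  show hh: "?\<pi> \<in> algebra_hom A (quot_algebra A J)"
    using h sm by (auto simp: algebra_hom_def)
  note hm = ring_hom_mult[OF h, symmetric] ring_hom_add[OF h, symmetric]
  show "K_algebra (quot_algebra A J)"
    by (rule K_algebraI[OF r])
     (auto simp: quot_elem sm hm A.smult_closed' A.smult_l_distr' A.smult_r_distr' A.smult_assoc' A.smult_one'
       A.smult_mult_left A.smult_mult_right)
qed

lemma algebra_homD:
  assumes "f \<in> algebra_hom A B"
  shows "f \<in> Ring.ring_hom A B" "x \<in> carrier A \<Longrightarrow> f x \<in> carrier B"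
   "x \<in> carrier A \<Longrightarrow> y \<in> carrier A \<Longrightarrow> f (x \<oplus>\<^bsub>A\<^esub> y) = f x \<oplus>\<^bsub>B\<^esub> f y"
   "x \<in> carrier A \<Longrightarrow> y \<in> carrier A \<Longrightarrow> f (x \<otimes>\<^bsub>A\<^esub> y) = f x \<otimes>\<^bsub>B\<^esub> f y"
   "f \<one>\<^bsub>A\<^esub> = \<one>\<^bsub>B\<^esub>" "x \<in> carrier A \<Longrightarrow> f (c \<odot>\<^bsub>A\<^esub> x) = c \<odot>\<^bsub>B\<^esub> f x"
  using assms by (auto simp: algebra_hom_def Ring.ring_hom_def)

lemma algebra_hom_minus:
  assumes "f \<in> algebra_hom A B" "ring A" "ring B" "x \<in> carrier A" "y \<in> carrier A"
  shows "f (x \<ominus>\<^bsub>A\<^esub> y) = f x \<ominus>\<^bsub>B\<^esub> f y" "f \<zero>\<^bsub>A\<^esub> = \<zero>\<^bsub>B\<^esub>"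
proof -
  interpret ring_hom_ring A B f
    using assms by (intro ring_hom_ringI2) (auto simp: algebra_hom_def)
  show "f (x \<ominus>\<^bsub>A\<^esub> y) = f x \<ominus>\<^bsub>B\<^esub> f y" "f \<zero>\<^bsub>A\<^esub> = \<zero>\<^bsub>B\<^esub>"
    using assms by (auto simp: a_minus_def)
qed

lemma quot_universal:
  assumes "K_algebra A" "K_algebra B" "S \<subseteq> carrier A" "f \<in> algebra_hom A B" "\<And>s. s \<in> S \<Longrightarrow> f s = \<zero>\<^bsub>B\<^esub>"
  obtains g where "g \<in> algebra_hom (quot_algebra A (Idl\<^bsub>A\<^esub> S)) B"
     "\<And>x. x \<in> carrier A \<Longrightarrow> g (Idl\<^bsub>A\<^esub> S +>\<^bsub>A\<^esub> x) = f x"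
proof -
  interpret A: K_algebra A by fact
  interpret B: K_algebra B by fact
  interpret F: ring_hom_ring A B f
    using assms A.ring_axioms B.ring_axioms by (intro ring_hom_ringI2) (auto simp: algebra_hom_def)
  define J where "J = Idl\<^bsub>A\<^esub> S"
  have J: "ideal J A" unfolding J_def by (rule A.genideal_ideal) fact
  interpret J: ideal J A by fact
  have sub: "J \<subseteq> a_kernel A B f"
    unfolding J_def
  proof (rule A.genideal_minimal[OF F.kernel_is_ideal], rule subsetI)
    fix s assume "s \<in> S"
    then show "s \<in> a_kernel A B f" unfolding a_kernel_def' using assms(3) assms(5)[of s] by blast
  qed
  have ex: "\<exists>z. \<forall>x\<in>X. f x = z" if X: "X \<in> carrier (quot_algebra A J)" for X
  proof -
    obtain x where x: "x \<in> carrier A" "X = J +>\<^bsub>A\<^esub> x" using X unfolding quot_elem by blast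
    have "f y = f x" if y: "y \<in> X" for y
    proof -
      obtain j where j: "j \<in> J" "y = j \<oplus>\<^bsub>A\<^esub> x" using y unfolding x(2) a_r_coset_def' by blast
      have "f j = \<zero>\<^bsub>B\<^esub>" "j \<in> carrier A" using j sub J.a_subset unfolding a_kernel_def' by blast+
      then show ?thesis using x j by simp
    qed
    then show ?thesis by blast
  qed
  define g where "g X = (SOME z. \<forall>x\<in>X. f x = z)" for X
  have g: "g (J +>\<^bsub>A\<^esub> x) = f x" if x: "x \<in> carrier A" for x
  proof -
    have "\<forall>y\<in>J +>\<^bsub>A\<^esub> x. f y = g (J +>\<^bsub>A\<^esub> x)"
      unfolding g_def by (rule someI_ex) (use ex[of "J +>\<^bsub>A\<^esub> x"] x quot_elem in blast)
    then show ?thesis using J.a_rcos_self[OF x] by simp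
  qed
  note Q = quot_algebra_hom[OF \<open>K_algebra A\<close> J]
  note p = algebra_homD(3-6)[OF Q(3), symmetric]
  have "g \<in> algebra_hom (quot_algebra A J) B"
    unfolding algebra_hom_def Ring.ring_hom_def
    by (auto simp: quot_elem p g A.smult_closed' algebra_homD(6)[OF assms(4)])
  then show ?thesis using g that unfolding J_def by blast
qed

lemma K_algebra_free: "K_algebra (free_algebra L)"
  unfolding free_algebra_def by (rule path_algebra) (auto simp: bouquet_def wf_digraph_def)

lemma succ_True: "successively (\<lambda>a b. True) xs"
  by (induct xs rule: induct_list012) auto

lemma bouquet_paths: "p \<in> paths (bouquet L) \<longleftrightarrow> set (snd p) \<subseteq> L"
  by (cases p) (auto simp: paths_def bouquet_def succ_True)

lemma bouquet_tail: "path_tail (bouquet L) p = ()" "path_mult (bouquet L) p r c = Poly_Mapping.single ((), snd p @ snd r) c"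
  by (auto simp: path_mult_def)

lemma free_closed_single: "set as \<subseteq> L \<Longrightarrow> Poly_Mapping.single ((), as) c \<in> carrier (free_algebra L)"
  by (auto simp: free_algebra_def pa_carrier bouquet_paths)

lemma letter_closed: "l \<in> L \<Longrightarrow> letter l \<in> carrier (free_algebra L)"
  unfolding letter_def by (rule free_closed_single) auto

lemma free_one: "\<one>\<^bsub>free_algebra L\<^esub> = Poly_Mapping.single ((), []) 1"
  by (auto simp: free_algebra_def pa_one bouquet_def)

lemma free_single_Cons:
  "Poly_Mapping.single ((), a # as) 1 = letter a \<otimes>\<^bsub>free_algebra L\<^esub> Poly_Mapping.single ((), as) 1"
  by (simp add: free_algebra_def letter_def pa_single bouquet_tail)

lemma free_single_smult:
  "Poly_Mapping.single ((), as) c = c \<odot>\<^bsub>free_algebra L\<^esub> Poly_Mapping.single ((), as) 1"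
  by (rule poly_mapping_eqI) (auto simp: free_algebra_def pa_smult lookup_smult lookup_single when_def)

lemma free_hom_eq:
  fixes h h' :: "(unit, 'l, 'k::field) path_sum \<Rightarrow> 'b"
  assumes "h \<in> algebra_hom (free_algebra L) B" "h' \<in> algebra_hom (free_algebra L) B"
    "\<And>l. l \<in> L \<Longrightarrow> h (letter l) = h' (letter l)" "ring B"
    and f: "f \<in> carrier (free_algebra L)"
  shows "h f = h' f"
proof -
  note D = algebra_homD[OF assms(1)] algebra_homD[OF assms(2)]
  interpret F: K_algebra "free_algebra L :: ('k, (unit, 'l, 'k) path_sum) module" by (rule K_algebra_free)
  have lc: "letter a \<in> carrier (free_algebra L :: ('k, (unit, 'l, 'k) path_sum) module)" if "a \<in> L" for a
    using that by (rule letter_closed)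
  have 1: "h (Poly_Mapping.single ((), as) 1) = h' (Poly_Mapping.single ((), as) 1)" if "set as \<subseteq> L" for as
    using that
  proof (induct as)
    case Nil then show ?case using D unfolding free_one by simp
  next
    case (Cons a as)
    then show ?case
      unfolding free_single_Cons[of a as L]
      using D(4,10)[of "letter a" "Poly_Mapping.single ((), as) 1"] assms(3)[of a] lc[of a] free_closed_single[of as L "1::'k"]
      by auto
  qed
  have 2: "h (Poly_Mapping.single p c) = h' (Poly_Mapping.single p c)" if "p \<in> paths (bouquet L)" for p c
  proof -
    have p: "p = ((), snd p)" by (cases p) auto
    have "h (Poly_Mapping.single ((), snd p) c) = h' (Poly_Mapping.single ((), snd p) c)"
      apply (subst (1 2) free_single_smult[of _ _ L])
      using that 1[of "snd p"] free_closed_single[of "snd p" L "1::'k"] D(6,12)[of "Poly_Mapping.single ((), snd p) 1" c]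
      unfolding bouquet_paths by auto
    then show ?thesis by (subst (1 2) p)
  qed
  have "h (\<Sum>p\<in>P. Poly_Mapping.single p (Poly_Mapping.lookup f p)) = h' (\<Sum>p\<in>P. Poly_Mapping.single p (Poly_Mapping.lookup f p))
     \<and> (\<Sum>p\<in>P. Poly_Mapping.single p (Poly_Mapping.lookup f p)) \<in> carrier (free_algebra L)"
    if "P \<subseteq> paths (bouquet L)" "finite P" for P
    using that(2,1)
  proof (induct P)
    case empty
    have "(0 :: (unit, 'l, 'k) path_sum) = \<zero>\<^bsub>free_algebra L\<^esub>" by (simp add: free_algebra_def pa_zero)
    then show ?case using algebra_hom_minus(2)[OF assms(1) F.ring_axioms assms(4) F.zero_closed F.zero_closed]
        algebra_hom_minus(2)[OF assms(2) F.ring_axioms assms(4) F.zero_closed F.zero_closed] F.zero_closed by simp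
  next
    case (insert p P)
    have pl: "f + g = f \<oplus>\<^bsub>free_algebra L\<^esub> g" for f g by (simp add: free_algebra_def pa_add)
    have "Poly_Mapping.single p (Poly_Mapping.lookup f p) \<in> carrier (free_algebra L)"
      using free_closed_single[of "snd p" L] insert by (cases p) (auto simp: bouquet_paths)
    then show ?case using insert 2 by (simp add: pl D)
  qed
  from this[of "Poly_Mapping.keys f"] show ?thesis
    using f by (simp add: pm_sum free_algebra_def pa_carrier)
qed

lemma free_universal:
  fixes L :: "'l set" and B :: "('k::field, 'b) module"
  assumes "K_algebra B" and \<phi>: "\<And>l. l \<in> L \<Longrightarrow> \<phi> l \<in> carrier B"
  shows "\<exists>h\<in>algebra_hom (free_algebra L) B. \<forall>l\<in>L. h (letter l) = \<phi> l"
proof -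
  interpret BR: ring B using assms(1) by (rule K_algebra.axioms(1))
  interpret B: K_algebra B by fact
  define w where "w p = foldr (\<lambda>l x. \<phi> l \<otimes>\<^bsub>B\<^esub> x) (snd (p :: (unit,'l) path)) \<one>\<^bsub>B\<^esub>" for p
  have w_closed: "w p \<in> carrier B" if "p \<in> paths (bouquet L)" for p
  proof -
    have "set as \<subseteq> L \<Longrightarrow> foldr (\<lambda>l x. \<phi> l \<otimes>\<^bsub>B\<^esub> x) as \<one>\<^bsub>B\<^esub> \<in> carrier B" for as
      by (induct as) (auto simp: \<phi>)
    then show ?thesis using that by (auto simp: w_def bouquet_paths)
  qed
  have w_mult: "w ((), snd p @ snd r) = w p \<otimes>\<^bsub>B\<^esub> w r" if "p \<in> paths (bouquet L)" "r \<in> paths (bouquet L)" for p r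
  proof -
    have "set as \<subseteq> L \<Longrightarrow> set bs \<subseteq> L \<Longrightarrow> w ((), as @ bs) = w ((), as) \<otimes>\<^bsub>B\<^esub> w ((), bs)" for as bs
    proof (induct as)
      case Nil then show ?case using w_closed[of "((),bs)"] by (simp add: w_def bouquet_paths)
    next
      case (Cons a as)
      then show ?case using w_closed[of "((),bs)"] w_closed[of "((),as)"] \<phi>[of a]
        by (simp add: w_def bouquet_paths BR.m_assoc)
    qed
    from this[of "snd p" "snd r"] that show ?thesis by (simp add: bouquet_paths w_def)
  qed
  define h where "h f = finsum B (\<lambda>p. Poly_Mapping.lookup f p \<odot>\<^bsub>B\<^esub> w p) (Poly_Mapping.keys f)" for f
  have z: "0 \<odot>\<^bsub>B\<^esub> x = \<zero>\<^bsub>B\<^esub>" if "x \<in> carrier B" for x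
    using B.smult_l_null[of x] that by simp
  have cl: "c \<odot>\<^bsub>B\<^esub> w p \<in> carrier B" if "p \<in> paths (bouquet L)" for c p
    using that by (simp add: B.smult_closed' w_closed)
  have h_super: "h f = finsum B (\<lambda>p. Poly_Mapping.lookup f p \<odot>\<^bsub>B\<^esub> w p) P"
    if "finite P" "Poly_Mapping.keys f \<subseteq> P" "P \<subseteq> paths (bouquet L)" for f P
    unfolding h_def finsum_def
    by (rule comm_monoid.finprod_mono_neutral_cong_left[OF BR.a_comm_monoid]) (use that in \<open>auto simp: in_keys_iff z w_closed subset_iff intro!: cl\<close>)
  have h_closed: "h f \<in> carrier B" if "Poly_Mapping.keys f \<subseteq> paths (bouquet L)" for f
    unfolding h_def by (rule BR.finsum_closed) (use that cl in auto)
  have h_single: "h (Poly_Mapping.single p c) = c \<odot>\<^bsub>B\<^esub> w p" if "p \<in> paths (bouquet L)" for p c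
    using that cl[OF that] by (subst h_super[of "{p}"]) auto
  have h_add: "h (f + g) = h f \<oplus>\<^bsub>B\<^esub> h g"
    if "Poly_Mapping.keys f \<subseteq> paths (bouquet L)" "Poly_Mapping.keys g \<subseteq> paths (bouquet L)" for f g
  proof -
    let ?P = "Poly_Mapping.keys f \<union> Poly_Mapping.keys g"
    have P: "finite ?P" "?P \<subseteq> paths (bouquet L)" using that by auto
    have "finsum B (\<lambda>p. Poly_Mapping.lookup (f + g) p \<odot>\<^bsub>B\<^esub> w p) ?P =
      finsum B (\<lambda>p. Poly_Mapping.lookup f p \<odot>\<^bsub>B\<^esub> w p \<oplus>\<^bsub>B\<^esub> Poly_Mapping.lookup g p \<odot>\<^bsub>B\<^esub> w p) ?P"
      by (rule BR.finsum_cong') (use P(2) in \<open>auto simp: lookup_add B.smult_l_distr' w_closed subset_iff intro!: cl\<close>)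
    also have "\<dots> = finsum B (\<lambda>p. Poly_Mapping.lookup f p \<odot>\<^bsub>B\<^esub> w p) ?P \<oplus>\<^bsub>B\<^esub> finsum B (\<lambda>p. Poly_Mapping.lookup g p \<odot>\<^bsub>B\<^esub> w p) ?P"
      by (rule BR.finsum_addf) (use P(2) in \<open>auto simp: subset_iff intro!: cl\<close>)
    finally show ?thesis
      using h_super[OF P(1) _ P(2), of f] h_super[OF P(1) _ P(2), of g] h_super[OF P(1) keys_add P(2)] by simp
  qed
  have h0: "h 0 = \<zero>\<^bsub>B\<^esub>" by (simp add: h_def)
  have h_sum: "h (sum F I) = finsum B (\<lambda>i. h (F i)) I" if "finite I" "\<And>i. i \<in> I \<Longrightarrow> Poly_Mapping.keys (F i) \<subseteq> paths (bouquet L)"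
    for F :: "'i \<Rightarrow> _" and I
    using that
  proof (induct I)
    case (insert i I)
    have "Poly_Mapping.keys (sum F I) \<subseteq> paths (bouquet L)" by (rule keys_sum_sub) (use insert in auto)
    then have "h (sum F (insert i I)) = h (F i) \<oplus>\<^bsub>B\<^esub> finsum B (\<lambda>i. h (F i)) I" using insert by (simp add: h_add)
    also have "\<dots> = finsum B (\<lambda>i. h (F i)) (insert i I)"
      by (rule BR.finsum_insert[symmetric]) (use insert h_closed in auto)
    finally show ?case .
  qed (simp add: h0)
  have h_mult: "h (f \<otimes>\<^bsub>free_algebra L\<^esub> g) = h f \<otimes>\<^bsub>B\<^esub> h g"
    if f: "Poly_Mapping.keys f \<subseteq> paths (bouquet L)" and g: "Poly_Mapping.keys g \<subseteq> paths (bouquet L)" for f g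
  proof -
    have app: "((), snd p @ snd r) \<in> paths (bouquet L)" if "p \<in> paths (bouquet L)" "r \<in> paths (bouquet L)" for p r
      using that by (simp add: bouquet_paths)
    have c: "h (path_mult (bouquet L) p r (a * b)) = (a \<odot>\<^bsub>B\<^esub> w p) \<otimes>\<^bsub>B\<^esub> (b \<odot>\<^bsub>B\<^esub> w r)"
      if "p \<in> paths (bouquet L)" "r \<in> paths (bouquet L)" for p r a b
      using that by (simp add: bouquet_tail h_single[OF app] w_mult B.smult_mult_left B.smult_mult_right w_closed
         B.smult_assoc'[symmetric] B.smult_closed' mult.commute)
    have fc: "c \<odot>\<^bsub>B\<^esub> w p \<in> carrier B" if "p \<in> Poly_Mapping.keys f" for c p
      using that f cl by blast
    have gc: "c \<odot>\<^bsub>B\<^esub> w p \<in> carrier B" if "p \<in> Poly_Mapping.keys g" for c p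
      using that g cl by blast
    have "h (f \<otimes>\<^bsub>free_algebra L\<^esub> g) = finsum B (\<lambda>p. finsum B (\<lambda>r. (Poly_Mapping.lookup f p \<odot>\<^bsub>B\<^esub> w p) \<otimes>\<^bsub>B\<^esub> (Poly_Mapping.lookup g r \<odot>\<^bsub>B\<^esub> w r)) (Poly_Mapping.keys g)) (Poly_Mapping.keys f)"
      unfolding free_algebra_def pa_mult
      apply (subst h_sum)
      subgoal by simp
      subgoal for p using f g by (intro keys_sum_sub) (fastforce simp: bouquet_tail bouquet_paths subset_iff split: if_splits)
      apply (rule BR.finsum_cong', rule refl)
      subgoal by (auto intro!: BR.finsum_closed BR.m_closed intro: fc gc)
      apply (subst h_sum)
      subgoal by simp
      subgoal for p r using f g by (fastforce simp: bouquet_tail bouquet_paths subset_iff split: if_splits)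
      apply (rule BR.finsum_cong', rule refl)
      subgoal by (auto intro!: BR.m_closed intro: fc gc)
      subgoal using f g c by blast
      done
    also have "\<dots> = finsum B (\<lambda>p. (Poly_Mapping.lookup f p \<odot>\<^bsub>B\<^esub> w p) \<otimes>\<^bsub>B\<^esub> h g) (Poly_Mapping.keys f)"
      apply (rule BR.finsum_cong', rule refl)
      subgoal using h_closed[OF g] by (auto intro!: fc)
      unfolding h_def
      by (rule BR.finsum_rdistr[symmetric]) (auto intro: fc gc)
    also have "\<dots> = h f \<otimes>\<^bsub>B\<^esub> h g"
      unfolding h_def[of f]
      by (rule BR.finsum_ldistr[symmetric]) (use h_closed[OF g] in \<open>auto intro!: fc\<close>)
    finally show ?thesis .
  qed
  have h_smult: "h (c \<odot>\<^bsub>free_algebra L\<^esub> f) = c \<odot>\<^bsub>B\<^esub> h f" if f: "Poly_Mapping.keys f \<subseteq> paths (bouquet L)" for c f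
  proof -
    interpret F: K_algebra "free_algebra L :: ('k, (unit,'l,'k) path_sum) module" by (rule K_algebra_free)
    have e: "c \<odot>\<^bsub>free_algebra L\<^esub> f = Poly_Mapping.single ((), []) c \<otimes>\<^bsub>free_algebra L\<^esub> f"
    proof -
      have "f \<in> carrier (free_algebra L)" using f by (simp add: free_algebra_def pa_carrier)
      from F.smult_via_one[OF this, of c] show ?thesis
        unfolding free_one free_single_smult[of "[]" c L, symmetric] .
    qed
    have p: "((), []) \<in> paths (bouquet L)" by (simp add: bouquet_paths)
    show ?thesis unfolding e using h_mult[of "Poly_Mapping.single ((), []) c" f] f p
      by (simp add: h_single w_def B.smult_mult_left h_closed)
  qed
  have h1: "h \<one>\<^bsub>free_algebra L\<^esub> = \<one>\<^bsub>B\<^esub>"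
    unfolding free_one by (subst h_single) (auto simp: bouquet_paths w_def B.smult_one')
  have "h \<in> algebra_hom (free_algebra L) B"
    unfolding algebra_hom_def Ring.ring_hom_def
    using h_closed h_mult h_add h1 h_smult by (auto simp: free_algebra_def pa_carrier pa_add)
  moreover have "h (letter l) = \<phi> l" if "l \<in> L" for l
    unfolding letter_def using that by (subst h_single) (auto simp: bouquet_paths w_def B.smult_one' \<phi>)
  ultimately show ?thesis by blast
qed

lemma enumeration_ex1:
  assumes "finite B" "strict_linear_order_on B lt"
  shows "\<exists>!bs. set bs = B \<and> sorted_wrt (\<lambda>a b. (a, b) \<in> lt) bs"
proof -
  have tr: "trans lt" and ir: "irrefl lt" and tot: "total_on B lt"
    using assms(2) by (auto simp: strict_linear_order_on_def)
  have ex: "\<exists>bs. set bs = C \<and> sorted_wrt (\<lambda>a b. (a, b) \<in> lt) bs" if "finite C" "C \<subseteq> B" for C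
    using that
  proof (induct C)
    case (insert x C)
    then obtain bs where bs: "set bs = C" "sorted_wrt (\<lambda>a b. (a, b) \<in> lt) bs" by auto
    let ?bs = "filter (\<lambda>b. (b, x) \<in> lt) bs @ x # filter (\<lambda>b. (x, b) \<in> lt) bs"
    have "set ?bs = insert x C"
      using bs insert tot by (auto simp: total_on_def)
    moreover have "sorted_wrt (\<lambda>a b. (a, b) \<in> lt) ?bs"
      using bs(2) tr by (auto simp: sorted_wrt_append sorted_wrt_filter dest: transD)
    ultimately show ?case by blast
  qed auto
  have un: "set bs = set cs \<Longrightarrow> sorted_wrt (\<lambda>a b. (a, b) \<in> lt) bs \<Longrightarrow> sorted_wrt (\<lambda>a b. (a, b) \<in> lt) cs \<Longrightarrow> bs = cs"
    for bs cs
  proof (induct bs arbitrary: cs)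
    case (Cons b bs)
    then obtain c cs' where cs: "cs = c # cs'" by (cases cs) auto
    have asym: "(x, y) \<in> lt \<Longrightarrow> (y, x) \<notin> lt" for x y using tr ir by (meson irrefl_def transD)
    have "b = c" using Cons(2-4) asym unfolding cs by (metis list.set_intros(1) set_ConsD sorted_wrt.simps(2))
    moreover have "b \<notin> set bs" "c \<notin> set cs'" using Cons(3,4) ir unfolding cs by (auto simp: irrefl_def)
    ultimately have "set bs = set cs'" using Cons(2) unfolding cs by auto
    then show ?case using Cons(1)[of cs'] Cons(3,4) \<open>b = c\<close> unfolding cs by simp
  qed simp
  from ex[OF assms(1)] un show ?thesis by (metis order_refl)
qed

lemma enumeration:
  assumes "finite B" "strict_linear_order_on B lt"
  shows "set (enumeration B lt) = B" "sorted_wrt (\<lambda>a b. (a, b) \<in> lt) (enumeration B lt)"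
  using theI'[OF enumeration_ex1[OF assms]] by (auto simp: enumeration_def)

lemma quot_rel:
  assumes A: "K_algebra A" and S: "S \<subseteq> carrier A" and x: "x \<in> carrier A" and y: "y \<in> carrier A"
    and r: "x \<ominus>\<^bsub>A\<^esub> y \<in> S"
  shows "Idl\<^bsub>A\<^esub> S +>\<^bsub>A\<^esub> x = Idl\<^bsub>A\<^esub> S +>\<^bsub>A\<^esub> y"
proof -
  interpret ring A using A by (rule K_algebra.axioms(1))
  interpret J: ideal "Idl\<^bsub>A\<^esub> S" A using S by (rule genideal_ideal)
  have "x \<ominus>\<^bsub>A\<^esub> y \<in> Idl\<^bsub>A\<^esub> S" using r genideal_self[OF S] by blast
  then have "x \<in> Idl\<^bsub>A\<^esub> S +>\<^bsub>A\<^esub> y"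
    unfolding a_r_coset_def' using x y
    by (force simp: minus_eq a_assoc l_neg intro!: bexI[of _ "x \<ominus>\<^bsub>A\<^esub> y"])
  then show ?thesis using a_repr_independence[OF _ y J.a_subgroup] by metis
qed

lemma ring_minus_zero: "ring B \<Longrightarrow> b \<in> carrier B \<Longrightarrow> b \<ominus>\<^bsub>B\<^esub> b = \<zero>\<^bsub>B\<^esub>"
  by (simp add: a_minus_def ring.ring_simprules)

context
  fixes A :: "('k::field, 'a) module" and S :: "'a set"
  assumes A: "K_algebra A" and S: "S \<subseteq> carrier A"
begin

private abbreviation "FF \<equiv> loc_free A S"

private lemma KF: "K_algebra FF" unfolding loc_free_def by (rule K_algebra_free)
private lemma RF: "ring FF" using KF by (rule K_algebra.axioms(1))
private lemma RA: "ring A" using A by (rule K_algebra.axioms(1))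
private lemma inl: "x \<in> carrier A \<Longrightarrow> letter (Inl x) \<in> carrier FF" unfolding loc_free_def by (rule letter_closed) auto
private lemma inr: "x \<in> S \<Longrightarrow> letter (Inr x) \<in> carrier FF" unfolding loc_free_def by (rule letter_closed) auto

private lemmas A_closed = ring.ring_simprules(1,2,4,5,6)[OF RA] K_algebra.smult_closed'[OF A]
private lemmas F_closed = ring.ring_simprules(1,2,4,5,6)[OF RF] K_algebra.smult_closed'[OF KF] inl inr

private lemma rel_sub: "loc_relations A S \<subseteq> carrier FF"
  unfolding loc_relations_def Let_def using S by (auto intro!: F_closed A_closed)

lemma loc_K: "K_algebra (localization A S)" and
  loc_pi: "(\<lambda>x. loc_ideal A S +>\<^bsub>FF\<^esub> x) \<in> algebra_hom FF (localization A S)"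
  using quot_algebra_hom[OF KF ring.genideal_ideal[OF RF rel_sub]]
  by (auto simp: localization_def loc_ideal_def)

private lemma loc_rel: "x \<ominus>\<^bsub>FF\<^esub> y \<in> loc_relations A S \<Longrightarrow> x \<in> carrier FF \<Longrightarrow> y \<in> carrier FF \<Longrightarrow>
   loc_ideal A S +>\<^bsub>FF\<^esub> x = loc_ideal A S +>\<^bsub>FF\<^esub> y"
  unfolding loc_ideal_def by (rule quot_rel[OF KF rel_sub])

private lemma rels:
  "x \<in> carrier A \<Longrightarrow> y \<in> carrier A \<Longrightarrow> letter (Inl (x \<oplus>\<^bsub>A\<^esub> y)) \<ominus>\<^bsub>FF\<^esub> (letter (Inl x) \<oplus>\<^bsub>FF\<^esub> letter (Inl y)) \<in> loc_relations A S"
  "x \<in> carrier A \<Longrightarrow> y \<in> carrier A \<Longrightarrow> letter (Inl (x \<otimes>\<^bsub>A\<^esub> y)) \<ominus>\<^bsub>FF\<^esub> (letter (Inl x) \<otimes>\<^bsub>FF\<^esub> letter (Inl y)) \<in> loc_relations A S"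
  "x \<in> carrier A \<Longrightarrow> letter (Inl (c \<odot>\<^bsub>A\<^esub> x)) \<ominus>\<^bsub>FF\<^esub> (c \<odot>\<^bsub>FF\<^esub> letter (Inl x)) \<in> loc_relations A S"
  "letter (Inl \<one>\<^bsub>A\<^esub>) \<ominus>\<^bsub>FF\<^esub> \<one>\<^bsub>FF\<^esub> \<in> loc_relations A S"
  "s \<in> S \<Longrightarrow> letter (Inl s) \<otimes>\<^bsub>FF\<^esub> letter (Inr s) \<ominus>\<^bsub>FF\<^esub> \<one>\<^bsub>FF\<^esub> \<in> loc_relations A S"
  "s \<in> S \<Longrightarrow> letter (Inr s) \<otimes>\<^bsub>FF\<^esub> letter (Inl s) \<ominus>\<^bsub>FF\<^esub> \<one>\<^bsub>FF\<^esub> \<in> loc_relations A S"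
  unfolding loc_relations_def Let_def by blast+

lemma loc_map_hom: "loc_map A S \<in> algebra_hom A (localization A S)"
proof -
  note D = algebra_homD[OF loc_pi]
  have add: "loc_map A S (x \<oplus>\<^bsub>A\<^esub> y) = loc_map A S x \<oplus>\<^bsub>localization A S\<^esub> loc_map A S y"
    if "x \<in> carrier A" "y \<in> carrier A" for x y
    unfolding loc_map_def D(3)[OF inl[OF that(1)] inl[OF that(2)], symmetric]
    by (rule loc_rel; (intro rels F_closed A_closed that)?)
  have mult: "loc_map A S (x \<otimes>\<^bsub>A\<^esub> y) = loc_map A S x \<otimes>\<^bsub>localization A S\<^esub> loc_map A S y"
    if "x \<in> carrier A" "y \<in> carrier A" for x y
    unfolding loc_map_def D(4)[OF inl[OF that(1)] inl[OF that(2)], symmetric]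
    by (rule loc_rel; (intro rels F_closed A_closed that)?)
  have sm: "loc_map A S (c \<odot>\<^bsub>A\<^esub> x) = c \<odot>\<^bsub>localization A S\<^esub> loc_map A S x"
    if "x \<in> carrier A" for x c
    unfolding loc_map_def D(6)[OF inl[OF that(1)], symmetric]
    by (rule loc_rel; (intro rels F_closed A_closed that)?)
  have one: "loc_map A S \<one>\<^bsub>A\<^esub> = \<one>\<^bsub>localization A S\<^esub>"
    unfolding loc_map_def D(5)[symmetric]
    by (rule loc_rel; (intro rels F_closed A_closed)?)
  show ?thesis unfolding algebra_hom_def Ring.ring_hom_def
    using add mult sm one D(2)[OF inl] by (auto simp: loc_map_def)
qed

lemma loc_map_inv:
  assumes s: "s \<in> S"
  shows "loc_map A S s \<otimes>\<^bsub>localization A S\<^esub> (loc_ideal A S +>\<^bsub>FF\<^esub> letter (Inr s)) = \<one>\<^bsub>localization A S\<^esub>"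
    "(loc_ideal A S +>\<^bsub>FF\<^esub> letter (Inr s)) \<otimes>\<^bsub>localization A S\<^esub> loc_map A S s = \<one>\<^bsub>localization A S\<^esub>"
proof -
  note D = algebra_homD[OF loc_pi]
  have sA: "s \<in> carrier A" using s S by auto
  show "loc_map A S s \<otimes>\<^bsub>localization A S\<^esub> (loc_ideal A S +>\<^bsub>FF\<^esub> letter (Inr s)) = \<one>\<^bsub>localization A S\<^esub>"
    unfolding loc_map_def D(4)[OF inl[OF sA] inr[OF s], symmetric] D(5)[symmetric]
    by (rule loc_rel; (intro rels F_closed A_closed s sA)?)
  show "(loc_ideal A S +>\<^bsub>FF\<^esub> letter (Inr s)) \<otimes>\<^bsub>localization A S\<^esub> loc_map A S s = \<one>\<^bsub>localization A S\<^esub>"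
    unfolding loc_map_def D(4)[OF inr[OF s] inl[OF sA], symmetric] D(5)[symmetric]
    by (rule loc_rel; (intro rels F_closed A_closed s sA)?)
qed

lemma loc_map_unit: "s \<in> S \<Longrightarrow> loc_map A S s \<in> Units (localization A S)"
  using loc_map_inv[of s] algebra_homD(2)[OF loc_map_hom, of s] algebra_homD(2)[OF loc_pi inr, of s] S
  unfolding Units_def by blast

lemma loc_universal:
  assumes B: "K_algebra (B :: ('k, 'b) module)" and f: "f \<in> algebra_hom A B" and u: "\<And>s. s \<in> S \<Longrightarrow> f s \<in> Units B"
  obtains g where "g \<in> algebra_hom (localization A S) B" "\<And>x. x \<in> carrier A \<Longrightarrow> g (loc_map A S x) = f x"
proof -
  have RB: "ring B" using B by (rule K_algebra.axioms(1))
  interpret BR: ring B by fact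
  note D = algebra_homD[OF f]
  define \<phi> where "\<phi> l = (case l of Inl x \<Rightarrow> f x | Inr s \<Rightarrow> inv\<^bsub>B\<^esub> (f s))" for l
  have phi: "\<phi> l \<in> carrier B" if "l \<in> Inl ` carrier A \<union> Inr ` S" for l
    using that D(2) u by (auto simp: \<phi>_def)
  have "\<exists>h\<in>algebra_hom FF B. \<forall>l\<in>Inl ` carrier A \<union> Inr ` S. h (letter l) = \<phi> l"
    unfolding loc_free_def by (rule free_universal[OF B phi])
  then obtain h where h: "h \<in> algebra_hom FF B" "\<forall>l \<in> Inl ` carrier A \<union> Inr ` S. h (letter l) = \<phi> l"
    by blast
  have hl: "h (letter (Inl x)) = f x" if "x \<in> carrier A" for x using bspec[OF h(2), of "Inl x"] that by (simp add: \<phi>_def)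
  have hr: "h (letter (Inr x)) = inv\<^bsub>B\<^esub> (f x)" if "x \<in> S" for x using bspec[OF h(2), of "Inr x"] that by (simp add: \<phi>_def)
  note E = algebra_homD[OF h(1)] and M = algebra_hom_minus(1)[OF h(1) RF RB]
  have z: "h r = \<zero>\<^bsub>B\<^esub>" if "r \<in> loc_relations A S" for r
    using that S unfolding loc_relations_def Let_def
    by (auto simp: M F_closed A_closed subset_iff E hl hr D ring_minus_zero[OF RB] u
        K_algebra.smult_closed'[OF B])
  obtain g where g: "g \<in> algebra_hom (quot_algebra FF (Idl\<^bsub>FF\<^esub> (loc_relations A S))) B"
    "\<And>x. x \<in> carrier FF \<Longrightarrow> g (Idl\<^bsub>FF\<^esub> (loc_relations A S) +>\<^bsub>FF\<^esub> x) = h x"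
    using quot_universal[OF KF B rel_sub h(1) z] by blast
  show ?thesis
    by (rule that[of g]) (use g inl hl in \<open>auto simp: localization_def loc_map_def loc_ideal_def\<close>)
qed

lemma loc_unique:
  assumes B: "ring (B :: ('k, 'b) module)"
    and g: "g \<in> algebra_hom (localization A S) B" "g' \<in> algebra_hom (localization A S) B"
    and eq: "\<And>x. x \<in> carrier A \<Longrightarrow> g (loc_map A S x) = g' (loc_map A S x)"
    and X: "X \<in> carrier (localization A S)"
  shows "g X = g' X"
proof -
  interpret BR: ring B by fact
  let ?\<pi> = "\<lambda>x. loc_ideal A S +>\<^bsub>FF\<^esub> x"
  have comp: "(\<lambda>x. k (?\<pi> x)) \<in> algebra_hom FF B" if k: "k \<in> algebra_hom (localization A S) B" for k
    unfolding algebra_hom_def Ring.ring_hom_def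
    by (auto simp: algebra_homD[OF loc_pi] algebra_homD[OF k])
  have r: "g (?\<pi> (letter (Inr s))) = g' (?\<pi> (letter (Inr s)))" if s: "s \<in> S" for s
  proof -
    let ?y = "?\<pi> (letter (Inr s))"
    have c: "?y \<in> carrier (localization A S)" "loc_map A S s \<in> carrier (localization A S)"
      using algebra_homD(2)[OF loc_pi inr[OF s]] algebra_homD(2)[OF loc_map_hom, of s] s S by auto
    have 1: "k (loc_map A S s) \<otimes>\<^bsub>B\<^esub> k ?y = \<one>\<^bsub>B\<^esub>" "k ?y \<otimes>\<^bsub>B\<^esub> k (loc_map A S s) = \<one>\<^bsub>B\<^esub>"
      if k: "k \<in> algebra_hom (localization A S) B" for k
      using loc_map_inv[OF s] algebra_homD(4,5)[OF k] c by metis+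
    have sA: "s \<in> carrier A" using s S by auto
    show ?thesis
      using BR.inv_unique[of "g ?y" "g (loc_map A S s)" "g' ?y"] 1[OF g(1)] 1[OF g(2)] eq[OF sA]
        algebra_homD(2)[OF g(1)] algebra_homD(2)[OF g(2)] c by simp
  qed
  have "\<exists>x\<in>carrier FF. X = ?\<pi> x" using X unfolding localization_def quot_elem .
  then obtain x where x: "x \<in> carrier FF" "X = ?\<pi> x" by blast
  have "(\<lambda>x. g (?\<pi> x)) x = (\<lambda>x. g' (?\<pi> x)) x"
    by (rule free_hom_eq[of _ "Inl ` carrier A \<union> Inr ` S" B])
      (use comp[OF g(1)] comp[OF g(2)] x(1) B r eq in \<open>auto simp: loc_free_def loc_map_def\<close>)
  then show ?thesis using x by simp
qed

end

lemma alg_hom_units: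
  assumes g: "g \<in> algebra_hom A B" and A: "ring A" and B: "ring B" and x: "x \<in> Units A"
  shows "g x \<in> Units B" "g (x [^]\<^bsub>A\<^esub> eps a) = g x [^]\<^bsub>B\<^esub> eps a" "x [^]\<^bsub>A\<^esub> eps a \<in> carrier A"
proof -
  interpret A: ring A by fact
  interpret B: ring B by fact
  note D = algebra_homD[OF g]
  have c: "x \<in> carrier A" "inv\<^bsub>A\<^esub> x \<in> carrier A" using x by auto
  have i: "g x \<otimes>\<^bsub>B\<^esub> g (inv\<^bsub>A\<^esub> x) = \<one>\<^bsub>B\<^esub>" "g (inv\<^bsub>A\<^esub> x) \<otimes>\<^bsub>B\<^esub> g x = \<one>\<^bsub>B\<^esub>"
    using D(4)[OF c] D(4)[OF c(2,1)] x D(5) by simp_all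
  show u: "g x \<in> Units B" unfolding Units_def using i D(2)[OF c(1)] D(2)[OF c(2)] by blast
  have inv: "inv\<^bsub>B\<^esub> (g x) = g (inv\<^bsub>A\<^esub> x)"
    using B.inv_char[of "g x" "g (inv\<^bsub>A\<^esub> x)"] i D(2)[OF c(1)] D(2)[OF c(2)] by simp
  show "g (x [^]\<^bsub>A\<^esub> eps a) = g x [^]\<^bsub>B\<^esub> eps a" "x [^]\<^bsub>A\<^esub> eps a \<in> carrier A"
    by (cases a; use c D inv in \<open>simp add: int_pow_def2\<close>)+
qed

context
  fixes Q :: "('v, 'a) pre_digraph" and lt :: "'a darrow rel" and q :: "'v \<Rightarrow> 'k::field"
  assumes Q: "fin_digraph Q"
    and lt: "strict_linear_order_on (arcs (double Q)) lt"
begin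

interpretation fin_digraph Q by (rule Q)

private lemma en: "set (enumeration (arcs (double Q)) lt) = arcs (double Q)"
  by (rule enumeration(1)[OF _ lt]) (simp add: double_def)

private abbreviation "AA \<equiv> (double_algebra Q :: ('k, ('v, 'a darrow, 'k) path_sum) module)"
private abbreviation "LL \<equiv> (mpa_loc Q :: ('k, ('v, 'a, 'k) loc_elem) module)"

lemma double_wf: "wf_digraph (double Q)" "finite (verts (double Q))"
  by (auto simp: wf_digraph_def double_def)

private lemma KA: "K_algebra AA" by (rule path_algebra[OF double_wf(2,1)])
private lemma RAA: "ring AA" using KA by (rule K_algebra.axioms(1))

lemma star_arc: "a \<in> arcs (double Q) \<Longrightarrow> star a \<in> arcs (double Q)"
  by (cases a) (auto simp: double_def)
lemma arrow_closed: "a \<in> arcs (double Q) \<Longrightarrow> arrow_elem (double Q) a \<in> carrier AA"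
  using wf_digraph.head_in_verts[OF double_wf(1)] by (auto simp: pa_carrier arrow_elem_def paths_def)
lemma one_plus_closed: "a \<in> arcs (double Q) \<Longrightarrow> one_plus Q a \<in> carrier AA"
  unfolding one_plus_def
  by (intro ring.ring_simprules(1,2,4,5,6)[OF RAA] arrow_closed star_arc)
lemma rhs_closed: "mpa_rhs Q q \<in> carrier AA"
  unfolding mpa_rhs_def pa_carrier by (rule keys_sum_sub) (auto simp: paths_def double_def)

private lemma SS: "one_plus Q ` arcs (double Q) \<subseteq> carrier AA" using one_plus_closed by auto

private lemma lhs_closed:
  assumes "ring R" "f \<in> algebra_hom AA R" "\<forall>a\<in>arcs (double Q). f (one_plus Q a) \<in> Units R"
  shows "mpa_lhs Q lt R f \<in> carrier R"
proof -
  interpret ring R by fact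
  have "(\<lambda>x. x) \<in> algebra_hom R R" by (auto simp: algebra_hom_def Ring.ring_hom_def)
  note pc = alg_hom_units(3)[OF this assms(1) assms(1)]
  have "set as \<subseteq> arcs (double Q) \<Longrightarrow> foldr (\<lambda>a x. (f (one_plus Q a) [^]\<^bsub>R\<^esub> eps a) \<otimes>\<^bsub>R\<^esub> x) as \<one>\<^bsub>R\<^esub> \<in> carrier R" for as
    using pc assms(3) by (induct as) auto
  then show ?thesis using en by (auto simp: mpa_lhs_def)
qed

private lemma lhs_hom:
  assumes "ring R" "f \<in> algebra_hom AA R" "\<forall>a\<in>arcs (double Q). f (one_plus Q a) \<in> Units R"
    and "ring B" "g \<in> algebra_hom R B" "\<And>x. x \<in> carrier AA \<Longrightarrow> g (f x) = f' x"
  shows "g (mpa_lhs Q lt R f) = mpa_lhs Q lt B f'"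
proof -
  interpret ring R by fact
  note D = algebra_homD[OF assms(5)] and U = alg_hom_units[OF assms(5,1,4)]
  have "set as \<subseteq> arcs (double Q) \<Longrightarrow> foldr (\<lambda>a x. (f (one_plus Q a) [^]\<^bsub>R\<^esub> eps a) \<otimes>\<^bsub>R\<^esub> x) as \<one>\<^bsub>R\<^esub> \<in> carrier R \<and>
    g (foldr (\<lambda>a x. (f (one_plus Q a) [^]\<^bsub>R\<^esub> eps a) \<otimes>\<^bsub>R\<^esub> x) as \<one>\<^bsub>R\<^esub>) = foldr (\<lambda>a x. (f' (one_plus Q a) [^]\<^bsub>B\<^esub> eps a) \<otimes>\<^bsub>B\<^esub> x) as \<one>\<^bsub>B\<^esub>" for as
    using assms(3) by (induct as) (auto simp: D U assms(6)[OF one_plus_closed])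
  then show ?thesis using en by (auto simp: mpa_lhs_def)
qed

private lemma KL: "K_algebra LL" unfolding mpa_loc_def by (rule loc_K[OF KA SS])
private lemma RL: "ring LL" using KL by (rule K_algebra.axioms(1))
private lemma mL: "mpa_loc_map Q \<in> algebra_hom AA LL"
  unfolding mpa_loc_def mpa_loc_map_def by (rule loc_map_hom[OF KA SS])
private lemma uL: "a \<in> arcs (double Q) \<Longrightarrow> mpa_loc_map Q (one_plus Q a) \<in> Units LL"
  unfolding mpa_loc_def mpa_loc_map_def by (rule loc_map_unit[OF KA SS]) auto

private lemma RelL: "{mpa_lhs Q lt LL (mpa_loc_map Q) \<ominus>\<^bsub>LL\<^esub> mpa_loc_map Q (mpa_rhs Q q)} \<subseteq> carrier LL"
proof -
  interpret ring LL by (rule RL)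
  show ?thesis using lhs_closed[OF RL mL] uL algebra_homD(2)[OF mL rhs_closed] by auto
qed

lemma mpa_K: "K_algebra (mpa Q lt q)" and
  mpa_pi: "(\<lambda>x. mpa_ideal Q lt q +>\<^bsub>LL\<^esub> x) \<in> algebra_hom LL (mpa Q lt q)"
  using quot_algebra_hom[OF KL ring.genideal_ideal[OF RL RelL]]
  by (auto simp: mpa_def mpa_ideal_def)

private lemma Rmpa: "ring (mpa Q lt q)" using mpa_K by (rule K_algebra.axioms(1))

lemma mpa_map_hom: "mpa_map Q lt q \<in> algebra_hom AA (mpa Q lt q)"
  unfolding algebra_hom_def Ring.ring_hom_def mpa_map_def
  by (auto simp: algebra_homD[OF mL] algebra_homD[OF mpa_pi])

theorem mpa_hom_mpa: "mpa_hom Q lt q (mpa Q lt q) (mpa_map Q lt q)"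
  unfolding mpa_hom_def
proof (intro conjI ballI mpa_map_hom)
  fix a assume "a \<in> arcs (double Q)"
  then show "mpa_map Q lt q (one_plus Q a) \<in> Units (mpa Q lt q)"
    unfolding mpa_map_def by (rule alg_hom_units(1)[OF mpa_pi RL Rmpa uL])
next
  have "mpa_lhs Q lt (mpa Q lt q) (mpa_map Q lt q) = mpa_ideal Q lt q +>\<^bsub>LL\<^esub> mpa_lhs Q lt LL (mpa_loc_map Q)"
    by (rule lhs_hom[OF RL mL _ Rmpa mpa_pi, symmetric]) (auto simp: uL mpa_map_def)
  also have "\<dots> = mpa_map Q lt q (mpa_rhs Q q)"
    unfolding mpa_map_def mpa_ideal_def
    by (rule quot_rel[OF KL RelL lhs_closed[OF RL mL] algebra_homD(2)[OF mL rhs_closed]]) (auto simp: uL)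
  finally show "mpa_lhs Q lt (mpa Q lt q) (mpa_map Q lt q) = mpa_map Q lt q (mpa_rhs Q q)" .
qed

theorem mpa_universal:
  assumes B: "K_algebra (B :: ('k, 'b) module)" and f: "mpa_hom Q lt q B f"
  obtains g where "g \<in> algebra_hom (mpa Q lt q) B" "\<And>x. x \<in> carrier AA \<Longrightarrow> g (mpa_map Q lt q x) = f x"
proof -
  have RB: "ring B" using B by (rule K_algebra.axioms(1))
  have f: "f \<in> algebra_hom AA B" "\<And>a. a \<in> arcs (double Q) \<Longrightarrow> f (one_plus Q a) \<in> Units B"
     "mpa_lhs Q lt B f = f (mpa_rhs Q q)" using f by (auto simp: mpa_hom_def)
  obtain g1 where g1: "g1 \<in> algebra_hom LL B" "\<And>x. x \<in> carrier AA \<Longrightarrow> g1 (mpa_loc_map Q x) = f x"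
    unfolding mpa_loc_def mpa_loc_map_def
    by (rule loc_universal[OF KA SS B f(1)]) (use f(2) in auto)
  have "g1 (mpa_lhs Q lt LL (mpa_loc_map Q)) = mpa_lhs Q lt B f"
    by (rule lhs_hom[OF RL mL _ RB g1(1)]) (auto simp: uL g1)
  then have z: "g1 (mpa_lhs Q lt LL (mpa_loc_map Q) \<ominus>\<^bsub>LL\<^esub> mpa_loc_map Q (mpa_rhs Q q)) = \<zero>\<^bsub>B\<^esub>"
    using algebra_hom_minus(1)[OF g1(1) RL RB lhs_closed[OF RL mL] algebra_homD(2)[OF mL rhs_closed]] uL
      f(3) g1(2)[OF rhs_closed] ring_minus_zero[OF RB algebra_homD(2)[OF f(1) rhs_closed]] by simp
  obtain g where "g \<in> algebra_hom (quot_algebra LL (mpa_ideal Q lt q)) B"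
    "\<And>x. x \<in> carrier LL \<Longrightarrow> g (mpa_ideal Q lt q +>\<^bsub>LL\<^esub> x) = g1 x"
    unfolding mpa_ideal_def using quot_universal[OF KL B RelL g1(1)] z by blast
  then show ?thesis
    by (intro that[of g]) (auto simp: mpa_def mpa_map_def algebra_homD(2)[OF mL] g1)
qed

theorem mpa_unique:
  assumes B: "K_algebra (B :: ('k, 'b) module)"
    and g: "g \<in> algebra_hom (mpa Q lt q) B" "g' \<in> algebra_hom (mpa Q lt q) B"
    and eq: "\<And>x. x \<in> carrier AA \<Longrightarrow> g (mpa_map Q lt q x) = g' (mpa_map Q lt q x)"
    and X: "X \<in> carrier (mpa Q lt q)"
  shows "g X = g' X"
proof -
  have RB: "ring B" using B by (rule K_algebra.axioms(1))
  let ?\<pi> = "\<lambda>x. mpa_ideal Q lt q +>\<^bsub>LL\<^esub> x"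
  have comp: "(\<lambda>x. k (?\<pi> x)) \<in> algebra_hom LL B" if k: "k \<in> algebra_hom (mpa Q lt q) B" for k
    unfolding algebra_hom_def Ring.ring_hom_def
    by (auto simp: algebra_homD[OF mpa_pi] algebra_homD[OF k])
  have "\<exists>x\<in>carrier LL. X = ?\<pi> x" using X unfolding mpa_def quot_elem .
  then obtain x where x: "x \<in> carrier LL" "X = ?\<pi> x" by blast
  have "(\<lambda>x. g (?\<pi> x)) x = (\<lambda>x. g' (?\<pi> x)) x"
    by (rule loc_unique[OF KA SS RB])
      (use comp[OF g(1)] comp[OF g(2)] x(1) eq in \<open>auto simp: mpa_loc_def mpa_map_def mpa_loc_map_def\<close>)
  then show ?thesis using x by simp
qed

end


section \<open>Yoneda extensions\<close>

lemma equiv_ext_equiv: "equiv (extensions R M N) (ext_equiv R M N)"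
proof (rule equivI)
  show "ext_equiv R M N \<subseteq> extensions R M N \<times> extensions R M N"
    by (auto simp: ext_equiv_def)
  show "refl_on (extensions R M N) (ext_equiv R M N)"
    by (rule refl_onI)
      (auto simp: ext_equiv_def left_module_hom_def intro!: bexI[of _ "\<lambda>x. x"] bij_betw_id[unfolded id_def])
  show "sym (ext_equiv R M N)"
  proof (rule symI)
    fix x y assume "(x, y) \<in> ext_equiv R M N"
    then obtain E i p E' i' p' f where *: "x = (E, i, p)" "y = (E', i', p')" "(E, i, p) \<in> extensions R M N"
      "(E', i', p') \<in> extensions R M N" "f \<in> left_module_hom R E E'" "bij_betw f (carrier E) (carrier E')"
      "\<forall>x\<in>carrier N. f (i x) = i' x" "\<forall>x\<in>carrier E. p' (f x) = p x"
      by (auto simp: ext_equiv_def)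
    interpret E: left_module R E using *(3) by (auto simp: extensions_def)
    let ?g = "inv_into (carrier E) f"
    have g: "?g y \<in> carrier E" "f (?g y) = y" if "y \<in> carrier E'" for y
      using *(6) that by (auto simp: bij_betw_def inv_into_into f_inv_into_f)
    have gf: "?g (f x) = x" if "x \<in> carrier E" for x
      using *(6) that by (auto simp: bij_betw_def)
    have hf: "f (x \<oplus>\<^bsub>E\<^esub> y) = f x \<oplus>\<^bsub>E'\<^esub> f y" "f (a \<odot>\<^bsub>E\<^esub> x) = a \<odot>\<^bsub>E'\<^esub> f x"
      if "x \<in> carrier E" "y \<in> carrier E" "a \<in> carrier R" for x y a
      using *(5) that by (auto simp: left_module_hom_def)
    have g1: "?g (x \<oplus>\<^bsub>E'\<^esub> y) = ?g x \<oplus>\<^bsub>E\<^esub> ?g y" if "x \<in> carrier E'" "y \<in> carrier E'" for x y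
      using hf(1)[of "?g x" "?g y" "\<zero>\<^bsub>R\<^esub>"] gf[of "?g x \<oplus>\<^bsub>E\<^esub> ?g y"] g that by simp
    have g2: "?g (a \<odot>\<^bsub>E'\<^esub> x) = a \<odot>\<^bsub>E\<^esub> ?g x" if "x \<in> carrier E'" "a \<in> carrier R" for a x
      using hf(2)[of "?g x" "?g x" a] gf[of "a \<odot>\<^bsub>E\<^esub> ?g x"] g that by (simp add: E.smult_closed)
    have gh: "?g \<in> left_module_hom R E' E" using g g1 g2 by (auto simp: left_module_hom_def)
    have i: "i x \<in> carrier E" if "x \<in> carrier N" for x using *(3) that by (auto simp: extensions_def left_module_hom_def)
    show "(y, x) \<in> ext_equiv R M N"
      unfolding ext_equiv_def using *(1-4) gh bij_betw_inv_into[OF *(6)]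
      by (auto intro!: bexI[of _ ?g]) (metis *(7) gf i, metis *(8) g)
  qed
  show "trans (ext_equiv R M N)"
  proof (rule transI)
    fix x y z assume "(x, y) \<in> ext_equiv R M N" "(y, z) \<in> ext_equiv R M N"
    then obtain E i p E' i' p' E2 i2 p2 f f' where *: "x = (E, i, p)" "y = (E', i', p')" "z = (E2, i2, p2)"
       "(E, i, p) \<in> extensions R M N" "(E2, i2, p2) \<in> extensions R M N"
       "f \<in> left_module_hom R E E'" "bij_betw f (carrier E) (carrier E')"
      "\<forall>x\<in>carrier N. f (i x) = i' x" "\<forall>x\<in>carrier E. p' (f x) = p x"
       "f' \<in> left_module_hom R E' E2" "bij_betw f' (carrier E') (carrier E2)"
      "\<forall>x\<in>carrier N. f' (i' x) = i2 x" "\<forall>x\<in>carrier E'. p2 (f' x) = p' x"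
      by (fastforce simp: ext_equiv_def)
    have fE: "f x \<in> carrier E'" if "x \<in> carrier E" for x using *(6) that by (auto simp: left_module_hom_def)
    have "f' \<circ> f \<in> left_module_hom R E E2"
      using *(6,10) unfolding left_module_hom_def by (auto simp: Pi_iff)
    then show "(x, z) \<in> ext_equiv R M N"
      unfolding ext_equiv_def using *(1-5) bij_betw_trans[OF *(7,11)] *(8,9,12,13) fE
      by (auto intro!: bexI[of _ "f' \<circ> f"])
  qed
qed

lemma direct_sum_module:
  assumes "left_module R M" "left_module R N"
  shows "left_module R (direct_sum M N)"
proof -
  interpret M: left_module R M by fact
  interpret N: left_module R N by fact
  have MM: "abelian_group M" and NN: "abelian_group N" using assms by (auto simp: left_module_def)
  interpret MA: abelian_group M by fact
  interpret NA: abelian_group N by fact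
  have "abelian_group (direct_sum M N)"
  proof (rule abelian_groupI)
    fix x assume "x \<in> carrier (direct_sum M N)"
    then show "\<exists>y\<in>carrier (direct_sum M N). y \<oplus>\<^bsub>direct_sum M N\<^esub> x = \<zero>\<^bsub>direct_sum M N\<^esub>"
      by (intro bexI[of _ "(\<ominus>\<^bsub>M\<^esub> fst x, \<ominus>\<^bsub>N\<^esub> snd x)"])
       (auto simp: direct_sum_def abelian_group.l_neg[OF MM] abelian_group.l_neg[OF NN]
         abelian_group.a_inv_closed[OF MM] abelian_group.a_inv_closed[OF NN])
  qed (auto simp: direct_sum_def abelian_monoid.a_closed[OF abelian_group.axioms(1)[OF MM]] abelian_monoid.a_closed[OF abelian_group.axioms(1)[OF NN]]
     abelian_monoid.zero_closed[OF abelian_group.axioms(1)[OF MM]] abelian_monoid.zero_closed[OF abelian_group.axioms(1)[OF NN]]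
     abelian_monoid.l_zero[OF abelian_group.axioms(1)[OF MM]] abelian_monoid.l_zero[OF abelian_group.axioms(1)[OF NN]]
     abelian_monoid.a_assoc[OF abelian_group.axioms(1)[OF MM]] abelian_monoid.a_assoc[OF abelian_group.axioms(1)[OF NN]]
     abelian_monoid.a_comm[OF abelian_group.axioms(1)[OF MM]] abelian_monoid.a_comm[OF abelian_group.axioms(1)[OF NN]]
     abelian_monoid.a_lcomm[OF abelian_group.axioms(1)[OF MM]] abelian_monoid.a_lcomm[OF abelian_group.axioms(1)[OF NN]])
  then show ?thesis
    using assms(1)
    by (auto simp: left_module_def left_module_axioms_def direct_sum_def M.smult_closed N.smult_closed M.smult_l_distr N.smult_l_distr
       M.smult_r_distr N.smult_r_distr M.smult_assoc N.smult_assoc M.smult_one N.smult_one)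
qed

lemma smult_zero_right:
  assumes "left_module R M" "a \<in> carrier R" shows "a \<odot>\<^bsub>M\<^esub> \<zero>\<^bsub>M\<^esub> = \<zero>\<^bsub>M\<^esub>"
proof -
  interpret M: left_module R M by fact
  have MM: "abelian_group M" using assms by (auto simp: left_module_def)
  interpret MA: abelian_group M by fact
  have z: "\<zero>\<^bsub>M\<^esub> \<in> carrier M" "\<zero>\<^bsub>M\<^esub> \<oplus>\<^bsub>M\<^esub> \<zero>\<^bsub>M\<^esub> = \<zero>\<^bsub>M\<^esub>"
    using abelian_monoid.zero_closed[OF abelian_group.axioms(1)[OF MM]] abelian_monoid.l_zero[OF abelian_group.axioms(1)[OF MM]] by auto
  have c: "a \<odot>\<^bsub>M\<^esub> \<zero>\<^bsub>M\<^esub> \<in> carrier M" using M.smult_closed assms z by blast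
  have "a \<odot>\<^bsub>M\<^esub> \<zero>\<^bsub>M\<^esub> = a \<odot>\<^bsub>M\<^esub> \<zero>\<^bsub>M\<^esub> \<oplus>\<^bsub>M\<^esub> a \<odot>\<^bsub>M\<^esub> \<zero>\<^bsub>M\<^esub>"
    using M.smult_r_distr[OF assms(2) z(1) z(1)] z by simp
  then show ?thesis using c abelian_group.axioms(2)[OF MM] 
    by (metis M.M.add.l_cancel_one)
qed

lemma split_extension:
  assumes M: "left_module R M" and N: "left_module R N"
  shows "(direct_sum N M, \<lambda>y. (y, \<zero>\<^bsub>M\<^esub>), snd) \<in> extensions R M N"
proof -
  have MM: "abelian_monoid M" and NN: "abelian_monoid N" using assms by (auto simp: left_module_def abelian_group_def)
  show ?thesis
    using direct_sum_module[OF N M] abelian_monoid.zero_closed[OF MM] abelian_monoid.l_zero[OF MM]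
     abelian_monoid.zero_closed[OF NN] smult_zero_right[OF M]
    by (auto simp: extensions_def left_module_hom_def direct_sum_def inj_on_def image_iff)
qed


section \<open>Reflections\<close>

lemma reflection_involution:
  assumes "finite (verts Q)" "finite (arcs Q)" "loopfree Q v"
  shows "reflection Q v \<circ> reflection Q v = id"
proof -
  have form: "sym_form Q (\<lambda>w. \<alpha> w - c * \<beta> w) \<gamma> = sym_form Q \<alpha> \<gamma> - c * sym_form Q \<beta> \<gamma>" for \<alpha> \<beta> \<gamma> c
    by (simp add: sym_form_def algebra_simps sum.distrib sum_subtractf sum_distrib_left)
  have "(\<Sum>a\<in>arcs Q. coord v (head Q a) * coord v (tail Q a) + coord v (tail Q a) * coord v (head Q a)) = 0"
    by (rule sum.neutral) (use assms(3) in \<open>auto simp: coord_def loopfree_def\<close>)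
  then have "sym_form Q (coord v) (coord v) = 2"
    using assms by (simp add: sym_form_def coord_def loopfree_def if_distrib cong: if_cong)
  then show ?thesis
    by (intro ext) (simp add: reflection_def form)
qed

end

theory Submission
  imports Defs "HOL-Library.Function_Algebras" "HOL-Library.Nat_Bijection"
begin

text \<open>
  A finite-dimensional module over the multiplicative preprojective algebra amounts to coordinates
  and matrices: disjoint finite sets \<open>S v\<close> of coordinates, whose cardinalities form the dimension vector
  \<open>dimv S\<close>, and an endomorphism \<open>A b\<close> for each arrow of the double quiver, satisfying the defining
  relations (\<open>coord_rep\<close>). Everything takes place in one ring, the linear endomorphisms of
  \<open>nat \<Rightarrow> 'k\<close>, where vertices act by coordinate projections. Two arguments carry the proof.

  The first is the reflection at a loopfree vertex \<open>v\<close> with \<open>q v \<noteq> 1\<close> (\<open>reflect_rep\<close>), a multiplicative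
  version of the Bernstein-Gelfand-Ponomarev functors. The arrows into and out of \<open>v\<close> combine to maps
  \<open>\<phi>\<close> from the space at \<open>v\<close> to the sum of the neighbouring spaces and \<open>\<pi>\<close> back, with
  \<open>\<pi> \<phi> = q v - 1\<close>. As this is invertible, the sum of the neighbours splits, and replacing the space at
  \<open>v\<close> by the complement of the image of \<open>\<phi>\<close> gives a representation for a changed
  parameter with the dimension vector reflected. Simplicity and having only scalar endomorphisms are
  preserved. The reflection permutes the positive roots other than \<open>coord v\<close> (\<open>s_positive_roots\<close>),
  and \<open>coord v\<close> cannot occur in a decomposition when \<open>q v \<noteq> 1\<close>, so the conditions
  on the root are transported as well. When \<open>q v = 1\<close> and \<open>S\<close> is simple of dimension vector other
  than \<open>coord v\<close>, the map \<open>\<phi>\<close> is injective, \<open>\<pi>\<close> is surjective and \<open>\<pi> \<phi> = 0\<close>,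
  whence \<open>(dimv S, coord v) \<le> 0\<close> (\<open>simple_trivial_parameter\<close>). If \<open>(\<alpha>, \<alpha>) > 0\<close>, some loopfree \<open>v\<close> has
  \<open>(\<alpha>, coord v) > 0\<close>, and reflecting there lowers the total dimension. Induction shows that a simple
  representation with \<open>(\<alpha>, \<alpha>) > 0\<close> has the required dimension vector (\<open>simple_rep_root\<close>) and that
  every admissible real root comes from a simple representation (\<open>real_root_rep\<close>).

  The second relates rigidity to the form. First order deformations modulo infinitesimal changes of
  basis are the middle homology of a complex
  \<open>\<Prod>\<^sub>v End(X\<^sub>v) \<rightarrow> \<Prod>\<^sub>b Hom(X\<^sub>t\<^sub>b, X\<^sub>h\<^sub>b) \<rightarrow> \<Prod>\<^sub>v End(X\<^sub>v)\<close>
  whose outer terms together exceed the middle one in dimension by \<open>(\<alpha>, \<alpha>)\<close>. The kernel of the first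
  map consists of the endomorphisms of \<open>X\<close>, and under the trace pairing so does the dual of the
  cokernel of the second (\<open>trace_endo\<close>). Hence rigidity of a nonzero representation forces
  \<open>(\<alpha>, \<alpha>) > 0\<close> (\<open>rigid_form\<close>), and conversely scalar endomorphisms together with \<open>(\<alpha>, \<alpha>) = 2\<close>, as for
  real roots, force rigidity (\<open>brick_rigid\<close>).

  The translation to modules rests on the universal property: homomorphisms from the algebra to a
  corner \<open>u R u\<close> of a ring are the same as elements of \<open>R\<close> satisfying the relations
  (\<open>mpa_rep_of_hom\<close>, \<open>hom_of_mpa_rep\<close>). Taking endomorphisms for \<open>R\<close> gives modules; taking dual numbers over
  endomorphisms gives self-extensions, which identifies the vanishing of \<open>Ext\<^sup>1\<close> with the absence of
  nontrivial first order deformations (\<open>rigid_iff\<close>).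
\<close>

section \<open>Roots and reflections\<close>

locale quiver = fin_digraph Q for Q :: "('v, 'a) pre_digraph"
begin

abbreviation form :: "('v \<Rightarrow> int) \<Rightarrow> ('v \<Rightarrow> int) \<Rightarrow> int" where "form \<equiv> sym_form Q"
abbreviation s :: "'v \<Rightarrow> ('v \<Rightarrow> int) \<Rightarrow> ('v \<Rightarrow> int)" where "s \<equiv> reflection Q"

lemma form_sym: "form \<alpha> \<beta> = form \<beta> \<alpha>"
  unfolding sym_form_def by (simp add: algebra_simps)

lemma form_lin: "form (\<lambda>w. \<alpha> w + c * \<beta> w) \<gamma> = form \<alpha> \<gamma> + c * form \<beta> \<gamma>"
  "form (\<lambda>w. \<alpha> w - c * \<beta> w) \<gamma> = form \<alpha> \<gamma> - c * form \<beta> \<gamma>"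
  by (simp_all add: sym_form_def algebra_simps sum.distrib sum_subtractf sum_distrib_left)

lemma form_scale: "form (\<lambda>w. c * \<beta> w) \<gamma> = c * form \<beta> \<gamma>"
  using form_lin(1)[of "\<lambda>_. 0" c \<beta> \<gamma>] by (simp add: sym_form_def)

lemma form_lin2: "form \<gamma> (\<lambda>w. \<alpha> w + c * \<beta> w) = form \<gamma> \<alpha> + c * form \<gamma> \<beta>"
  "form \<gamma> (\<lambda>w. \<alpha> w - c * \<beta> w) = form \<gamma> \<alpha> - c * form \<gamma> \<beta>"
  by (simp_all add: form_sym[of \<gamma>] form_lin)

lemma form_coord: "form \<alpha> (coord v) = (if v \<in> verts Q then 2 * \<alpha> v else 0)
   - (\<Sum>a\<in>arcs Q. (if tail Q a = v then \<alpha> (head Q a) else 0) + (if head Q a = v then \<alpha> (tail Q a) else 0))"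
proof -
  have "(\<Sum>w\<in>verts Q. \<alpha> w * coord v w) = (if v \<in> verts Q then \<alpha> v else 0)"
    by (simp add: coord_def if_distrib cong: if_cong)
  moreover have "(\<Sum>a\<in>arcs Q. \<alpha> (head Q a) * coord v (tail Q a) + \<alpha> (tail Q a) * coord v (head Q a))
    = (\<Sum>a\<in>arcs Q. (if tail Q a = v then \<alpha> (head Q a) else 0) + (if head Q a = v then \<alpha> (tail Q a) else 0))"
    by (rule sum.cong) (auto simp: coord_def)
  ultimately show ?thesis unfolding sym_form_def by simp
qed

lemma form_coord_self: "loopfree Q v \<Longrightarrow> form (coord v) (coord v) = 2"
  unfolding form_coord by (subst sum.neutral) (auto simp: loopfree_def coord_def)

lemma form_coord_neg: "v \<noteq> w \<Longrightarrow> form (coord v) (coord w) \<le> 0"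
proof -
  assume "v \<noteq> w"
  then have "form (coord v) (coord w) = - (\<Sum>a\<in>arcs Q. (if tail Q a = w then coord v (head Q a) else 0) + (if head Q a = w then coord v (tail Q a) else 0))"
    unfolding form_coord by (simp add: coord_def)
  moreover have "(\<Sum>a\<in>arcs Q. (if tail Q a = w then coord v (head Q a) else 0) + (if head Q a = w then coord v (tail Q a) else 0)) \<ge> (0::int)"
    by (rule sum_nonneg) (auto simp: coord_def)
  ultimately show ?thesis by linarith
qed

lemma form_expand:
  assumes "\<alpha> \<in> root_lattice Q" shows "form \<beta> \<alpha> = (\<Sum>v\<in>verts Q. \<alpha> v * form \<beta> (coord v))"
proof -
  have 1: "\<alpha> x = (\<Sum>v\<in>verts Q. \<alpha> v * coord v x)" for x
    using assms by (auto simp: coord_def root_lattice_def if_distrib cong: if_cong)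
  have 2: "form \<beta> (\<lambda>x. \<Sum>v\<in>V. \<alpha> v * coord v x) = (\<Sum>v\<in>V. \<alpha> v * form \<beta> (coord v))" if "finite V" for V
    using that
  proof induct
    case empty then show ?case by (simp add: sym_form_def)
  next
    case (insert v V)
    then show ?case using form_lin2(1)[of \<beta> "\<lambda>x. \<Sum>v\<in>V. \<alpha> v * coord v x" "\<alpha> v" "coord v"]
      by (simp add: add.commute)
  qed
  from 2[OF finite_verts] 1 show ?thesis by (metis (no_types, lifting) ext)
qed

lemma s_apply: "s v \<alpha> = (\<lambda>w. \<alpha> w - form \<alpha> (coord v) * coord v w)"
  by (simp add: reflection_def)

lemma s_other: "w \<noteq> v \<Longrightarrow> s v \<alpha> w = \<alpha> w"
  by (simp add: s_apply coord_def)

lemma s_lin: "s v (\<lambda>w. \<alpha> w + c * \<beta> w) = (\<lambda>w. s v \<alpha> w + c * s v \<beta> w)"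
  by (rule ext) (simp add: s_apply form_lin algebra_simps)

lemma s_coord_self: "loopfree Q v \<Longrightarrow> s v (coord v) = (\<lambda>w. - coord v w)"
  by (rule ext) (simp add: s_apply form_coord_self)

lemma form_s: "loopfree Q v \<Longrightarrow> form (s v \<alpha>) (s v \<beta>) = form \<alpha> \<beta>"
  unfolding s_apply form_lin form_lin2 by (simp add: form_coord_self form_sym[of "coord v" \<beta>])

lemma s_involution: "loopfree Q v \<Longrightarrow> s v (s v \<alpha>) = \<alpha>"
  using reflection_involution[OF finite_verts finite_arcs] by (metis comp_apply id_apply)

lemma s_lattice: "loopfree Q v \<Longrightarrow> \<alpha> \<in> root_lattice Q \<Longrightarrow> s v \<alpha> \<in> root_lattice Q"
  by (auto simp: root_lattice_def s_apply coord_def loopfree_def)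

definition loopfree_verts :: "'v set" where "loopfree_verts = {v. loopfree Q v}"

text \<open>Words in the simple reflections give access to the length function of the Weyl group.\<close>
definition wd :: "'v list \<Rightarrow> ('v \<Rightarrow> int) \<Rightarrow> ('v \<Rightarrow> int)" where
  "wd xs = foldr (\<lambda>v f. s v \<circ> f) xs id"

lemma wd_simps [simp]: "wd [] = id" "wd (x # xs) = s x \<circ> wd xs"
  by (simp_all add: wd_def)

lemma wd_append: "wd (xs @ ys) = wd xs \<circ> wd ys"
  by (induct xs) (simp_all add: comp_assoc)

lemma weyl_wd: "w \<in> weyl_group Q \<longleftrightarrow> (\<exists>xs\<in>lists loopfree_verts. w = wd xs)"
proof
  assume "w \<in> weyl_group Q"
  then show "\<exists>xs\<in>lists loopfree_verts. w = wd xs"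
  proof induct
    case weyl_id then show ?case by (intro bexI[of _ "[]"]) auto
  next
    case (weyl_step w v)
    then obtain xs where "xs \<in> lists loopfree_verts" "w = wd xs" by blast
    then show ?case using weyl_step by (intro bexI[of _ "v # xs"]) (auto simp: loopfree_verts_def)
  qed
next
  have "xs \<in> lists loopfree_verts \<Longrightarrow> wd xs \<in> weyl_group Q" for xs
    by (induct xs) (auto simp: loopfree_verts_def weyl_group.weyl_id[unfolded id_def[symmetric]] intro: weyl_group.intros simp del: comp_apply)
  then show "\<exists>xs\<in>lists loopfree_verts. w = wd xs \<Longrightarrow> w \<in> weyl_group Q" by blast
qed

lemma weyl_comp: "w \<in> weyl_group Q \<Longrightarrow> w' \<in> weyl_group Q \<Longrightarrow> w \<circ> w' \<in> weyl_group Q"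
  unfolding weyl_wd by (metis append_in_lists_conv wd_append)

lemma weyl_s: "loopfree Q v \<Longrightarrow> s v \<in> weyl_group Q"
  using weyl_group.weyl_step[OF weyl_group.weyl_id] by simp

lemma wd_lin: "wd xs (\<lambda>w. \<alpha> w + c * \<beta> w) = (\<lambda>w. wd xs \<alpha> w + c * wd xs \<beta> w)"
  by (induct xs) (simp_all add: s_lin)

lemma wd_zero: "wd xs (\<lambda>_. 0) = (\<lambda>_. 0)"
  by (induct xs) (auto simp: s_apply sym_form_def)

lemma wd_scale: "wd xs (\<lambda>w. c * \<beta> w) = (\<lambda>w. c * wd xs \<beta> w)"
  using wd_lin[of xs "\<lambda>_. 0" c \<beta>] by (simp add: wd_zero)

lemma wd_form: "xs \<in> lists loopfree_verts \<Longrightarrow> form (wd xs \<alpha>) (wd xs \<beta>) = form \<alpha> \<beta>"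
  by (induct xs) (auto simp: form_s loopfree_verts_def)

lemma wd_lattice: "xs \<in> lists loopfree_verts \<Longrightarrow> \<alpha> \<in> root_lattice Q \<Longrightarrow> wd xs \<alpha> \<in> root_lattice Q"
  by (induct xs) (auto simp: s_lattice loopfree_verts_def)

definition len :: "(('v \<Rightarrow> int) \<Rightarrow> ('v \<Rightarrow> int)) \<Rightarrow> nat" where
  "len w = (LEAST n. \<exists>xs\<in>lists loopfree_verts. length xs = n \<and> w = wd xs)"

lemma len_le: "xs \<in> lists loopfree_verts \<Longrightarrow> len (wd xs) \<le> length xs"
  unfolding len_def by (rule Least_le) auto

lemma len_ex: "w \<in> weyl_group Q \<Longrightarrow> \<exists>xs\<in>lists loopfree_verts. length xs = len w \<and> w = wd xs"
  unfolding len_def weyl_wd by (rule LeastI_ex) auto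

lemma len_comp: "w \<in> weyl_group Q \<Longrightarrow> zs \<in> lists loopfree_verts \<Longrightarrow> len (w \<circ> wd zs) \<le> len w + length zs"
  using len_ex[of w] len_le by (metis append_in_lists_conv length_append wd_append)

lemma coord_lattice: "v \<in> verts Q \<Longrightarrow> coord v \<in> root_lattice Q"
  by (auto simp: root_lattice_def coord_def)

text \<open>The alternating word of length \<open>k\<close> that ends in \<open>t\<close>; the reduced words in two letters are of this form.\<close>
fun alt :: "'v \<Rightarrow> 'v \<Rightarrow> nat \<Rightarrow> 'v list" where
  "alt t u 0 = []"
| "alt t u (Suc k) = (if even k then t else u) # alt t u k"

lemma length_alt [simp]: "length (alt t u k) = k" by (induct k) auto

text \<open>The rank two case of the positivity of \<open>w (coord u)\<close>, computed by hand: a word of minimal length that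
  cannot be shortened by appending \<open>u\<close> alternates and ends in \<open>t\<close>, and the coefficients it produces obey a
  Chebyshev-type recursion in \<open>- (coord t, coord u)\<close>. For small values of that number the dihedral
  group is finite and the recursion is cut off before a coefficient can become negative.\<close>
lemma dihedral:
  assumes tu: "loopfree Q t" "loopfree Q u" "t \<noteq> u" and zs: "zs \<in> lists {t, u}"
    and red: "\<And>ys. ys \<in> lists {t, u} \<Longrightarrow> wd ys = wd zs \<Longrightarrow> length zs \<le> length ys"
    and redu: "\<And>ys. ys \<in> lists {t, u} \<Longrightarrow> wd ys = wd zs \<circ> s u \<Longrightarrow> length zs \<le> length ys"
  shows "\<exists>a b. 0 \<le> a \<and> 0 \<le> b \<and> wd zs (coord u) = (\<lambda>w. a * coord t w + b * coord u w)"
proof -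
  have ssid: "s t \<circ> s t = id" "s u \<circ> s u = id" using s_involution tu by auto
  have alt: "ps @ ys = zs \<Longrightarrow> ys = alt t u (length ys)" for ps ys
  proof (induct ys arbitrary: ps)
    case (Cons x ys)
    then have ys: "ys = alt t u (length ys)" by (metis Cons_eq_append_conv append.assoc append_Cons append_Nil)
    have x: "x = t \<or> x = u" and psl: "ps \<in> lists {t,u}" "ys \<in> lists {t,u}" using Cons(2) zs by auto
    have "x = (if even (length ys) then t else u)"
    proof (cases "ys")
      case Nil
      have "x \<noteq> u"
      proof
        assume "x = u"
        then have "wd ps = wd zs \<circ> s u" using Cons(2)[symmetric] Nil by (simp add: wd_append comp_assoc ssid)
        then have "length zs \<le> length ps" using redu psl by blast
        then show False using Cons(2)[symmetric] by simp
      qed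
      then show ?thesis using x Nil by simp
    next
      case C: (Cons y zs')
      have "x \<noteq> y"
      proof
        assume "x = y"
        have ssy: "s y (s y \<alpha>) = \<alpha>" for \<alpha>
          using x \<open>x = y\<close> s_involution tu by auto
        then have "wd (ps @ zs') = wd zs" using Cons(2)[symmetric] C \<open>x = y\<close> by (auto simp: wd_append)
        moreover have "ps @ zs' \<in> lists {t,u}" using psl C by auto
        ultimately have "length zs \<le> length (ps @ zs')" using red by blast
        then show False using Cons(2)[symmetric] C by simp
      qed
      then show ?thesis using x ys C by (auto split: if_splits)
    qed
    then show ?case using ys by simp
  qed simp
  define k where "k = length zs"
  have zk: "zs = alt t u k" using alt[of "[]" zs] by (simp add: k_def)
  have suf: "\<exists>ps. zs = ps @ alt t u j \<and> ps \<in> lists {t,u} \<and> length ps = k - j" if "j \<le> k" for j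
  proof -
    have "\<exists>ps. alt t u k = ps @ alt t u j" using that
    proof (induct k)
      case (Suc k) then show ?case by (cases "j = Suc k") (auto simp: le_Suc_eq)
    qed simp
    then obtain ps where ps: "zs = ps @ alt t u j" using zk by blast
    moreover have "ps \<in> lists {t,u}" using ps zs by auto
    moreover have "length ps = k - j" using ps by (simp add: k_def)
    ultimately show ?thesis by blast
  qed
  define m where "m = - form (coord t) (coord u)"
  have m0: "0 \<le> m" using form_coord_neg[of t u] tu by (simp add: m_def)
  have f: "form (coord t) (coord t) = 2" "form (coord u) (coord u) = 2" "form (coord t) (coord u) = - m" "form (coord u) (coord t) = - m"
    using tu by (simp_all add: form_coord_self m_def form_sym)
  have st: "s t (\<lambda>w. a * coord t w + b * coord u w) = (\<lambda>w. (m * b - a) * coord t w + b * coord u w)" for a b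
    by (rule ext) (simp add: s_apply form_lin form_scale f algebra_simps)
  have su: "s u (\<lambda>w. a * coord t w + b * coord u w) = (\<lambda>w. a * coord t w + (m * a - b) * coord u w)" for a b
    by (rule ext) (simp add: s_apply form_lin form_scale f algebra_simps)
  have cu: "coord u = (\<lambda>w. 0 * coord t w + 1 * coord u w)" by simp
  have st': "s t (\<lambda>w. \<alpha> w + a * coord t w + b * coord u w) = (\<lambda>w. \<alpha> w + (m * b - a - form \<alpha> (coord t)) * coord t w + b * coord u w)" for \<alpha> a b
    unfolding s_apply form_lin f by (rule ext) (simp add: algebra_simps)
  have su': "s u (\<lambda>w. \<alpha> w + a * coord t w + b * coord u w) = (\<lambda>w. \<alpha> w + a * coord t w + (m * a - b - form \<alpha> (coord u)) * coord u w)" for \<alpha> a b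
    unfolding s_apply form_lin f by (rule ext) (simp add: algebra_simps)
  have alt2: "alt t u (Suc (Suc 0)) = [u, t]" "alt t u (Suc (Suc (Suc 0))) = [t, u, t]" by simp_all
  consider "m = 0" | "m = 1" | "m \<ge> 2" using m0 by linarith
  then show ?thesis
  proof cases
    case 1
    have com: "s u (s t (s u \<alpha>)) = s t \<alpha>" for \<alpha>
    proof -
      have "s u (s t (s u (\<lambda>w. \<alpha> w + 0 * coord t w + 0 * coord u w))) = s t (\<lambda>w. \<alpha> w + 0 * coord t w + 0 * coord u w)"
        unfolding st' su' 1 by simp
      then show ?thesis by simp
    qed
    have "k \<le> 1"
    proof (rule ccontr)
      assume "\<not> k \<le> 1"
      then obtain ps where ps: "zs = ps @ alt t u (Suc (Suc 0))" "ps \<in> lists {t,u}" "length ps = k - Suc (Suc 0)" using suf[of "Suc (Suc 0)"] by auto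
      have wps: "wd (ps @ [t]) = wd zs \<circ> s u"
        proof -
        have "wd zs = wd ps \<circ> (s u \<circ> s t)" using ps(1) alt2 by (simp only: wd_append wd_simps comp_id)
        moreover have "s u \<circ> s t \<circ> s u = s t" using com by (simp only: fun_eq_iff comp_apply) simp
        ultimately show ?thesis by (simp only: wd_append wd_simps comp_id comp_assoc)
      qed
      then have "k \<le> length (ps @ [t])" using redu[OF _ wps] ps(2) unfolding k_def by auto
      then show False using ps(3) \<open>\<not> k \<le> 1\<close> by simp
    qed
    then have "k = 0 \<or> k = 1" by auto
    then show ?thesis
    proof
      assume "k = 0" then show ?thesis using zk by (intro exI[of _ 0] exI[of _ 1]) simp
    next
      assume "k = 1"
      then have "wd zs (coord u) = (\<lambda>w. (m * 1 - 0) * coord t w + 1 * coord u w)"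
        unfolding zk by (subst cu) (simp only: st One_nat_def alt.simps wd_simps even_zero if_True comp_apply id_apply)
      then show ?thesis using m0 by (metis (full_types) diff_zero mult_1_right zero_le_one)
    qed
  next
    case 2
    have com: "s t (s u (s t (s u \<alpha>))) = s u (s t \<alpha>)" for \<alpha>
    proof -
      have "s t (s u (s t (s u (\<lambda>w. \<alpha> w + 0 * coord t w + 0 * coord u w)))) = s u (s t (\<lambda>w. \<alpha> w + 0 * coord t w + 0 * coord u w))"
        unfolding st' su' 2 by simp
      then show ?thesis by simp
    qed
    have "k \<le> 2"
    proof (rule ccontr)
      assume "\<not> k \<le> 2"
      then obtain ps where ps: "zs = ps @ alt t u (Suc (Suc (Suc 0)))" "ps \<in> lists {t,u}" "length ps = k - Suc (Suc (Suc 0))" using suf[of "Suc (Suc (Suc 0))"] by auto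
      have wps: "wd (ps @ [u, t]) = wd zs \<circ> s u"
        proof -
        have "wd zs = wd ps \<circ> (s t \<circ> s u \<circ> s t)" using ps(1) alt2 by (simp only: wd_append wd_simps comp_id comp_assoc)
        moreover have "s t \<circ> s u \<circ> s t \<circ> s u = s u \<circ> s t" using com by (simp only: fun_eq_iff comp_apply) simp
        ultimately show ?thesis by (simp only: wd_append wd_simps comp_id comp_assoc)
      qed
      then have "k \<le> length (ps @ [u, t])" using redu[OF _ wps] ps(2) unfolding k_def by auto
      then show False using ps(3) \<open>\<not> k \<le> 2\<close> by simp
    qed
    then have "k = 0 \<or> k = 1 \<or> k = 2" by auto
    then show ?thesis
    proof (elim disjE)
      assume "k = 0" then show ?thesis using zk by (intro exI[of _ 0] exI[of _ 1]) simp
    next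
      assume "k = 1"
      then have "wd zs (coord u) = (\<lambda>w. (m * 1 - 0) * coord t w + 1 * coord u w)"
        unfolding zk by (subst cu) (simp only: st One_nat_def alt.simps wd_simps even_zero if_True comp_apply id_apply)
      then show ?thesis using m0 by (metis (full_types) diff_zero mult_1_right zero_le_one)
    next
      assume "k = 2"
      have "wd zs (coord u) = s u (s t (\<lambda>w. 0 * coord t w + 1 * coord u w))"
        unfolding zk \<open>k = 2\<close> by (simp add: numeral_2_eq_2)
      also have "\<dots> = (\<lambda>w. (m * 1 - 0) * coord t w + (m * (m * 1 - 0) - 1) * coord u w)" by (simp only: st su)
      finally show ?thesis using 2 by (intro exI[of _ 1] exI[of _ 0]) simp
    qed
  next
    case 3
    have "\<exists>a b. wd (alt t u k) (coord u) = (\<lambda>w. a * coord t w + b * coord u w) \<and> 0 \<le> a \<and> 0 \<le> b \<and>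
      (if even k then a \<le> b else b \<le> a)" for k
    proof (induct k)
      case 0 then show ?case by (intro exI[of _ 0] exI[of _ 1]) simp
    next
      case (Suc k)
      then obtain a b where ab: "wd (alt t u k) (coord u) = (\<lambda>w. a * coord t w + b * coord u w)" "0 \<le> a" "0 \<le> b"
        "if even k then a \<le> b else b \<le> a" by blast
      have m2: "m * a \<ge> 2 * a" "m * b \<ge> 2 * b" using 3 ab by (auto intro: mult_right_mono)
      show ?case
      proof (cases "even k")
        case True
        then have "wd (alt t u (Suc k)) (coord u) = (\<lambda>w. (m * b - a) * coord t w + b * coord u w)"
          using ab(1) by (simp add: st)
        then show ?thesis using m2 ab True by (intro exI[of _ "m * b - a"] exI[of _ b]) simp
      next
        case False
        then have "wd (alt t u (Suc k)) (coord u) = (\<lambda>w. a * coord t w + (m * a - b) * coord u w)"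
          using ab(1) by (simp add: su)
        then show ?thesis using m2 ab False by (intro exI[of _ a] exI[of _ "m * a - b"]) simp
      qed
    qed
    then show ?thesis using zk by metis
  qed
qed

text \<open>The standard argument for Coxeter groups: peel off from \<open>w\<close> a maximal factor in the dihedral group of
  \<open>u\<close> and the last letter \<open>t\<close> of a reduced word. The dihedral factor maps \<open>coord u\<close> to a nonnegative
  combination of \<open>coord t\<close> and \<open>coord u\<close>, and what is left of \<open>w\<close> is shorter and keeps both nonnegative.\<close>
lemma pos_of_len:
  "w \<in> weyl_group Q \<Longrightarrow> loopfree Q u \<Longrightarrow> len w \<le> len (w \<circ> s u) \<Longrightarrow> 0 \<le> w (coord u) x"
proof (induct "len w" arbitrary: w u x rule: less_induct)
  case less
  obtain xs where xs: "xs \<in> lists loopfree_verts" "length xs = len w" "w = wd xs" using len_ex[OF less(2)] by blast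
  show ?case
  proof (cases xs rule: rev_cases)
    case Nil then show ?thesis using xs by (simp add: coord_def)
  next
    case (snoc ys t)
    have t: "loopfree Q t" and ysl: "ys \<in> lists loopfree_verts" using xs snoc by (auto simp: loopfree_verts_def)
    have "w \<circ> s t = wd ys" unfolding xs(3) snoc using s_involution[OF t] by (auto simp: wd_append)
    then have wst: "len (w \<circ> s t) < len w" using len_le[OF ysl] xs(2) snoc by simp
    then have tu: "t \<noteq> u" using less(4) by auto
    have IL: "lists {t,u} \<subseteq> lists loopfree_verts" using t less(3) by (intro lists_mono) (auto simp: loopfree_verts_def)
    let ?P = "\<lambda>(w', zs). w' \<in> weyl_group Q \<and> zs \<in> lists {t,u} \<and> w = w' \<circ> wd zs \<and> len w = len w' + length zs"
    have "len w \<le> len (w \<circ> s t) + 1"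
      using len_comp[of "w \<circ> s t" "[t]"] weyl_comp[OF less(2) weyl_s[OF t]] t s_involution[OF t]
      by (simp add: loopfree_verts_def comp_assoc o_def id_def)
    then have P0: "?P (w \<circ> s t, [t])"
      using wst weyl_comp[OF less(2) weyl_s[OF t]] s_involution[OF t] by (auto simp: comp_assoc)
    obtain x0 where x0: "?P x0" "\<And>y. ?P y \<Longrightarrow> len (fst x0) \<le> len (fst y)"
      using ex_has_least_nat[of ?P "(w \<circ> s t, [t])" "\<lambda>x. len (fst x)", OF P0] by blast
    obtain w' zs where xx: "x0 = (w', zs)" by (cases x0)
    have P: "?P (w', zs)" using x0(1) unfolding xx .
    have min: "?P (w2, zs2) \<Longrightarrow> len w' \<le> len w2" for w2 zs2
      using x0(2)[of "(w2, zs2)"] unfolding xx fst_conv .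
    then have w': "w' \<in> weyl_group Q" "zs \<in> lists {t,u}" "w = w' \<circ> wd zs" "len w = len w' + length zs"
      using P unfolding split_conv by blast+
    have lw': "len w' < len w" using min[OF P0] wst by simp
    have up: "len w' \<le> len (w' \<circ> s r)" if r: "r \<in> {t,u}" for r
    proof (rule ccontr)
      assume a: "\<not> ?thesis"
      have lr: "loopfree Q r" using r t less(3) by auto
      have m: "w' \<circ> s r \<in> weyl_group Q" by (rule weyl_comp[OF w'(1) weyl_s[OF lr]])
      have e: "w = (w' \<circ> s r) \<circ> wd (r # zs)" unfolding w'(3) using s_involution[OF lr] by auto
      have z: "r # zs \<in> lists {t,u}" using r w'(2) by auto
      have "len w \<le> len (w' \<circ> s r) + length (r # zs)" using len_comp[OF m] z IL e by (metis subsetD)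
      then have "?P (w' \<circ> s r, r # zs)" using m e z a w'(4) by simp
      from min[OF this] a show False by simp
    qed
    have pos: "0 \<le> w' (coord r) x" if "r \<in> {t,u}" for r x
      by (rule less(1)[OF lw' w'(1)]) (use that t less(3) up in auto)
    have "\<exists>a b. 0 \<le> a \<and> 0 \<le> b \<and> wd zs (coord u) = (\<lambda>w. a * coord t w + b * coord u w)"
    proof (rule dihedral[OF t less(3) tu w'(2)])
      fix ys assume "ys \<in> lists {t,u}" "wd ys = wd zs"
      then show "length zs \<le> length ys" using len_comp[OF w'(1), of ys] IL w'(3,4) by auto
    next
      fix ys assume y: "ys \<in> lists {t,u}" "wd ys = wd zs \<circ> s u"
      have "w \<circ> s u = w' \<circ> wd ys" unfolding w'(3) y(2) by (simp add: comp_assoc)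
      then have "len w \<le> len w' + length ys" using len_comp[OF w'(1) subsetD[OF IL y(1)]] less(4) by simp
      then show "length zs \<le> length ys" using w'(4) by simp
    qed
    then obtain a b where ab: "0 \<le> a" "0 \<le> b" "wd zs (coord u) = (\<lambda>w. a * coord t w + b * coord u w)" by blast
    obtain xs' where xs': "w' = wd xs'" using w'(1) weyl_wd by blast
    have "w (coord u) = (\<lambda>y. a * w' (coord t) y + b * w' (coord u) y)"
      unfolding w'(3) comp_apply ab(3) xs' by (simp add: wd_lin wd_scale)
    then show ?thesis using ab pos by simp
  qed
qed

text \<open>One of \<open>w\<close> and \<open>w \<circ> s v\<close> is the shorter, and \<open>s v\<close> changes the sign of \<open>coord v\<close>.\<close>
lemma real_root_sign:
  assumes "\<beta> \<in> real_roots Q" shows "(\<forall>x. 0 \<le> \<beta> x) \<or> (\<forall>x. \<beta> x \<le> 0)"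
proof -
  obtain w v where w: "w \<in> weyl_group Q" "loopfree Q v" "\<beta> = w (coord v)" using assms by (auto simp: real_roots_def)
  obtain xs where xs: "xs \<in> lists loopfree_verts" "w = wd xs" using w weyl_wd by blast
  show ?thesis
  proof (cases "len w \<le> len (w \<circ> s v)")
    case True then show ?thesis using pos_of_len[OF w(1,2)] w by auto
  next
    case False
    have "len (w \<circ> s v) \<le> len (w \<circ> s v \<circ> s v)" using False s_involution[OF w(2)] by (simp add: comp_def)
    from pos_of_len[OF weyl_comp[OF w(1) weyl_s[OF w(2)]] w(2) this]
    have "0 \<le> wd xs (\<lambda>y. - 1 * coord v y) x" for x by (simp add: s_coord_self[OF w(2)] xs)
    then show ?thesis unfolding wd_scale w(3) xs(2) by auto
  qed
qed

lemma real_root_lattice: "\<beta> \<in> real_roots Q \<Longrightarrow> \<beta> \<in> root_lattice Q"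
proof -
  assume "\<beta> \<in> real_roots Q"
  then obtain w v where w: "w \<in> weyl_group Q" "loopfree Q v" "\<beta> = w (coord v)" by (auto simp: real_roots_def)
  obtain xs where xs: "xs \<in> lists loopfree_verts" "w = wd xs" using w weyl_wd by blast
  show ?thesis unfolding w(3) xs(2) using w(2) by (intro wd_lattice xs coord_lattice) (simp add: loopfree_def)
qed

lemma real_root_form: "\<beta> \<in> real_roots Q \<Longrightarrow> form \<beta> \<beta> = 2"
proof -
  assume "\<beta> \<in> real_roots Q"
  then obtain w v where w: "w \<in> weyl_group Q" "loopfree Q v" "\<beta> = w (coord v)" by (auto simp: real_roots_def)
  obtain xs where xs: "xs \<in> lists loopfree_verts" "w = wd xs" using w weyl_wd by blast
  show ?thesis unfolding w(3) xs(2) wd_form[OF xs(1)] by (rule form_coord_self[OF w(2)])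
qed

lemma real_root_s: "\<beta> \<in> real_roots Q \<Longrightarrow> loopfree Q v \<Longrightarrow> s v \<beta> \<in> real_roots Q"
proof -
  assume "\<beta> \<in> real_roots Q" and v: "loopfree Q v"
  then obtain w u where w: "w \<in> weyl_group Q" "loopfree Q u" "\<beta> = w (coord u)" by (auto simp: real_roots_def)
  then have "s v \<beta> = (s v \<circ> w) (coord u)" "s v \<circ> w \<in> weyl_group Q" using v weyl_group.weyl_step by auto
  then show ?thesis unfolding real_roots_def using w by blast
qed

text \<open>Each step along a reduced word adds a nonnegative multiple of a positive root, so the Weyl group moves
  elements of the fundamental region upwards; in particular their orbits stay in \<open>\<nat>\<^sup>I\<close>.\<close>
lemma fundamental_le:
  "\<alpha> \<in> fundamental_region Q \<Longrightarrow> w \<in> weyl_group Q \<Longrightarrow> \<alpha> x \<le> w \<alpha> x"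
proof (induct "len w" arbitrary: w x rule: less_induct)
  case less
  obtain xs where xs: "xs \<in> lists loopfree_verts" "length xs = len w" "w = wd xs" using len_ex[OF less(3)] by blast
  show ?case
  proof (cases xs rule: rev_cases)
    case Nil then show ?thesis using xs by simp
  next
    case (snoc ys t)
    have t: "loopfree Q t" and ysl: "ys \<in> lists loopfree_verts" using xs snoc by (auto simp: loopfree_verts_def)
    have l: "len (wd ys) < len w" using len_le[OF ysl] xs(2) snoc by simp
    have W: "wd ys \<in> weyl_group Q" using ysl weyl_wd by blast
    have we: "w = wd ys \<circ> s t" using xs snoc by (simp add: wd_append)
    have e: "w \<alpha> = (\<lambda>y. wd ys \<alpha> y + (- form \<alpha> (coord t)) * wd ys (coord t) y)"
      unfolding we comp_apply wd_lin[symmetric] by (simp add: s_apply)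
    have "\<alpha> x \<le> wd ys \<alpha> x" by (rule less(1)[OF l less(2) W])
    moreover have "0 \<le> wd ys (coord t) x" by (rule pos_of_len[OF W t]) (use l we in simp)
    moreover have "0 \<le> - form \<alpha> (coord t)" using less(2) t by (auto simp: fundamental_region_def loopfree_def)
    ultimately show ?thesis unfolding e using mult_nonneg_nonneg by (metis add_increasing2)
  qed
qed

lemma imaginary_cases:
  assumes "\<beta> \<in> imaginary_roots Q"
  shows "\<exists>\<alpha>\<in>fundamental_region Q. \<exists>w\<in>weyl_group Q. \<beta> = w \<alpha> \<or> \<beta> = - w \<alpha>"
  using assms
proof induct
  case (fundamental \<alpha>) then show ?case using weyl_group.weyl_id by (metis id_apply)
next
  case (weyl \<beta> w)
  then obtain \<alpha> w' where a: "\<alpha> \<in> fundamental_region Q" "w' \<in> weyl_group Q" "\<beta> = w' \<alpha> \<or> \<beta> = - w' \<alpha>" by blast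
  obtain xs where "w = wd xs" using weyl weyl_wd by blast
  then have "w (- \<gamma>) = - w \<gamma>" for \<gamma> using wd_scale[of xs "-1" \<gamma>] by (simp add: fun_Compl_def)
  then have "w \<beta> = (w \<circ> w') \<alpha> \<or> w \<beta> = - (w \<circ> w') \<alpha>" using a by auto
  then show ?case using a weyl_comp[OF weyl(3) a(2)] by blast
next
  case (sign \<beta>)
  then obtain \<alpha> w where "\<alpha> \<in> fundamental_region Q" "w \<in> weyl_group Q" "\<beta> = w \<alpha> \<or> \<beta> = - w \<alpha>" by blast
  then show ?case by (intro bexI[of _ \<alpha>] bexI[of _ w]) auto
qed

lemma fundamental_nonneg: "\<alpha> \<in> fundamental_region Q \<Longrightarrow> 0 \<le> \<alpha> x"
  unfolding fundamental_region_def root_lattice_def by (cases "x \<in> verts Q") simp_all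

lemma root_nonzero: "\<beta> \<in> real_roots Q \<union> imaginary_roots Q \<Longrightarrow> \<beta> \<noteq> (\<lambda>_. 0)"
proof
  assume "\<beta> \<in> real_roots Q \<union> imaginary_roots Q" and z: "\<beta> = (\<lambda>_. 0)"
  then consider "\<beta> \<in> real_roots Q" | "\<beta> \<in> imaginary_roots Q" by blast
  then show False
  proof cases
    case 1 then show False using real_root_form[OF 1] z by (simp add: sym_form_def)
  next
    case 2
    then obtain \<alpha> w where a: "\<alpha> \<in> fundamental_region Q" "w \<in> weyl_group Q" "\<beta> = w \<alpha> \<or> \<beta> = - w \<alpha>"
      using imaginary_cases by blast
    have "w \<alpha> x = 0" for x using fun_cong[OF z, of x] a(3) by auto
    then have "\<alpha> x \<le> 0" for x using fundamental_le[OF a(1,2), of x] by simp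
    moreover have "0 \<le> \<alpha> x" for x using fundamental_nonneg[OF a(1)] .
    ultimately have "\<alpha> x = 0" for x by (meson order_antisym)
    then have "\<alpha> = (\<lambda>_. 0)" by (rule ext)
    then show False using a(1) unfolding fundamental_region_def mem_Collect_eq by (elim conjE notE)
  qed
qed

lemma positive_pos: "positive Q \<beta> \<Longrightarrow> 0 \<le> \<beta> x"
  by (cases "x \<in> verts Q") (auto simp: positive_def root_lattice_def)

text \<open>A real root other than \<open>coord v\<close> that is positive has a nonzero entry away from \<open>v\<close>, which the reflection
  does not change, so its image cannot be negative. Imaginary roots are governed by \<open>fundamental_le\<close>.\<close>
theorem s_positive_roots:
  assumes v: "loopfree Q v" and b: "\<beta> \<in> positive_roots Q" "\<beta> \<noteq> coord v"
  shows "s v \<beta> \<in> positive_roots Q"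
proof -
  have pos: "0 \<le> \<beta> x" for x using b positive_pos by (auto simp: positive_roots_def)
  have lat: "\<beta> \<in> root_lattice Q" using b by (auto simp: positive_roots_def positive_def)
  consider "\<beta> \<in> real_roots Q" | "\<beta> \<in> imaginary_roots Q" using b by (auto simp: positive_roots_def)
  then show ?thesis
  proof cases
    case 1
    have r: "s v \<beta> \<in> real_roots Q" by (rule real_root_s[OF 1 v])
    have "\<exists>x. x \<noteq> v \<and> \<beta> x \<noteq> 0"
    proof (rule ccontr)
      assume "\<not> ?thesis"
      then obtain c where e: "\<beta> = (\<lambda>w. c * coord v w)" 
        by (intro that[of "\<beta> v"] ext) (auto simp: coord_def)
      then have c: "\<beta> v = c" by (simp add: coord_def)
      have "form \<beta> \<beta> = \<beta> v * (\<beta> v * 2)"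
        unfolding c unfolding e using v by (simp add: form_scale form_sym[of "coord v" "\<lambda>w. c * coord v w"] form_coord_self)
      then have "\<beta> v * \<beta> v = 1" using real_root_form[OF 1] by simp
      then have "\<beta> v = 1" using pos[of v] by (auto simp: zmult_eq_1_iff)
      then show False using e c b(2) by simp
    qed
    then obtain x where x0: "x \<noteq> v" "\<beta> x \<noteq> 0" by blast
    then have x: "x \<noteq> v" "0 < \<beta> x" using pos[of x] by auto
    have "0 < s v \<beta> x" unfolding s_other[OF x(1)] by (rule x(2))
    then have "\<not> (\<forall>x. s v \<beta> x \<le> 0)" by (meson not_less)
    then have "\<forall>x. 0 \<le> s v \<beta> x" using real_root_sign[OF r] by blast
    then show ?thesis using r real_root_lattice[OF r] unfolding positive_roots_def positive_def by blast
  next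
    case 2
    then obtain \<alpha> w where a: "\<alpha> \<in> fundamental_region Q" "w \<in> weyl_group Q" "\<beta> = w \<alpha> \<or> \<beta> = - w \<alpha>"
      using imaginary_cases by blast
    have al: "0 \<le> \<alpha> x" for x using fundamental_nonneg[OF a(1)] .
    have wa: "0 \<le> w \<alpha> x" for x using fundamental_le[OF a(1,2), of x] al[of x] by simp
    have "\<beta> = w \<alpha>"
    proof (rule ccontr)
      assume "\<beta> \<noteq> w \<alpha>"
      then have "\<beta> = - w \<alpha>" using a by blast
      then have "\<beta> x = 0" for x using wa[of x] pos[of x] by simp
      then show False using root_nonzero 2 by blast
    qed
    then have e: "s v \<beta> = (s v \<circ> w) \<alpha>" by simp
    have W: "s v \<circ> w \<in> weyl_group Q" using a(2) v by (rule weyl_group.weyl_step)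
    have "0 \<le> s v \<beta> x" for x using fundamental_le[OF a(1) W, of x] al[of x] e by simp
    moreover have "s v \<beta> \<in> imaginary_roots Q" using imaginary_roots.weyl[OF 2 weyl_s[OF v]] .
    ultimately show ?thesis using s_lattice[OF v lat] by (auto simp: positive_roots_def positive_def)
  qed
qed

end

section \<open>Linear algebra of coordinate spaces\<close>

abbreviation scl :: "'k::field \<Rightarrow> ('x \<Rightarrow> 'k) \<Rightarrow> 'x \<Rightarrow> 'k" where "scl c x \<equiv> (\<lambda>i. c * x i)"

global_interpretation fv: vector_space "scl :: 'k::field \<Rightarrow> ('x \<Rightarrow> 'k) \<Rightarrow> 'x \<Rightarrow> 'k"
  by unfold_locales (auto simp: algebra_simps)

declare fv.scale_eq_0_iff [simp del] fv.scale_cancel_left [simp del] fv.scale_cancel_right [simp del]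
  fv.scale_scale [simp del] fv.scale_one [simp del] fv.scale_zero_left [simp del] fv.scale_zero_right [simp del]
  fv.scale_minus_left [simp del] fv.scale_minus_right [simp del]

lemma fv_linear: "Vector_Spaces.linear scl scl f \<longleftrightarrow> (\<forall>x y. f (x + y) = f x + f y) \<and> (\<forall>c x. f (scl c x) = scl c (f x))"
  for f :: "('x \<Rightarrow> 'k::field) \<Rightarrow> 'y \<Rightarrow> 'k"
  by (simp add: Vector_Spaces.linear_iff fv.vector_space_axioms)

lemma kernel_subspace:
  fixes f :: "('x \<Rightarrow> 'k::field) \<Rightarrow> 'y \<Rightarrow> 'k"
  assumes "Vector_Spaces.linear scl scl f" "fv.subspace V"
  shows "fv.subspace {x\<in>V. f x = 0}"
proof -
  interpret f: Vector_Spaces.linear scl scl f by (rule assms(1))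
  show ?thesis
  proof (rule fv.subspaceI)
    fix c x assume "x \<in> {x\<in>V. f x = 0}"
    then have "scl c x \<in> V" "f (scl c x) = 0"
      using fv.subspace_scale[OF assms(2)] f.scale[of c x] fv.scale_zero_right[of c] by (auto simp only: mem_Collect_eq)
    then show "scl c x \<in> {x\<in>V. f x = 0}" by simp
  qed (use fv.subspace_0[OF assms(2)] fv.subspace_add[OF assms(2)] f.zero f.add in auto)
qed

text \<open>For finite \<open>S\<close> these are the coordinate spaces that carry all finite-dimensional spaces below.\<close>
definition supp_sp :: "'x set \<Rightarrow> ('x \<Rightarrow> 'k::field) set" where "supp_sp S = {x. \<forall>i. i \<notin> S \<longrightarrow> x i = 0}"

definition unitv :: "'x \<Rightarrow> 'x \<Rightarrow> 'k::field" where "unitv i = (\<lambda>j. if j = i then 1 else 0)"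

lemma unitv_nz: "unitv i \<noteq> (0 :: 'x \<Rightarrow> 'k::field)"
  by (auto simp: fun_eq_iff unitv_def intro!: exI[of _ i])

lemma supp_sp_subspace: "fv.subspace (supp_sp S)"
  by (rule fv.subspaceI) (auto simp: supp_sp_def)

lemma sum_fun_apply: "(\<Sum>a\<in>A. f a) x = (\<Sum>a\<in>A. f a x)" for f :: "'a \<Rightarrow> 'b \<Rightarrow> 'c::comm_monoid_add"
  by (induct A rule: infinite_finite_induct) auto

lemma supp_sp_expand:
  assumes "finite S" "x \<in> supp_sp S" shows "x = (\<Sum>i\<in>S. scl (x i) (unitv i))"
  by (rule ext) (use assms in \<open>auto simp: sum_fun_apply unitv_def supp_sp_def if_distrib cong: if_cong\<close>)

lemma unitv_inj: "inj_on (unitv :: 'x \<Rightarrow> 'x \<Rightarrow> 'k::field) S"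
  by (rule inj_onI) (metis unitv_def zero_neq_one)

lemma unitv_in: "i \<in> S \<Longrightarrow> unitv i \<in> supp_sp S" by (auto simp: unitv_def supp_sp_def)

lemma supp_sp_basis:
  assumes "finite S"
  shows "fv.independent (unitv ` S :: ('x \<Rightarrow> 'k::field) set)" "fv.span (unitv ` S) = (supp_sp S :: ('x \<Rightarrow> 'k) set)"
    "fv.dim (supp_sp S :: ('x \<Rightarrow> 'k) set) = card S"
proof -
  show ind: "fv.independent (unitv ` S :: ('x \<Rightarrow> 'k) set)"
  proof (rule fv.independent_if_scalars_zero)
    fix f :: "('x \<Rightarrow> 'k) \<Rightarrow> 'k" and x :: "'x \<Rightarrow> 'k"
    assume z: "(\<Sum>x\<in>(unitv ` S :: ('x \<Rightarrow> 'k) set). scl (f x) x) = 0" and "x \<in> unitv ` S"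
    then obtain i where i: "i \<in> S" "x = unitv i" by auto
    have "(\<Sum>j\<in>S. scl (f (unitv j)) (unitv j)) i = 0"
      using z by (subst (asm) sum.reindex[OF unitv_inj]) (simp add: fun_eq_iff)
    then have "(\<Sum>j\<in>S. f (unitv j) * (if i = j then 1 else 0)) = 0"
      unfolding sum_fun_apply by (simp add: unitv_def)
    then show "f x = 0" using assms i by (simp add: if_distrib cong: if_cong)
  qed (use assms in simp)
  show sp: "fv.span (unitv ` S) = (supp_sp S :: ('x \<Rightarrow> 'k) set)"
  proof (rule fv.span_unique)
    show "unitv ` S \<subseteq> (supp_sp S :: ('x \<Rightarrow> 'k) set)" using unitv_in by auto
    fix T' :: "('x \<Rightarrow> 'k) set" assume T: "unitv ` S \<subseteq> T'" "fv.subspace T'"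
    show "supp_sp S \<subseteq> T'"
    proof
      fix x :: "'x \<Rightarrow> 'k" assume "x \<in> supp_sp S"
      then show "x \<in> T'" using T
        by (subst supp_sp_expand[OF assms]) (auto intro!: fv.subspace_sum fv.subspace_scale)
    qed
  qed (rule supp_sp_subspace)
  have "fv.dim (supp_sp S :: ('x \<Rightarrow> 'k) set) = card (unitv ` S :: ('x \<Rightarrow> 'k) set)"
    by (rule fv.dim_unique) (use ind sp unitv_in in auto)
  then show "fv.dim (supp_sp S :: ('x \<Rightarrow> 'k) set) = card S" by (simp add: card_image[OF unitv_inj])
qed

lemma indep_finite:
  assumes "finite S" "B \<subseteq> supp_sp S" "fv.independent (B :: ('x \<Rightarrow> 'k::field) set)"
  shows "finite B" "card B \<le> card S"
proof -
  have f: "finite (unitv ` S :: ('x \<Rightarrow> 'k) set)" using assms(1) by simp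
  have sub: "B \<subseteq> fv.span (unitv ` S)" using assms supp_sp_basis(2) by blast
  have "finite B \<and> card B \<le> card (unitv ` S :: ('x \<Rightarrow> 'k) set)" by (rule fv.independent_span_bound[OF f assms(3) sub])
  then show "finite B" "card B \<le> card S" using card_image_le[OF assms(1), of "unitv :: 'x \<Rightarrow> 'x \<Rightarrow> 'k"] by auto
qed

lemma subspace_basis:
  assumes "finite S" "fv.subspace V" "V \<subseteq> supp_sp S" "A \<subseteq> V" "fv.independent (A :: ('x \<Rightarrow> 'k::field) set)"
  obtains B where "A \<subseteq> B" "finite B" "fv.independent B" "fv.span B = V" "card B = fv.dim V"
proof -
  obtain B where B: "A \<subseteq> B" "B \<subseteq> V" "fv.independent B" "V \<subseteq> fv.span B"
    using fv.maximal_independent_subset_extend[OF assms(4,5)] by blast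
  have "finite B" using indep_finite(1)[OF assms(1) _ B(3)] B assms by blast
  moreover have "fv.span B = V" using B assms(2) by (simp add: fv.span_minimal subset_antisym)
  moreover have "card B = fv.dim V" using B fv.basis_card_eq_dim by blast
  ultimately show ?thesis using that B by blast
qed

lemma rank_nullity:
  fixes f :: "('x \<Rightarrow> 'k::field) \<Rightarrow> 'y \<Rightarrow> 'k"
  assumes S: "finite S" "fv.subspace V" "V \<subseteq> supp_sp S" and f: "Vector_Spaces.linear scl scl f"
  shows "fv.dim V = fv.dim {x\<in>V. f x = 0} + fv.dim (f ` V)"
proof -
  interpret f: Vector_Spaces.linear scl scl f by (rule f)
  let ?K = "{x\<in>V. f x = 0}"
  have K: "fv.subspace ?K" by (rule kernel_subspace[OF f S(2)])
  obtain A where A: "finite A" "fv.independent A" "fv.span A = ?K" "card A = fv.dim ?K"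
    by (rule subspace_basis[OF S(1) K _ empty_subsetI fv.independent_empty]) (use S in auto)
  have AV: "A \<subseteq> V" using A fv.span_superset by blast
  obtain B where B: "A \<subseteq> B" "finite B" "fv.independent B" "fv.span B = V" "card B = fv.dim V"
    using subspace_basis[OF S AV A(2)] .
  let ?C = "B - A"
  have inj: "inj_on f (fv.span ?C)"
  proof (rule inj_onI)
    fix x y assume xy: "x \<in> fv.span ?C" "y \<in> fv.span ?C" "f x = f y"
    then have d: "x - y \<in> fv.span ?C" "f (x - y) = 0" by (auto simp: fv.span_diff f.diff)
    have "x - y \<in> V" using d B fv.span_mono[of ?C B] by blast
    then have "x - y \<in> fv.span A" using d A by auto
    then have "fv.representation B (x - y) = fv.representation A (x - y)"
      "fv.representation B (x - y) = fv.representation ?C (x - y)"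
      using fv.representation_extend[OF B(3)] B(1) d(1) by blast+
    then have "fv.representation B (x - y) b = 0" for b using fv.representation_ne_zero by (metis DiffD2)
    then have "x - y = 0" using fv.sum_nonzero_representation_eq[OF B(3), of "x - y"] \<open>x - y \<in> V\<close> B(4) by simp
    then show "x = y" by simp
  qed
  have fC: "fv.independent (f ` ?C)"
    by (rule f.independent_injective_image) (use fv.independent_mono[OF B(3), of "B - A"] inj in auto)
  have "fv.span (f ` ?C) = f ` V"
  proof -
    have "fv.span (f ` B) = f ` V" using f.span_image B by auto
    moreover have "fv.span (f ` B) \<subseteq> fv.span (f ` ?C)"
    proof (rule fv.span_minimal)
      have "f b = 0" if "b \<in> A" for b using that A(3) fv.span_base by blast
      then have "f b \<in> fv.span (f ` ?C)" if "b \<in> B" for b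
        using that fv.span_zero[of "f ` ?C"] fv.span_base[of "f b" "f ` ?C"] by (cases "b \<in> A") auto
      then show "f ` B \<subseteq> fv.span (f ` ?C)" by blast
    qed simp
    ultimately show ?thesis using fv.span_mono[of "f ` ?C" "f ` B"] by blast
  qed
  then have "fv.dim (f ` V) = card (f ` ?C)" using fv.dim_span_eq_card_independent[OF fC] by simp
  also have "\<dots> = card ?C" using inj_on_subset[OF inj fv.span_superset] by (rule card_image)
  also have "\<dots> = card B - card A" using B A by (simp add: card_Diff_subset)
  finally show ?thesis using A B card_mono[of B A] by simp
qed

lemma dim_mono:
  assumes "finite S" "fv.subspace W" "W \<subseteq> (supp_sp S :: ('x \<Rightarrow> 'k::field) set)" "fv.subspace V" "V \<subseteq> W"
  shows "fv.dim V \<le> fv.dim W" "fv.dim V = fv.dim W \<Longrightarrow> V = W"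
proof -
  obtain A where A: "finite A" "fv.independent A" "fv.span A = V" "card A = fv.dim V"
    using subspace_basis[OF assms(1,4), of "{}"] assms fv.independent_empty by blast
  have "A \<subseteq> W" using A assms fv.span_superset by blast
  then obtain B where B: "A \<subseteq> B" "finite B" "fv.independent B" "fv.span B = W" "card B = fv.dim W"
    using subspace_basis[OF assms(1-3) _ A(2)] by blast
  show "fv.dim V \<le> fv.dim W" using A B card_mono by metis
  show "V = W" if "fv.dim V = fv.dim W" using that A B card_subset_eq by metis
qed

lemma dim_zero: "fv.dim ({0} :: ('x \<Rightarrow> 'k::field) set) = 0"
  using fv.dim_span[of "{} :: ('x \<Rightarrow> 'k) set"] fv.dim_eq_card_independent[OF fv.independent_empty] by (simp add: fv.span_empty)

lemma dim_inj_image: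
  fixes f :: "('x \<Rightarrow> 'k::field) \<Rightarrow> 'y \<Rightarrow> 'k"
  assumes S: "finite S" "fv.subspace V" "V \<subseteq> supp_sp S" and f: "Vector_Spaces.linear scl scl f"
    and inj: "\<And>x. x \<in> V \<Longrightarrow> f x = 0 \<Longrightarrow> x = 0"
  shows "fv.dim (f ` V) = fv.dim V"
proof -
  interpret f: Vector_Spaces.linear scl scl f by (rule f)
  have "{x\<in>V. f x = 0} = {0}" using inj fv.subspace_0[OF S(2)] f.zero by auto
  then show ?thesis using rank_nullity[OF assms(1-4)] by (simp add: dim_zero)
qed

lemma supp_sp_mono: "S \<subseteq> T \<Longrightarrow> supp_sp S \<subseteq> supp_sp T" by (auto simp: supp_sp_def)

lemma linear_subspace_image:
  fixes f :: "('x \<Rightarrow> 'k::field) \<Rightarrow> 'y \<Rightarrow> 'k"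
  shows "Vector_Spaces.linear scl scl f \<Longrightarrow> fv.subspace V \<Longrightarrow> fv.subspace (f ` V)"
  by (rule module_hom.subspace_image) (auto simp: module_hom_iff_linear)

lemma rank_nullity_supp:
  fixes f :: "('x \<Rightarrow> 'k::field) \<Rightarrow> 'y \<Rightarrow> 'k"
  assumes "finite S" "Vector_Spaces.linear scl scl f"
  shows "card S = fv.dim {x\<in>supp_sp S. f x = 0} + fv.dim (f ` supp_sp S)"
  using rank_nullity[OF assms(1) supp_sp_subspace order.refl assms(2)] supp_sp_basis(3)[OF assms(1), where 'k='k] by simp

text \<open>Cardinalities of coordinate sets are compared through mutually inverse linear maps.\<close>
lemma card_eq_of_inverse:
  fixes f :: "('x \<Rightarrow> 'k::field) \<Rightarrow> 'y \<Rightarrow> 'k"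
  assumes "finite S" "finite T" and f: "Vector_Spaces.linear scl scl f"
    and "\<And>x. x \<in> supp_sp S \<Longrightarrow> f x \<in> supp_sp T" "\<And>x. x \<in> supp_sp S \<Longrightarrow> g (f x) = x"
    "\<And>y. y \<in> supp_sp T \<Longrightarrow> g y \<in> supp_sp S" "\<And>y. y \<in> supp_sp T \<Longrightarrow> f (g y) = y"
  shows "card S = card T"
proof -
  interpret f: Vector_Spaces.linear scl scl f by (rule f)
  have im: "f ` supp_sp S = supp_sp T" using assms(4,6,7) by (auto simp: image_iff) metis
  have "g 0 = 0" using assms(5)[of 0] fv.subspace_0[OF supp_sp_subspace] f.zero by metis
  then have "fv.dim (f ` supp_sp S) = fv.dim (supp_sp S :: ('x \<Rightarrow> 'k) set)"
    using assms by (intro dim_inj_image supp_sp_subspace) (auto, metis)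
  then show ?thesis using im supp_sp_basis(3)[OF assms(1), where 'k='k] supp_sp_basis(3)[OF assms(2), where 'k='k] by simp
qed

text \<open>The Euler characteristic of a complex \<open>I \<rightarrow> J \<rightarrow> I\<close> of coordinate spaces: exactness in the middle and a
  nonzero element in the kernel of the first map leave too little room for the middle term.\<close>
lemma card_less_of_exact:
  fixes d0 :: "('x \<Rightarrow> 'k::field) \<Rightarrow> 'y \<Rightarrow> 'k" and d1 :: "('y \<Rightarrow> 'k) \<Rightarrow> 'x \<Rightarrow> 'k"
  assumes fin: "finite I" "finite J" and lin: "Vector_Spaces.linear scl scl d0" "Vector_Spaces.linear scl scl d1"
    and cl: "\<And>x. x \<in> supp_sp I \<Longrightarrow> d0 x \<in> supp_sp J" "\<And>y. y \<in> supp_sp J \<Longrightarrow> d1 y \<in> supp_sp I"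
    and ex: "\<And>y. y \<in> supp_sp J \<Longrightarrow> d1 y = 0 \<Longrightarrow> \<exists>x\<in>supp_sp I. y = d0 x"
    and u: "u \<in> supp_sp I" "u \<noteq> 0" "d0 u = 0"
  shows "card J < 2 * card I"
proof -
  interpret d0: Vector_Spaces.linear scl scl d0 by (rule lin)
  interpret d1: Vector_Spaces.linear scl scl d1 by (rule lin)
  let ?I = "supp_sp I :: ('x \<Rightarrow> 'k) set" and ?J = "supp_sp J :: ('y \<Rightarrow> 'k) set"
  let ?K = "{x\<in>?I. d0 x = 0}" and ?L = "{y\<in>?J. d1 y = 0}"
  have K: "fv.subspace ?K" by (rule kernel_subspace[OF lin(1) supp_sp_subspace])
  have L: "fv.subspace ?L" by (rule kernel_subspace[OF lin(2) supp_sp_subspace])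
  have "fv.dim ?K \<noteq> 0"
  proof
    assume "fv.dim ?K = 0"
    moreover have z: "fv.subspace {0 :: 'x \<Rightarrow> 'k}" "{0} \<subseteq> ?K" using fv.subspace_0[OF K] by (simp_all only: fv.subspace_single_0) blast
    ultimately have "{0} = ?K" using dim_mono(2)[OF fin(1) K _ z] by (simp add: dim_zero)
    then show False using u by blast
  qed
  moreover have "card I = fv.dim ?K + fv.dim (d0 ` ?I)" by (rule rank_nullity_supp[OF fin(1) lin(1)])
  moreover have "fv.dim ?L \<le> fv.dim (d0 ` ?I)"
    using dim_mono(1)[OF fin(2) linear_subspace_image[OF lin(1) supp_sp_subspace] _ L] ex cl(1) by blast
  moreover have "card J = fv.dim ?L + fv.dim (d1 ` ?J)" by (rule rank_nullity_supp[OF fin(2) lin(2)])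
  moreover have "fv.dim (d1 ` ?J) \<le> card I"
    using dim_mono(1)[OF fin(1) supp_sp_subspace order.refl linear_subspace_image[OF lin(2) supp_sp_subspace[of J]]] cl(2)
      supp_sp_basis(3)[OF fin(1), where 'k='k] by auto
  ultimately show ?thesis by linarith
qed

text \<open>The functionals that vanish on a subspace of codimension at least two form a space of dimension at
  least two, which therefore contains more than the multiples of \<open>t0\<close>.\<close>
lemma codim_functional:
  assumes fin: "finite I" and V: "fv.subspace V" "V \<subseteq> (supp_sp I :: ('x \<Rightarrow> 'k::field) set)" and d: "fv.dim V + 1 < card I"
  obtains t where "t \<in> supp_sp I" "\<And>v. v \<in> V \<Longrightarrow> (\<Sum>i\<in>I. t i * v i) = 0" "\<And>c. t \<noteq> scl c t0"
proof -
  obtain B where B: "finite B" "fv.independent B" "fv.span B = V" "card B = fv.dim V"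
    using subspace_basis[OF fin V, of "{}"] fv.independent_empty by blast
  define f where "f t = (\<lambda>b. if b \<in> B then \<Sum>i\<in>I. t i * b i else 0)" for t :: "'x \<Rightarrow> 'k"
  have f: "Vector_Spaces.linear scl scl f"
    unfolding fv_linear f_def by (auto simp: fun_eq_iff sum.distrib algebra_simps sum_distrib_left)
  interpret f: Vector_Spaces.linear scl scl f by (rule f)
  let ?K = "{x\<in>supp_sp I. f x = 0}"
  have "fv.dim (f ` supp_sp I) \<le> fv.dim (supp_sp B :: (('x \<Rightarrow> 'k) \<Rightarrow> 'k) set)"
    by (rule dim_mono(1)[OF B(1) supp_sp_subspace order.refl linear_subspace_image[OF f supp_sp_subspace]]) (auto simp: f_def supp_sp_def)
  then have "fv.dim (f ` supp_sp I) \<le> card B" using supp_sp_basis(3)[OF B(1), where 'k='k] by simp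
  moreover have "card I = fv.dim ?K + fv.dim (f ` supp_sp I)" by (rule rank_nullity_supp[OF fin f])
  ultimately have "fv.dim ?K > 1" using d B by linarith
  have "\<not> ?K \<subseteq> fv.span {t0}"
  proof
    assume "?K \<subseteq> fv.span {t0}"
    then have "fv.dim ?K \<le> card {t0}" by (rule fv.dim_le_card) auto
    then show False using \<open>fv.dim ?K > 1\<close> by simp
  qed
  then obtain t where t: "t \<in> supp_sp I" "f t = 0" "t \<notin> fv.span {t0}" by blast
  have "(\<Sum>i\<in>I. t i * v i) = 0" if "v \<in> V" for v
  proof -
    have "v \<in> fv.span B" using that B by simp
    then show ?thesis
    proof (rule fv.span_induct_alt)
      fix c b y assume "b \<in> B" "(\<Sum>i\<in>I. t i * y i) = 0"
      moreover have "(\<Sum>i\<in>I. t i * b i) = 0" using fun_cong[OF t(2), of b] \<open>b \<in> B\<close> by (simp add: f_def)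
      moreover have "(\<Sum>i\<in>I. t i * (scl c b + y) i) = c * (\<Sum>i\<in>I. t i * b i) + (\<Sum>i\<in>I. t i * y i)"
        by (simp add: algebra_simps sum.distrib sum_distrib_left)
      ultimately show "(\<Sum>i\<in>I. t i * (scl c b + y) i) = 0" by simp
    qed simp
  qed
  moreover have "t \<noteq> scl c t0" for c using t(3) by (metis fv.span_base fv.span_scale insertI1)
  ultimately show ?thesis using that t(1) by blast
qed

text \<open>The converse count. The kernel of \<open>d0\<close> and the functionals vanishing on the image of \<open>d1\<close> are at most
  one-dimensional, so both maps have rank at least \<open>card I - 1\<close>, which accounts for all of \<open>card J\<close>.\<close>
lemma exact_of_card:
  fixes d0 :: "('x \<Rightarrow> 'k::field) \<Rightarrow> 'y \<Rightarrow> 'k" and d1 :: "('y \<Rightarrow> 'k) \<Rightarrow> 'x \<Rightarrow> 'k"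
  assumes fin: "finite I" "finite J" and lin: "Vector_Spaces.linear scl scl d0" "Vector_Spaces.linear scl scl d1"
    and cl: "\<And>x. x \<in> supp_sp I \<Longrightarrow> d0 x \<in> supp_sp J" "\<And>y. y \<in> supp_sp J \<Longrightarrow> d1 y \<in> supp_sp I"
    and cx: "\<And>x. x \<in> supp_sp I \<Longrightarrow> d1 (d0 x) = 0"
    and k0: "\<And>x. x \<in> supp_sp I \<Longrightarrow> d0 x = 0 \<Longrightarrow> \<exists>c. x = scl c u0"
    and k1: "\<And>t. t \<in> supp_sp I \<Longrightarrow> (\<And>y. y \<in> supp_sp J \<Longrightarrow> (\<Sum>i\<in>I. t i * d1 y i) = 0) \<Longrightarrow> \<exists>c. t = scl c t0"
    and cnt: "card J + 2 = 2 * card I"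
    and y: "y \<in> supp_sp J" "d1 y = 0"
  shows "\<exists>x\<in>supp_sp I. y = d0 x"
proof -
  interpret d0: Vector_Spaces.linear scl scl d0 by (rule lin)
  interpret d1: Vector_Spaces.linear scl scl d1 by (rule lin)
  let ?I = "supp_sp I :: ('x \<Rightarrow> 'k) set" and ?J = "supp_sp J :: ('y \<Rightarrow> 'k) set"
  let ?K = "{x\<in>?I. d0 x = 0}" and ?L = "{y\<in>?J. d1 y = 0}"
  have L: "fv.subspace ?L" by (rule kernel_subspace[OF lin(2) supp_sp_subspace])
  have "?K \<subseteq> fv.span {u0}" using k0 by (auto simp: fv.span_singleton)
  then have "fv.dim ?K \<le> card {u0}" by (rule fv.dim_le_card) auto
  moreover have "card I = fv.dim ?K + fv.dim (d0 ` ?I)" by (rule rank_nullity_supp[OF fin(1) lin(1)])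
  moreover have "card J = fv.dim ?L + fv.dim (d1 ` ?J)" by (rule rank_nullity_supp[OF fin(2) lin(2)])
  moreover have "card I \<le> fv.dim (d1 ` ?J) + 1"
  proof (rule ccontr)
    assume "\<not> ?thesis"
    then have d: "fv.dim (d1 ` ?J) + 1 < card I" by simp
    have sub: "d1 ` ?J \<subseteq> supp_sp I" using cl by auto
    obtain t where t: "t \<in> supp_sp I" "\<And>v. v \<in> d1 ` ?J \<Longrightarrow> (\<Sum>i\<in>I. t i * v i) = 0" "\<And>c. t \<noteq> scl c t0"
      by (rule codim_functional[OF fin(1) linear_subspace_image[OF lin(2) supp_sp_subspace] sub d, of t0]) (rule that)
    then have "\<exists>c. t = scl c t0" by (intro k1) auto
    then show False using t(3) by blast
  qed
  ultimately have le: "fv.dim ?L \<le> fv.dim (d0 ` ?I)" using cnt by simp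
  have sub: "d0 ` ?I \<subseteq> ?L" using cl(1) cx by blast
  have "d0 ` ?I = ?L"
    using dim_mono[OF fin(2) L _ linear_subspace_image[OF lin(1) supp_sp_subspace] sub] le by (auto simp: order_antisym)
  then show ?thesis using y by blast
qed

section \<open>The ring of linear endomorphisms\<close>

typedef (overloaded) ('k::field) endo = "{f :: (nat \<Rightarrow> 'k) \<Rightarrow> nat \<Rightarrow> 'k. Vector_Spaces.linear scl scl f}"
  morphisms app Endo
  by (rule exI[of _ "\<lambda>_. 0"]) (auto simp: fv_linear)

setup_lifting type_definition_endo

lemma app_linear: "Vector_Spaces.linear scl scl (app f)" using app[of f] by simp

lemma app_vec: "app f (x + y) = app f x + app f y" "app f (scl c x) = scl c (app f x)" "app f 0 = 0"
  "app f (x - y) = app f x - app f y" "app f (\<Sum>i\<in>I. g i) = (\<Sum>i\<in>I. app f (g i))"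
proof -
  interpret f: Vector_Spaces.linear scl scl "app f" by (rule app_linear)
  show "app f (x + y) = app f x + app f y" "app f (scl c x) = scl c (app f x)" "app f 0 = 0"
  "app f (x - y) = app f x - app f y" "app f (\<Sum>i\<in>I. g i) = (\<Sum>i\<in>I. app f (g i))"
    by (rule f.add f.scale f.zero f.diff f.sum)+
qed

instantiation endo :: (field) ring_1
begin
lift_definition zero_endo :: "'a endo" is "\<lambda>_. 0" by (auto simp: fv_linear)
lift_definition one_endo :: "'a endo" is "\<lambda>x. x" by (auto simp: fv_linear)
lift_definition plus_endo :: "'a endo \<Rightarrow> 'a endo \<Rightarrow> 'a endo" is "\<lambda>f g x. f x + g x"
  by (auto simp: fv_linear fun_eq_iff algebra_simps)
lift_definition minus_endo :: "'a endo \<Rightarrow> 'a endo \<Rightarrow> 'a endo" is "\<lambda>f g x. f x - g x"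
  by (auto simp: fv_linear fun_eq_iff algebra_simps)
lift_definition uminus_endo :: "'a endo \<Rightarrow> 'a endo" is "\<lambda>f x. - f x"
  by (auto simp: fv_linear fun_eq_iff)
lift_definition times_endo :: "'a endo \<Rightarrow> 'a endo \<Rightarrow> 'a endo" is "\<lambda>f g x. f (g x)"
  by (auto simp: fv_linear)
instance
proof
  fix a b c :: "'a endo"
  show "a * (b + c) = a * b + a * c" by transfer (auto simp: fv_linear)
  show "(0 :: 'a endo) \<noteq> 1" by transfer (auto simp: fun_eq_iff intro!: exI[of _ "\<lambda>_. 1"])
qed (transfer; auto simp: fun_eq_iff algebra_simps)+
end

lemma app_simps [simp]: "app 0 x = 0" "app 1 x = x" "app (f + g) x = app f x + app g x"
  "app (f - g) x = app f x - app g x" "app (- f) x = - app f x" "app (f * g) x = app f (app g x)"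
  by (transfer; auto)+

lemma app_sum [simp]: "app (\<Sum>i\<in>I. f i) x = (\<Sum>i\<in>I. app (f i) x)"
  by (induct I rule: infinite_finite_induct) auto

lemma endo_eqI: "(\<And>x. app f x = app g x) \<Longrightarrow> f = g"
  by transfer auto

text \<open>The scalars, embedded as central elements.\<close>
lift_definition sc :: "'k::field \<Rightarrow> 'k endo" is scl by (auto simp: fv_linear fun_eq_iff algebra_simps)
lemma app_sc [simp]: "app (sc c) x = scl c x" by transfer simp

lemma sc_simps: "sc (c + d) = sc c + sc d" "sc (c * d) = sc c * sc d" "sc 1 = 1" "sc 0 = 0" "sc (- c) = - sc c" "sc (c - d) = sc c - sc d"
proof -
  show "sc (c + d) = sc c + sc d" by (rule endo_eqI, rule ext) (simp only: app_sc app_simps plus_fun_apply distrib_right)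
  show "sc (c * d) = sc c * sc d" by (rule endo_eqI, rule ext) (simp only: app_sc app_simps mult.assoc)
  show "sc 1 = 1" by (rule endo_eqI) simp
  show "sc 0 = 0" by (rule endo_eqI, rule ext) (simp only: app_sc app_simps mult_zero_left zero_fun_apply)
  show "sc (- c) = - sc c" by (rule endo_eqI, rule ext) (simp only: app_sc app_simps uminus_apply mult_minus_left)
  show "sc (c - d) = sc c - sc d" by (rule endo_eqI, rule ext) (simp only: app_sc app_simps minus_apply left_diff_distrib)
qed

lemma sc_comm: "f * sc c = sc c * f" by (rule endo_eqI) (simp add: app_vec)
lemma sc_left: "f * (sc c * g) = sc c * (f * g)" by (metis sc_comm mult.assoc)

lift_definition pr :: "nat set \<Rightarrow> 'k::field endo" is "\<lambda>S x i. if i \<in> S then x i else 0"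
  by (auto simp: fv_linear fun_eq_iff)
lemma app_pr [simp]: "app (pr S) x = (\<lambda>i. if i \<in> S then x i else 0)" by transfer simp
lemma pr_mult: "pr S * pr T = pr (S \<inter> T)" by (rule endo_eqI) auto
lemma pr_empty: "pr {} = 0" by (rule endo_eqI) auto
lemma pr_Un: "S \<inter> T = {} \<Longrightarrow> pr (S \<union> T) = pr S + pr T" by (rule endo_eqI) (auto simp: fun_eq_iff)
lemma pr_UN: "finite I \<Longrightarrow> disjoint_family_on F I \<Longrightarrow> pr (\<Union>i\<in>I. F i) = (\<Sum>i\<in>I. pr (F i))"
proof (induct I rule: finite_induct)
  case (insert x I)
  then have "F x \<inter> (\<Union>i\<in>I. F i) = {}" by (fastforce simp: disjoint_family_on_def)
  then show ?case using insert by (simp add: pr_Un disjoint_family_on_def)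
qed (simp add: pr_empty)
lemma pr_supp: "app (pr S) x = x \<longleftrightarrow> x \<in> supp_sp S"
  unfolding app_pr supp_sp_def fun_eq_iff mem_Collect_eq by (auto split: if_splits)
lemma pr_in: "app (pr S) x \<in> supp_sp S" by (auto simp: supp_sp_def)

text \<open>Infinitely many disjoint copies of the space fit into itself: \<open>sh j\<close> embeds the \<open>j\<close>-th copy and
  \<open>rt j\<close> retrieves it. Direct sums of spaces are formed this way inside one ring.\<close>
lift_definition sh :: "nat \<Rightarrow> 'k::field endo" is "\<lambda>j x i. if fst (prod_decode i) = j then x (snd (prod_decode i)) else 0"
  by (auto simp: fv_linear fun_eq_iff)
lift_definition rt :: "nat \<Rightarrow> 'k::field endo" is "\<lambda>j x i. x (prod_encode (j, i))"
  by (auto simp: fv_linear fun_eq_iff)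
lemma app_sh: "app (sh j) x = (\<lambda>i. if fst (prod_decode i) = j then x (snd (prod_decode i)) else 0)" by transfer simp
lemma app_rt: "app (rt j) x = (\<lambda>i. x (prod_encode (j, i)))" by transfer simp
lemma rt_sh: "rt i * sh j = (if i = j then 1 else 0)"
  by (rule endo_eqI) (auto simp: app_sh app_rt fun_eq_iff)
lemma sh_pr_rt: "sh j * (pr S * rt j) = pr (prod_encode ` ({j} \<times> S))"
proof (rule endo_eqI, rule ext)
  fix x :: "nat \<Rightarrow> 'a" and i
  obtain a b where i: "i = prod_encode (a, b)" by (metis prod_decode_inverse surj_pair)
  show "app (sh j * (pr S * rt j)) x i = app (pr (prod_encode ` ({j} \<times> S))) x i"
    by (auto simp: app_sh app_rt i image_iff)
qed

lemma pr_card_eq: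
  assumes "finite S" "finite T" and xy: "x * y = pr T" "y * x = (pr S :: 'k::field endo)" "x * pr S = x" "pr T * x = x" "y * pr T = y" "pr S * y = y"
  shows "card S = card T"
proof (rule card_eq_of_inverse[OF assms(1,2) app_linear[of x], where g = "app y"])
  have a: "app x (app y u) = app (pr T) u" "app y (app x u) = app (pr S) u" "app x (app (pr S) u) = app x u" "app (pr T) (app x u) = app x u"
    "app y (app (pr T) u) = app y u" "app (pr S) (app y u) = app y u" for u
    using arg_cong[OF xy(1), of "\<lambda>f. app f u"] arg_cong[OF xy(2), of "\<lambda>f. app f u"] arg_cong[OF xy(3), of "\<lambda>f. app f u"]
      arg_cong[OF xy(4), of "\<lambda>f. app f u"] arg_cong[OF xy(5), of "\<lambda>f. app f u"] arg_cong[OF xy(6), of "\<lambda>f. app f u"] by (simp_all del: app_pr)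
  show "app x u \<in> supp_sp T" "app y u \<in> supp_sp S" for u using a(4,6) pr_supp by blast+
  show "app y (app x u) = u" if "u \<in> supp_sp S" for u using that a(2) pr_supp by metis
  show "app x (app y u) = u" if "u \<in> supp_sp T" for u using that a(1) pr_supp by metis
qed

text \<open>The image of an idempotent of finite rank has a basis, which can be indexed by any set of
  coordinates of the right size; so every such idempotent is equivalent to a coordinate projection.\<close>
lemma split_idempotent:
  fixes p :: "'k::field endo"
  assumes T: "finite T" and p: "p * p = p" "pr T * p = p"
  obtains n where "\<And>S. finite S \<Longrightarrow> card S = n \<Longrightarrow>
    \<exists>\<iota> \<rho>. \<iota> * \<rho> = p \<and> \<rho> * \<iota> = pr S \<and> \<iota> * pr S = \<iota> \<and> pr S * \<rho> = \<rho>"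
proof -
  have pp: "app p (app p x) = app p x" for x using arg_cong[OF p(1), of "\<lambda>f. app f x"] by simp
  have pT: "app p x \<in> supp_sp T" for x using arg_cong[OF p(2), of "\<lambda>f. app f x"] pr_supp[of T "app p x"] by simp
  define V where "V = range (app p)"
  have V: "fv.subspace V" unfolding V_def by (rule linear_subspace_image[OF app_linear fv.subspace_UNIV])
  have VT: "V \<subseteq> supp_sp T" using pT by (auto simp: V_def)
  obtain B where B: "finite B" "fv.independent B" "fv.span B = V" "card B = fv.dim V"
    by (rule subspace_basis[OF T V VT empty_subsetI fv.independent_empty])
  have Vp: "app p x = x" if "x \<in> V" for x using that pp by (auto simp: V_def)
  have "\<exists>\<iota> \<rho>. \<iota> * \<rho> = p \<and> \<rho> * \<iota> = pr S \<and> \<iota> * pr S = \<iota> \<and> pr S * \<rho> = \<rho>" if S: "finite S" "card S = card B" for S :: "nat set"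
  proof -
    obtain \<beta> where \<beta>: "bij_betw \<beta> S B" using finite_same_card_bij[OF S(1) B(1) S(2)] by blast
    have \<beta>B: "\<beta> i \<in> B" if "i \<in> S" for i using \<beta> that by (auto simp: bij_betw_def)
    define i0 where "i0 x = (\<Sum>i\<in>S. scl (x i) (\<beta> i))" for x :: "nat \<Rightarrow> 'k"
    define r0 where "r0 x = (\<lambda>i. if i \<in> S then fv.representation B (app p x) (\<beta> i) else 0)" for x
    have "i0 (x + y) = i0 x + i0 y" for x y
      by (rule ext) (simp add: i0_def sum_fun_apply distrib_right sum.distrib)
    moreover have "i0 (scl c x) = scl c (i0 x)" for c x
      by (simp only: i0_def fv.scale_sum_right fv.scale_scale)
    ultimately have i0l: "Vector_Spaces.linear scl scl i0" unfolding fv_linear by blast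
    have pB: "app p x \<in> fv.span B" for x using B(3) by (auto simp: V_def)
    have "r0 (x + y) = r0 x + r0 y" for x y
      unfolding r0_def app_vec(1) fv.representation_add[OF B(2) pB pB] by (rule ext) (simp only: plus_fun_apply, simp)
    moreover have "r0 (scl c x) = scl c (r0 x)" for c x
      unfolding r0_def app_vec(2) fv.representation_scale[OF B(2) pB] by (rule ext) simp
    ultimately have r0l: "Vector_Spaces.linear scl scl r0" unfolding fv_linear by blast
    define \<iota> where "\<iota> = Endo i0"
    define \<rho> where "\<rho> = Endo r0"
    have a: "app \<iota> = i0" "app \<rho> = r0" unfolding \<iota>_def \<rho>_def using i0l r0l by (auto simp: Endo_inverse)
    have ri: "r0 (i0 x) = app (pr S) x" for x
    proof (rule ext)
      fix j
      have i0V: "i0 x \<in> V" unfolding i0_def B(3)[symmetric]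
        by (intro fv.span_sum fv.span_scale fv.span_base \<beta>B)
      show "r0 (i0 x) j = app (pr S) x j"
      proof (cases "j \<in> S")
        case True
        have "fv.representation B (i0 x) = (\<lambda>b. \<Sum>i\<in>S. fv.representation B (scl (x i) (\<beta> i)) b)"
          unfolding i0_def by (rule fv.representation_sum[OF B(2)]) (rule fv.span_scale[OF fv.span_base[OF \<beta>B]])
        then have "fv.representation B (i0 x) (\<beta> j) = (\<Sum>i\<in>S. fv.representation B (scl (x i) (\<beta> i)) (\<beta> j))"
          by simp
        also have "\<dots> = (\<Sum>i\<in>S. x i * (if \<beta> j = \<beta> i then 1 else 0))"
          by (rule sum.cong) (simp_all add: fv.representation_scale[OF B(2) fv.span_base[OF \<beta>B]] fv.representation_basis[OF B(2) \<beta>B])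
        also have "\<dots> = (\<Sum>i\<in>S. if i = j then x i else 0)"
          using \<beta> True by (intro sum.cong) (auto simp: bij_betw_def inj_on_def)
        finally show ?thesis using True S Vp[OF i0V] by (simp add: r0_def)
      qed (simp add: r0_def)
    qed
    have ir: "i0 (r0 x) = app p x" for x
    proof -
      have "i0 (r0 x) = (\<Sum>i\<in>S. scl (fv.representation B (app p x) (\<beta> i)) (\<beta> i))"
        by (simp add: i0_def r0_def cong: sum.cong)
      also have "\<dots> = (\<Sum>b\<in>B. scl (fv.representation B (app p x) b) b)"
        by (rule sum.reindex_bij_betw[OF \<beta>])
      also have "\<dots> = app p x" by (rule fv.sum_representation_eq[OF B(2) pB B(1) order.refl])
      finally show ?thesis .
    qed
    have ip: "i0 (app (pr S) x) = i0 x" for x by (simp add: i0_def cong: sum.cong)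
    have rp: "app (pr S) (r0 x) = r0 x" for x by (rule ext) (simp add: r0_def)
    show ?thesis
    proof (rule exI[of _ \<iota>], rule exI[of _ \<rho>], intro conjI)
      show "\<iota> * \<rho> = p" by (rule endo_eqI) (simp only: a ir app_simps)
      show "\<rho> * \<iota> = pr S" by (rule endo_eqI) (simp only: a ri app_simps)
      show "\<iota> * pr S = \<iota>" by (rule endo_eqI) (simp only: a ip app_simps)
      show "pr S * \<rho> = \<rho>" by (rule endo_eqI) (simp only: a rp app_simps)
    qed
  qed
  then show ?thesis using that by blast
qed

text \<open>The matrix units.\<close>
lift_definition eu :: "nat \<Rightarrow> nat \<Rightarrow> 'k::field endo" is "\<lambda>i j x. scl (x j) (unitv i)"
  by (auto simp: fv_linear distrib_right mult.assoc fun_eq_iff)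
lemma app_eu: "app (eu i j) x = scl (x j) (unitv i)" by transfer simp

definition ent :: "'k::field endo \<Rightarrow> nat \<Rightarrow> nat \<Rightarrow> 'k" where "ent f i j = app f (unitv j) i"

lemma ent_lin: "ent (f + g) i j = ent f i j + ent g i j" "ent (f - g) i j = ent f i j - ent g i j" "ent (- f) i j = - ent f i j"
  "ent 0 i j = 0" "ent (sc c * f) i j = c * ent f i j" "ent (\<Sum>a\<in>X. F a) i j = (\<Sum>a\<in>X. ent (F a) i j)"
  by (simp_all add: ent_def sum_fun_apply)

lemma ent_pr: "ent (pr S * f) i j = (if i \<in> S then ent f i j else 0)" "ent (f * pr S) i j = (if j \<in> S then ent f i j else 0)"
proof -
  show "ent (pr S * f) i j = (if i \<in> S then ent f i j else 0)" by (simp add: ent_def)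
  have "app (pr S) (unitv j) = (if j \<in> S then unitv j else (0 :: nat \<Rightarrow> 'a))" by (auto simp: unitv_def fun_eq_iff)
  then show "ent (f * pr S) i j = (if j \<in> S then ent f i j else 0)" by (simp add: ent_def app_vec del: app_pr)
qed

lemma ent_mult:
  assumes "finite S" "f * pr S = f \<or> pr S * g = g" shows "ent (f * g) i j = (\<Sum>k\<in>S. ent f i k * ent g k j)"
proof -
  have "f * g = f * (pr S * g)" using assms(2) by (metis mult.assoc)
  then have "ent (f * g) i j = app f (app (pr S) (app g (unitv j))) i" by (simp add: ent_def del: app_pr)
  also have "app (pr S) (app g (unitv j)) = (\<Sum>k\<in>S. scl (ent g k j) (unitv k))"
    using supp_sp_expand[OF assms(1) pr_in, of "app g (unitv j)"] by (simp add: ent_def cong: sum.cong)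
  also have "app f (\<Sum>k\<in>S. scl (ent g k j) (unitv k)) = (\<Sum>k\<in>S. scl (ent g k j) (app f (unitv k)))"
    by (simp only: app_vec)
  finally show ?thesis by (simp add: sum_fun_apply ent_def mult.commute)
qed

lemma ent_eqI:
  fixes f g :: "'k::field endo"
  assumes "finite S" "f * pr S = f" "g * pr S = g" "pr S * f = f" "pr S * g = g"
    and "\<And>i j. i \<in> S \<Longrightarrow> j \<in> S \<Longrightarrow> ent f i j = ent g i j"
  shows "f = g"
proof (rule endo_eqI)
  fix x :: "nat \<Rightarrow> 'k"
  have e: "ent f i j = ent g i j" for i j
    using assms(6)[of i j] ent_pr(1)[where S=S and f=f and i=i and j=j] ent_pr(1)[where S=S and f=g and i=i and j=j]
      ent_pr(2)[where S=S and f=f and i=i and j=j] ent_pr(2)[where S=S and f=g and i=i and j=j] assms(2-5) by (auto split: if_splits)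
  then have u: "app f (unitv j) = app g (unitv j)" for j by (auto simp: ent_def)
  have "app h x = (\<Sum>i\<in>S. scl (x i) (app h (unitv i)))" if "h * pr S = h" for h :: "'k endo"
  proof -
    have "app h x = app h (app (pr S) x)" using arg_cong[OF that, of "\<lambda>f. app f x"] by (simp del: app_pr)
    also have "app (pr S) x = (\<Sum>i\<in>S. scl (x i) (unitv i))"
      using supp_sp_expand[OF assms(1) pr_in, of x] by (simp cong: sum.cong)
    finally show ?thesis by (simp add: app_vec)
  qed
  then show "app f x = app g x" using assms(2,3) u by simp
qed

lemma ent_eu: "ent (eu i j) k l = (if k = i \<and> l = j then 1 else 0)"
  by (auto simp: ent_def app_eu unitv_def)

lemma eu_pr: "i \<in> S \<Longrightarrow> pr S * eu i j = eu i j" "j \<in> S \<Longrightarrow> eu i j * pr S = eu i j"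
  by (rule endo_eqI, auto simp: app_eu unitv_def fun_eq_iff)+

definition tr :: "nat set \<Rightarrow> 'k::field endo \<Rightarrow> 'k" where "tr S f = (\<Sum>i\<in>S. ent f i i)"

lemma tr_lin: "tr S (f + g) = tr S f + tr S g" "tr S (- f) = - tr S f" "tr S (f - g) = tr S f - tr S g" "tr S 0 = 0" "tr S (\<Sum>a\<in>X. F a) = (\<Sum>a\<in>X. tr S (F a))"
  by (simp_all add: tr_def ent_lin sum.distrib sum_negf sum_subtractf sum.swap[of _ X])

lemma tr_comm:
  assumes "finite S" "f * pr S = f \<or> pr S * g = g" "g * pr S = g \<or> pr S * f = f"
  shows "tr S (f * g) = tr S (g * f)"
proof -
  have "tr S (f * g) = (\<Sum>i\<in>S. \<Sum>k\<in>S. ent f i k * ent g k i)" by (simp add: tr_def ent_mult[OF assms(1,2)])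
  also have "\<dots> = (\<Sum>k\<in>S. \<Sum>i\<in>S. ent g k i * ent f i k)" by (subst sum.swap) (simp add: mult.commute)
  also have "\<dots> = tr S (g * f)" by (simp add: tr_def ent_mult[OF assms(1,3)])
  finally show ?thesis .
qed

lemma tr_eu: "finite S \<Longrightarrow> i \<in> S \<Longrightarrow> j \<in> S \<Longrightarrow> pr S * f = f \<Longrightarrow> tr S (f * eu i j) = ent f j i"
proof -
  assume a: "finite S" "i \<in> S" "j \<in> S" "pr S * f = f"
  have "tr S (f * eu i j) = (\<Sum>l\<in>S. \<Sum>k\<in>S. ent f l k * (if k = i \<and> l = j then 1 else 0))"
    unfolding tr_def by (simp only: ent_mult[OF a(1) disjI2[OF eu_pr(1)[OF a(2)]]] ent_eu)
  also have "\<dots> = (\<Sum>l\<in>S. if l = j then ent f l i else 0)"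
  proof (rule sum.cong)
    fix l
    show "(\<Sum>k\<in>S. ent f l k * (if k = i \<and> l = j then 1 else 0)) = (if l = j then ent f l i else 0)"
      using a by (cases "l = j") (auto simp: if_distrib cong: if_cong)
  qed simp
  also have "\<dots> = ent f j i" using a by simp
  finally show ?thesis .
qed

section \<open>The reflection construction in a ring\<close>

definition isunit :: "'r::ring_1 \<Rightarrow> bool" where "isunit x \<longleftrightarrow> (\<exists>y. x * y = 1 \<and> y * x = 1)"
definition uinv :: "'r::ring_1 \<Rightarrow> 'r" where "uinv x = (SOME y. x * y = 1 \<and> y * x = 1)"

lemma uinv: "isunit x \<Longrightarrow> x * uinv x = 1" "isunit x \<Longrightarrow> uinv x * x = 1"
  unfolding isunit_def uinv_def by (metis (mono_tags, lifting) someI_ex)+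

lemma uinv_unique: "x * y = 1 \<Longrightarrow> y * x = 1 \<Longrightarrow> uinv x = (y :: 'r::ring_1)"
proof -
  assume a: "x * y = 1" "y * x = 1"
  then have "x * uinv x = 1" using uinv(1)[of x] by (auto simp: isunit_def)
  then have "y * (x * uinv x) = y" by simp
  then show ?thesis using a by (simp add: mult.assoc[symmetric])
qed

lemma isunitI: "x * y = 1 \<Longrightarrow> y * x = 1 \<Longrightarrow> isunit x" by (auto simp: isunit_def)
lemma isunit_1: "isunit (1 :: 'r::ring_1)" by (rule isunitI[of _ 1]) auto
lemma isunit_mult: "isunit x \<Longrightarrow> isunit y \<Longrightarrow> isunit (x * y :: 'r::ring_1)"
  by (rule isunitI[of _ "uinv y * uinv x"]) (metis mult.assoc mult_1_right uinv)+

lemma mult_chain: "a * b = c \<Longrightarrow> a * (b * x) = c * (x :: 'r::ring_1)" by (metis mult.assoc)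

lemma mult_mid_0: "a * p = a \<Longrightarrow> p * b = 0 \<Longrightarrow> a * b = (0 :: 'r::ring_1)" "a * p = 0 \<Longrightarrow> p * b = b \<Longrightarrow> a * b = 0"
  by (metis mult.assoc mult_zero_right, metis mult.assoc mult_zero_left)

lemma mult_absorb: "z * p = p \<Longrightarrow> p * a = a \<Longrightarrow> z * a = (a :: 'r::ring_1)" "a * p = a \<Longrightarrow> p * z = p \<Longrightarrow> a * z = a"
  by (metis mult.assoc, metis mult.assoc)

text \<open>Invertibility of \<open>1 + a b\<close> and \<open>1 + b a\<close> are equivalent, with an explicit inverse.\<close>
lemma unit_swap:
  assumes "isunit (1 + a * b :: 'r::ring_1)"
  shows "(1 + b * a) * (1 - b * uinv (1 + a * b) * a) = 1" "(1 - b * uinv (1 + a * b) * a) * (1 + b * a) = 1"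
proof -
  let ?u = "uinv (1 + a * b)"
  have 1: "?u + a * b * ?u = 1" "?u + ?u * a * b = 1" using uinv[OF assms] by (simp_all add: algebra_simps)
  have "(1 + b * a) * (1 - b * ?u * a) = 1 + b * (1 - (?u + a * b * ?u)) * a" by (simp add: algebra_simps)
  then show "(1 + b * a) * (1 - b * ?u * a) = 1" unfolding 1 by simp
  have "(1 - b * ?u * a) * (1 + b * a) = 1 + b * (1 - (?u + ?u * a * b)) * a" by (simp add: algebra_simps)
  then show "(1 - b * ?u * a) * (1 + b * a) = 1" unfolding 1 by simp
qed

text \<open>The linear algebra at the vertex to be reflected. Here \<open>e\<close> projects to the space at the vertex; the
  arrows \<open>c j\<close> lead into it from spaces with projections \<open>f j\<close>, and \<open>t j\<close> lead back. The maps \<open>s j\<close>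
  and \<open>r j\<close> are the injections and projections of a direct sum, so that \<open>z\<close> below projects to the sum of
  the neighbouring spaces, \<open>\<phi>\<close> maps the vertex to it and \<open>\<pi>\<close> maps it back.\<close>
locale reflection_core =
  fixes e :: "'k::field endo" and k :: nat and c t f s r :: "nat \<Rightarrow> 'k endo"
  assumes te: "j < k \<Longrightarrow> t j * e = t j" and ft: "j < k \<Longrightarrow> f j * t j = t j"
    and ec: "j < k \<Longrightarrow> e * c j = c j" and cf: "j < k \<Longrightarrow> c j * f j = c j"
    and ff: "j < k \<Longrightarrow> f j * f j = f j"
    and ee: "e * e = e"
    and rs: "\<And>i j. r i * s j = (if i = j then 1 else 0)"
    and unit: "j < k \<Longrightarrow> isunit (1 + c j * t j)"
begin

primrec P where "P 0 = 1" | "P (Suc j) = P j * (1 + c j * t j)"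

definition "\<phi> = (\<Sum>j<k. s j * t j)"
definition "\<pi> = (\<Sum>j<k. P j * c j * r j)"
definition "z = (\<Sum>j<k. s j * f j * r j)"
definition "ez j = (\<Sum>i<j. s i * f i * r i)"

lemma r_sum: "j < k \<Longrightarrow> r j * (\<Sum>i<k. s i * g i) = g j"
proof -
  assume j: "j < k"
  have "r j * (\<Sum>i<k. s i * g i) = (\<Sum>i<k. if j = i then g i else 0)"
    unfolding sum_distrib_left by (rule sum.cong) (simp_all add: mult.assoc[symmetric] rs)
  then show ?thesis using j by simp
qed
lemma sum_s: "j < k \<Longrightarrow> (\<Sum>i<k. g i * r i) * s j = g j"
proof -
  assume j: "j < k"
  have "(\<Sum>i<k. g i * r i) * s j = (\<Sum>i<k. if i = j then g i else 0)"
    unfolding sum_distrib_right by (rule sum.cong) (simp_all add: mult.assoc rs)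
  then show ?thesis using j by simp
qed

lemma r\<phi>: "j < k \<Longrightarrow> r j * \<phi> = t j" unfolding \<phi>_def by (rule r_sum)
lemma \<pi>s: "j < k \<Longrightarrow> \<pi> * s j = P j * c j" unfolding \<pi>_def by (rule sum_s)
lemma rz: "j < k \<Longrightarrow> r j * z = f j * r j" unfolding z_def mult.assoc by (rule r_sum)
lemma zs: "j < k \<Longrightarrow> z * s j = s j * f j" unfolding z_def by (rule sum_s)
lemma ez_k: "ez k = z" by (simp add: ez_def z_def)
lemma \<phi>e: "\<phi> * e = \<phi>" unfolding \<phi>_def sum_distrib_right by (rule sum.cong) (simp_all add: mult.assoc te)
lemma r_ez: "i < k \<Longrightarrow> j \<le> k \<Longrightarrow> r i * ez j = (if i < j then f i * r i else 0)"
proof -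
  assume a: "i < k" "j \<le> k"
  have "r i * ez j = (\<Sum>l<j. if i = l then f l * r l else 0)"
    unfolding ez_def sum_distrib_left by (rule sum.cong) (simp_all add: mult.assoc[symmetric] rs)
  then show ?thesis by simp
qed
lemma ez_s: "i < k \<Longrightarrow> j \<le> k \<Longrightarrow> ez j * s i = (if i < j then s i * f i else 0)"
proof -
  assume a: "i < k" "j \<le> k"
  have "ez j * s i = (\<Sum>l<j. if l = i then s l * f l else 0)"
    unfolding ez_def sum_distrib_right by (rule sum.cong) (simp_all add: mult.assoc rs)
  then show ?thesis by simp
qed
lemma z_ez: "j \<le> k \<Longrightarrow> z * ez j = ez j"
  unfolding ez_def sum_distrib_left
  by (rule sum.cong) (simp_all add: mult.assoc mult_chain[OF zs] mult_chain[OF ff])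
lemma zz: "z * z = z" using z_ez[of k] by (simp add: ez_k)
lemma z\<phi>: "z * \<phi> = \<phi>"
  unfolding \<phi>_def sum_distrib_left by (rule sum.cong) (simp_all add: mult_chain[OF zs] mult.assoc ft)
lemma \<pi>z: "\<pi> * z = \<pi>"
  unfolding \<pi>_def sum_distrib_right by (rule sum.cong) (simp_all add: mult.assoc rz mult_chain[OF cf])
lemma ez_ez: "j \<le> k \<Longrightarrow> ez j * ez j = ez j"
proof -
  assume j: "j \<le> k"
  have "ez j * ez j = (\<Sum>i<j. s i * f i * (r i * ez j))" by (simp only: ez_def[of j] sum_distrib_right mult.assoc)
  also have "\<dots> = (\<Sum>i<j. s i * f i * r i)"
    by (rule sum.cong) (use j in \<open>simp_all add: r_ez mult.assoc mult_chain[OF ff]\<close>)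
  finally show ?thesis by (simp only: ez_def)
qed

lemma eP: "j \<le> k \<Longrightarrow> e * P j = P j * e"
proof (induct j)
  case (Suc j)
  then have j: "j < k" by simp
  have "e * P (Suc j) = P j * (e * (1 + c j * t j))" using Suc by (simp add: mult.assoc[symmetric])
  also have "e * (1 + c j * t j) = (1 + c j * t j) * e"
    by (simp add: distrib_left distrib_right mult_chain[OF ec[OF j]] mult.assoc te[OF j])
  finally show ?case by (simp add: mult.assoc)
qed simp
lemma e\<pi>: "e * \<pi> = \<pi>"
  unfolding \<pi>_def sum_distrib_left by (rule sum.cong) (simp_all add: mult.assoc[symmetric] eP, simp add: mult.assoc mult_chain[OF ec])
lemma isunit_P: "j \<le> k \<Longrightarrow> isunit (P j)"
  by (induct j) (auto intro!: isunit_1 isunit_mult unit)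

text \<open>Telescoping: \<open>P (j + 1) - P j = P j c\<^sub>j t\<^sub>j\<close>. The prefix products in the definition of \<open>\<pi>\<close> are chosen to make
  this true; for \<open>j = k\<close> it turns the multiplicative relation at the vertex into a formula for \<open>\<pi> \<phi>\<close>.\<close>
lemma \<pi>ez\<phi>: "j \<le> k \<Longrightarrow> \<pi> * ez j * \<phi> = P j - 1"
proof (induct j)
  case (Suc j)
  then have j: "j < k" by simp
  have "\<pi> * ez (Suc j) * \<phi> = \<pi> * ez j * \<phi> + \<pi> * s j * f j * (r j * \<phi>)"
    by (simp add: ez_def algebra_simps)
  also have "\<dots> = P j - 1 + P j * c j * t j" using Suc by (simp add: r\<phi> \<pi>s mult.assoc ft j)
  finally show ?case by (simp add: algebra_simps)
qed (simp add: ez_def)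
end

text \<open>With the relation at the vertex, \<open>\<pi> \<phi> = q - 1\<close> is invertible on the vertex space, so \<open>p\<close> below is an
  idempotent projecting the sum of the neighbours to the image of \<open>\<phi>\<close>, with complement \<open>p'\<close>.\<close>
locale reflection_core_rel = reflection_core +
  fixes q
  assumes q0: "q \<noteq> 0" and q1: "q \<noteq> 1" and rel: "e * P k = sc q * e"
begin

lemma \<pi>\<phi>: "\<pi> * \<phi> = sc (q - 1) * e"
proof -
  have 1: "\<pi> * \<phi> = P k - 1" using \<pi>ez\<phi>[of k] by (simp add: ez_k \<pi>z)
  have "\<pi> * \<phi> = e * (\<pi> * \<phi>)" by (simp add: mult.assoc[symmetric] e\<pi>)
  also have "\<dots> = sc q * e - e" unfolding 1 by (simp add: right_diff_distrib rel)
  finally show ?thesis by (simp add: sc_simps left_diff_distrib)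
qed

definition "p = sc (inverse (q - 1)) * (\<phi> * \<pi>)"

lemma \<phi>\<pi>: "\<phi> * \<pi> = sc (q - 1) * p"
  using q1 by (simp add: p_def mult.assoc[symmetric] sc_simps(2)[symmetric] sc_simps(3))

lemma zp: "z * p = p" by (simp add: p_def sc_left mult_chain[OF z\<phi>])
lemma pz: "p * z = p" by (simp add: p_def mult.assoc \<pi>z)
lemma p\<phi>: "p * \<phi> = \<phi>"
proof -
  have "p * \<phi> = sc (inverse (q - 1)) * (\<phi> * (\<pi> * \<phi>))" by (simp add: p_def mult.assoc)
  also have "\<dots> = sc (inverse (q - 1)) * (sc (q - 1) * \<phi>)" by (simp only: \<pi>\<phi> sc_left[of \<phi>] \<phi>e)
  also have "\<dots> = \<phi>" using q1 by (simp add: mult.assoc[symmetric] sc_simps(2)[symmetric] sc_simps(3))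
  finally show ?thesis .
qed
lemma \<pi>p: "\<pi> * p = \<pi>"
proof -
  have "\<pi> * p = sc (inverse (q - 1)) * (\<pi> * \<phi> * \<pi>)" by (simp add: p_def mult.assoc sc_left)
  also have "\<dots> = sc (inverse (q - 1)) * (sc (q - 1) * \<pi>)" by (simp add: \<pi>\<phi> mult.assoc e\<pi>)
  also have "\<dots> = \<pi>" using q1 by (simp add: mult.assoc[symmetric] sc_simps(2)[symmetric] sc_simps(3))
  finally show ?thesis .
qed
lemma pp: "p * p = p"
proof -
  have "p * p = p * (sc (inverse (q - 1)) * (\<phi> * \<pi>))" by (simp only: p_def)
  also have "\<dots> = sc (inverse (q - 1)) * (p * (\<phi> * \<pi>))" by (rule sc_left)
  also have "p * (\<phi> * \<pi>) = p * \<phi> * \<pi>" by (rule mult.assoc[symmetric])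
  also have "sc (inverse (q - 1)) * (p * \<phi> * \<pi>) = p" unfolding p\<phi> by (rule p_def[symmetric])
  finally show ?thesis .
qed

definition "p' = z - p"
lemma p'p': "p' * p' = p'" by (simp add: p'_def algebra_simps zz zp pz pp)
lemma zp': "z * p' = p'" and p'z: "p' * z = p'" by (simp_all add: p'_def algebra_simps zz zp pz)
lemma p'\<phi>: "p' * \<phi> = 0" and \<pi>p': "\<pi> * p' = 0" by (simp_all add: p'_def algebra_simps z\<phi> \<pi>z p\<phi> \<pi>p)

end

text \<open>The complement \<open>p'\<close> becomes the new vertex space, realised as the image of the projection \<open>e'\<close>. The new
  outgoing maps \<open>t' j\<close> are the components of its inclusion \<open>\<iota>\<close>; the new incoming maps \<open>c' j\<close> are the
  components of its projection \<open>\<rho>\<close>, scaled by \<open>q\<^sup>-\<^sup>1 - 1\<close> and stripped of the prefix products \<open>P' j\<close>, which are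
  thereby the prefix products of the new arrows.\<close>
locale reflection_core_split = reflection_core_rel +
  fixes \<iota> \<rho> e'
  assumes io: "\<iota> * \<rho> = p'" and oi: "\<rho> * \<iota> = e'" and ie: "\<iota> * e' = \<iota>" and eo: "e' * \<rho> = \<rho>"
begin

definition "M = inverse q - 1"
definition "P' j = 1 + sc M * (\<rho> * ez j * \<iota>)"
definition "H j = 1 - \<phi> * uinv (P j) * \<pi> * ez j"
definition "H' j = (1 + sc (q - 1) * ez j) * H j"
definition "c' j = uinv (P' j) * (sc M * (\<rho> * s j * f j))"
definition "t' j = f j * r j * \<iota>"

lemma p'\<iota>: "p' * \<iota> = \<iota>" using io oi ie by (metis mult.assoc)
lemma \<rho>p': "\<rho> * p' = \<rho>" using io oi eo by (metis mult.assoc)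
lemma z\<iota>: "z * \<iota> = \<iota>" by (metis p'\<iota> mult.assoc zp')
lemma \<rho>z: "\<rho> * z = \<rho>" by (metis \<rho>p' mult.assoc p'z)
lemma e'e': "e' * e' = e'" by (metis oi ie mult.assoc)

lemma Mq: "sc M * sc (q - 1) = - sc M - sc (q - 1)" "sc (q - 1) * sc M = - sc M - sc (q - 1)"
  using q0 by (simp_all add: M_def sc_simps(2)[symmetric] sc_simps(5,6)[symmetric] algebra_simps)

lemma G_H: assumes j: "j \<le> k"
  shows "(1 + sc (q - 1) * (p * ez j)) * H j = 1" "H j * (1 + sc (q - 1) * (p * ez j)) = 1"
    "H j * (sc (q - 1) * p) = \<phi> * uinv (P j) * \<pi>"
proof -
  have a: "1 + \<pi> * ez j * \<phi> = P j" using \<pi>ez\<phi>[OF j] by simp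
  have b: "sc (q - 1) * (p * ez j) = \<phi> * (\<pi> * ez j)" by (simp add: mult.assoc[symmetric] \<phi>\<pi>)
  have u: "isunit (1 + (\<pi> * ez j) * \<phi>)" using isunit_P[OF j] a by simp
  show "(1 + sc (q - 1) * (p * ez j)) * H j = 1" "H j * (1 + sc (q - 1) * (p * ez j)) = 1"
    using unit_swap[OF u] unfolding b H_def a by (simp_all only: mult.assoc)
  have "H j * (sc (q - 1) * p) = \<phi> * \<pi> - \<phi> * uinv (P j) * (\<pi> * ez j * \<phi>) * \<pi>"
    unfolding \<phi>\<pi>[symmetric] H_def by (simp add: algebra_simps)
  also have "\<dots> = \<phi> * \<pi> - \<phi> * (uinv (P j) * P j - uinv (P j)) * \<pi>" unfolding \<pi>ez\<phi>[OF j] by (simp add: algebra_simps)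
  also have "\<dots> = \<phi> * uinv (P j) * \<pi>" using uinv(2)[OF isunit_P[OF j]] by (simp add: algebra_simps)
  finally show "H j * (sc (q - 1) * p) = \<phi> * uinv (P j) * \<pi>" .
qed

lemma G'_mult: "j \<le> k \<Longrightarrow> (1 + sc M * (p' * ez j)) * (1 + sc (q - 1) * ez j) = 1 + sc (q - 1) * (p * ez j)"
proof -
  assume j: "j \<le> k"
  have p': "p' * ez j = ez j - p * ez j" by (simp add: p'_def left_diff_distrib z_ez j)
  have "(1 + sc M * (p' * ez j)) * (1 + sc (q - 1) * ez j)
    = 1 + sc (q - 1) * ez j + sc M * (p' * ez j) + sc M * sc (q - 1) * (p' * (ez j * ez j))"
    by (simp add: algebra_simps sc_left[of "p' * ez j"] sc_left[of "ez j"] sc_left[of "p'"])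
  also have "\<dots> = 1 + sc (q - 1) * ez j - sc (q - 1) * (p' * ez j)"
    by (simp add: ez_ez j Mq algebra_simps)
  also have "\<dots> = 1 + sc (q - 1) * (p * ez j)" by (simp add: p' algebra_simps)
  finally show ?thesis .
qed

lemma ez_unit: "j \<le> k \<Longrightarrow> (1 + sc (q - 1) * ez j) * (1 + sc M * ez j) = 1"
proof -
  assume j: "j \<le> k"
  have "(1 + sc (q - 1) * ez j) * (1 + sc M * ez j) = 1 + sc M * ez j + sc (q - 1) * ez j + sc (q - 1) * sc M * (ez j * ez j)"
    by (simp add: algebra_simps sc_left[of "ez j"])
  then show ?thesis unfolding ez_ez[OF j] Mq by (simp add: algebra_simps)
qed

lemma G'_H': assumes j: "j \<le> k" shows "(1 + sc M * (p' * ez j)) * H' j = 1" "H' j * (1 + sc M * (p' * ez j)) = 1"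
proof -
  let ?G' = "1 + sc M * (p' * ez j)" and ?D = "1 + sc (q - 1) * ez j" and ?D' = "1 + sc M * ez j"
  show 1: "?G' * H' j = 1" unfolding H'_def using G'_mult[OF j] G_H(1)[OF j] by (simp add: mult.assoc[symmetric])
  have "H' j * ?G' = H' j * (?G' * (?D * ?D'))" by (simp only: ez_unit[OF j] mult_1_right)
  also have "\<dots> = ?D * (H j * (?G' * ?D)) * ?D'" by (simp only: H'_def mult.assoc)
  finally have "H' j * ?G' = ?D * (H j * (?G' * ?D)) * ?D'" .
  then show "H' j * ?G' = 1" using G'_mult[OF j] G_H(2)[OF j] ez_unit[OF j] by simp
qed

text \<open>Invertibility is moved across the factorisation by \<open>unit_swap\<close>: the prefix product \<open>P' j\<close> lives on the
  new vertex space, while its inverse is computed in the sum of the neighbours from that of \<open>P j\<close>.\<close>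
lemma P'_unit: assumes j: "j \<le> k"
  shows "isunit (P' j)" "\<iota> * uinv (P' j) * \<rho> = H' j * p'"
proof -
  have ba: "1 + \<iota> * (sc M * (\<rho> * ez j)) = 1 + sc M * (p' * ez j)" 
    unfolding sc_left[of \<iota>] io[symmetric] by (simp only: mult.assoc)
  have u: "isunit (1 + \<iota> * (sc M * (\<rho> * ez j)))" unfolding ba by (rule isunitI[OF G'_H'[OF j]])
  have ui: "uinv (1 + \<iota> * (sc M * (\<rho> * ez j))) = H' j" unfolding ba by (rule uinv_unique[OF G'_H'[OF j]])
  have P': "1 + sc M * (\<rho> * ez j) * \<iota> = P' j" by (simp add: P'_def mult.assoc)
  note sw = unit_swap[OF u, unfolded ui P']
  show "isunit (P' j)" by (rule isunitI[OF sw])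
  have ue: "uinv (P' j) = 1 - sc M * (\<rho> * ez j) * H' j * \<iota>" by (rule uinv_unique[OF sw])
  have "\<iota> * uinv (P' j) * \<rho> = \<iota> * \<rho> - sc M * (\<iota> * \<rho> * ez j) * H' j * (\<iota> * \<rho>)"
    unfolding ue by (simp add: algebra_simps sc_left[of \<iota>])
  also have "\<dots> = (1 - sc M * (p' * ez j) * H' j) * p'" by (simp add: io algebra_simps)
  also have "1 - sc M * (p' * ez j) * H' j = H' j" using G'_H'(1)[OF j] by (simp add: algebra_simps)
  finally show "\<iota> * uinv (P' j) * \<rho> = H' j * p'" .
qed

lemma P'_Suc: "j < k \<Longrightarrow> P' j * (1 + c' j * t' j) = P' (Suc j)"
proof -
  assume j: "j < k"
  have "P' j * (1 + c' j * t' j) = P' j + (P' j * uinv (P' j)) * (sc M * (\<rho> * s j * f j)) * t' j"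
    by (simp add: c'_def algebra_simps)
  also have "\<dots> = P' j + sc M * (\<rho> * (s j * (f j * f j) * r j) * \<iota>)"
    using uinv(1)[OF P'_unit(1)] j by (simp add: t'_def mult.assoc)
  also have "\<dots> = P' (Suc j)" unfolding P'_def ff[OF j] by (simp add: ez_def algebra_simps)
  finally show ?thesis .
qed

lemma P'_k: "P' k = 1 + sc M * e'" by (simp add: P'_def ez_k mult.assoc z\<iota> oi)

lemma c't'_unit: "j < k \<Longrightarrow> isunit (1 + c' j * t' j)"
proof -
  assume j: "j < k"
  have "1 + c' j * t' j = uinv (P' j) * P' (Suc j)"
    using uinv(2)[OF P'_unit(1)] j by (simp add: P'_Suc[OF j, symmetric] mult.assoc[symmetric])
  moreover have "isunit (uinv (P' j))" using uinv[OF P'_unit(1)[of j]] j by (intro isunitI[of _ "P' j"]) auto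
  ultimately show ?thesis using P'_unit(1)[of "Suc j"] j isunit_mult by simp
qed

text \<open>At the other end of an arrow the reflection changes \<open>1 + t c\<close> only by the scalar \<open>q\<^sup>-\<^sup>1\<close>. This is why the
  relations at the neighbours survive with a changed parameter.\<close>
lemma t'c': assumes j: "j < k" shows "f j + t' j * c' j = sc (inverse q) * (f j + t j * c j)"
proof -
  have jk: "j \<le> k" using j by simp
  have Hs: "H j * s j * f j = s j * f j"
  proof -
    have "(1 + sc (q - 1) * (p * ez j)) * (s j * f j) = s j * f j"
      using ez_s[OF j jk] by (simp add: algebra_simps mult_chain[OF ez_s[OF j jk]])
    then have "H j * (s j * f j) = H j * (1 + sc (q - 1) * (p * ez j)) * (s j * f j)" by (simp add: mult.assoc)
    then show ?thesis by (simp add: G_H(2)[OF jk] mult.assoc)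
  qed
  have tc: "t j * c j = f j * r j * (H j * (sc (q - 1) * p)) * s j * f j"
  proof -
    have "f j * r j * (\<phi> * uinv (P j) * \<pi>) * s j * f j = f j * (r j * \<phi>) * uinv (P j) * (\<pi> * s j) * f j"
      by (simp add: mult.assoc)
    also have "\<dots> = f j * t j * (uinv (P j) * P j) * c j * f j" by (simp add: r\<phi> \<pi>s j mult.assoc)
    also have "\<dots> = t j * c j" using uinv(2)[OF isunit_P[OF jk]] j by (simp add: ft mult.assoc cf)
    finally show ?thesis unfolding G_H(3)[OF jk] by simp
  qed
  have "t' j * c' j = sc M * (f j * r j * (\<iota> * uinv (P' j) * \<rho>) * s j * f j)"
    by (simp add: t'_def c'_def mult.assoc sc_left)
  also have "\<dots> = sc M * (f j * (r j * (1 + sc (q - 1) * ez j)) * H j * (z * s j - p * s j) * f j)"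
    unfolding P'_unit(2)[OF jk] H'_def p'_def by (simp add: algebra_simps)
  also have "r j * (1 + sc (q - 1) * ez j) = r j" using r_ez[OF j jk] by (simp add: algebra_simps sc_left)
  also have "f j * r j * H j * (z * s j - p * s j) * f j = f j * r j * (H j * s j * f j) * f j - f j * r j * (H j * p) * s j * f j"
    by (simp add: zs[OF j] algebra_simps)
  also have "\<dots> = f j - f j * r j * (H j * p) * s j * f j"
  proof -
    have "f j * r j * (s j * f j) * f j = f j * (r j * s j) * (f j * f j)" by (simp only: mult.assoc)
    also have "\<dots> = f j" by (simp add: rs ff j)
    finally show ?thesis unfolding Hs by simp
  qed
  also have "sc M * (f j - f j * r j * (H j * p) * s j * f j) = sc M * f j + sc (inverse q) * (f j * r j * (H j * (sc (q - 1) * p)) * s j * f j)"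
  proof -
    have "sc (inverse q) * sc (q - 1) = - sc M" using q0 by (simp add: M_def sc_simps(2)[symmetric] sc_simps(5)[symmetric] algebra_simps)
    moreover have "f j * r j * (H j * (sc (q - 1) * p)) * s j * f j = sc (q - 1) * (f j * r j * (H j * p) * s j * f j)"
      by (simp only: mult.assoc sc_left[of "H j"] sc_left[of "r j"] sc_left[of "f j"])
    ultimately show ?thesis by (simp add: right_diff_distrib mult.assoc[symmetric])
  qed
  finally have "t' j * c' j = sc M * f j + sc (inverse q) * (t j * c j)" using tc by simp
  then show ?thesis by (simp add: M_def sc_simps algebra_simps)
qed

end

section \<open>Representations by matrices\<close>

lemma star_star [simp]: "star (star b) = b" by (cases b) auto
lemma eps_star [simp]: "eps (star b) = - eps b" by (cases b) auto
lemma eps_cases: "eps b = 1 \<or> eps b = - 1" by (cases b) auto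
lemma head_star [simp]: "head (double Q) (star b) = tail (double Q) b" by (cases b) (auto simp: double_def)
lemma tail_star [simp]: "tail (double Q) (star b) = head (double Q) b" by (cases b) (auto simp: double_def)
lemma star_neq: "star b \<noteq> b" by (cases b) auto
lemma verts_double [simp]: "verts (double Q) = verts Q" by (simp add: double_def)

text \<open>The factor \<open>(1 + a a\<^sup>*)\<^sup>\<plusminus>\<^sup>1\<close> of the defining relation.\<close>
definition rel_factor :: "('a darrow \<Rightarrow> 'r::ring_1) \<Rightarrow> 'a darrow \<Rightarrow> 'r" where
  "rel_factor A b = (if eps b = 1 then 1 + A b * A (star b) else uinv (1 + A b * A (star b)))"

text \<open>Rescaling the arrows of one orientation by a unit turns every factor into the form \<open>1 + c t\<close> without
  inverse, which is the form used at the vertex to be reflected.\<close>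
definition normal_arrow :: "('a darrow \<Rightarrow> 'r::ring_1) \<Rightarrow> 'a darrow \<Rightarrow> 'r" where
  "normal_arrow A b = (if eps b = 1 then A b else - (rel_factor A b * A b))"

lemma isunit_uinv: "isunit x \<Longrightarrow> isunit (uinv x)" "isunit x \<Longrightarrow> uinv (uinv x) = x"
  by (auto intro!: isunitI[of _ x] uinv_unique simp: uinv)

lemma isunit_rel_factor: "isunit (1 + A b * A (star b)) \<Longrightarrow> isunit (rel_factor A b)"
  by (simp add: rel_factor_def isunit_uinv)

lemma rel_factor_normal_arrow:
  assumes "isunit (1 + A b * A (star b))"
  shows "rel_factor A b = 1 + normal_arrow A b * A (star b)" "isunit (1 + A (star b) * normal_arrow A b)"
    "rel_factor A (star b) = uinv (1 + A (star b) * normal_arrow A b)"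
proof -
  let ?g = "1 + A b * A (star b)"
  note sw = unit_swap[OF assms]
  have 1: "rel_factor A b = 1 + normal_arrow A b * A (star b) \<and> isunit (1 + A (star b) * normal_arrow A b) \<and> rel_factor A (star b) = uinv (1 + A (star b) * normal_arrow A b)"
  proof (cases "eps b = 1")
    case True
    then show ?thesis using isunitI[OF sw] by (simp add: rel_factor_def normal_arrow_def)
  next
    case False
    then have e: "eps b = -1" using eps_cases by metis
    have g: "rel_factor A b = uinv ?g" using False by (simp add: rel_factor_def)
    have "uinv ?g = uinv ?g * ?g - uinv ?g * (A b * A (star b))" by (simp add: algebra_simps)
    then have 1: "uinv ?g = 1 - uinv ?g * (A b * A (star b))" using uinv(2)[OF assms] by simp
    have n: "1 + A (star b) * normal_arrow A b = 1 - A (star b) * uinv ?g * A b" using e by (simp add: normal_arrow_def g mult.assoc)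
    have "rel_factor A (star b) = 1 + A (star b) * A b" using e by (simp add: rel_factor_def)
    also have "\<dots> = uinv (1 - A (star b) * uinv ?g * A b)" by (rule uinv_unique[symmetric, OF sw(2,1)])
    finally show ?thesis using 1 e isunitI[OF sw(2,1)] unfolding n by (simp add: normal_arrow_def g mult.assoc)
  qed
  then show "rel_factor A b = 1 + normal_arrow A b * A (star b)" "isunit (1 + A (star b) * normal_arrow A b)"
    "rel_factor A (star b) = uinv (1 + A (star b) * normal_arrow A b)" by auto
qed

text \<open>The inverse of the rescaling in \<open>normal_arrow\<close>, given \<open>t\<close> for the starred arrow.\<close>
definition arrow_of_normal :: "'r::ring_1 \<Rightarrow> 'r \<Rightarrow> 'a darrow \<Rightarrow> 'r" where
  "arrow_of_normal c t b = (if eps b = 1 then c else - (uinv (1 + c * t) * c))"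

lemma normal_arrow_of_normal:
  assumes u: "isunit (1 + c * t)" and A: "A b = arrow_of_normal c t b" "A (star b) = t"
  shows "isunit (1 + A b * A (star b))" "normal_arrow A b = c"
proof -
  have "isunit (1 + A b * A (star b)) \<and> normal_arrow A b = c"
  proof (cases "eps b = 1")
    case True then show ?thesis using u A by (simp add: arrow_of_normal_def normal_arrow_def)
  next
    case False
    have "uinv (1 + c * t) = uinv (1 + c * t) * (1 + c * t) - uinv (1 + c * t) * (c * t)" by (simp add: algebra_simps)
    then have 1: "1 + A b * A (star b) = uinv (1 + c * t)"
      using uinv(2)[OF u] False A by (simp add: arrow_of_normal_def mult.assoc)
    have "rel_factor A b = 1 + c * t" using False isunit_uinv[OF u] unfolding rel_factor_def 1 by simp
    then have "normal_arrow A b = (1 + c * t) * (uinv (1 + c * t) * c)" using False A by (simp add: normal_arrow_def arrow_of_normal_def)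
    also have "\<dots> = c" using uinv(1)[OF u] by (simp add: mult.assoc[symmetric])
    finally show ?thesis unfolding 1 using isunit_uinv[OF u] by simp
  qed
  then show "isunit (1 + A b * A (star b))" "normal_arrow A b = c" by auto
qed

lemma uinv_comm: "isunit g \<Longrightarrow> x * g = g * x \<Longrightarrow> x * uinv g = uinv g * (x :: 'r::ring_1)"
proof -
  assume u: "isunit g" and c: "x * g = g * x"
  have "x * uinv g = (uinv g * g) * x * uinv g" using uinv(2)[OF u] by simp
  also have "\<dots> = uinv g * (x * g) * uinv g" by (simp only: c mult.assoc)
  also have "\<dots> = uinv g * x" using uinv(1)[OF u] by (simp add: mult.assoc)
  finally show ?thesis .
qed

locale mult_preproj = quiver Q for Q :: "('v, 'a) pre_digraph" +
  fixes lt :: "'a darrow rel"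
  assumes lt: "strict_linear_order_on (arcs (double Q)) lt"
begin

abbreviation "D \<equiv> double Q"
definition "bs = enumeration (arcs D) lt"

lemma fin_D: "finite (arcs D)" by (simp add: double_def)
lemma set_bs: "set bs = arcs D" unfolding bs_def by (rule enumeration(1)[OF fin_D lt])

lemma distinct_bs: "distinct bs"
proof -
  have st: "sorted_wrt (\<lambda>a b. (a, b) \<in> lt) bs" unfolding bs_def by (rule enumeration(2)[OF fin_D lt])
  have "irrefl lt" using lt by (auto simp: strict_linear_order_on_def)
  then have "sorted_wrt (\<lambda>a b. (a, b) \<in> lt) xs \<Longrightarrow> distinct xs" for xs by (induct xs) (auto simp: irrefl_def)
  with st show ?thesis by blast
qed

lemma star_arcs: "b \<in> arcs D \<Longrightarrow> star b \<in> arcs D" by (cases b) (auto simp: double_def)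
lemma ends_verts: "b \<in> arcs D \<Longrightarrow> head D b \<in> verts Q" "b \<in> arcs D \<Longrightarrow> tail D b \<in> verts Q"
  by (auto simp: double_def)
lemma loopfree_D: "loopfree Q v \<Longrightarrow> b \<in> arcs D \<Longrightarrow> head D b = v \<Longrightarrow> tail D b \<noteq> v"
  by (auto simp: double_def loopfree_def)

text \<open>Representations are formulated in an arbitrary ring, so that they can be taken in endomorphisms as well as in
  dual numbers over endomorphisms. The scalar map \<open>sm\<close> of the next definition supplies the parameters.\<close>
definition quiver_rep :: "('v \<Rightarrow> 'r::ring_1) \<Rightarrow> ('a darrow \<Rightarrow> 'r) \<Rightarrow> bool" where
  "quiver_rep E A \<longleftrightarrow> (\<forall>v\<in>verts Q. \<forall>w\<in>verts Q. E v * E w = (if v = w then E v else 0)) \<and>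
     (\<forall>b\<in>arcs D. E (head D b) * A b = A b \<and> A b * E (tail D b) = A b)"

definition mpa_rep :: "('k \<Rightarrow> 'r::ring_1) \<Rightarrow> ('v \<Rightarrow> 'k) \<Rightarrow> ('v \<Rightarrow> 'r) \<Rightarrow> ('a darrow \<Rightarrow> 'r) \<Rightarrow> bool" where
  "mpa_rep sm q E A \<longleftrightarrow> quiver_rep E A \<and> (\<forall>b\<in>arcs D. isunit (1 + A b * A (star b))) \<and>
     (\<forall>w\<in>verts Q. E w * prod_list (map (rel_factor A) bs) = sm (q w) * E w)"

lemma quiver_repD:
  assumes "quiver_rep E A"
  shows "v \<in> verts Q \<Longrightarrow> E v * E v = E v" "v \<in> verts Q \<Longrightarrow> w \<in> verts Q \<Longrightarrow> v \<noteq> w \<Longrightarrow> E v * E w = 0"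
    "b \<in> arcs D \<Longrightarrow> E (head D b) * A b = A b" "b \<in> arcs D \<Longrightarrow> A b * E (tail D b) = A b"
    "b \<in> arcs D \<Longrightarrow> v \<in> verts Q \<Longrightarrow> v \<noteq> head D b \<Longrightarrow> E v * A b = 0"
    "b \<in> arcs D \<Longrightarrow> v \<in> verts Q \<Longrightarrow> v \<noteq> tail D b \<Longrightarrow> A b * E v = 0"
proof -
  show 1: "v \<in> verts Q \<Longrightarrow> E v * E v = E v" "v \<in> verts Q \<Longrightarrow> w \<in> verts Q \<Longrightarrow> v \<noteq> w \<Longrightarrow> E v * E w = 0"
    "b \<in> arcs D \<Longrightarrow> E (head D b) * A b = A b" "b \<in> arcs D \<Longrightarrow> A b * E (tail D b) = A b" for v w b
    using assms by (auto simp: quiver_rep_def)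
  show "b \<in> arcs D \<Longrightarrow> v \<in> verts Q \<Longrightarrow> v \<noteq> head D b \<Longrightarrow> E v * A b = 0"
    using 1(2)[of v "head D b"] 1(3)[of b] ends_verts by (metis mult.assoc mult_zero_left)
  show "b \<in> arcs D \<Longrightarrow> v \<in> verts Q \<Longrightarrow> v \<noteq> tail D b \<Longrightarrow> A b * E v = 0"
    using 1(2)[of "tail D b" v] 1(4)[of b] ends_verts by (metis mult.assoc mult_zero_right)
qed

lemma rel_factor_idem:
  assumes "quiver_rep E A" "b \<in> arcs D" "isunit (1 + A b * A (star b))" "w \<in> verts Q"
  shows "E w * rel_factor A b = rel_factor A b * E w" "w \<noteq> head D b \<Longrightarrow> E w * rel_factor A b = E w"
proof -
  note D = quiver_repD[OF assms(1)]
  let ?g = "1 + A b * A (star b)"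
  have 1: "E w * ?g = ?g * E w"
  proof (cases "w = head D b")
    case True
    then show ?thesis using D(3)[OF assms(2)] D(4)[OF star_arcs[OF assms(2)]]
      by (simp add: distrib_left distrib_right mult.assoc[symmetric]) (simp add: mult.assoc)
  next
    case False
    then show ?thesis using D(5)[OF assms(2,4)] D(6)[OF star_arcs[OF assms(2)] assms(4)]
      by (simp add: distrib_left distrib_right mult.assoc[symmetric]) (simp add: mult.assoc)
  qed
  show 2: "E w * rel_factor A b = rel_factor A b * E w"
    unfolding rel_factor_def using 1 uinv_comm[OF assms(3) 1] by simp
  assume w: "w \<noteq> head D b"
  have g: "E w * ?g = E w" using D(5)[OF assms(2,4) w] by (simp add: distrib_left mult.assoc[symmetric])
  then have "E w * ?g * uinv ?g = E w * uinv ?g" by simp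
  then have "E w * uinv ?g = E w" using uinv(1)[OF assms(3)] by (simp add: mult.assoc)
  then show "E w * rel_factor A b = E w" using g by (simp add: rel_factor_def)
qed

text \<open>A factor acts as the identity at every vertex but the head of its arrow. Hence at a vertex only the arrows
  into it contribute to the relation, in their given order.\<close>
lemma prod_E:
  assumes "quiver_rep E A" "\<And>b. b \<in> arcs D \<Longrightarrow> isunit (1 + A b * A (star b))" "w \<in> verts Q" "set xs \<subseteq> arcs D"
  shows "E w * prod_list (map (rel_factor A) xs) = prod_list (map (rel_factor A) xs) * E w"
    "E w * prod_list (map (rel_factor A) xs) = E w * prod_list (map (rel_factor A) (filter (\<lambda>b. head D b = w) xs))"
proof -
  have "E w * prod_list (map (rel_factor A) xs) = prod_list (map (rel_factor A) xs) * E w \<and>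
    E w * prod_list (map (rel_factor A) xs) = E w * prod_list (map (rel_factor A) (filter (\<lambda>b. head D b = w) xs))"
    using assms(4)
  proof (induct xs)
    case (Cons b xs)
    have b: "b \<in> arcs D" using Cons(2) by auto
    note g = rel_factor_idem[OF assms(1) b assms(2)[OF b] assms(3)]
    let ?p = "prod_list (map (rel_factor A) xs)" and ?p' = "prod_list (map (rel_factor A) (filter (\<lambda>b. head D b = w) xs))"
    have IH: "E w * ?p = ?p * E w" "E w * ?p = E w * ?p'" using Cons by auto
    have "E w * (rel_factor A b * ?p) = rel_factor A b * (E w * ?p)" using g(1) by (simp add: mult.assoc[symmetric])
    then have 1: "E w * (rel_factor A b * ?p) = rel_factor A b * ?p * E w" unfolding IH(1) by (simp add: mult.assoc)
    have 2: "E w * (rel_factor A b * ?p) = E w * prod_list (map (rel_factor A) (filter (\<lambda>b. head D b = w) (b # xs)))"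
    proof (cases "head D b = w")
      case True
      have "E w * (rel_factor A b * ?p) = rel_factor A b * (E w * ?p')"
        unfolding IH(2)[symmetric] using g(1) by (simp add: mult.assoc[symmetric])
      also have "\<dots> = E w * (rel_factor A b * ?p')" using g(1) by (simp add: mult.assoc[symmetric])
      finally show ?thesis using True by simp
    next
      case False
      then have "E w * (rel_factor A b * ?p) = E w * ?p" using g(2) by (simp add: mult.assoc[symmetric])
      then show ?thesis using False IH(2) by simp
    qed
    show ?case using 1 2 by simp
  qed simp
  then show "E w * prod_list (map (rel_factor A) xs) = prod_list (map (rel_factor A) xs) * E w"
    "E w * prod_list (map (rel_factor A) xs) = E w * prod_list (map (rel_factor A) (filter (\<lambda>b. head D b = w) xs))" by blast+
qed

section \<open>Coordinate representations\<close>

definition tot :: "('v \<Rightarrow> nat set) \<Rightarrow> nat set" where "tot S = (\<Union>v\<in>verts Q. S v)"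

text \<open>The sets \<open>S v\<close> are required to be disjoint so that the vertices act by orthogonal idempotents.\<close>
definition coord_rep :: "('v \<Rightarrow> 'k::field) \<Rightarrow> ('v \<Rightarrow> nat set) \<Rightarrow> ('a darrow \<Rightarrow> 'k endo) \<Rightarrow> bool" where
  "coord_rep q S A \<longleftrightarrow> (\<forall>v\<in>verts Q. finite (S v)) \<and> disjoint_family_on S (verts Q) \<and> mpa_rep sc q (\<lambda>v. pr (S v)) A"

definition subrep :: "('v \<Rightarrow> nat set) \<Rightarrow> ('a darrow \<Rightarrow> 'k::field endo) \<Rightarrow> (nat \<Rightarrow> 'k) set \<Rightarrow> bool" where
  "subrep S A U \<longleftrightarrow> fv.subspace U \<and> U \<subseteq> supp_sp (tot S) \<and> (\<forall>v\<in>verts Q. \<forall>x\<in>U. app (pr (S v)) x \<in> U) \<and>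
     (\<forall>b\<in>arcs D. \<forall>x\<in>U. app (A b) x \<in> U)"

definition simple_rep :: "('v \<Rightarrow> nat set) \<Rightarrow> ('a darrow \<Rightarrow> 'k::field endo) \<Rightarrow> bool" where
  "simple_rep S A \<longleftrightarrow> tot S \<noteq> {} \<and> (\<forall>U. subrep S A U \<longrightarrow> U = {0} \<or> U = supp_sp (tot S))"

definition brick :: "('v \<Rightarrow> nat set) \<Rightarrow> ('a darrow \<Rightarrow> 'k::field endo) \<Rightarrow> bool" where
  "brick S A \<longleftrightarrow> (\<forall>h. (\<forall>v\<in>verts Q. h * pr (S v) = pr (S v) * h) \<longrightarrow> (\<forall>b\<in>arcs D. h * A b = A b * h) \<longrightarrow>
      h * pr (tot S) = h \<longrightarrow> (\<exists>c. h = sc c * pr (tot S)))"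

definition dimv :: "('v \<Rightarrow> nat set) \<Rightarrow> 'v \<Rightarrow> int" where
  "dimv S v = (if v \<in> verts Q then int (card (S v)) else 0)"

lemma dimv_lattice: "dimv S \<in> root_lattice Q" by (simp add: dimv_def root_lattice_def)
lemma dimv_nonneg: "0 \<le> dimv S v" by (simp add: dimv_def)

lemma coord_repD:
  assumes "coord_rep q S A"
  shows "v \<in> verts Q \<Longrightarrow> finite (S v)" "disjoint_family_on S (verts Q)" "finite (tot S)"
    "quiver_rep (\<lambda>v. pr (S v)) A" "b \<in> arcs D \<Longrightarrow> isunit (1 + A b * A (star b))"
    "w \<in> verts Q \<Longrightarrow> pr (S w) * prod_list (map (rel_factor A) bs) = sc (q w) * pr (S w)"
    "pr (tot S) = (\<Sum>v\<in>verts Q. pr (S v) :: 'k::field endo)"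
  using assms pr_UN[OF finite_verts] by (auto simp: coord_rep_def mpa_rep_def tot_def)

lemma tot_sub: "v \<in> verts Q \<Longrightarrow> S v \<subseteq> tot S" by (auto simp: tot_def)
lemma pr_tot: "v \<in> verts Q \<Longrightarrow> pr (tot S) * pr (S v) = pr (S v)" "v \<in> verts Q \<Longrightarrow> pr (S v) * pr (tot S) = pr (S v)"
  using tot_sub[of v S] by (simp_all add: pr_mult Int_absorb1 Int_absorb2)

text \<open>An injective endomorphism of a finite-dimensional subspace is onto it, so its inverse preserves it too.\<close>
lemma uinv_invariant:
  assumes T: "finite T" and U: "fv.subspace U" "U \<subseteq> supp_sp T" and g: "isunit g" "\<And>x. x \<in> U \<Longrightarrow> app g x \<in> U"
    and x: "x \<in> U"
  shows "app (uinv g) x \<in> U"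
proof -
  have i: "app (uinv g) (app g y) = y" for y using arg_cong[OF uinv(2)[OF g(1)], of "\<lambda>f. app f y"] by simp
  have "fv.dim (app g ` U) = fv.dim U"
    by (rule dim_inj_image[OF T U app_linear]) (metis i app_vec(3))
  then have "app g ` U = U"
    using dim_mono(2)[OF T U linear_subspace_image[OF app_linear U(1)]] g(2) by blast
  then obtain y where "y \<in> U" "x = app g y" using x by blast
  then show ?thesis using i by simp
qed

section \<open>The effect of reflections on the parameters\<close>

text \<open>The dual action of the reflection, chosen to make \<open>q_power_refl\<close> hold.\<close>
definition refl_q :: "('v \<Rightarrow> 'k::field) \<Rightarrow> 'v \<Rightarrow> 'v \<Rightarrow> 'k" where
  "refl_q q v w = q w * q v powi (- form (coord v) (coord w))"

lemma powi_sum: "(x::'k::field) \<noteq> 0 \<Longrightarrow> x powi (\<Sum>i\<in>I. f i) = (\<Prod>i\<in>I. x powi f i)"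
  by (induct I rule: infinite_finite_induct) (auto simp: power_int_add)

lemma q_power_refl:
  assumes q: "\<And>w. w \<in> verts Q \<Longrightarrow> q w \<noteq> 0" and v: "v \<in> verts Q" and \<alpha>: "\<alpha> \<in> root_lattice Q"
  shows "q_power Q (refl_q q v) \<alpha> = q_power Q q (s v \<alpha>)"
proof -
  have "q_power Q (refl_q q v) \<alpha> = (\<Prod>w\<in>verts Q. q w powi \<alpha> w * q v powi (\<alpha> w * - form (coord v) (coord w)))"
    unfolding q_power_def refl_q_def
    by (rule prod.cong) (auto simp: power_int_mult_distrib power_int_mult[symmetric] mult.commute)
  also have "\<dots> = (\<Prod>w\<in>verts Q. q w powi \<alpha> w) * q v powi (\<Sum>w\<in>verts Q. \<alpha> w * - form (coord v) (coord w))"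
    using q[OF v] by (simp add: prod.distrib powi_sum)
  also have "(\<Sum>w\<in>verts Q. \<alpha> w * - form (coord v) (coord w)) = - form (coord v) \<alpha>"
    by (simp add: form_expand[OF \<alpha>] sum_negf)
  also have "(\<Prod>w\<in>verts Q. q w powi \<alpha> w) * q v powi (- form (coord v) \<alpha>) = q_power Q q (s v \<alpha>)"
  proof -
    have "q_power Q q (s v \<alpha>) = (\<Prod>w\<in>verts Q. q w powi \<alpha> w * (if w = v then q v powi (- form (coord v) \<alpha>) else 1))"
      unfolding q_power_def
      by (rule prod.cong) (auto simp: s_apply coord_def q power_int_add[symmetric] form_sym[of \<alpha>])
    also have "\<dots> = (\<Prod>w\<in>verts Q. q w powi \<alpha> w) * q v powi (- form (coord v) \<alpha>)"
      using v by (simp add: prod.distrib)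
    finally show ?thesis by simp
  qed
  finally show ?thesis .
qed

lemma refl_q_nz: "q v \<noteq> 0 \<Longrightarrow> q w \<noteq> 0 \<Longrightarrow> refl_q q v w \<noteq> 0" by (simp add: refl_q_def)

lemma refl_q_self: "loopfree Q v \<Longrightarrow> q v \<noteq> 0 \<Longrightarrow> refl_q q v v = inverse (q v)"
  by (simp add: refl_q_def form_coord_self power_int_minus power2_eq_square field_simps)

lemma refl_q_refl_q:
  assumes "loopfree Q v" "q v \<noteq> 0" shows "refl_q (refl_q q v) v w = q w"
  unfolding refl_q_def[of "refl_q q v"] refl_q_self[of v q, OF assms]
  using assms(2) by (simp add: refl_q_def power_int_minus power_int_inverse)

text \<open>The arrows from \<open>v\<close> to \<open>w\<close> in the double quiver are the arrows between \<open>v\<close> and \<open>w\<close> in either direction.\<close>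
lemma arrow_count:
  assumes v: "loopfree Q v" and w: "w \<noteq> v"
  shows "int (length (filter (\<lambda>b. head D b = w \<and> tail D b = v) bs)) = - form (coord v) (coord w)"
proof -
  let ?X = "{a \<in> arcs Q. head Q a = w \<and> tail Q a = v}" and ?Y = "{a \<in> arcs Q. tail Q a = w \<and> head Q a = v}"
  have "length (filter (\<lambda>b. head D b = w \<and> tail D b = v) bs) = card (set (filter (\<lambda>b. head D b = w \<and> tail D b = v) bs))"
    by (rule distinct_card[symmetric]) (simp add: distinct_bs)
  also have "set (filter (\<lambda>b. head D b = w \<and> tail D b = v) bs) = Orig ` ?X \<union> Rev ` ?Y"
    by (auto simp: set_bs double_def)
  also have "card (Orig ` ?X \<union> Rev ` ?Y) = card ?X + card ?Y"
    by (subst card_Un_disjoint) (auto simp: card_image inj_on_def)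
  finally have 1: "int (length (filter (\<lambda>b. head D b = w \<and> tail D b = v) bs)) = int (card ?X) + int (card ?Y)" by simp
  have "form (coord v) (coord w) = - (\<Sum>a\<in>arcs Q. (if tail Q a = w then coord v (head Q a) else 0) + (if head Q a = w then coord v (tail Q a) else 0))"
    unfolding form_coord using w by (simp add: coord_def)
  also have "(\<Sum>a\<in>arcs Q. (if tail Q a = w then coord v (head Q a) else 0) + (if head Q a = w then coord v (tail Q a) else 0))
    = (\<Sum>a\<in>arcs Q. (if tail Q a = w \<and> head Q a = v then 1 else 0)) + (\<Sum>a\<in>arcs Q. (if head Q a = w \<and> tail Q a = v then 1 else 0))"
    unfolding sum.distrib[symmetric] by (intro sum.cong refl arg_cong2[where f = "(+)"]) (simp_all add: coord_def)
  also have "\<dots> = int (card ?Y) + int (card ?X)"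
    unfolding sum.inter_filter[OF finite_arcs, symmetric] by simp
  finally show ?thesis using 1 by simp
qed

lemma arrow_sum:
  assumes "v \<in> verts Q"
  shows "form \<alpha> (coord v) = 2 * \<alpha> v - (\<Sum>b\<leftarrow>filter (\<lambda>b. head D b = v) bs. \<alpha> (tail D b))"
proof -
  have "(\<Sum>b\<leftarrow>filter (\<lambda>b. head D b = v) bs. \<alpha> (tail D b)) = (\<Sum>b\<in>set (filter (\<lambda>b. head D b = v) bs). \<alpha> (tail D b))"
    by (rule sum_list_distinct_conv_sum_set) (simp add: distinct_bs)
  also have "\<dots> = (\<Sum>b\<in>arcs D. if head D b = v then \<alpha> (tail D b) else 0)"
    using fin_D by (simp add: set_bs sum.inter_filter)
  also have "\<dots> = (\<Sum>b\<in>Orig ` arcs Q. if head D b = v then \<alpha> (tail D b) else 0) + (\<Sum>b\<in>Rev ` arcs Q. if head D b = v then \<alpha> (tail D b) else 0)"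
    by (subst sum.union_disjoint[symmetric]) (auto simp: double_def)
  also have "\<dots> = (\<Sum>a\<in>arcs Q. (if head Q a = v then \<alpha> (tail Q a) else 0)) + (\<Sum>a\<in>arcs Q. (if tail Q a = v then \<alpha> (head Q a) else 0))"
    by (simp add: sum.reindex inj_on_def double_def cong: if_cong)
  finally show ?thesis using assms by (simp add: form_coord sum.distrib)
qed

end

section \<open>Reflecting a representation\<close>

lemma prod_list_take:
  "k \<le> length L \<Longrightarrow> P 0 = (1 :: 'r::ring_1) \<Longrightarrow> (\<And>j. j < k \<Longrightarrow> P (Suc j) = P j * g (L ! j)) \<Longrightarrow> P k = prod_list (map g (take k L))"
  by (induct k) (simp_all add: take_Suc_conv_app_nth)

text \<open>The notation of \<open>reflection_core\<close> at the vertex \<open>v\<close>: \<open>L\<close> lists the arrows into \<open>v\<close> in the given order and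
  \<open>cc j\<close>, \<open>tt j\<close>, \<open>ff j\<close> belong to the \<open>j\<close>-th of them.\<close>
locale vertex_reflection = mult_preproj Q lt for Q :: "('v, 'a) pre_digraph" and lt +
  fixes q :: "'v \<Rightarrow> 'k::field" and S :: "'v \<Rightarrow> nat set" and A :: "'a darrow \<Rightarrow> 'k endo" and v :: 'v
  assumes rep: "coord_rep q S A" and lf: "loopfree Q v"
begin

definition "L = filter (\<lambda>b. head D b = v) bs"
definition "kk = length L"
definition "cc j = normal_arrow A (L ! j)"
definition "tt j = A (star (L ! j))"
definition "ff j = (pr (S (tail D (L ! j))) :: 'k endo)"
abbreviation "ev \<equiv> (pr (S v) :: 'k endo)"

lemma v: "v \<in> verts Q" using lf by (simp add: loopfree_def)
lemmas rD = coord_repD[OF rep]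
lemmas qD = quiver_repD[OF rD(4)]

lemma Lj: "j < kk \<Longrightarrow> L ! j \<in> arcs D" "j < kk \<Longrightarrow> head D (L ! j) = v"
  using nth_mem[of j L] by (auto simp: kk_def L_def set_bs)
lemma Lt: "j < kk \<Longrightarrow> tail D (L ! j) \<in> verts Q" "j < kk \<Longrightarrow> tail D (L ! j) \<noteq> v"
  using Lj[of j] ends_verts loopfree_D[OF lf] by auto
lemma Ls: "j < kk \<Longrightarrow> star (L ! j) \<in> arcs D" using Lj star_arcs by auto
lemma L_ex: "b \<in> arcs D \<Longrightarrow> head D b = v \<Longrightarrow> \<exists>j<kk. b = L ! j"
proof -
  assume "b \<in> arcs D" "head D b = v"
  then have "b \<in> set L" by (simp add: L_def set_bs)
  then show ?thesis unfolding in_set_conv_nth kk_def by metis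
qed
lemma L_inj: "i < kk \<Longrightarrow> j < kk \<Longrightarrow> L ! i = L ! j \<Longrightarrow> i = j"
  using distinct_bs by (simp add: L_def kk_def nth_eq_iff_index_eq)

lemma gam_L: assumes j: "j < kk"
  shows "rel_factor A (L ! j) = 1 + cc j * tt j" "isunit (1 + tt j * cc j)" "rel_factor A (star (L ! j)) = uinv (1 + tt j * cc j)"
    "isunit (1 + cc j * tt j)"
  using rel_factor_normal_arrow[OF rD(5)[OF Lj(1)[OF j]]] isunit_rel_factor[OF rD(5)[OF Lj(1)[OF j]]] by (simp_all add: cc_def tt_def)

lemma ev_cc: "j < kk \<Longrightarrow> ev * cc j = cc j"
proof -
  assume j: "j < kk"
  have h: "ev * A (L ! j) = A (L ! j)" using qD(3)[OF Lj(1)[OF j]] Lj(2)[OF j] by simp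
  have "ev * rel_factor A (L ! j) = rel_factor A (L ! j) * ev" by (rule rel_factor_idem(1)[OF rD(4) Lj(1)[OF j] rD(5)[OF Lj(1)[OF j]] v])
  then show ?thesis using h by (simp add: cc_def normal_arrow_def mult.assoc[symmetric]) (simp add: mult.assoc)
qed

lemma cc_ff: "j < kk \<Longrightarrow> cc j * ff j = cc j"
  using qD(4)[OF Lj(1)] by (simp add: cc_def ff_def normal_arrow_def mult.assoc)

lemma ff_ff: "ff j * ff j = ff j" by (simp add: ff_def pr_mult)

sublocale reflection_core ev kk cc tt ff sh rt
  using qD(4)[OF Ls] qD(3)[OF Ls] Lj
  by unfold_locales (simp_all add: tt_def ff_def ev_cc cc_ff[unfolded ff_def] pr_mult rt_sh gam_L[unfolded tt_def])

lemma P_kk: "ev * P kk = sc (q v) * ev"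
proof -
  have "P kk = prod_list (map (rel_factor A) (take kk L))"
    by (rule prod_list_take) (use gam_L(1) in \<open>auto simp: kk_def\<close>)
  then have "P kk = prod_list (map (rel_factor A) L)" by (simp add: kk_def)
  then have "ev * P kk = ev * prod_list (map (rel_factor A) bs)" using prod_E(2)[OF rD(4,5) v, of bs] set_bs by (simp add: L_def)
  then show ?thesis using rD(6)[OF v] by simp
qed

definition "Tz = (\<Union>j\<in>{..<kk}. prod_encode ` ({j} \<times> S (tail D (L ! j))))"

lemma Tz_fin: "finite Tz" using Lt rD(1) by (auto simp: Tz_def)
lemma Tz_disj: "disjoint_family_on (\<lambda>j. prod_encode ` ({j} \<times> S (tail D (L ! j)))) {..<kk}"
  by (auto simp: disjoint_family_on_def dest: inj_onD[OF inj_prod_encode[of UNIV]])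
lemma Tz_pr: "(\<Sum>j<kk. sh j * ff j * rt j) = (pr Tz :: 'k endo)"
  unfolding Tz_def by (subst pr_UN[OF _ Tz_disj]) (simp_all add: ff_def mult.assoc sh_pr_rt)
lemma z_Tz: "z = pr Tz" unfolding z_def by (rule Tz_pr)
lemma Tz_card: "int (card Tz) = 2 * dimv S v - form (dimv S) (coord v)"
proof -
  have "card Tz = (\<Sum>j<kk. card (prod_encode ` ({j} \<times> S (tail D (L ! j)))))"
    unfolding Tz_def by (rule card_UN_disjoint) (use Lt rD(1) Tz_disj in \<open>auto simp: disjoint_family_on_def\<close>)
  also have "\<dots> = (\<Sum>j<kk. card (S (tail D (L ! j))))"
    by (simp add: card_image[OF inj_on_subset[OF inj_prod_encode[of UNIV]]] card_cartesian_product)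
  finally have "int (card Tz) = (\<Sum>j<kk. dimv S (tail D (L ! j)))" using Lt(1) by (simp add: dimv_def)
  also have "\<dots> = (\<Sum>b\<leftarrow>L. dimv S (tail D b))" by (simp add: sum_list_sum_nth kk_def atLeast0LessThan)
  finally show ?thesis using arrow_sum[OF v, of "dimv S"] by (simp add: L_def)
qed

end

locale vertex_reflection_nontriv = vertex_reflection + assumes q0: "q v \<noteq> 0" and q1: "q v \<noteq> 1"
begin

sublocale reflection_core_rel ev kk cc tt ff sh rt "q v"
  by (intro reflection_core_rel.intro reflection_core_rel_axioms.intro reflection_core_axioms q0 q1 P_kk)

text \<open>The new vertex space is placed on fresh coordinates \<open>Sv\<close>. Its dimension is found from
  the isomorphism of \<open>Tz\<close> with \<open>S v \<union> Sv\<close>, the splitting of the sum of the neighbours by \<open>p\<close> and \<open>p'\<close>.\<close>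
lemma ex_split: "\<exists>\<iota> \<rho> Sv. finite Sv \<and> Sv \<inter> tot S = {} \<and> int (card Sv) = dimv S v - form (dimv S) (coord v) \<and>
   \<iota> * \<rho> = p' \<and> \<rho> * \<iota> = pr Sv \<and> \<iota> * pr Sv = \<iota> \<and> pr Sv * \<rho> = \<rho>"
proof -
  obtain n where n: "\<And>X. finite X \<Longrightarrow> card X = n \<Longrightarrow>
    \<exists>\<iota> \<rho>. \<iota> * \<rho> = p' \<and> \<rho> * \<iota> = pr X \<and> \<iota> * pr X = \<iota> \<and> pr X * \<rho> = \<rho>"
    by (rule split_idempotent[OF Tz_fin p'p']) (use zp' in \<open>auto simp: z_Tz\<close>)
  have "infinite (- tot S)" using rD(3) by (simp add: Compl_eq_Diff_UNIV)
  then obtain Sv where Sv: "finite Sv" "card Sv = n" "Sv \<subseteq> - tot S" using infinite_arbitrarily_large by blast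
  obtain \<iota> \<rho> where i: "\<iota> * \<rho> = p'" "\<rho> * \<iota> = pr Sv" "\<iota> * pr Sv = \<iota>" "pr Sv * \<rho> = \<rho>" using n[OF Sv(1,2)] by blast
  have dj: "S v \<inter> Sv = {}" using Sv(3) tot_sub[OF v, of S] by auto
  have 0: "ev * pr Sv = 0" "pr Sv * ev = 0" using dj by (simp_all add: pr_mult Int_commute pr_empty)
  have \<rho>p': "\<rho> * p' = \<rho>" using i by (metis mult.assoc)
  have p'\<iota>: "p' * \<iota> = \<iota>" using i by (metis mult.assoc)
  have \<rho>\<phi>: "\<rho> * \<phi> = 0" by (rule mult_mid_0(1)[OF \<rho>p' p'\<phi>])
  have \<pi>\<iota>: "\<pi> * \<iota> = 0" by (rule mult_mid_0(2)[OF \<pi>p' p'\<iota>])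
  have \<phi>v: "\<phi> * pr Sv = 0" by (rule mult_mid_0(1)[OF \<phi>e 0(1)])
  have v\<pi>: "pr Sv * \<pi> = 0" by (rule mult_mid_0(2)[OF 0(2) e\<pi>])
  have \<iota>v: "\<iota> * ev = 0" by (rule mult_mid_0(1)[OF i(3) 0(2)])
  have v\<rho>: "ev * \<rho> = 0" by (rule mult_mid_0(2)[OF 0(1) i(4)])
  define x where "x = \<phi> + \<iota>"
  define y where "y = sc (inverse (q v - 1)) * \<pi> + \<rho>"
  have prU: "pr (S v \<union> Sv) = ev + pr Sv" by (rule pr_Un[OF dj])
  have "sc (inverse (q v - 1)) * sc (q v - 1) = 1" using q1 by (simp add: sc_simps(2)[symmetric] sc_simps(3))
  then have d1: "sc (inverse (q v - 1)) * (sc (q v - 1) * X) = X" for X by (simp add: mult.assoc[symmetric])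
  have "card (S v \<union> Sv) = card Tz"
  proof (rule pr_card_eq)
    have "\<phi> * \<rho> = 0" "\<iota> * \<pi> = 0"
      by (rule mult_mid_0(1)[OF \<phi>e v\<rho>], rule mult_mid_0(2)[OF \<iota>v e\<pi>])
    then have "x * y = p + p'" unfolding x_def y_def
      by (simp add: distrib_left distrib_right sc_left[of \<phi>] sc_left[of \<iota>] i p_def)
    then show "x * y = pr Tz" by (simp add: p'_def z_Tz)
    show "y * x = pr (S v \<union> Sv)" unfolding x_def y_def prU
      by (simp add: distrib_left distrib_right mult.assoc \<pi>\<phi> d1 \<pi>\<iota> \<rho>\<phi> i)
    show "x * pr (S v \<union> Sv) = x" unfolding x_def prU by (simp add: distrib_left distrib_right \<phi>e \<phi>v \<iota>v i)
    show "pr (S v \<union> Sv) * y = y" unfolding y_def prU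
      by (simp add: distrib_left distrib_right sc_left[of ev] sc_left[of "pr Sv"] e\<pi> v\<pi> v\<rho> i)
    have "z * \<iota> = \<iota>" "\<rho> * z = \<rho>" by (metis p'\<iota> mult.assoc zp') (metis \<rho>p' mult.assoc p'z)
    then show "pr Tz * x = x" "y * pr Tz = y" unfolding x_def y_def z_Tz[symmetric]
      by (simp_all add: distrib_left distrib_right z\<phi> \<pi>z mult.assoc)
  qed (use Sv rD(1)[OF v] Tz_fin in auto)
  then have "card (S v) + card Sv = card Tz" using card_Un_disjoint[OF rD(1)[OF v] Sv(1) dj] by simp
  then have "int (card Sv) = dimv S v - form (dimv S) (coord v)" using Tz_card v by (simp add: dimv_def)
  then show ?thesis using Sv i by blast
qed

end

locale vertex_reflection_split = vertex_reflection_nontriv +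
  fixes \<iota> \<rho> :: "'c endo" and Sv :: "nat set"
  assumes Sv: "finite Sv" "Sv \<inter> tot S = {}"
   and ir: "\<iota> * \<rho> = p'" "\<rho> * \<iota> = pr Sv" "\<iota> * pr Sv = \<iota>" "pr Sv * \<rho> = \<rho>"
begin

sublocale reflection_core_split ev kk cc tt ff sh rt "q v" \<iota> \<rho> "pr Sv"
  by unfold_locales (rule ir)+

abbreviation "e' \<equiv> pr Sv"

definition "idx b = (LEAST j. L ! j = b)"
definition "A' b = (if head D b = v then arrow_of_normal (c' (idx b)) (t' (idx b)) b
   else if tail D b = v then t' (idx (star b)) else A b)"
definition "S' = S(v := Sv)"

lemma idx: "j < kk \<Longrightarrow> idx (L ! j) = j"
proof -
  assume j: "j < kk"
  have "L ! idx (L ! j) = L ! j" "idx (L ! j) \<le> j" unfolding idx_def by (rule LeastI) (auto intro: Least_le)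
  then show ?thesis using L_inj[of "idx (L ! j)" j] j by simp
qed

lemma A'_L: "j < kk \<Longrightarrow> A' (L ! j) = arrow_of_normal (c' j) (t' j) (L ! j)" "j < kk \<Longrightarrow> A' (star (L ! j)) = t' j"
  "head D b \<noteq> v \<Longrightarrow> tail D b \<noteq> v \<Longrightarrow> A' b = A b"
  using Lj(2) Lt(2) by (auto simp: A'_def idx)

lemma S'_simps: "S' v = Sv" "w \<noteq> v \<Longrightarrow> S' w = S w" by (auto simp: S'_def)

lemma gam'_L: assumes j: "j < kk"
  shows "rel_factor A' (L ! j) = 1 + c' j * t' j" "isunit (1 + t' j * c' j)" "rel_factor A' (star (L ! j)) = uinv (1 + t' j * c' j)"
    "isunit (1 + A' (L ! j) * A' (star (L ! j)))" "normal_arrow A' (L ! j) = c' j"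
proof -
  note u = normal_arrow_of_normal[where A = A', OF c't'_unit[OF j] A'_L(1)[OF j] A'_L(2)[OF j]]
  show "isunit (1 + A' (L ! j) * A' (star (L ! j)))" "normal_arrow A' (L ! j) = c' j" by (rule u)+
  show "rel_factor A' (L ! j) = 1 + c' j * t' j" "isunit (1 + t' j * c' j)" "rel_factor A' (star (L ! j)) = uinv (1 + t' j * c' j)"
    using rel_factor_normal_arrow[OF u(1)] unfolding u(2) A'_L(2)[OF j] .
qed

lemma b_cases: assumes "b \<in> arcs D"
  obtains j where "j < kk" "b = L ! j" | j where "j < kk" "b = star (L ! j)" | "head D b \<noteq> v" "tail D b \<noteq> v"
proof -
  consider "head D b = v" | "tail D b = v" | "head D b \<noteq> v" "tail D b \<noteq> v" by blast
  then show ?thesis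
  proof cases
    case 1 then show ?thesis using L_ex[OF assms] that by blast
  next
    case 2
    then have "head D (star b) = v" by simp
    then obtain j where "j < kk" "star b = L ! j" using L_ex[OF star_arcs[OF assms]] by blast
    then have "b = star (L ! j)" by (metis star_star)
    then show ?thesis using that \<open>j < kk\<close> by blast
  next
    case 3 then show ?thesis using that by blast
  qed
qed

lemma unit': "b \<in> arcs D \<Longrightarrow> isunit (1 + A' b * A' (star b))"
proof -
  assume b: "b \<in> arcs D"
  then show ?thesis
  proof (cases rule: b_cases)
    case (1 j) then show ?thesis using gam'_L(4) by simp
  next
    case (2 j)
    then have "isunit (1 + A' (L ! j) * A' (star (L ! j)))" using gam'_L(4) by simp
    from unit_swap[OF this] isunitI have "isunit (1 + A' (star (L ! j)) * A' (L ! j))" by blast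
    then show ?thesis using 2 by simp
  next
    case 3 then show ?thesis using A'_L(3)[of b] A'_L(3)[of "star b"] rD(5)[OF b] by simp
  qed
qed

lemma e'_P': "e' * P' j = P' j * e'" by (simp add: P'_def distrib_left distrib_right sc_left[of e'] mult.assoc ir mult_chain[OF ir(4)])
lemma e'_c': "j < kk \<Longrightarrow> e' * c' j = c' j"
  using uinv_comm[OF P'_unit(1) e'_P', of j]
  by (simp add: c'_def mult.assoc[symmetric]) (simp add: mult.assoc sc_left[of e'] mult_chain[OF ir(4)])
lemma c'_ff: "c' j * ff j = c' j" by (simp add: c'_def mult.assoc ff_ff)
lemma ff_t': "ff j * t' j = t' j" by (simp add: t'_def mult.assoc mult_chain[OF ff_ff])
lemma t'_e': "t' j * e' = t' j" by (simp add: t'_def mult.assoc ir)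
lemma t'_r: "j < kk \<Longrightarrow> t' j = rt j * \<iota>" using rz[of j] by (metis t'_def mult.assoc z\<iota>)
lemma gam'_e': "j < kk \<Longrightarrow> e' * (1 + c' j * t' j) = (1 + c' j * t' j) * e'"
  by (simp add: distrib_left distrib_right mult.assoc t'_e' mult_chain[OF e'_c'])

lemma arrow_of_normal_ends: "j < kk \<Longrightarrow> e' * arrow_of_normal (c' j) (t' j) b = arrow_of_normal (c' j) (t' j) b" "arrow_of_normal (c' j) (t' j) b * ff j = arrow_of_normal (c' j) (t' j) b"
  using uinv_comm[OF c't'_unit gam'_e', of j]
  by (simp_all add: arrow_of_normal_def e'_c' c'_ff mult.assoc[symmetric]) (simp_all add: e'_c' c'_ff mult.assoc)

lemma Sv_disj: "w \<in> verts Q \<Longrightarrow> w \<noteq> v \<Longrightarrow> Sv \<inter> S w = {}" using Sv(2) tot_sub[of w S] by auto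

lemma disj': "disjoint_family_on S' (verts Q)"
  unfolding disjoint_family_on_def
proof (intro ballI impI)
  fix a b assume a: "a \<in> verts Q" "b \<in> verts Q" "a \<noteq> b"
  show "S' a \<inter> S' b = {}"
    using rD(2) Sv_disj a by (cases "a = v"; cases "b = v") (auto simp: S'_simps disjoint_family_on_def)
qed

lemma refl_quiver_rep: "quiver_rep (\<lambda>w. pr (S' w)) A'"
  unfolding quiver_rep_def
proof (intro conjI ballI)
  fix a b assume a: "a \<in> verts Q" "b \<in> verts Q"
  show "pr (S' a) * pr (S' b) = (if a = b then pr (S' a) else (0 :: 'c endo))"
    using disj' a by (auto simp: pr_mult pr_empty disjoint_family_on_def)
next
  fix b assume b: "b \<in> arcs D"
  have "pr (S' (head D b)) * A' b = A' b \<and> A' b * pr (S' (tail D b)) = A' b"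
    using b
  proof (cases rule: b_cases)
    case (1 j) then show ?thesis using arrow_of_normal_ends[of j "L ! j"] Lj(2) Lt(2) by (simp add: A'_L S'_simps ff_def)
  next
    case (2 j) then show ?thesis using ff_t'[of j] t'_e' Lj(2) Lt(2) by (simp add: A'_L S'_simps ff_def)
  next
    case 3 then show ?thesis using qD(3,4)[OF b] by (simp add: A'_L S'_simps)
  qed
  then show "pr (S' (head D b)) * A' b = A' b" "A' b * pr (S' (tail D b)) = A' b" by auto
qed

text \<open>For an arrow from \<open>v\<close> to a neighbour the factor in the relation there gains the scalar \<open>q v\<close>; as
  these are as many as \<open>- (coord v, coord w)\<close>, the parameter at \<open>w\<close> becomes \<open>refl_q q v w\<close>.\<close>
lemma star_rel: assumes j: "j < kk" shows "ff j * rel_factor A' (star (L ! j)) = sc (q v) * (ff j * rel_factor A (star (L ! j)))"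
proof -
  let ?X = "1 + t' j * c' j" and ?Y = "1 + tt j * cc j"
  have fX: "ff j * ?X = sc (inverse (q v)) * (ff j * ?Y)"
    using t'c'[OF j] by (simp add: distrib_left mult.assoc[symmetric] ff_t' ft[OF j])
  have Xf: "?X * ff j = ff j * ?X" by (simp add: distrib_left distrib_right mult.assoc c'_ff) (simp add: mult.assoc[symmetric] ff_t')
  have "ff j * uinv ?Y = uinv ?X * ?X * (ff j * uinv ?Y)" using uinv(2)[OF gam'_L(2)[OF j]] by simp
  also have "\<dots> = uinv ?X * (ff j * ?X) * uinv ?Y" by (simp only: Xf[symmetric] mult.assoc)
  also have "\<dots> = sc (inverse (q v)) * (uinv ?X * ff j * (?Y * uinv ?Y))" unfolding fX by (simp only: sc_left[of "uinv ?X"] mult.assoc)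
  also have "\<dots> = sc (inverse (q v)) * (ff j * uinv ?X)"
    using uinv(1)[OF gam_L(2)[OF j]] uinv_comm[OF gam'_L(2)[OF j] Xf[symmetric]] by simp
  finally have "sc (q v) * (ff j * uinv ?Y) = sc (q v * inverse (q v)) * (ff j * uinv ?X)" by (simp add: sc_simps mult.assoc)
  then show ?thesis using q0 by (simp add: gam'_L(3) gam_L(3) j sc_simps)
qed

lemma rel_other:
  assumes w: "w \<in> verts Q" "w \<noteq> v" and xs: "set xs \<subseteq> arcs D"
  shows "pr (S w) * prod_list (map (rel_factor A') xs) =
    sc (q v ^ length (filter (\<lambda>b. head D b = w \<and> tail D b = v) xs)) * (pr (S w) * prod_list (map (rel_factor A) xs))"
  using xs
proof (induct xs)
  case Nil then show ?case by (simp add: sc_simps)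
next
  case (Cons b xs)
  then have b: "b \<in> arcs D" by auto
  let ?m = "length (filter (\<lambda>b. head D b = w \<and> tail D b = v) xs)" and ?E = "pr (S w) :: 'c endo"
  have IH: "?E * prod_list (map (rel_factor A') xs) = sc (q v ^ ?m) * (?E * prod_list (map (rel_factor A) xs))" using Cons by simp
  have one: "?E * rel_factor A' b = sc (if head D b = w \<and> tail D b = v then q v else 1) * (?E * rel_factor A b)"
  proof (cases "head D b = w")
    case False
    have "pr (S' w) * rel_factor A' b = (pr (S' w) :: 'c endo)" by (rule rel_factor_idem(2)[OF refl_quiver_rep b unit'[OF b] w(1)]) (use False in auto)
    moreover have "?E * rel_factor A b = ?E" by (rule rel_factor_idem(2)[OF rD(4) b rD(5)[OF b] w(1)]) (use False in auto)
    ultimately show ?thesis using False w by (simp add: S'_simps sc_simps)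
  next
    case True
    show ?thesis using b
    proof (cases rule: b_cases)
      case (1 j) then show ?thesis using True w Lj(2) by auto
    next
      case (2 j)
      then have "ff j = ?E" using True by (simp add: ff_def)
      then show ?thesis using star_rel[OF 2(1)] 2 Lj(2) True by simp
    next
      case 3
      then have "rel_factor A' b = rel_factor A b" unfolding rel_factor_def using A'_L(3)[of b] A'_L(3)[of "star b"] by simp
      then show ?thesis using 3 by (simp add: sc_simps)
    qed
  qed
  have c1: "?E * rel_factor A' b = rel_factor A' b * ?E" using rel_factor_idem(1)[OF refl_quiver_rep b unit'[OF b] w(1)] w by (simp add: S'_simps)
  have c2: "?E * rel_factor A b = rel_factor A b * ?E" by (rule rel_factor_idem(1)[OF rD(4) b rD(5)[OF b] w(1)])
  let ?x = "if head D b = w \<and> tail D b = v then q v else 1"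
  have "?E * (rel_factor A' b * prod_list (map (rel_factor A') xs)) = rel_factor A' b * (?E * prod_list (map (rel_factor A') xs))"
    by (simp only: mult.assoc[symmetric] c1)
  also have "\<dots> = sc (q v ^ ?m) * (?E * rel_factor A' b * prod_list (map (rel_factor A) xs))"
    unfolding IH by (simp only: sc_left[of "rel_factor A' b"] c1 mult.assoc)
  also have "\<dots> = sc (q v ^ ?m * ?x) * (?E * rel_factor A b * prod_list (map (rel_factor A) xs))"
    unfolding one by (simp only: sc_simps mult.assoc)
  finally show ?case by (simp add: mult.assoc mult.commute)
qed

lemma rel_v: "e' * prod_list (map (rel_factor A') bs) = sc (inverse (q v)) * e'"
proof -
  have "P' kk = prod_list (map (rel_factor A') (take kk L))"
  proof (rule prod_list_take)
    show "P' (Suc j) = P' j * rel_factor A' (L ! j)" if "j < kk" for j using P'_Suc[OF that] gam'_L(1)[OF that] by simp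
  qed (simp_all add: kk_def P'_def ez_def)
  then have "P' kk = prod_list (map (rel_factor A') L)" by (simp add: kk_def)
  then have "e' * prod_list (map (rel_factor A') bs) = e' * P' kk"
    using prod_E(2)[OF refl_quiver_rep unit' v, of bs] set_bs by (simp add: L_def S'_simps)
  also have "\<dots> = sc (inverse (q v)) * e'"
    unfolding P'_k by (simp add: distrib_left sc_left[of e'] pr_mult M_def sc_simps algebra_simps)
  finally show ?thesis .
qed

lemma refl_coord_rep: "coord_rep (refl_q q v) S' A'"
  unfolding coord_rep_def mpa_rep_def
proof (intro conjI ballI disj' refl_quiver_rep unit')
  show "finite (S' w)" if "w \<in> verts Q" for w using rD(1)[OF that] Sv by (simp add: S'_def)
  show "pr (S' w) * prod_list (map (rel_factor A') bs) = sc (refl_q q v w) * pr (S' w)" if w: "w \<in> verts Q" for w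
  proof (cases "w = v")
    case True then show ?thesis using rel_v refl_q_self[of v q] lf q0 by (simp add: S'_simps)
  next
    case False
    have "q v ^ length (filter (\<lambda>b. head D b = w \<and> tail D b = v) bs) = q v powi (- form (coord v) (coord w))"
      unfolding arrow_count[OF lf False, symmetric] by simp
    then show ?thesis using rel_other[OF w False, of bs] rD(6)[OF w] False
      by (simp add: S'_simps set_bs refl_q_def sc_simps mult.assoc[symmetric] mult.commute[of "q w"])
  qed
qed

lemma refl_dimv: "int (card Sv) = dimv S v - form (dimv S) (coord v) \<Longrightarrow> dimv S' = s v (dimv S)"
  by (rule ext) (auto simp: s_apply coord_def dimv_def S'_def v)

end

section \<open>Reflections preserve simplicity and bricks\<close>

lemma app_app: "app a (app b x) = app (a * b) x" by simp

context mult_preproj begin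

lemma rel_factor_subrep:
  assumes c: "coord_rep q S A" and U: "subrep S A U" and b: "b \<in> arcs D" and x: "x \<in> U"
  shows "app (rel_factor A b) x \<in> U"
proof -
  have sub: "fv.subspace U" "U \<subseteq> supp_sp (tot S)" using U by (auto simp: subrep_def)
  have 1: "app (1 + A b * A (star b)) y \<in> U" if "y \<in> U" for y
    using U b star_arcs[OF b] that fv.subspace_add[OF sub(1)] by (simp add: subrep_def)
  then show ?thesis
    unfolding rel_factor_def using uinv_invariant[OF coord_repD(3)[OF c] sub coord_repD(5)[OF c b]] x by auto
qed

lemma normal_arrow_subrep:
  assumes "coord_rep q S A" "subrep S A U" "b \<in> arcs D" "x \<in> U" shows "app (normal_arrow A b) x \<in> U"
proof -
  have "app (A b) x \<in> U" "fv.subspace U" using assms by (auto simp: subrep_def)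
  then show ?thesis using rel_factor_subrep[OF assms(1,2,3)] fv.subspace_neg[of U] by (simp add: normal_arrow_def)
qed

lemma supp_tot_decomp:
  assumes "coord_rep q S (A :: 'a darrow \<Rightarrow> 'k::field endo)" "x \<in> supp_sp (tot S)" shows "x = (\<Sum>w\<in>verts Q. app (pr (S w)) x)"
proof -
  have "x = app (pr (tot S)) x" using assms(2) pr_supp[of "tot S" x] by (simp del: app_pr)
  then show ?thesis unfolding coord_repD(7)[OF assms(1)] app_sum .
qed

end

context vertex_reflection_split begin

lemma M0: "M \<noteq> 0" using q0 q1 by (simp add: M_def)

text \<open>Recovers \<open>\<rho>\<close> from the new arrows, so that subspaces stable under these are stable under \<open>\<rho>\<close>.\<close>
lemma \<rho>s: "j < kk \<Longrightarrow> \<rho> * sh j * ff j = sc (inverse M) * (P' j * c' j)"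
proof -
  assume j: "j < kk"
  have "P' j * c' j = P' j * uinv (P' j) * (sc M * (\<rho> * sh j * ff j))" by (simp only: c'_def mult.assoc)
  also have "\<dots> = sc M * (\<rho> * sh j * ff j)" using uinv(1)[OF P'_unit(1)] j by simp
  finally show ?thesis using M0 by (simp add: mult.assoc[symmetric] sc_simps(2)[symmetric] sc_simps(3))
qed

lemma \<rho>_sum: "\<rho> = (\<Sum>j<kk. \<rho> * sh j * ff j * rt j)"
  using \<rho>z unfolding z_def sum_distrib_left by (simp add: mult.assoc)

lemma \<iota>_sum: "\<iota> = (\<Sum>j<kk. sh j * t' j)"
proof -
  have "\<iota> = z * \<iota>" by (simp add: z\<iota>)
  then show ?thesis unfolding z_def sum_distrib_right by (simp add: mult.assoc t'_def)
qed

context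
  fixes U assumes U: "subrep S' A' U"
begin

private lemma sub: "fv.subspace U" using U by (simp add: subrep_def)
private lemma Usup: "U \<subseteq> supp_sp (tot S')" using U by (simp add: subrep_def)
private lemma prU: "w \<in> verts Q \<Longrightarrow> x \<in> U \<Longrightarrow> app (pr (S' w)) x \<in> U" using U by (simp add: subrep_def)
private lemma AU: "b \<in> arcs D \<Longrightarrow> x \<in> U \<Longrightarrow> app (A' b) x \<in> U" using U by (simp add: subrep_def)
private lemma cU: "j < kk \<Longrightarrow> x \<in> U \<Longrightarrow> app (c' j) x \<in> U"
  using normal_arrow_subrep[OF refl_coord_rep U Lj(1)] gam'_L(5) by metis
private lemma tU: "j < kk \<Longrightarrow> x \<in> U \<Longrightarrow> app (t' j) x \<in> U"
  using AU[OF Ls] A'_L(2) by metis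
private lemma PU: "j \<le> kk \<Longrightarrow> x \<in> U \<Longrightarrow> app (P' j) x \<in> U"
proof (induct j arbitrary: x)
  case 0 then show ?case by (simp add: P'_def ez_def)
next
  case (Suc j)
  then have j: "j < kk" by simp
  have "app (1 + c' j * t' j) x \<in> U" using cU[OF j tU[OF j Suc(3)]] fv.subspace_add[OF sub] Suc by simp
  then show ?case using Suc unfolding P'_Suc[OF j, symmetric] by simp
qed

private definition "UZ = {y. app z y = y \<and> (\<forall>j<kk. app (rt j) y \<in> U)}"

private lemma UZ_sub: "fv.subspace UZ"
  by (rule fv.subspaceI) (use sub in \<open>auto simp: UZ_def app_vec fv.subspace_0 fv.subspace_add fv.subspace_scale\<close>)

private lemma \<rho>UZ: "y \<in> UZ \<Longrightarrow> app \<rho> y \<in> U"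
proof -
  assume y: "y \<in> UZ"
  have "app \<rho> y = (\<Sum>j<kk. app (\<rho> * sh j * ff j * rt j) y)" by (subst \<rho>_sum) (simp only: app_sum)
  also have "\<dots> \<in> U"
  proof (rule fv.subspace_sum[OF sub])
    fix j assume "j \<in> {..<kk}"
    then have j: "j < kk" by simp
    have "app (\<rho> * sh j * ff j * rt j) y = scl (inverse M) (app (P' j) (app (c' j) (app (rt j) y)))"
      unfolding \<rho>s[OF j] by (simp add: mult.assoc)
    then show "app (\<rho> * sh j * ff j * rt j) y \<in> U" using y j PU[OF _ cU[OF j]] fv.subspace_scale[OF sub] by (simp add: UZ_def)
  qed
  finally show ?thesis .
qed

private lemma p'UZ: "y \<in> UZ \<Longrightarrow> app p' y \<in> UZ"
proof -
  assume y: "y \<in> UZ"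
  have "app (rt j) (app p' y) = app (t' j) (app \<rho> y)" if "j < kk" for j
    unfolding app_app by (simp only: t'_r[OF that] ir(1)[symmetric] mult.assoc)
  then have "app (rt j) (app p' y) \<in> U" if "j < kk" for j using tU[OF that \<rho>UZ[OF y]] that by simp
  moreover have "app z (app p' y) = app p' y" unfolding app_app zp' ..
  ultimately show ?thesis by (simp add: UZ_def)
qed

private lemma pUZ: "y \<in> UZ \<Longrightarrow> app p y \<in> UZ"
proof -
  assume y: "y \<in> UZ"
  have "p = z - p'" by (simp add: p'_def)
  then have "app p y = y - app p' y" using y by (simp add: UZ_def)
  then show ?thesis using fv.subspace_diff[OF UZ_sub y p'UZ[OF y]] by simp
qed

private lemma ezUZ: "i \<le> kk \<Longrightarrow> y \<in> UZ \<Longrightarrow> app (ez i) y \<in> UZ"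
proof -
  assume i: "i \<le> kk" and y: "y \<in> UZ"
  have "app (rt j) (app (ez i) y) \<in> U" if j: "j < kk" for j
  proof (cases "j < i")
    case True
    then have "app (rt j) (app (ez i) y) = app (rt j) (app z y)" unfolding app_app by (simp only: r_ez[OF j i] rz[OF j] if_True)
    then show ?thesis using y j by (simp add: UZ_def)
  next
    case False
    then show ?thesis unfolding app_app by (simp add: r_ez[OF j i] fv.subspace_0[OF sub])
  qed
  moreover have "app z (app (ez i) y) = app (ez i) y" unfolding app_app z_ez[OF i] ..
  ultimately show ?thesis by (simp add: UZ_def)
qed

private definition "V = app \<pi> ` UZ"

private lemma V_sub: "fv.subspace V" unfolding V_def by (rule linear_subspace_image[OF app_linear UZ_sub])
private lemma V_ev: "x \<in> V \<Longrightarrow> app ev x = x" unfolding V_def by (auto simp only: app_app e\<pi>)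
private lemma V_sup: "V \<subseteq> supp_sp (S v)" using V_ev pr_supp by blast

private lemma PV: "i \<le> kk \<Longrightarrow> x \<in> V \<Longrightarrow> app (P i) x \<in> V"
proof -
  assume i: "i \<le> kk" and x: "x \<in> V"
  obtain y where y: "y \<in> UZ" "x = app \<pi> y" using x by (auto simp: V_def)
  have P: "P i = 1 + \<pi> * ez i * \<phi>" using \<pi>ez\<phi>[OF i] by simp
  have "P i * \<pi> = \<pi> + \<pi> * (ez i * (\<phi> * \<pi>))" unfolding P by (simp add: distrib_right mult.assoc)
  also have "\<dots> = \<pi> * (1 + sc (q v - 1) * (ez i * p))" by (simp only: \<phi>\<pi> sc_left[of "ez i"] distrib_left mult_1_right)
  finally have "app (P i) x = app \<pi> (y + scl (q v - 1) (app (ez i) (app p y)))" unfolding y(2) app_app by simp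
  moreover have "y + scl (q v - 1) (app (ez i) (app p y)) \<in> UZ"
    by (intro fv.subspace_add[OF UZ_sub] fv.subspace_scale[OF UZ_sub] y ezUZ i pUZ)
  ultimately show ?thesis by (simp add: V_def)
qed

private lemma cV: "j < kk \<Longrightarrow> u \<in> U \<Longrightarrow> app (ff j) u = u \<Longrightarrow> app (cc j) u \<in> V"
proof -
  assume j: "j < kk" and u: "u \<in> U" "app (ff j) u = u"
  have "app z (app (sh j) u) = app (sh j) u" unfolding app_app zs[OF j] unfolding app_app[symmetric] u ..
  moreover have "app (rt i) (app (sh j) u) \<in> U" for i unfolding app_app rt_sh using u fv.subspace_0[OF sub] by simp
  ultimately have "app (sh j) u \<in> UZ" by (simp add: UZ_def)
  then have 1: "app (\<pi> * sh j) u \<in> V" by (simp add: V_def)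
  have "cc j = uinv (P j) * P j * cc j" using uinv(2)[OF isunit_P] j by simp
  then have "cc j = uinv (P j) * (\<pi> * sh j)" by (simp only: \<pi>s[OF j] mult.assoc)
  then have "app (cc j) u = app (uinv (P j)) (app (\<pi> * sh j) u)" unfolding app_app by simp
  then show ?thesis
    using uinv_invariant[OF rD(1)[OF v] V_sub V_sup isunit_P PV 1] j by simp
qed

private lemma tV: "j < kk \<Longrightarrow> x \<in> V \<Longrightarrow> app (tt j) x \<in> U"
proof -
  assume j: "j < kk" and x: "x \<in> V"
  obtain y where y: "y \<in> UZ" "x = app \<pi> y" using x by (auto simp: V_def)
  have "tt j * \<pi> = rt j * (\<phi> * \<pi>)" by (simp only: r\<phi>[OF j, symmetric] mult.assoc)
  then have "app (tt j) x = scl (q v - 1) (app (rt j) (app p y))" unfolding y(2) app_app \<phi>\<pi> by (simp add: sc_left)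
  then show ?thesis using pUZ[OF y(1)] j fv.subspace_scale[OF sub] by (simp add: UZ_def)
qed

private lemma AV: "j < kk \<Longrightarrow> u \<in> U \<Longrightarrow> app (ff j) u = u \<Longrightarrow> app (A (L ! j)) u \<in> V"
proof -
  assume j: "j < kk" and u: "u \<in> U" "app (ff j) u = u"
  show ?thesis
  proof (cases "eps (L ! j) = 1")
    case True then show ?thesis using cV[OF j u] by (simp add: cc_def normal_arrow_def)
  next
    case False
    have gV: "app (1 + cc j * tt j) x \<in> V" if "x \<in> V" for x
    proof -
      have "app (ff j) (app (tt j) x) = app (tt j) x" unfolding app_app ft[OF j] ..
      then show ?thesis using cV[OF j tV[OF j that]] fv.subspace_add[OF V_sub that] by simp
    qed
    have "uinv (1 + cc j * tt j) * cc j = - (uinv (1 + cc j * tt j) * (1 + cc j * tt j) * A (L ! j))"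
      using False gam_L(1)[OF j] by (simp add: cc_def normal_arrow_def mult.assoc)
    then have "A (L ! j) = - (uinv (1 + cc j * tt j) * cc j)" using uinv(2)[OF gam_L(4)[OF j]] by simp
    then have "app (A (L ! j)) u = - app (uinv (1 + cc j * tt j)) (app (cc j) u)" by simp
    then show ?thesis using uinv_invariant[OF rD(1)[OF v] V_sub V_sup gam_L(4)[OF j] gV cV[OF j u]] fv.subspace_neg[OF V_sub] by simp
  qed
qed

text \<open>Agrees with \<open>U\<close> away from \<open>v\<close>; at \<open>v\<close> it is the part \<open>V\<close> generated by the arrows.\<close>
private definition "UU = {x \<in> supp_sp (tot S). (\<forall>w\<in>verts Q. w \<noteq> v \<longrightarrow> app (pr (S w)) x \<in> U) \<and> app ev x \<in> V}"

private lemma pr_pr: "w \<in> verts Q \<Longrightarrow> w' \<in> verts Q \<Longrightarrow> app (pr (S w)) (app (pr (S w')) (x :: nat \<Rightarrow> 'c)) = (if w = w' then app (pr (S w)) x else 0)"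
  by (cases "w = w'") (simp_all only: app_app qD(1,2) app_simps(1) if_True if_False simp_thms)

private lemma UU_pure: "w \<in> verts Q \<Longrightarrow> app (pr (S w)) x = x \<Longrightarrow> (w \<noteq> v \<Longrightarrow> x \<in> U) \<Longrightarrow> (w = v \<Longrightarrow> x \<in> V) \<Longrightarrow> x \<in> UU"
proof -
  assume a: "w \<in> verts Q" "app (pr (S w)) x = x" "w \<noteq> v \<Longrightarrow> x \<in> U" "w = v \<Longrightarrow> x \<in> V"
  have "x \<in> supp_sp (S w)" using a(2) pr_supp by blast
  then have 1: "x \<in> supp_sp (tot S)" using supp_sp_mono[OF tot_sub[OF a(1)]] by blast
  have 2: "app (pr (S w')) x = (if w' = w then x else 0)" if "w' \<in> verts Q" for w'
    using pr_pr[OF that a(1), of x] a(2) by (cases "w' = w") (simp_all del: app_pr)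
  have "app (pr (S w')) x \<in> U" if "w' \<in> verts Q" "w' \<noteq> v" for w'
    using 2[OF that(1)] a(3) that(2) fv.subspace_0[OF sub] by (cases "w' = w") (simp_all del: app_pr)
  moreover have "app ev x \<in> V"
  proof (cases "w = v")
    case True
    have "app ev x = x" using 2[OF v] True by (simp del: app_pr)
    then show ?thesis using a(4)[OF True] by (simp only:)
  next
    case False
    have "app ev x = 0" using 2[OF v] False by (simp del: app_pr)
    then show ?thesis using fv.subspace_0[OF V_sub] by (simp only:)
  qed
  ultimately show ?thesis unfolding UU_def using 1 by blast
qed

private lemma UU_subrep: "subrep S A UU"
  unfolding subrep_def
proof (intro conjI ballI)
  have s_involution: "fv.subspace (supp_sp (tot S) :: (nat \<Rightarrow> 'c) set)" by (rule supp_sp_subspace)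
  show "fv.subspace UU"
    by (rule fv.subspaceI)
      (use s_involution sub V_sub in \<open>auto simp: UU_def app_vec fv.subspace_0 fv.subspace_add fv.subspace_scale simp del: app_pr\<close>)
  show "UU \<subseteq> supp_sp (tot S)" by (auto simp: UU_def)
next
  fix w x assume w: "w \<in> verts Q" and x: "x \<in> UU"
  show "app (pr (S w)) x \<in> UU"
    by (rule UU_pure[OF w]) (use pr_pr[OF w w] x w in \<open>auto simp: UU_def simp del: app_pr\<close>)
next
  fix b x assume b: "b \<in> arcs D" and x: "x \<in> UU"
  have tl: "app (A b) x = app (A b) (app (pr (S (tail D b))) x)" unfolding app_app qD(4)[OF b] ..
  have xt: "tail D b \<noteq> v \<Longrightarrow> app (pr (S (tail D b))) x \<in> U" "tail D b = v \<Longrightarrow> app (pr (S (tail D b))) x \<in> V"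
    using x ends_verts[OF b] by (auto simp: UU_def simp del: app_pr)
  show "app (A b) x \<in> UU"
  proof (rule UU_pure[OF ends_verts(1)[OF b]])
    show "app (pr (S (head D b))) (app (A b) x) = app (A b) x" unfolding app_app qD(3)[OF b] ..
    show "app (A b) x \<in> U" if h: "head D b \<noteq> v"
      using b
    proof (cases rule: b_cases)
      case (1 j) then show ?thesis using h Lj(2) by simp
    next
      case (2 j)
      then show ?thesis unfolding tl using xt(2) tV[OF 2(1)] Lj(2)[OF 2(1)] by (simp add: tt_def del: app_pr)
    next
      case 3 then show ?thesis unfolding tl using AU[OF b xt(1)] A'_L(3)[of b] by simp
    qed
    show "app (A b) x \<in> V" if h: "head D b = v"
    proof -
      obtain j where j: "j < kk" "b = L ! j" using L_ex[OF b h] by blast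
      have "tail D b \<noteq> v" using Lt(2) j by simp
      then show ?thesis unfolding tl using AV[OF j(1) xt(1)] j pr_pr[OF Lt(1,1)[OF j(1)]]
        by (simp add: ff_def del: app_pr)
    qed
  qed
qed

text \<open>A subrepresentation \<open>U\<close> of the reflection is compared with the subrepresentation \<open>UU\<close> of the
  original one that agrees with \<open>U\<close> away from \<open>v\<close>. If \<open>UU\<close> vanishes, \<open>U\<close> is concentrated at \<open>v\<close>
  and killed by all \<open>t' j\<close>, hence by the injective \<open>\<iota>\<close>. If \<open>UU\<close> is everything, \<open>U\<close> contains all neighbouring
  spaces and therefore also their image under the surjective \<open>\<rho>\<close>.\<close>
lemma simple_step: assumes "simple_rep S A" shows "U = {0} \<or> U = supp_sp (tot S')"
proof -
  consider "UU = {0}" | "UU = supp_sp (tot S)" using assms UU_subrep by (auto simp: simple_rep_def)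
  then show ?thesis
  proof cases
    case 1
    have "x = 0" if x: "x \<in> U" for x
    proof -
      have 0: "u = 0" if "u \<in> U" "w \<in> verts Q" "w \<noteq> v" "app (pr (S w)) u = u" for u w
        using UU_pure[OF that(2,4)] that 1 by simp
      have o: "app (pr (S' w)) x = 0" if "w \<in> verts Q" "w \<noteq> v" for w
        using 0[OF prU[OF that(1) x] that] that pr_pr[OF that(1,1), of x] by (simp add: S'_simps del: app_pr)
      have "app (t' j) x = 0" if "j < kk" for j
      proof (rule 0[OF tU[OF that x] Lt[OF that]])
        show "app (pr (S (tail D (L ! j)))) (app (t' j) x) = app (t' j) x"
          using ff_t'[of j] unfolding app_app ff_def by simp
      qed
      then have "app \<iota> x = 0" by (subst \<iota>_sum) (simp add: app_vec)
      then have "app e' x = 0" unfolding ir(2)[symmetric] by (simp add: app_vec)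
      then have "app (pr (S' w)) x = 0" if "w \<in> verts Q" for w using o[OF that] by (cases "w = v") (auto simp: S'_simps simp del: app_pr)
      moreover have "x = (\<Sum>w\<in>verts Q. app (pr (S' w)) x)" using supp_tot_decomp[OF refl_coord_rep] Usup x by blast
      ultimately show ?thesis by (simp del: app_pr)
    qed
    then show ?thesis using fv.subspace_0[OF sub] by blast
  next
    case 2
    have o: "u \<in> U" if "w \<in> verts Q" "w \<noteq> v" "app (pr (S w)) u = u" for u w
    proof -
      have "u \<in> supp_sp (tot S)" using that pr_supp[of "S w" u] supp_sp_mono[OF tot_sub[OF that(1)]] by blast
      then have "u \<in> UU" using 2 by simp
      then have "app (pr (S w)) u \<in> U" using that unfolding UU_def by blast
      then show ?thesis using that by simp
    qed
    have e: "u \<in> U" if "app e' u = u" for u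
    proof -
      have "app (rt j) (app \<iota> u) \<in> U" if j: "j < kk" for j
      proof (rule o[OF Lt[OF j]])
        show "app (pr (S (tail D (L ! j)))) (app (rt j) (app \<iota> u)) = app (rt j) (app \<iota> u)"
          using ff_t'[of j] t'_r[OF j] unfolding app_app ff_def by (simp add: mult.assoc)
      qed
      moreover have "app z (app \<iota> u) = app \<iota> u" unfolding app_app z\<iota> ..
      ultimately have "app \<iota> u \<in> UZ" by (simp add: UZ_def)
      then have "app \<rho> (app \<iota> u) \<in> U" by (rule \<rho>UZ)
      then show ?thesis using that unfolding app_app ir(2) by simp
    qed
    have "x \<in> U" if x: "x \<in> supp_sp (tot S')" for x
    proof -
      have "app (pr (S' w)) x \<in> U" if w: "w \<in> verts Q" for w
      proof (cases "w = v")
        case True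
        have "app e' (app e' x) = app e' x" unfolding app_app e'e' ..
        then show ?thesis using e True by (simp add: S'_simps del: app_pr)
      next
        case False
        then show ?thesis using o[OF w False] pr_pr[OF w w, of x] by (simp add: S'_simps del: app_pr)
      qed
      then have "(\<Sum>w\<in>verts Q. app (pr (S' w)) x) \<in> U" by (intro fv.subspace_sum[OF sub])
      then show ?thesis using supp_tot_decomp[OF refl_coord_rep x] by simp
    qed
    then show ?thesis using Usup by blast
  qed
qed

end

lemma refl_simple: assumes "simple_rep S A" shows "simple_rep S' A'"
  unfolding simple_rep_def
proof (intro conjI allI impI notI)
  assume e: "tot S' = {}"
  have Sw: "S w = {}" if "w \<in> verts Q" "w \<noteq> v" for w using e that by (auto simp: tot_def S'_simps)
  have "Tz = {}" using Sw Lt by (auto simp: Tz_def)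
  then have "z = 0" by (simp add: z_Tz pr_empty)
  then have "sc (q v - 1) * ev = 0" using \<pi>\<phi> z\<phi> by simp
  then have "sc (inverse (q v - 1)) * sc (q v - 1) * ev = 0" by (simp add: mult.assoc)
  then have ev0: "ev = 0" using q1 by (simp add: sc_simps(2)[symmetric] sc_simps(3))
  have "S v = {}"
  proof (rule ccontr)
    assume "S v \<noteq> {}"
    then obtain i where "i \<in> S v" by blast
    moreover have "app ev (\<lambda>_. 1) i = 0" unfolding ev0 by simp
    ultimately show False by simp
  qed
  then have "tot S = {}" using Sw unfolding tot_def by blast
  then show False using assms by (simp add: simple_rep_def)
next
  fix U assume "subrep S' A' U"
  then show "U = {0} \<or> U = supp_sp (tot S')" by (rule simple_step[OF _ assms])
qed

text \<open>An endomorphism \<open>h'\<close> of the reflection acts on the sum of the neighbours by \<open>hZ\<close>, which commutes with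
  both idempotents; compressing it along \<open>\<phi>\<close> and \<open>\<pi>\<close> extends \<open>h'\<close> away from \<open>v\<close> to an endomorphism \<open>h\<close> of
  the original representation. This is a scalar, and then so is \<open>h'\<close>, first on the neighbours and then at \<open>v\<close>.\<close>
lemma refl_brick: assumes br: "brick S A" shows "brick S' A'"
  unfolding brick_def
proof (intro allI impI)
  fix h' :: "'c endo"
  assume hp: "\<forall>w\<in>verts Q. h' * pr (S' w) = pr (S' w) * h'" and hA: "\<forall>b\<in>arcs D. h' * A' b = A' b * h'"
    and ht: "h' * pr (tot S') = h'"
  have hf: "h' * pr (S w) = pr (S w) * h'" if "w \<in> verts Q" "w \<noteq> v" for w using hp that S'_simps(2) by metis
  have hff: "h' * ff j = ff j * h'" if "j < kk" for j unfolding ff_def by (rule hf[OF Lt[OF that]])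
  have he: "h' * e' = e' * h'" using hp v S'_simps(1) by metis
  have hgam: "h' * rel_factor A' b = rel_factor A' b * h'" if b: "b \<in> arcs D" for b
  proof -
    have 1: "h' * (1 + A' b * A' (star b)) = (1 + A' b * A' (star b)) * h'"
      using hA b star_arcs[OF b] by (simp add: distrib_left distrib_right mult.assoc[symmetric]) (simp add: mult.assoc)
    then show ?thesis unfolding rel_factor_def using uinv_comm[OF unit'[OF b] 1] by simp
  qed
  have hc: "h' * c' j = c' j * h'" if "j < kk" for j
  proof -
    have "h' * normal_arrow A' (L ! j) = normal_arrow A' (L ! j) * h'" using hA Lj(1)[OF that] hgam[OF Lj(1)[OF that]]
      by (simp add: normal_arrow_def mult.assoc[symmetric]) (simp add: mult.assoc)
    then show ?thesis unfolding gam'_L(5)[OF that] .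
  qed
  have htt: "h' * t' j = t' j * h'" if "j < kk" for j using hA Ls[OF that] A'_L(2)[OF that] by metis
  have hP: "h' * P' j = P' j * h'" if "j \<le> kk" for j
    using that
  proof (induct j)
    case 0 then show ?case by (simp add: P'_def ez_def)
  next
    case (Suc j)
    then have j: "j < kk" by simp
    have "h' * (1 + c' j * t' j) = (1 + c' j * t' j) * h'"
      using hc[OF j] htt[OF j] by (simp add: distrib_left distrib_right mult.assoc[symmetric]) (simp add: mult.assoc)
    then show ?case unfolding P'_Suc[OF j, symmetric] using Suc by (simp add: mult.assoc[symmetric]) (simp add: mult.assoc)
  qed
  define hZ where "hZ = (\<Sum>j<kk. sh j * (ff j * h') * rt j)"
  have rhZ: "rt j * hZ = ff j * h' * rt j" if "j < kk" for j
    unfolding hZ_def mult.assoc using r_sum[OF that] by (simp add: mult.assoc)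
  have hZs: "hZ * sh j = sh j * (ff j * h')" if "j < kk" for j
    unfolding hZ_def by (rule sum_s[OF that])
  have ez_hZ: "ez i * hZ = hZ * ez i" if "i \<le> kk" for i
  proof -
    have "ez i * hZ = (\<Sum>j<i. sh j * ff j * (rt j * hZ))" by (simp add: ez_def sum_distrib_right mult.assoc)
    also have "\<dots> = (\<Sum>j<i. hZ * (sh j * ff j * rt j))"
    proof (rule sum.cong)
      fix j assume "j \<in> {..<i}"
      then have j: "j < kk" using that by simp
      have "hZ * (sh j * ff j * rt j) = sh j * (ff j * (h' * ff j)) * rt j" by (simp only: hZs[OF j] mult.assoc[symmetric])
      then show "sh j * ff j * (rt j * hZ) = hZ * (sh j * ff j * rt j)"
        using ff_ff[of j] by (simp add: rhZ[OF j] hff[OF j] mult.assoc mult_chain[OF ff_ff])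
    qed simp
    finally show ?thesis by (simp add: ez_def sum_distrib_left)
  qed
  have zhZ: "z * hZ = hZ" "hZ * z = hZ"
  proof -
    show "z * hZ = hZ" unfolding hZ_def sum_distrib_left
      by (rule sum.cong) (simp_all add: mult.assoc mult_chain[OF zs] mult_chain[OF ff_ff])
    then show "hZ * z = hZ" using ez_hZ[of kk] by (simp add: ez_k)
  qed
  have t'_fold: "ff j * (rt j * \<iota>) = t' j" for j by (simp add: t'_def mult.assoc)
  have hZ\<iota>: "hZ * \<iota> = \<iota> * h'"
  proof -
    have "hZ * \<iota> = (\<Sum>j<kk. sh j * (h' * (ff j * rt j * \<iota>)))"
      unfolding hZ_def sum_distrib_right by (rule sum.cong) (simp_all add: hff[symmetric] mult.assoc)
    also have "\<dots> = (\<Sum>j<kk. sh j * t' j * h')"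
      by (rule sum.cong) (simp_all add: htt[symmetric] mult.assoc t'_fold)
    also have "\<dots> = \<iota> * h'" by (subst \<iota>_sum) (simp add: sum_distrib_right)
    finally show ?thesis .
  qed
  have \<rho>hZ: "\<rho> * hZ = h' * \<rho>"
  proof -
    have "\<rho> * hZ = (\<Sum>j<kk. (\<rho> * sh j * ff j) * h' * rt j)" by (simp add: hZ_def sum_distrib_left mult.assoc)
    also have "\<dots> = (\<Sum>j<kk. h' * (\<rho> * sh j * ff j * rt j))"
    proof (rule sum.cong)
      fix j assume "j \<in> {..<kk}"
      then have j: "j < kk" by simp
      have "P' j * c' j * h' = h' * (P' j * c' j)"
        by (simp only: mult.assoc hc[OF j, symmetric]) (simp only: mult.assoc[symmetric] hP[OF less_imp_le[OF j]])
      then show "(\<rho> * sh j * ff j) * h' * rt j = h' * (\<rho> * sh j * ff j * rt j)"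
        unfolding \<rho>s[OF j] by (simp only: sc_left[of h'] mult.assoc)
    qed simp
    also have "\<dots> = h' * \<rho>" unfolding sum_distrib_left[symmetric] \<rho>_sum[symmetric] ..
    finally show ?thesis .
  qed
  have p'hZ: "hZ * p' = p' * hZ"
    unfolding ir(1)[symmetric] by (simp only: mult.assoc[symmetric] hZ\<iota>) (simp only: mult.assoc \<rho>hZ)
  have phZ: "hZ * p = p * hZ"
  proof -
    have "p = z - p'" by (simp add: p'_def)
    then show ?thesis by (simp add: right_diff_distrib left_diff_distrib zhZ p'hZ)
  qed
  \<comment> \<open>The compression of \<open>hZ\<close> to the space at \<open>v\<close>; the scalar compensates \<open>\<pi> \<phi> = q v - 1\<close>.\<close>
  define k0 where "k0 = sc (inverse (q v - 1)) * (\<pi> * hZ * \<phi>)"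
  have k0\<pi>: "k0 * \<pi> = \<pi> * hZ"
  proof -
    have "k0 * \<pi> = \<pi> * hZ * p" by (simp add: k0_def p_def mult.assoc sc_left)
    also have "\<dots> = \<pi> * p * hZ" by (simp only: mult.assoc phZ)
    finally show ?thesis by (simp only: \<pi>p)
  qed
  have \<phi>k0: "\<phi> * k0 = hZ * \<phi>"
  proof -
    have "\<phi> * k0 = p * hZ * \<phi>" by (simp add: k0_def p_def mult.assoc sc_left[of \<phi>])
    also have "\<dots> = hZ * (p * \<phi>)" by (simp only: mult.assoc[symmetric] phZ)
    finally show ?thesis by (simp only: p\<phi>)
  qed
  have ek0: "ev * k0 = k0" "k0 * ev = k0"
    by (simp only: k0_def sc_left[of ev] mult.assoc mult_chain[OF e\<pi>], simp only: k0_def mult.assoc \<phi>e)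
  define h where "h = (\<Sum>w\<in>verts Q - {v}. pr (S w) * h') + k0"
  have oth: "pr (S w) * (\<Sum>w\<in>verts Q - {v}. pr (S w) * h') = pr (S w) * h'" if "w \<in> verts Q" "w \<noteq> v" for w
  proof -
    have "pr (S w) * (\<Sum>w\<in>verts Q - {v}. pr (S w) * h') = (\<Sum>u\<in>verts Q - {v}. if u = w then pr (S w) * h' else 0)"
      unfolding sum_distrib_left by (rule sum.cong) (use qD(1,2) that in \<open>auto simp: mult.assoc[symmetric]\<close>)
    then show ?thesis using that by simp
  qed
  have oth2: "(\<Sum>w\<in>verts Q - {v}. pr (S w) * h') * pr (S w) = pr (S w) * h'" if "w \<in> verts Q" "w \<noteq> v" for w
  proof -
    have "(\<Sum>w\<in>verts Q - {v}. pr (S w) * h') * pr (S w) = (\<Sum>u\<in>verts Q - {v}. if u = w then pr (S w) * h' else 0)"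
      unfolding sum_distrib_right by (rule sum.cong) (simp_all only: mult.assoc hf[OF that], use qD(1,2) that in \<open>auto simp: mult.assoc[symmetric]\<close>)
    then show ?thesis using that by simp
  qed
  have othv: "ev * (\<Sum>w\<in>verts Q - {v}. pr (S w) * h') = 0" "(\<Sum>w\<in>verts Q - {v}. pr (S w) * h') * ev = 0"
  proof -
    show "ev * (\<Sum>w\<in>verts Q - {v}. pr (S w) * h') = 0"
      unfolding sum_distrib_left
    proof (rule sum.neutral, rule ballI)
      fix w assume "w \<in> verts Q - {v}"
      then have "ev * pr (S w) = 0" using qD(2)[OF v, of w] by auto
      then show "ev * (pr (S w) * h') = 0" by (simp add: mult.assoc[symmetric])
    qed
    show "(\<Sum>w\<in>verts Q - {v}. pr (S w) * h') * ev = 0"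
      unfolding sum_distrib_right
    proof (rule sum.neutral, rule ballI)
      fix w assume "w \<in> verts Q - {v}"
      then have w: "w \<in> verts Q" "w \<noteq> v" by auto
      have "pr (S w) * ev = 0" using qD(2)[OF w(1) v w(2)] .
      then show "pr (S w) * h' * ev = 0" by (simp add: hf[OF w, symmetric] mult.assoc)
    qed
  qed
  have k0w: "pr (S w) * k0 = 0" "k0 * pr (S w) = 0" if "w \<in> verts Q" "w \<noteq> v" for w
    using mult_mid_0(2)[OF qD(2)[OF that(1) v that(2)] ek0(1)] mult_mid_0(1)[OF ek0(2) qD(2)[OF v that(1)]] that(2) by auto
  have hw: "pr (S w) * h = pr (S w) * h'" "h * pr (S w) = pr (S w) * h'" if "w \<in> verts Q" "w \<noteq> v" for w
    unfolding h_def using that by (simp_all add: distrib_left distrib_right oth oth2 k0w)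
  have hv: "ev * h = k0" "h * ev = k0" unfolding h_def by (simp_all add: distrib_left distrib_right othv ek0)
  have hpr: "h * pr (S w) = pr (S w) * h" if "w \<in> verts Q" for w using hw[OF that] hv by (cases "w = v") auto
  have t: "h * tt j = tt j * h" if j: "j < kk" for j
  proof -
    have "h * tt j = h * ff j * tt j" by (simp only: mult.assoc ft[OF j])
    also have "\<dots> = ff j * h' * tt j" unfolding ff_def by (simp only: hw(2)[OF Lt[OF j]])
    also have "\<dots> = rt j * (hZ * \<phi>)" by (simp only: r\<phi>[OF j, symmetric] mult.assoc[symmetric] rhZ[OF j])
    also have "\<dots> = rt j * \<phi> * k0" by (simp only: \<phi>k0[symmetric] mult.assoc)
    also have "\<dots> = tt j * (ev * h)" by (simp only: r\<phi>[OF j] hv)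
    finally show ?thesis by (simp only: mult.assoc[symmetric] te[OF j])
  qed
  have c: "h * cc j = cc j * h" if j: "j < kk" for j
  proof -
    have "k0 * P j = P j * k0"
    proof -
      have P: "P j = 1 + \<pi> * ez j * \<phi>" using \<pi>ez\<phi>[OF less_imp_le[OF j]] by simp
      have "k0 * (\<pi> * ez j * \<phi>) = \<pi> * (hZ * ez j) * \<phi>" by (simp only: mult.assoc[symmetric] k0\<pi>)
      also have "\<dots> = \<pi> * ez j * \<phi> * k0" by (simp only: ez_hZ[OF less_imp_le[OF j], symmetric] mult.assoc \<phi>k0)
      finally show ?thesis unfolding P by (simp add: distrib_left distrib_right)
    qed
    then have "P j * (k0 * cc j) = k0 * (\<pi> * sh j)" by (simp only: mult.assoc[symmetric] \<pi>s[OF j])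
    also have "\<dots> = \<pi> * (hZ * sh j)" by (simp only: mult.assoc[symmetric] k0\<pi>)
    also have "\<dots> = P j * cc j * (ff j * h')" by (simp only: hZs[OF j] mult.assoc[symmetric] \<pi>s[OF j])
    also have "ff j * h' = ff j * h" unfolding ff_def by (rule hw(1)[OF Lt[OF j], symmetric])
    also have "P j * cc j * (ff j * h) = P j * (cc j * h)" by (simp only: mult.assoc) (simp only: mult_chain[OF cf[OF j]])
    finally have "uinv (P j) * P j * (k0 * cc j) = uinv (P j) * P j * (cc j * h)" by (simp only: mult.assoc)
    then have "k0 * cc j = cc j * h" using uinv(2)[OF isunit_P[OF less_imp_le[OF j]]] by simp
    moreover have "h * cc j = h * ev * cc j" by (simp only: mult.assoc ec[OF j])
    ultimately show ?thesis unfolding hv by simp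
  qed
  have hAb: "h * A b = A b * h" if b: "b \<in> arcs D" for b
    using b
  proof (cases rule: b_cases)
    case (1 j)
    show ?thesis
    proof (cases "eps (L ! j) = 1")
      case True then show ?thesis using c[OF 1(1)] 1 by (simp add: cc_def normal_arrow_def)
    next
      case False
      let ?g = "1 + cc j * tt j"
      have "h * ?g = ?g * h" using c[OF 1(1)] t[OF 1(1)] by (simp add: distrib_left distrib_right mult.assoc[symmetric]) (simp add: mult.assoc)
      from uinv_comm[OF gam_L(4)[OF 1(1)] this] have u: "h * uinv ?g = uinv ?g * h" .
      have "uinv ?g * cc j = - (uinv ?g * ?g * A (L ! j))"
        using False gam_L(1)[OF 1(1)] by (simp add: cc_def normal_arrow_def mult.assoc)
      then have "A (L ! j) = - (uinv ?g * cc j)" using uinv(2)[OF gam_L(4)[OF 1(1)]] by simp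
      then show ?thesis using u c[OF 1(1)] 1(2) by (simp add: mult.assoc[symmetric]) (simp add: mult.assoc)
    qed
  next
    case (2 j) then show ?thesis using t[OF 2(1)] by (simp add: tt_def)
  next
    case 3
    have "h * A b = h * pr (S (head D b)) * A b" by (simp only: mult.assoc qD(3)[OF b])
    also have "\<dots> = pr (S (head D b)) * h' * A b" by (simp only: hw(2)[OF ends_verts(1)[OF b] 3(1)])
    also have "\<dots> = h' * A b" by (simp only: hf[OF ends_verts(1)[OF b] 3(1), symmetric] mult.assoc qD(3)[OF b])
    also have "\<dots> = A b * h'" using hA b A'_L(3)[OF 3] by metis
    also have "\<dots> = A b * (pr (S (tail D b)) * h')" by (simp only: mult.assoc[symmetric] qD(4)[OF b])
    also have "\<dots> = A b * h" by (simp only: hw(1)[OF ends_verts(2)[OF b] 3(2), symmetric] mult.assoc[symmetric] qD(4)[OF b])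
    finally show ?thesis .
  qed
  have "h * pr (tot S) = h"
  proof -
    have "h * pr (tot S) = (\<Sum>w\<in>verts Q. h * pr (S w))" by (simp only: rD(7) sum_distrib_left)
    also have "\<dots> = h * ev + (\<Sum>w\<in>verts Q - {v}. h * pr (S w))" by (rule sum.remove[OF finite_verts v])
    also have "\<dots> = k0 + (\<Sum>w\<in>verts Q - {v}. pr (S w) * h')" unfolding hv by (simp add: hw)
    finally show ?thesis by (simp add: h_def)
  qed
  then obtain cst where cst: "h = sc cst * pr (tot S)" using br hpr hAb unfolding brick_def by blast
  have w: "pr (S w) * h' = sc cst * pr (S w)" if "w \<in> verts Q" "w \<noteq> v" for w
    unfolding hw(2)[OF that, symmetric] by (simp only: cst mult.assoc pr_tot(1)[OF that(1)])
  have "hZ = sc cst * z" unfolding hZ_def z_def sum_distrib_left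
    by (rule sum.cong) (use w[OF Lt] in \<open>simp_all add: ff_def sc_left mult.assoc\<close>)
  then have "h' * e' = sc cst * e'"
    unfolding ir(2)[symmetric] by (simp only: mult.assoc[symmetric] \<rho>hZ[symmetric]) (simp add: sc_left[of \<rho>] \<rho>z mult.assoc)
  then have "h' * pr (S' w) = sc cst * pr (S' w)" if "w \<in> verts Q" for w
    using w[OF that] hf[OF that] by (cases "w = v") (simp_all add: S'_simps)
  then have "h' * pr (tot S') = sc cst * pr (tot S')" unfolding coord_repD(7)[OF refl_coord_rep] sum_distrib_left by simp
  then show "\<exists>c. h' = sc c * pr (tot S')" using ht by auto
qed

end

theorem (in mult_preproj) reflect_rep:
  fixes A :: "'a darrow \<Rightarrow> 'k::field endo"
  assumes "coord_rep q S A" "loopfree Q v" "q v \<noteq> 0" "q v \<noteq> 1"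
  obtains S' A' where "coord_rep (refl_q q v) S' A'" "dimv S' = s v (dimv S)"
    "simple_rep S A \<Longrightarrow> simple_rep S' A'" "brick S A \<Longrightarrow> brick S' (A' :: 'a darrow \<Rightarrow> 'k endo)"
proof -
  interpret r1: vertex_reflection_nontriv Q lt q S A v by unfold_locales (rule assms)+
  obtain \<iota> \<rho> Sv where i: "finite Sv" "Sv \<inter> tot S = {}" "int (card Sv) = dimv S v - form (dimv S) (coord v)"
   "\<iota> * \<rho> = r1.p'" "\<rho> * \<iota> = pr Sv" "\<iota> * pr Sv = \<iota>" "pr Sv * \<rho> = \<rho>" using r1.ex_split by blast
  interpret r2: vertex_reflection_split Q lt q S A v \<iota> \<rho> Sv by unfold_locales (rule i)+
  show ?thesis by (rule that[OF r2.refl_coord_rep r2.refl_dimv[OF i(3)] r2.refl_simple r2.refl_brick])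
qed

section \<open>Roots of simple representations\<close>

context vertex_reflection begin

text \<open>Now \<open>\<pi> \<phi> = 0\<close>. The kernel of \<open>\<phi>\<close> is a subrepresentation at \<open>v\<close>, and the image of \<open>\<pi>\<close> together with the
  spaces at all other vertices is one as well. Simplicity makes \<open>\<phi>\<close> injective and \<open>\<pi>\<close> surjective, so that the
  sum of the neighbours has at least twice the dimension of the space at \<open>v\<close>.\<close>
lemma simple_trivial_parameter:
  assumes q: "q v = 1" and si: "simple_rep S A" and ne: "dimv S \<noteq> coord v"
  shows "form (dimv S) (coord v) \<le> 0"
proof -
  have P: "\<pi> * \<phi> = P kk - 1" using \<pi>ez\<phi>[of kk] by (simp add: ez_k \<pi>z)
  have "\<pi> * \<phi> = ev * (\<pi> * \<phi>)" by (simp add: mult.assoc[symmetric] e\<pi>)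
  also have "\<dots> = 0" unfolding P by (simp add: right_diff_distrib P_kk q sc_simps)
  finally have \<pi>\<phi>: "\<pi> * \<phi> = 0" .
  have A_pure: "app (A b) x = (if tail D b = v then app (A b) x else 0)" if "b \<in> arcs D" "x \<in> supp_sp (S v)" for b x
  proof (cases "tail D b = v")
    case False
    have "app (A b) x = app (A b) (app ev x)" using that(2) pr_supp[of "S v" x] by (simp del: app_pr)
    also have "\<dots> = 0" unfolding app_app using qD(6)[OF that(1) v] False by (simp del: app_pr)
    finally show ?thesis using False by simp
  qed simp
  have t_pure: "app (A b) x = 0" if b: "b \<in> arcs D" "tail D b = v" and x: "app \<phi> x = 0" for b x
  proof -
    obtain j where j: "j < kk" "star b = L ! j" using L_ex[OF star_arcs[OF b(1)]] b(2) by auto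
    have "A b = tt j" unfolding tt_def j(2)[symmetric] by simp
    then have "A b = rt j * \<phi>" using r\<phi>[OF j(1)] by simp
    then show ?thesis using x by (simp add: app_vec)
  qed
  have pr_v: "app (pr (S w)) x = (if w = v then x else 0)" if "w \<in> verts Q" "x \<in> supp_sp (S v)" for w and x :: "nat \<Rightarrow> 'k"
  proof -
    have x: "app ev x = x" using that(2) pr_supp by blast
    show ?thesis
    proof (cases "w = v")
      case True then show ?thesis using x by (simp del: app_pr)
    next
      case False
      have "app (pr (S w)) (app ev x) = 0" unfolding app_app qD(2)[OF that(1) v False] by (rule app_simps)
      then show ?thesis using False by (simp only: x if_False)
    qed
  qed
  have inv_v: "subrep S A U" if U: "fv.subspace U" "U \<subseteq> supp_sp (S v)" "\<And>b x. b \<in> arcs D \<Longrightarrow> x \<in> U \<Longrightarrow> app (A b) x = 0" for U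
    unfolding subrep_def
  proof (intro conjI ballI)
    show "U \<subseteq> supp_sp (tot S)" using U(2) supp_sp_mono[OF tot_sub[OF v]] by blast
    show "app (pr (S w)) x \<in> U" if "w \<in> verts Q" "x \<in> U" for w x
      using pr_v[OF that(1)] U that by (auto simp: fv.subspace_0 simp del: app_pr)
    show "app (A b) x \<in> U" if "b \<in> arcs D" "x \<in> U" for b x using U(3)[OF that] fv.subspace_0[OF U(1)] by simp
  qed (rule U)
  \<comment> \<open>If the kernel were everything, every line in it would be a subrepresentation.\<close>
  define U0 where "U0 = {x \<in> supp_sp (S v). app \<phi> x = 0}"
  have U0s: "fv.subspace U0" unfolding U0_def by (rule kernel_subspace[OF app_linear supp_sp_subspace])
  have U0A: "app (A b) x = 0" if "b \<in> arcs D" "x \<in> U0" for b x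
    using A_pure[OF that(1), of x] t_pure[OF that(1), of x] that(2) by (auto simp: U0_def split: if_splits)
  have "subrep S A U0" by (rule inv_v[OF U0s _ U0A]) (auto simp: U0_def)
  then have "U0 = {0} \<or> U0 = supp_sp (tot S)" using si by (simp add: simple_rep_def)
  moreover have "U0 \<noteq> supp_sp (tot S)"
  proof
    assume U0: "U0 = supp_sp (tot S)"
    obtain i where i: "i \<in> tot S" using si by (auto simp: simple_rep_def)
    have iU: "unitv j \<in> U0" if "j \<in> tot S" for j using unitv_in[OF that] U0 by simp
    have sp: "fv.span {unitv i :: nat \<Rightarrow> 'k} \<subseteq> U0" using iU[OF i] U0s by (simp add: fv.span_minimal)
    have "subrep S A (fv.span {unitv i})"
    proof (rule inv_v)
      show "fv.span {unitv i :: nat \<Rightarrow> 'k} \<subseteq> supp_sp (S v)" using sp by (auto simp: U0_def)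
      show "app (A b) x = 0" if "b \<in> arcs D" "x \<in> fv.span {unitv i}" for b x using U0A that sp by blast
    qed simp
    moreover have "fv.span {unitv i :: nat \<Rightarrow> 'k} \<noteq> {0}"
      using fv.span_base[of "unitv i :: nat \<Rightarrow> 'k" "{unitv i}"] unitv_nz by fastforce
    ultimately have a: "fv.span {unitv i} = (supp_sp (tot S) :: (nat \<Rightarrow> 'k) set)" using si by (auto simp: simple_rep_def)
    have "j = i" if "j \<in> tot S" for j
    proof (rule ccontr)
      assume "j \<noteq> i"
      have "unitv j \<in> fv.span {unitv i :: nat \<Rightarrow> 'k}" using unitv_in[OF that] a by auto
      then obtain c where "unitv j = scl c (unitv i :: nat \<Rightarrow> 'k)" by (auto simp: fv.span_singleton)
      then have "unitv j j = c * (unitv i j :: 'k)" by metis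
      then show False using \<open>j \<noteq> i\<close> by (simp add: unitv_def)
    qed
    then have t: "tot S = {i}" using i by blast
    have "i \<in> S v" using iU[OF i] by (auto simp: U0_def supp_sp_def unitv_def split: if_splits)
    then have Sv: "S v = {i}" using t tot_sub[OF v, of S] by auto
    have "S w = {}" if "w \<in> verts Q" "w \<noteq> v" for w
    proof -
      have "S w \<inter> S v = {}" using rD(2) that v unfolding disjoint_family_on_def by blast
      then show ?thesis using Sv t tot_sub[OF that(1), of S] by blast
    qed
    then have "dimv S = coord v" using Sv v by (auto simp: dimv_def coord_def)
    then show False using ne by simp
  qed
  ultimately have inj: "U0 = {0}" by blast
  define V where "V = range (app \<pi>)"
  have Vs: "fv.subspace V" unfolding V_def by (rule linear_subspace_image[OF app_linear fv.subspace_UNIV])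
  have Ve: "app ev x = x" if "x \<in> V" for x using that unfolding V_def by (auto simp only: app_app e\<pi>)
  have Vsup: "V \<subseteq> supp_sp (S v)" using Ve pr_supp by blast
  have PV: "app (P i) x \<in> V" if i: "i \<le> kk" and x: "x \<in> V" for i x
  proof -
    obtain y where y: "x = app \<pi> y" using x by (auto simp: V_def)
    have P: "P i = 1 + \<pi> * ez i * \<phi>" using \<pi>ez\<phi>[OF i] by simp
    have "app (P i) x = app \<pi> (y + app (ez i) (app \<phi> x))" unfolding P by (simp add: app_vec y)
    then show ?thesis by (simp add: V_def)
  qed
  have cV: "app (cc j) u \<in> V" if j: "j < kk" for j u
  proof -
    have 1: "app (\<pi> * sh j) u \<in> V" by (simp add: V_def)
    have "cc j = uinv (P j) * P j * cc j" using uinv(2)[OF isunit_P] j by simp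
    then have "cc j = uinv (P j) * (\<pi> * sh j)" by (simp only: \<pi>s[OF j] mult.assoc)
    then have "app (cc j) u = app (uinv (P j)) (app (\<pi> * sh j) u)" unfolding app_app by simp
    then show ?thesis
      using uinv_invariant[OF rD(1)[OF v] Vs Vsup isunit_P PV 1] j by simp
  qed
  have AV: "app (A (L ! j)) u \<in> V" if j: "j < kk" for j u
  proof (cases "eps (L ! j) = 1")
    case True then show ?thesis using cV[OF j] by (simp add: cc_def normal_arrow_def)
  next
    case False
    have gV: "app (1 + cc j * tt j) x \<in> V" if "x \<in> V" for x
      using cV[OF j] fv.subspace_add[OF Vs that] by simp
    have "uinv (1 + cc j * tt j) * cc j = - (uinv (1 + cc j * tt j) * (1 + cc j * tt j) * A (L ! j))"
      using False gam_L(1)[OF j] by (simp add: cc_def normal_arrow_def mult.assoc)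
    then have "A (L ! j) = - (uinv (1 + cc j * tt j) * cc j)" using uinv(2)[OF gam_L(4)[OF j]] by simp
    then have "app (A (L ! j)) u = - app (uinv (1 + cc j * tt j)) (app (cc j) u)" by simp
    then show ?thesis using uinv_invariant[OF rD(1)[OF v] Vs Vsup gam_L(4)[OF j] gV cV[OF j]] fv.subspace_neg[OF Vs] by simp
  qed
  define W where "W = {x \<in> supp_sp (tot S). app ev x \<in> V}"
  have "subrep S A W"
    unfolding subrep_def
  proof (intro conjI ballI)
    have s_involution: "fv.subspace (supp_sp (tot S) :: (nat \<Rightarrow> 'k) set)" by (rule supp_sp_subspace)
    show "fv.subspace W"
      by (rule fv.subspaceI) (use s_involution Vs in \<open>auto simp: W_def app_vec fv.subspace_0 fv.subspace_add fv.subspace_scale simp del: app_pr\<close>)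
    show "W \<subseteq> supp_sp (tot S)" by (auto simp: W_def)
  next
    fix w and x :: "nat \<Rightarrow> 'k" assume w: "w \<in> verts Q" and x: "x \<in> W"
    have "app (pr (S w)) x \<in> supp_sp (tot S)" using pr_in supp_sp_mono[OF tot_sub[OF w]] by blast
    moreover have "app ev (app (pr (S w)) x) \<in> V"
    proof (cases "w = v")
      case True
      have "app ev (app ev x) = app ev x" using qD(1)[OF v] by (simp only: app_app)
      then show ?thesis using x True by (simp add: W_def del: app_pr)
    next
      case False
      have "app ev (app (pr (S w)) x) = 0" unfolding app_app qD(2)[OF v w False[symmetric]] by (rule app_simps)
      then show ?thesis using fv.subspace_0[OF Vs] by (simp del: app_pr)
    qed
    ultimately show "app (pr (S w)) x \<in> W" by (simp add: W_def del: app_pr)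
  next
    fix b and x :: "nat \<Rightarrow> 'k" assume b: "b \<in> arcs D" and x: "x \<in> W"
    have h: "app (pr (S (head D b))) (app (A b) x) = app (A b) x" unfolding app_app qD(3)[OF b] ..
    then have "app (A b) x \<in> supp_sp (tot S)" using pr_in supp_sp_mono[OF tot_sub[OF ends_verts(1)[OF b]]] by (metis subsetD)
    moreover have "app ev (app (A b) x) \<in> V"
    proof (cases "head D b = v")
      case True
      then obtain j where "j < kk" "b = L ! j" using L_ex[OF b] by blast
      then show ?thesis using AV Ve by simp
    next
      case False
      have "app ev (app (A b) x) = 0" unfolding app_app using qD(5)[OF b v] False by (simp del: app_pr)
      then show ?thesis using fv.subspace_0[OF Vs] by (simp del: app_pr)
    qed
    ultimately show "app (A b) x \<in> W" by (simp add: W_def del: app_pr)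
  qed
  then have "W = {0} \<or> W = supp_sp (tot S)" using si by (simp add: simple_rep_def)
  moreover have "W \<noteq> {0}"
  proof
    assume W: "W = {0}"
    have Sw: "S w = {}" if w: "w \<in> verts Q" "w \<noteq> v" for w
    proof (rule ccontr)
      assume "S w \<noteq> {}"
      then obtain i where i: "i \<in> S w" by blast
      have u: "app (pr (S w)) (unitv i) = (unitv i :: nat \<Rightarrow> 'k)" using unitv_in[OF i] pr_supp by blast
      have "app ev (unitv i) = app ev (app (pr (S w)) (unitv i))" unfolding u ..
      also have "\<dots> = 0" unfolding app_app qD(2)[OF v w(1) w(2)[symmetric]] by (rule app_simps)
      finally have "unitv i \<in> W" using fv.subspace_0[OF Vs] unitv_in[of i "tot S"] i w by (auto simp: W_def tot_def simp del: app_pr)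
      then have "unitv i = (0 :: nat \<Rightarrow> 'k)" unfolding W by (rule singletonD)
      then show False using unitv_nz[of i] by (rule notE[rotated])
    qed
    have "Tz = {}" using Sw Lt by (auto simp: Tz_def)
    then have "\<phi> = 0" using z\<phi> by (simp add: z_Tz pr_empty)
    then have "U0 = supp_sp (S v)" by (simp add: U0_def)
    moreover have "tot S = S v" using Sw v unfolding tot_def by blast
    ultimately have "{0 :: nat \<Rightarrow> 'k} = supp_sp (tot S)" using inj by simp
    moreover obtain i where i: "i \<in> tot S" using si by (auto simp: simple_rep_def)
    ultimately have "unitv i \<in> {0 :: nat \<Rightarrow> 'k}" using unitv_in[OF i] by (simp only:)
    then have "unitv i = (0 :: nat \<Rightarrow> 'k)" by (rule singletonD)
    then show False using unitv_nz[of i] by (rule notE[rotated])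
  qed
  ultimately have W: "W = supp_sp (tot S)" by blast
  have "V = supp_sp (S v)"
  proof (rule subset_antisym[OF Vsup], rule subsetI)
    fix x :: "nat \<Rightarrow> 'k" assume x: "x \<in> supp_sp (S v)"
    then have "x \<in> W" using W supp_sp_mono[OF tot_sub[OF v]] by blast
    then have "app ev x \<in> V" unfolding W_def by blast
    then show "x \<in> V" using x pr_supp by metis
  qed
  moreover have "app \<pi> ` supp_sp Tz = V"
  proof -
    have "app \<pi> y = app \<pi> (app z y)" for y unfolding app_app \<pi>z ..
    moreover have "app z y \<in> supp_sp Tz" for y unfolding z_Tz by (rule pr_in)
    ultimately show ?thesis unfolding V_def by auto
  qed
  ultimately have "card Tz = fv.dim {y \<in> supp_sp Tz. app \<pi> y = 0} + fv.dim (supp_sp (S v) :: (nat \<Rightarrow> 'k) set)"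
    using rank_nullity_supp[OF Tz_fin app_linear[of \<pi>]] by simp
  moreover have "fv.dim (supp_sp (S v) :: (nat \<Rightarrow> 'k) set) = card (S v)" by (rule supp_sp_basis(3)[OF rD(1)[OF v]])
  moreover have "fv.dim (app \<phi> ` supp_sp (S v)) = fv.dim (supp_sp (S v) :: (nat \<Rightarrow> 'k) set)"
    by (rule dim_inj_image[OF rD(1)[OF v] supp_sp_subspace order.refl app_linear]) (use inj in \<open>auto simp: U0_def\<close>)
  moreover have "fv.dim (app \<phi> ` supp_sp (S v)) \<le> fv.dim {y \<in> supp_sp Tz. app \<pi> y = 0}"
  proof (rule dim_mono(1)[OF Tz_fin kernel_subspace[OF app_linear supp_sp_subspace] _ linear_subspace_image[OF app_linear supp_sp_subspace]])
    have "app \<pi> (app \<phi> x) = 0" for x unfolding app_app \<pi>\<phi> by simp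
    moreover have "app \<phi> x \<in> supp_sp Tz" for x using z\<phi> pr_in[of Tz "app \<phi> x"] unfolding z_Tz by (metis app_app)
    ultimately show "app \<phi> ` supp_sp (S v) \<subseteq> {y \<in> supp_sp Tz. app \<pi> y = 0}" by auto
  qed auto
  ultimately have "2 * card (S v) \<le> card Tz" by linarith
  then show ?thesis using Tz_card v by (simp add: dimv_def)
qed

end

context mult_preproj begin

definition decomp :: "('v \<Rightarrow> 'k::field) \<Rightarrow> ('v \<Rightarrow> int) \<Rightarrow> bool" where
  "decomp q \<alpha> \<longleftrightarrow> (\<exists>\<beta>s. length \<beta>s \<ge> 2 \<and> \<alpha> = (\<lambda>v. \<Sum>\<beta>\<leftarrow>\<beta>s. \<beta> v) \<and>
              (\<forall>\<beta>\<in>set \<beta>s. \<beta> \<in> positive_roots Q \<and> q_power Q q \<beta> = 1))"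

lemma q_power_coord: "v \<in> verts Q \<Longrightarrow> q_power Q q (coord v) = q v"
proof -
  assume v: "v \<in> verts Q"
  have "q_power Q q (coord v) = (\<Prod>w\<in>verts Q. if w = v then q v else 1)"
    unfolding q_power_def by (rule prod.cong) (auto simp: coord_def)
  then show ?thesis using v by simp
qed

lemma s_sum_list: "s v (\<lambda>w. \<Sum>\<beta>\<leftarrow>\<beta>s. \<beta> w) = (\<lambda>w. \<Sum>\<beta>\<leftarrow>map (s v) \<beta>s. \<beta> w)"
proof (induct \<beta>s)
  case Nil then show ?case by (auto simp: s_apply sym_form_def)
next
  case (Cons \<beta> \<beta>s)
  then show ?case using s_lin[of v \<beta> 1 "\<lambda>w. \<Sum>\<beta>\<leftarrow>\<beta>s. \<beta> w"] by (simp add: fun_eq_iff)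
qed

text \<open>As \<open>q v \<noteq> 1\<close>, no summand equals \<open>coord v\<close>, and all of them are reflected to positive roots.\<close>
lemma decomp_refl:
  assumes v: "loopfree Q v" and q: "\<And>w. w \<in> verts Q \<Longrightarrow> q w \<noteq> 0" "q v \<noteq> 1" and d: "decomp q \<alpha>"
  shows "decomp (refl_q q v) (s v \<alpha>)"
proof -
  have vv: "v \<in> verts Q" using v by (simp add: loopfree_def)
  obtain \<beta>s where b: "length \<beta>s \<ge> 2" "\<alpha> = (\<lambda>v. \<Sum>\<beta>\<leftarrow>\<beta>s. \<beta> v)" "\<And>\<beta>. \<beta> \<in> set \<beta>s \<Longrightarrow> \<beta> \<in> positive_roots Q \<and> q_power Q q \<beta> = 1"
    using d unfolding decomp_def by blast
  have "s v \<beta> \<in> positive_roots Q \<and> q_power Q (refl_q q v) (s v \<beta>) = 1" if "\<beta> \<in> set \<beta>s" for \<beta>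
  proof -
    have 1: "\<beta> \<in> positive_roots Q" "q_power Q q \<beta> = 1" using b(3)[OF that] by auto
    have ne: "\<beta> \<noteq> coord v" using 1(2) q_power_coord[OF vv, of q] q(2) by auto
    have lat: "s v \<beta> \<in> root_lattice Q" using s_positive_roots[OF v 1(1) ne] by (auto simp: positive_roots_def positive_def)
    show ?thesis using s_positive_roots[OF v 1(1) ne] q_power_refl[OF q(1) vv lat] 1(2) s_involution[OF v] by simp
  qed
  then show ?thesis unfolding decomp_def b(2) s_sum_list using b(1) by (intro exI[of _ "map (s v) \<beta>s"]) auto
qed

lemma positive_root_sum: "\<beta> \<in> positive_roots Q \<Longrightarrow> 1 \<le> (\<Sum>w\<in>verts Q. \<beta> w)"
proof -
  assume b: "\<beta> \<in> positive_roots Q"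
  then have p: "0 \<le> \<beta> x" for x using positive_pos by (auto simp: positive_roots_def)
  have "\<beta> \<noteq> (\<lambda>_. 0)" using root_nonzero b by (auto simp: positive_roots_def)
  then obtain x where x: "\<beta> x \<noteq> 0" by blast
  then have "x \<in> verts Q" using b by (auto simp: positive_roots_def positive_def root_lattice_def)
  then have "\<beta> x \<le> (\<Sum>w\<in>verts Q. \<beta> w)" using p by (intro member_le_sum) auto
  then show ?thesis using x p[of x] by linarith
qed

lemma coord_indecomp: "v \<in> verts Q \<Longrightarrow> \<not> decomp q (coord v)"
proof
  assume v: "v \<in> verts Q" and "decomp q (coord v)"
  then obtain \<beta>s where b: "length \<beta>s \<ge> 2" "coord v = (\<lambda>v. \<Sum>\<beta>\<leftarrow>\<beta>s. \<beta> v)" "\<And>\<beta>. \<beta> \<in> set \<beta>s \<Longrightarrow> \<beta> \<in> positive_roots Q"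
    unfolding decomp_def by blast
  have "(\<Sum>w\<in>verts Q. \<Sum>\<beta>\<leftarrow>bl. \<beta> w) \<ge> int (length bl)" if "set bl \<subseteq> set \<beta>s" for bl
    using that
  proof (induct bl)
    case (Cons \<beta> bl)
    then show ?case using positive_root_sum[OF b(3)[of \<beta>]] by (simp add: sum.distrib)
  qed simp
  from this[of \<beta>s] have "(\<Sum>w\<in>verts Q. coord v w) \<ge> 2" using b(1) unfolding b(2) by simp
  then show False using v by (simp add: coord_def)
qed

lemma not_loopfree_form:
  assumes "v \<in> verts Q" "\<not> loopfree Q v" "\<And>x. 0 \<le> \<alpha> x" shows "form \<alpha> (coord v) \<le> 0"
proof -
  obtain a where a: "a \<in> arcs Q" "head Q a = v" "tail Q a = v" using assms by (auto simp: loopfree_def)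
  have "(\<lambda>a. (if tail Q a = v then \<alpha> (head Q a) else 0) + (if head Q a = v then \<alpha> (tail Q a) else 0)) a
    \<le> (\<Sum>a\<in>arcs Q. (if tail Q a = v then \<alpha> (head Q a) else 0) + (if head Q a = v then \<alpha> (tail Q a) else 0))"
    by (rule member_le_sum) (use a assms in auto)
  then show ?thesis using a assms by (simp add: form_coord)
qed

text \<open>As \<open>(\<alpha>, \<alpha>)\<close> is the sum of the \<open>\<alpha> v (\<alpha>, coord v)\<close>, one of these is positive; a vertex with a loop does
  not contribute positively.\<close>
lemma ex_reflecting:
  assumes "\<alpha> \<in> root_lattice Q" "\<And>x. 0 \<le> \<alpha> x" "0 < form \<alpha> \<alpha>"
  obtains v where "loopfree Q v" "0 < form \<alpha> (coord v)"
proof -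
  have "\<exists>v\<in>verts Q. 0 < \<alpha> v * form \<alpha> (coord v)"
  proof (rule ccontr)
    assume "\<not> ?thesis"
    then have "(\<Sum>v\<in>verts Q. \<alpha> v * form \<alpha> (coord v)) \<le> 0" by (intro sum_nonpos) (simp add: not_less)
    then show False using assms(3) form_expand[OF assms(1), of \<alpha>] by simp
  qed
  then obtain v where v: "v \<in> verts Q" "0 < \<alpha> v * form \<alpha> (coord v)" by blast
  then have "0 < form \<alpha> (coord v)" using assms(2)[of v] by (simp add: zero_less_mult_iff)
  moreover have "loopfree Q v"
    using not_loopfree_form[of v \<alpha>] v(1) assms(2) calculation by force
  ultimately show ?thesis using that by blast
qed

lemma s_total: "v \<in> verts Q \<Longrightarrow> (\<Sum>w\<in>verts Q. s v \<alpha> w) = (\<Sum>w\<in>verts Q. \<alpha> w) - form \<alpha> (coord v)"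
proof -
  assume "v \<in> verts Q"
  then have "(\<Sum>w\<in>verts Q. coord v w) = 1" by (simp add: coord_def)
  then show ?thesis by (simp add: s_apply sum_subtractf sum_distrib_left[symmetric])
qed

lemma coord_real_root: "loopfree Q v \<Longrightarrow> coord v \<in> real_roots Q"
  unfolding real_roots_def using weyl_group.weyl_id by (force intro!: exI[of _ id] exI[of _ v])

theorem simple_rep_root:
  fixes A :: "'a darrow \<Rightarrow> 'k::field endo"
  assumes "\<And>w. w \<in> verts Q \<Longrightarrow> q w \<noteq> 0" "coord_rep q S A" "simple_rep S A" "0 < form (dimv S) (dimv S)"
  shows "dimv S \<in> real_roots Q \<and> q_power Q q (dimv S) = 1 \<and> \<not> decomp q (dimv S)"
  using assms
proof (induct "nat (\<Sum>w\<in>verts Q. dimv S w)" arbitrary: q S A rule: less_induct)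
  case less
  obtain v where v: "loopfree Q v" "0 < form (dimv S) (coord v)"
    using ex_reflecting[OF dimv_lattice dimv_nonneg less(5)] .
  have vv: "v \<in> verts Q" using v by (simp add: loopfree_def)
  interpret r: vertex_reflection Q lt q S A v by unfold_locales (rule less(3) v(1))+
  show ?case
  proof (cases "q v = 1")
    case True
    then have "dimv S = coord v" using r.simple_trivial_parameter[OF True less(4)] v(2) by linarith
    then show ?thesis using coord_real_root[OF v(1)] q_power_coord[OF vv, of q] True coord_indecomp[OF vv, of q] by simp
  next
    case False
    obtain S' A' where r: "coord_rep (refl_q q v) S' (A' :: 'a darrow \<Rightarrow> 'k endo)" "dimv S' = s v (dimv S)" "simple_rep S' A'"
      using reflect_rep[OF less(3) v(1) less(2)[OF vv] False] less(4) by metis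
    have q': "\<And>w. w \<in> verts Q \<Longrightarrow> refl_q q v w \<noteq> 0" using refl_q_nz less(2) vv by metis
    have "(\<Sum>w\<in>verts Q. dimv S' w) < (\<Sum>w\<in>verts Q. dimv S w)" unfolding r(2) s_total[OF vv] using v(2) by simp
    moreover have "0 \<le> (\<Sum>w\<in>verts Q. dimv S' w)" by (intro sum_nonneg dimv_nonneg)
    ultimately have lt: "nat (\<Sum>w\<in>verts Q. dimv S' w) < nat (\<Sum>w\<in>verts Q. dimv S w)" by linarith
    have IH: "s v (dimv S) \<in> real_roots Q \<and> q_power Q (refl_q q v) (s v (dimv S)) = 1 \<and> \<not> decomp (refl_q q v) (s v (dimv S))"
      using less(1)[OF lt q' r(1,3)] less(5) unfolding r(2) form_s[OF v(1)] by blast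
    have "dimv S \<in> real_roots Q" using real_root_s[OF conjunct1[OF IH] v(1)] s_involution[OF v(1)] by simp
    moreover have "q_power Q q (dimv S) = 1"
      using IH q_power_refl[of q v "s v (dimv S)"] less(2) vv s_lattice[OF v(1) dimv_lattice[of S]] s_involution[OF v(1)] by simp
    moreover have "\<not> decomp q (dimv S)" using IH decomp_refl[of v q "dimv S"] v(1) less(2) False by blast
    ultimately show ?thesis by blast
  qed
qed

lemma vertex_simple:
  assumes "loopfree Q v" "q v = (1 :: 'k::field)"
  defines "S \<equiv> (\<lambda>w. if w = v then {0} else {})" and "A \<equiv> (\<lambda>_. 0 :: 'k endo)"
  shows "coord_rep q S A" "simple_rep S A" "brick S A" "dimv S = coord v"
proof -
  have vv: "v \<in> verts Q" using assms(1) by (simp add: loopfree_def)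
  have t: "tot S = {0}" using vv by (auto simp: tot_def S_def)
  have u: "uinv 1 = (1 :: 'k endo)" by (rule uinv_unique) auto
  have g: "rel_factor A b = 1" for b by (simp add: rel_factor_def A_def u)
  have pl: "prod_list (map (rel_factor A) xs) = 1" for xs by (induct xs) (auto simp: g)
  show "coord_rep q S A" unfolding coord_rep_def mpa_rep_def quiver_rep_def pl
    by (auto simp: S_def A_def disjoint_family_on_def pr_mult pr_empty isunit_1 assms(2) sc_simps)
  show "dimv S = coord v" using vv by (auto simp: dimv_def S_def coord_def)
  show "simple_rep S A"
    unfolding simple_rep_def t
  proof (intro conjI allI impI)
    fix U :: "(nat \<Rightarrow> 'k) set" assume "subrep S A U"
    then have U: "fv.subspace U" "U \<subseteq> supp_sp {0}" by (auto simp: subrep_def t)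
    show "U = {0} \<or> U = supp_sp {0}"
    proof (cases "U \<subseteq> {0}")
      case True then show ?thesis using fv.subspace_0[OF U(1)] by blast
    next
      case False
      then obtain x where x: "x \<in> U" "x \<noteq> 0" by blast
      have x0: "x 0 \<noteq> 0"
      proof
        assume "x 0 = 0"
        then have "x i = 0" for i using x(1) U(2) by (cases "i = 0") (auto simp: supp_sp_def)
        then show False using x(2) by (auto simp: fun_eq_iff)
      qed
      have "y \<in> U" if "y \<in> supp_sp {0}" for y
      proof -
        have "y = scl (y 0 / x 0) x"
        proof
          fix i show "y i = y 0 / x 0 * x i" using that x0 x(1) U(2) by (cases "i = 0") (auto simp: supp_sp_def)
        qed
        then show ?thesis using fv.subspace_scale[OF U(1) x(1)] by metis
      qed
      then show ?thesis using U(2) by blast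
    qed
  qed simp
  show "brick S A"
    unfolding brick_def t
  proof (intro allI impI)
    fix h :: "'k endo" assume h: "\<forall>w\<in>verts Q. h * pr (S w) = pr (S w) * h" "h * pr {0} = h"
    have h2: "pr {0} * h = h" using h vv by (force simp: S_def)
    have "h = sc (ent h 0 0) * pr {0}"
    proof (rule ent_eqI[of "{0}"])
      show "pr {0} * (sc (ent h 0 0) * pr {0}) = sc (ent h 0 0) * pr {0}" by (simp add: sc_left[of "pr {0}"] pr_mult)
      have "ent (pr {0} :: 'k endo) 0 0 = 1" by (simp add: ent_def unitv_def)
      then show "ent h i j = ent (sc (ent h 0 0) * pr {0}) i j" if "i \<in> {0}" "j \<in> {0}" for i j
        using that by (simp add: ent_lin)
    qed (use h h2 in \<open>simp_all add: mult.assoc pr_mult\<close>)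
    then show "\<exists>c. h = sc c * pr {0}" by blast
  qed
qed

text \<open>The same descent as for \<open>simple_rep_root\<close>. It never meets a vertex with \<open>q v = 1\<close> other than at the end:
  there \<open>\<alpha> = s v \<alpha> + n coord v\<close> would be a forbidden decomposition.\<close>
theorem real_root_rep:
  fixes q :: "'v \<Rightarrow> 'k::field"
  assumes "\<And>w. w \<in> verts Q \<Longrightarrow> q w \<noteq> 0" "\<alpha> \<in> real_roots Q" "\<And>x. 0 \<le> \<alpha> x" "q_power Q q \<alpha> = 1" "\<not> decomp q \<alpha>"
  shows "\<exists>S (A :: 'a darrow \<Rightarrow> 'k endo). coord_rep q S A \<and> simple_rep S A \<and> brick S A \<and> dimv S = \<alpha>"
  using assms
proof (induct "nat (\<Sum>w\<in>verts Q. \<alpha> w)" arbitrary: q \<alpha> rule: less_induct)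
  case less
  have lat: "\<alpha> \<in> root_lattice Q" by (rule real_root_lattice[OF less(3)])
  have pr: "\<alpha> \<in> positive_roots Q" using less(3,4) lat by (auto simp: positive_roots_def positive_def)
  obtain v where v: "loopfree Q v" "0 < form \<alpha> (coord v)"
    by (rule ex_reflecting[OF lat less(4)]) (use real_root_form[OF less(3)] in auto)
  have vv: "v \<in> verts Q" using v by (simp add: loopfree_def)
  show ?case
  proof (cases "\<alpha> = coord v")
    case True
    then have "q v = 1" using less(5) q_power_coord[OF vv, of q] by simp
    then show ?thesis using vertex_simple[OF v(1), of q] True by blast
  next
    case False
    have sp: "s v \<alpha> \<in> positive_roots Q" by (rule s_positive_roots[OF v(1) pr False])
    have sl: "s v \<alpha> \<in> root_lattice Q" by (rule s_lattice[OF v(1) lat])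
    have q1: "q v \<noteq> 1"
    proof
      assume q: "q v = 1"
      have "refl_q q v = q" by (rule ext) (simp add: refl_q_def q)
      then have "q_power Q q (s v \<alpha>) = 1" using q_power_refl[of q v \<alpha>] less(2,5) vv lat by simp
      \<comment> \<open>The multiplicity of \<open>coord v\<close> in \<open>\<alpha> - s v \<alpha>\<close>.\<close>
      moreover define n where "n = nat (form \<alpha> (coord v))"
      have "\<alpha> = (\<lambda>w. \<Sum>\<beta>\<leftarrow>s v \<alpha> # replicate n (coord v). \<beta> w)"
        using v(2) by (intro ext) (simp add: s_apply n_def sum_list_replicate)
      moreover have "coord v \<in> positive_roots Q"
        using coord_real_root[OF v(1)] coord_lattice[OF vv] by (auto simp: positive_roots_def positive_def coord_def)
      moreover have "n \<ge> 1" using v(2) by (simp add: n_def)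
      ultimately have "decomp q \<alpha>" unfolding decomp_def using sp q_power_coord[OF vv, of q] q
        by (intro exI[of _ "s v \<alpha> # replicate n (coord v)"]) auto
      then show False using less(6) by simp
    qed
    let ?q = "refl_q q v"
    have q': "\<And>w. w \<in> verts Q \<Longrightarrow> ?q w \<noteq> 0" using refl_q_nz less(2) vv by metis
    have qv: "?q v = inverse (q v)" by (rule refl_q_self[of v q, OF v(1) less(2)[OF vv]])
    have qq: "refl_q ?q v = q" by (rule ext) (rule refl_q_refl_q[of v q, OF v(1) less(2)[OF vv]])
    have q1': "?q v \<noteq> 1" unfolding qv using q1 by simp
    have sn: "\<And>x. 0 \<le> s v \<alpha> x" using sp positive_pos by (auto simp: positive_roots_def)
    have "(\<Sum>w\<in>verts Q. s v \<alpha> w) < (\<Sum>w\<in>verts Q. \<alpha> w)" unfolding s_total[OF vv] using v(2) by simp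
    moreover have "0 \<le> (\<Sum>w\<in>verts Q. s v \<alpha> w)" by (intro sum_nonneg sn)
    ultimately have lt: "nat (\<Sum>w\<in>verts Q. s v \<alpha> w) < nat (\<Sum>w\<in>verts Q. \<alpha> w)" by linarith
    have "q_power Q ?q (s v \<alpha>) = 1" using q_power_refl[of q v "s v \<alpha>"] less(2,5) vv sl s_involution[OF v(1)] by simp
    moreover have "\<not> decomp ?q (s v \<alpha>)"
      using decomp_refl[of v ?q "s v \<alpha>"] v(1) q' q1' less(6) unfolding qq s_involution[OF v(1)] by blast
    ultimately obtain S and A :: "'a darrow \<Rightarrow> 'k endo" where "coord_rep ?q S A" "simple_rep S A" "brick S A" "dimv S = s v \<alpha>"
      using less(1)[of "s v \<alpha>" ?q] lt q' real_root_s[OF less(3) v(1)] sn by blast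
    then show ?thesis using reflect_rep[of ?q S A v, OF _ v(1) q'[OF vv] q1'] unfolding qq by (metis s_involution[OF v(1)])
  qed
qed

end

section \<open>Dual numbers\<close>

text \<open>The ring \<open>R[\<epsilon>]\<close> with \<open>\<epsilon>\<^sup>2 = 0\<close>, written in terms of real and infinitesimal part.\<close>
datatype 'r dual = Dual (dre: 'r) (dep: 'r)

instantiation dual :: (ring_1) ring_1
begin
definition "0 = Dual 0 0"
definition "1 = Dual 1 0"
definition "x + y = Dual (dre x + dre y) (dep x + dep y)"
definition "x - y = Dual (dre x - dre y) (dep x - dep y)"
definition "- x = Dual (- dre x) (- dep x)"
definition "x * y = Dual (dre x * dre y) (dre x * dep y + dep x * dre y)"
instance
  by standard (auto simp: zero_dual_def one_dual_def plus_dual_def minus_dual_def uminus_dual_def times_dual_def algebra_simps)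
end

lemmas dual_defs = zero_dual_def one_dual_def plus_dual_def minus_dual_def uminus_dual_def times_dual_def

lemma dual_mult: "Dual a b * Dual c d = Dual (a * c) (a * d + b * c)" by (simp add: dual_defs)
lemma dual_add: "Dual a b + Dual c d = Dual (a + c) (b + d)" by (simp add: dual_defs)
lemma dual_one_plus: "1 + Dual c d = Dual (1 + c) d" by (simp add: dual_defs)

lemma dual_unit:
  assumes "isunit (a :: 'r::ring_1)"
  shows "isunit (Dual a b)" "uinv (Dual a b) = Dual (uinv a) (- (uinv a * b * uinv a))"
proof -
  have 1: "Dual a b * Dual (uinv a) (- (uinv a * b * uinv a)) = 1"
    using uinv(1)[OF assms] by (simp add: dual_mult one_dual_def mult.assoc[symmetric])
  have 2: "Dual (uinv a) (- (uinv a * b * uinv a)) * Dual a b = 1"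
    using uinv(2)[OF assms] by (simp add: dual_mult one_dual_def mult.assoc)
  show "isunit (Dual a b)" by (rule isunitI[OF 1 2])
  show "uinv (Dual a b) = Dual (uinv a) (- (uinv a * b * uinv a))" by (rule uinv_unique[OF 1 2])
qed

section \<open>First order deformations\<close>

definition ddel :: "('a darrow \<Rightarrow> 'r::ring_1) \<Rightarrow> ('a darrow \<Rightarrow> 'r) \<Rightarrow> 'a darrow \<Rightarrow> 'r" where
  "ddel A \<xi> b = \<xi> b * A (star b) + A b * \<xi> (star b)"

text \<open>The derivative of a relation factor at \<open>A\<close> in the direction \<open>\<xi>\<close>; then \<open>dprod\<close> is that of the product.\<close>
definition deta :: "('a darrow \<Rightarrow> 'r::ring_1) \<Rightarrow> ('a darrow \<Rightarrow> 'r) \<Rightarrow> 'a darrow \<Rightarrow> 'r" where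
  "deta A \<xi> b = (if eps b = 1 then ddel A \<xi> b else - (rel_factor A b * ddel A \<xi> b * rel_factor A b))"

primrec dprod :: "('a darrow \<Rightarrow> 'r::ring_1) \<Rightarrow> ('a darrow \<Rightarrow> 'r) \<Rightarrow> 'a darrow list \<Rightarrow> 'r" where
  "dprod A \<xi> [] = 0"
| "dprod A \<xi> (b # xs) = rel_factor A b * dprod A \<xi> xs + deta A \<xi> b * prod_list (map (rel_factor A) xs)"

lemma rel_factor_dual:
  assumes "isunit (1 + A b * A (star b))"
  shows "rel_factor (\<lambda>b. Dual (A b) (\<xi> b)) b = Dual (rel_factor A b) (deta A \<xi> b)"
  using dual_unit(2)[OF assms]
  by (simp add: rel_factor_def deta_def ddel_def dual_mult dual_one_plus add.commute[of "A b * \<xi> (star b)"])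

lemma prod_dual:
  assumes "\<And>b. b \<in> set xs \<Longrightarrow> isunit (1 + A b * A (star b))"
  shows "prod_list (map (rel_factor (\<lambda>b. Dual (A b) (\<xi> b))) xs) = Dual (prod_list (map (rel_factor A) xs)) (dprod A \<xi> xs)"
  using assms by (induct xs) (simp_all add: one_dual_def rel_factor_dual dual_mult)

lemma dprod_sum: "dprod A \<xi> xs = (\<Sum>i<length xs. prod_list (map (rel_factor A) (take i xs)) * deta A \<xi> (xs ! i) * prod_list (map (rel_factor A) (drop (Suc i) xs)))"
proof (induct xs)
  case (Cons b xs)
  then show ?case
    by (simp add: lessThan_Suc_eq_insert_0 sum.reindex sum_distrib_left mult.assoc add.commute del: sum.lessThan_Suc)
qed simp

context mult_preproj begin

definition graded :: "('v \<Rightarrow> nat set) \<Rightarrow> 'k::field endo \<Rightarrow> bool" where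
  "graded S h \<longleftrightarrow> (\<forall>v\<in>verts Q. h * pr (S v) = pr (S v) * h) \<and> h * pr (tot S) = h"

definition arrow_family :: "('v \<Rightarrow> nat set) \<Rightarrow> ('a darrow \<Rightarrow> 'k::field endo) \<Rightarrow> bool" where
  "arrow_family S \<xi> \<longleftrightarrow> (\<forall>b\<in>arcs D. pr (S (head D b)) * \<xi> b = \<xi> b \<and> \<xi> b * pr (S (tail D b)) = \<xi> b)"

definition deform :: "('v \<Rightarrow> nat set) \<Rightarrow> ('a darrow \<Rightarrow> 'k::field endo) \<Rightarrow> ('a darrow \<Rightarrow> 'k endo) \<Rightarrow> bool" where
  "deform S A \<xi> \<longleftrightarrow> arrow_family S \<xi> \<and> (\<forall>w\<in>verts Q. pr (S w) * dprod A \<xi> bs = 0)"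

text \<open>Every first order deformation comes from an infinitesimal change of basis.\<close>
definition rigid_rep :: "('v \<Rightarrow> nat set) \<Rightarrow> ('a darrow \<Rightarrow> 'k::field endo) \<Rightarrow> bool" where
  "rigid_rep S A \<longleftrightarrow> (\<forall>\<xi>. deform S A \<xi> \<longrightarrow> (\<exists>h. graded S h \<and> (\<forall>b\<in>arcs D. \<xi> b = h * A b - A b * h)))"

lemma deform_dual:
  assumes "coord_rep q S A"
  shows "mpa_rep (\<lambda>c. Dual (sc c) 0) q (\<lambda>v. Dual (pr (S v)) 0) (\<lambda>b. Dual (A b) (\<xi> b)) \<longleftrightarrow> deform S A \<xi>"
proof -
  note r = coord_repD[OF assms]
  have u: "isunit (1 + Dual (A b) (\<xi> b) * Dual (A (star b)) (\<xi> (star b)))" if "b \<in> arcs D" for b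
    using dual_unit(1)[OF r(5)[OF that]] by (simp add: dual_mult dual_one_plus)
  have p: "prod_list (map (rel_factor (\<lambda>b. Dual (A b) (\<xi> b))) bs) = Dual (prod_list (map (rel_factor A) bs)) (dprod A \<xi> bs)"
    by (rule prod_dual) (use r(5) set_bs in auto)
  have "quiver_rep (\<lambda>v. Dual (pr (S v)) 0) (\<lambda>b. Dual (A b) (\<xi> b)) \<longleftrightarrow> arrow_family S \<xi>"
    using r(4) by (auto simp: quiver_rep_def arrow_family_def dual_mult zero_dual_def)
  then show ?thesis unfolding mpa_rep_def deform_def p using u r(6) by (auto simp: dual_mult)
qed

lemma gradedD:
  assumes "graded S h" shows "v \<in> verts Q \<Longrightarrow> h * pr (S v) = pr (S v) * h" "h * pr (tot S) = h"
  using assms by (auto simp: graded_def)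

end

locale first_order = mult_preproj Q lt for Q :: "('v, 'a) pre_digraph" and lt +
  fixes q :: "'v \<Rightarrow> 'k::field" and S :: "'v \<Rightarrow> nat set" and A :: "'a darrow \<Rightarrow> 'k endo"
  assumes rep: "coord_rep q S A"
begin

lemmas rD = coord_repD[OF rep]
lemmas qD = quiver_repD[OF rD(4)]
abbreviation "pt \<equiv> (pr (tot S) :: 'k endo)"
abbreviation "gr \<equiv> (graded S :: 'k endo \<Rightarrow> bool)"
abbreviation "af \<equiv> (arrow_family S :: ('a darrow \<Rightarrow> 'k endo) \<Rightarrow> bool)"
abbreviation "G \<equiv> rel_factor A"
abbreviation "PL xs \<equiv> prod_list (map G xs)"

lemma pt_pr: "v \<in> verts Q \<Longrightarrow> pt * pr (S v) = pr (S v)" "v \<in> verts Q \<Longrightarrow> pr (S v) * pt = pr (S v)"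
  by (simp_all add: pr_tot)
lemma pt_pt: "pt * pt = pt" by (simp add: pr_mult)
lemma A_pt: "b \<in> arcs D \<Longrightarrow> pt * A b = A b" "b \<in> arcs D \<Longrightarrow> A b * pt = A b"
  by (rule mult_absorb(1)[OF pt_pr(1)[OF ends_verts(1)] qD(3)], assumption+, rule mult_absorb(2)[OF qD(4) pt_pr(2)[OF ends_verts(2)]], assumption+)
lemma comm_pt: assumes "\<And>v. v \<in> verts Q \<Longrightarrow> h * pr (S v) = pr (S v) * h" shows "h * pt = pt * h"
  unfolding rD(7) sum_distrib_left sum_distrib_right by (rule sum.cong) (use assms in auto)
lemma graded_pt: "gr h \<Longrightarrow> pt * h = h" using comm_pt[of h] gradedD[of S h] by simp

lemma G_unit: "b \<in> arcs D \<Longrightarrow> isunit (G b)" by (rule isunit_rel_factor[of A b, OF rD(5)])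
lemma G_pr: "b \<in> arcs D \<Longrightarrow> v \<in> verts Q \<Longrightarrow> G b * pr (S v) = pr (S v) * G b"
  using rel_factor_idem(1)[OF rD(4) _ rD(5)] by metis
lemma G_pt: "b \<in> arcs D \<Longrightarrow> G b * pt = pt * G b" by (rule comm_pt) (rule G_pr)
lemma PL_pr: "set xs \<subseteq> arcs D \<Longrightarrow> v \<in> verts Q \<Longrightarrow> PL xs * pr (S v) = pr (S v) * PL xs"
  using prod_E(1)[OF rD(4,5)] by metis
lemma PL_pt: "set xs \<subseteq> arcs D \<Longrightarrow> PL xs * pt = pt * PL xs" by (rule comm_pt) (rule PL_pr)
lemma PL_unit: "set xs \<subseteq> arcs D \<Longrightarrow> isunit (PL xs)" by (induct xs) (auto intro: isunit_1 isunit_mult G_unit)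

definition "Qm = (\<Sum>w\<in>verts Q. sc (q w) * (pr (S w) :: 'k endo))"

lemma PL_Qm: "pt * PL bs = Qm"
  unfolding rD(7) sum_distrib_right Qm_def by (rule sum.cong) (simp_all add: rD(6))

context fixes \<xi> :: "'a darrow \<Rightarrow> 'k endo" assumes \<xi>: "af \<xi>" begin

lemma ddel_ends: "b \<in> arcs D \<Longrightarrow> pr (S (head D b)) * ddel A \<xi> b = ddel A \<xi> b" "b \<in> arcs D \<Longrightarrow> ddel A \<xi> b * pr (S (head D b)) = ddel A \<xi> b"
proof -
  assume b: "b \<in> arcs D"
  note s = star_arcs[OF b]
  have x: "pr (S (head D b)) * \<xi> b = \<xi> b" "\<xi> (star b) * pr (S (head D b)) = \<xi> (star b)"
    using \<xi> b s by (auto simp: arrow_family_def)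
  show "pr (S (head D b)) * ddel A \<xi> b = ddel A \<xi> b"
    using qD(3)[OF b] x by (simp add: ddel_def distrib_left mult.assoc[symmetric])
  show "ddel A \<xi> b * pr (S (head D b)) = ddel A \<xi> b"
    using qD(4)[OF s] x by (simp add: ddel_def distrib_right mult.assoc)
qed

lemma deta_ends: "b \<in> arcs D \<Longrightarrow> pr (S (head D b)) * deta A \<xi> b = deta A \<xi> b" "b \<in> arcs D \<Longrightarrow> deta A \<xi> b * pr (S (head D b)) = deta A \<xi> b"
proof -
  assume b: "b \<in> arcs D"
  note d = ddel_ends[OF b] and g = G_pr[OF b ends_verts(1)[OF b]]
  have "pr (S (head D b)) * (G b * ddel A \<xi> b * G b) = G b * (pr (S (head D b)) * ddel A \<xi> b) * G b" by (simp only: mult.assoc[symmetric] g)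
  then show "pr (S (head D b)) * deta A \<xi> b = deta A \<xi> b" using d by (simp add: deta_def)
  have "(G b * ddel A \<xi> b * G b) * pr (S (head D b)) = G b * (ddel A \<xi> b * pr (S (head D b))) * G b" by (simp only: mult.assoc g)
  then show "deta A \<xi> b * pr (S (head D b)) = deta A \<xi> b" using d by (simp add: deta_def)
qed

lemma deta_pr: "b \<in> arcs D \<Longrightarrow> v \<in> verts Q \<Longrightarrow> deta A \<xi> b * pr (S v) = pr (S v) * deta A \<xi> b"
proof (cases "v = head D b")
  case False
  assume b: "b \<in> arcs D" and v: "v \<in> verts Q"
  have "deta A \<xi> b * pr (S v) = 0" by (rule mult_mid_0(1)[OF deta_ends(2)[OF b] qD(2)[OF ends_verts(1)[OF b] v]]) (use False in auto)
  moreover have "pr (S v) * deta A \<xi> b = 0" by (rule mult_mid_0(2)[OF qD(2)[OF v ends_verts(1)[OF b]] deta_ends(1)[OF b]]) (use False in auto)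
  ultimately show ?thesis by simp
qed (simp add: deta_ends)

lemma deta_pt: "b \<in> arcs D \<Longrightarrow> pt * deta A \<xi> b = deta A \<xi> b" "b \<in> arcs D \<Longrightarrow> deta A \<xi> b * pt = deta A \<xi> b"
  by (rule mult_absorb(1)[OF pt_pr(1)[OF ends_verts(1)] deta_ends(1)], assumption+, rule mult_absorb(2)[OF deta_ends(2) pt_pr(2)[OF ends_verts(1)]], assumption+)
lemma ddel_pt: "b \<in> arcs D \<Longrightarrow> pt * ddel A \<xi> b = ddel A \<xi> b" "b \<in> arcs D \<Longrightarrow> ddel A \<xi> b * pt = ddel A \<xi> b"
  by (rule mult_absorb(1)[OF pt_pr(1)[OF ends_verts(1)] ddel_ends(1)], assumption+, rule mult_absorb(2)[OF ddel_ends(2) pt_pr(2)[OF ends_verts(1)]], assumption+)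

lemma dprod_graded: "set xs \<subseteq> arcs D \<Longrightarrow> gr (dprod A \<xi> xs)"
proof (induct xs)
  case Nil then show ?case by (simp add: graded_def)
next
  case (Cons b xs)
  then have b: "b \<in> arcs D" and xs: "set xs \<subseteq> arcs D" and IH: "gr (dprod A \<xi> xs)" by auto
  have 1: "dprod A \<xi> (b # xs) * pr (S v) = pr (S v) * dprod A \<xi> (b # xs)" if v: "v \<in> verts Q" for v
    by (simp add: distrib_left distrib_right mult.assoc gradedD(1)[OF IH v] PL_pr[OF xs v])
      (simp add: mult.assoc[symmetric] G_pr[OF b v] deta_pr[OF b v])
  have "dprod A \<xi> (b # xs) * pt = dprod A \<xi> (b # xs)"
    using deta_pt[OF b] by (simp add: distrib_right mult.assoc gradedD(2)[OF IH] PL_pt[OF xs]) (simp add: mult.assoc[symmetric])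
  then show ?case using 1 by (simp add: graded_def)
qed

end

lemma deta_add: "deta A (\<lambda>b. \<xi> b + \<xi>' b) b = deta A \<xi> b + deta A \<xi>' b"
  by (simp add: deta_def ddel_def algebra_simps)
lemma deta_scale: "deta A (\<lambda>b. sc c * \<xi> b) b = sc c * deta A \<xi> b"
proof -
  have "ddel A (\<lambda>b. sc c * \<xi> b) b = sc c * ddel A \<xi> b" by (simp add: ddel_def sc_left[of "A b"] algebra_simps)
  then show ?thesis by (simp add: deta_def sc_left[of "G b"] mult.assoc)
qed
lemma dprod_add: "dprod A (\<lambda>b. \<xi> b + \<xi>' b) xs = dprod A \<xi> xs + dprod A \<xi>' xs"
  by (induct xs) (simp_all add: deta_add algebra_simps)
lemma dprod_scale: "dprod A (\<lambda>b. sc c * \<xi> b) xs = sc c * dprod A \<xi> xs"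
  by (induct xs) (simp_all add: deta_scale sc_left[of "G _"] algebra_simps)
lemma dprod_cong: "set xs \<subseteq> arcs D \<Longrightarrow> (\<And>b. b \<in> arcs D \<Longrightarrow> \<xi> b = \<xi>' b) \<Longrightarrow> dprod A \<xi> xs = dprod A \<xi>' xs"
  by (induct xs) (auto simp: deta_def ddel_def star_arcs)

lemma deta_inner:
  assumes b: "b \<in> arcs D"
  shows "deta A (\<lambda>b. h * A b - A b * h) b = h * G b - G b * h"
proof -
  let ?g = "1 + A b * A (star b)"
  have d: "ddel A (\<lambda>b. h * A b - A b * h) b = h * ?g - ?g * h" by (simp add: ddel_def algebra_simps)
  have u: "uinv ?g * ?g = 1" "?g * uinv ?g = 1" using uinv[OF rD(5)[OF b]] by auto
  have "uinv ?g * (h * ?g - ?g * h) * uinv ?g = uinv ?g * h * (?g * uinv ?g) - (uinv ?g * ?g) * h * uinv ?g"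
    by (simp only: right_diff_distrib left_diff_distrib mult.assoc)
  then have "uinv ?g * (h * ?g - ?g * h) * uinv ?g = uinv ?g * h - h * uinv ?g" unfolding u by simp
  then show ?thesis unfolding deta_def d by (simp add: rel_factor_def)
qed

lemma dprod_inner: "set xs \<subseteq> arcs D \<Longrightarrow> dprod A (\<lambda>b. h * A b - A b * h) xs = h * PL xs - PL xs * h"
proof (induct xs)
  case (Cons b xs)
  then have b: "b \<in> arcs D" and IH: "dprod A (\<lambda>b. h * A b - A b * h) xs = h * PL xs - PL xs * h" by auto
  show ?case unfolding dprod.simps IH deta_inner[OF b] by (simp add: algebra_simps)
qed simp

definition "I = (\<Union>v\<in>verts Q. S v \<times> S v)"
definition "J = (SIGMA b : arcs D. S (head D b) \<times> S (tail D b))"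
definition mat :: "(nat \<times> nat \<Rightarrow> 'k) \<Rightarrow> 'k endo" where "mat x = (\<Sum>(i, j)\<in>I. sc (x (i, j)) * eu i j)"
definition cof :: "'k endo \<Rightarrow> nat \<times> nat \<Rightarrow> 'k" where "cof h = (\<lambda>(i, j). if (i, j) \<in> I then ent h i j else 0)"
definition fam :: "('a darrow \<times> nat \<times> nat \<Rightarrow> 'k) \<Rightarrow> 'a darrow \<Rightarrow> 'k endo" where
  "fam y b = (\<Sum>(i, j)\<in>S (head D b) \<times> S (tail D b). sc (y (b, i, j)) * eu i j)"
definition cofam :: "('a darrow \<Rightarrow> 'k endo) \<Rightarrow> 'a darrow \<times> nat \<times> nat \<Rightarrow> 'k" where
  "cofam \<xi> = (\<lambda>(b, i, j). if (b, i, j) \<in> J then ent (\<xi> b) i j else 0)"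

lemma finI: "finite I" and finJ: "finite J"
  using rD(1) fin_D ends_verts by (auto simp: I_def J_def)

lemma cardI: "int (card I) = (\<Sum>v\<in>verts Q. dimv S v * dimv S v)"
proof -
  have "card I = (\<Sum>v\<in>verts Q. card (S v \<times> S v))"
    unfolding I_def by (rule card_UN_disjoint) (use rD(1,2) in \<open>auto simp: disjoint_family_on_def\<close>)
  then show ?thesis by (simp add: dimv_def card_cartesian_product)
qed
lemma cardJ: "int (card J) = (\<Sum>b\<in>arcs D. dimv S (head D b) * dimv S (tail D b))"
proof -
  have "card J = (\<Sum>b\<in>arcs D. card (S (head D b) \<times> S (tail D b)))"
    unfolding J_def by (rule card_SigmaI) (use fin_D rD(1) ends_verts in auto)
  then show ?thesis by (simp add: dimv_def ends_verts card_cartesian_product)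
qed
lemma form_card: "form (dimv S) (dimv S) = 2 * int (card I) - int (card J)"
proof -
  have "(\<Sum>b\<in>arcs D. dimv S (head D b) * dimv S (tail D b))
    = (\<Sum>b\<in>Orig ` arcs Q. dimv S (head D b) * dimv S (tail D b)) + (\<Sum>b\<in>Rev ` arcs Q. dimv S (head D b) * dimv S (tail D b))"
    by (subst sum.union_disjoint[symmetric]) (auto simp: double_def)
  also have "\<dots> = (\<Sum>a\<in>arcs Q. dimv S (head Q a) * dimv S (tail Q a)) + (\<Sum>a\<in>arcs Q. dimv S (tail Q a) * dimv S (head Q a))"
    by (simp add: sum.reindex inj_on_def double_def)
  also have "(\<Sum>a\<in>arcs Q. dimv S (tail Q a) * dimv S (head Q a)) = (\<Sum>a\<in>arcs Q. dimv S (head Q a) * dimv S (tail Q a))"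
    by (simp only: mult.commute)
  finally show ?thesis unfolding cardI cardJ by (simp add: sym_form_def sum_distrib_left[symmetric] mult.commute)
qed

lemma I_tot: "(i, j) \<in> I \<Longrightarrow> i \<in> tot S \<and> j \<in> tot S" by (auto simp: I_def tot_def)
lemma I_sym: "(i, j) \<in> I \<Longrightarrow> (j, i) \<in> I" by (auto simp: I_def)
lemma I_diag: "i \<in> tot S \<Longrightarrow> (i, i) \<in> I" by (auto simp: I_def tot_def)
lemma I_col: "(i, j) \<in> I \<Longrightarrow> v \<in> verts Q \<Longrightarrow> i \<in> S v \<longleftrightarrow> j \<in> S v"
proof -
  assume "(i, j) \<in> I" and v: "v \<in> verts Q"
  then obtain w where w: "w \<in> verts Q" "i \<in> S w" "j \<in> S w" by (auto simp: I_def)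
  have "v \<noteq> w \<Longrightarrow> S v \<inter> S w = {}" using rD(2) v w(1) by (auto simp: disjoint_family_on_def)
  then show ?thesis using w by (cases "v = w") auto
qed

lemma ent_mat: "ent (mat x) i j = (if (i, j) \<in> I then x (i, j) else 0)"
proof -
  have "ent (mat x) i j = (\<Sum>p\<in>I. if p = (i, j) then x (i, j) else 0)"
    unfolding mat_def ent_lin by (rule sum.cong) (auto simp: ent_lin ent_eu split: if_splits)
  then show ?thesis using finI by simp
qed

lemma ent_fam: "b \<in> arcs D \<Longrightarrow> ent (fam y b) i j = (if (b, i, j) \<in> J then y (b, i, j) else 0)"
proof -
  assume b: "b \<in> arcs D"
  have "ent (fam y b) i j = (\<Sum>p\<in>S (head D b) \<times> S (tail D b). if p = (i, j) then y (b, i, j) else 0)"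
    unfolding fam_def ent_lin by (rule sum.cong) (auto simp: ent_lin ent_eu split: if_splits)
  then show ?thesis using b rD(1) ends_verts by (simp add: J_def)
qed

lemma pr_eu: "pr X * eu i j = (if i \<in> X then eu i j else (0 :: 'k endo))" "eu i j * pr X = (if j \<in> X then eu i j else (0 :: 'k endo))"
  by (rule endo_eqI, auto simp: app_eu unitv_def fun_eq_iff)+

lemma mat_graded: "gr (mat x)"
  unfolding graded_def
proof (intro conjI ballI)
  fix v assume "v \<in> verts Q"
  then show "mat x * pr (S v) = pr (S v) * mat x"
    unfolding mat_def sum_distrib_left sum_distrib_right
    by (intro sum.cong) (auto simp: mult.assoc sc_left[of "pr (S v)"] pr_eu I_col)
next
  show "mat x * pt = mat x"
    unfolding mat_def sum_distrib_right by (intro sum.cong) (auto simp: mult.assoc pr_eu dest: I_tot)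
qed

lemma fam_arrow: "af (fam y)"
  unfolding arrow_family_def fam_def sum_distrib_left sum_distrib_right
  by (intro ballI conjI sum.cong) (auto simp: mult.assoc sc_left[of "pr _"] pr_eu)

lemma graded_ent: "gr h \<Longrightarrow> (i, j) \<notin> I \<Longrightarrow> ent h i j = 0"
proof -
  assume h: "gr h" and n: "(i, j) \<notin> I"
  show ?thesis
  proof (cases "i \<in> tot S")
    case False
    have "ent (pt * h) i j = 0" using False by (simp add: ent_pr)
    then show ?thesis using graded_pt[OF h] by simp
  next
    case True
    then obtain v where v: "v \<in> verts Q" "i \<in> S v" by (auto simp: tot_def)
    then have j: "j \<notin> S v" using n by (auto simp: I_def)
    have "ent (pr (S v) * h) i j = ent h i j" using v by (simp add: ent_pr)
    moreover have "ent (h * pr (S v)) i j = 0" using j by (simp add: ent_pr)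
    ultimately show ?thesis using gradedD(1)[OF h v(1)] by simp
  qed
qed

lemma graded_eqI: "gr h \<Longrightarrow> gr h' \<Longrightarrow> (\<And>i j. (i, j) \<in> I \<Longrightarrow> ent h i j = ent h' i j) \<Longrightarrow> h = h'"
proof -
  assume h: "gr h" "gr h'" and e: "\<And>i j. (i, j) \<in> I \<Longrightarrow> ent h i j = ent h' i j"
  have "ent h i j = ent h' i j" for i j using e graded_ent[OF h(1)] graded_ent[OF h(2)] by (cases "(i, j) \<in> I") auto
  then show ?thesis by (intro ent_eqI[OF rD(3) gradedD(2)[OF h(1)] gradedD(2)[OF h(2)] graded_pt[OF h(1)] graded_pt[OF h(2)]])
qed

lemma mat_cof: "gr h \<Longrightarrow> mat (cof h) = h"
  by (rule graded_eqI[OF mat_graded]) (auto simp: ent_mat cof_def)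
lemma cof_mat: "x \<in> supp_sp I \<Longrightarrow> cof (mat x) = x"
  by (auto simp: cof_def ent_mat supp_sp_def fun_eq_iff)
lemma cof_supp: "cof h \<in> supp_sp I" by (auto simp: cof_def supp_sp_def)
lemma cofam_supp: "cofam \<xi> \<in> supp_sp J" by (auto simp: cofam_def supp_sp_def)

lemma arrow_ent: "af \<xi> \<Longrightarrow> b \<in> arcs D \<Longrightarrow> (b, i, j) \<notin> J \<Longrightarrow> ent (\<xi> b) i j = 0"
proof -
  assume a: "af \<xi>" "b \<in> arcs D" "(b, i, j) \<notin> J"
  have "pr (S (head D b)) * \<xi> b * pr (S (tail D b)) = \<xi> b" using a by (simp add: arrow_family_def)
  moreover have "ent (pr (S (head D b)) * \<xi> b * pr (S (tail D b))) i j = 0" using a by (auto simp: ent_pr J_def)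
  ultimately show ?thesis by simp
qed

lemma arrow_pt: assumes "af \<xi>" "b \<in> arcs D" shows "pt * \<xi> b = \<xi> b" "\<xi> b * pt = \<xi> b"
proof -
  have "pr (S (head D b)) * \<xi> b = \<xi> b" "\<xi> b * pr (S (tail D b)) = \<xi> b" using assms by (auto simp: arrow_family_def)
  note e = this
  show "pt * \<xi> b = \<xi> b" by (rule mult_absorb(1)[OF pt_pr(1)[OF ends_verts(1)[OF assms(2)]] e(1)])
  show "\<xi> b * pt = \<xi> b" by (rule mult_absorb(2)[OF e(2) pt_pr(2)[OF ends_verts(2)[OF assms(2)]]])
qed

lemma arrow_eqI: "af \<xi> \<Longrightarrow> af \<xi>' \<Longrightarrow> b \<in> arcs D \<Longrightarrow> (\<And>i j. (b, i, j) \<in> J \<Longrightarrow> ent (\<xi> b) i j = ent (\<xi>' b) i j) \<Longrightarrow> \<xi> b = \<xi>' b"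
proof -
  assume h: "af \<xi>" "af \<xi>'" and b: "b \<in> arcs D" and e: "\<And>i j. (b, i, j) \<in> J \<Longrightarrow> ent (\<xi> b) i j = ent (\<xi>' b) i j"
  have "ent (\<xi> b) i j = ent (\<xi>' b) i j" for i j
    using e arrow_ent[OF h(1) b] arrow_ent[OF h(2) b] by (cases "(b, i, j) \<in> J") auto
  then show ?thesis by (intro ent_eqI[OF rD(3) arrow_pt(2)[OF h(1) b] arrow_pt(2)[OF h(2) b] arrow_pt(1)[OF h(1) b] arrow_pt(1)[OF h(2) b]])
qed

lemma fam_cofam: "af \<xi> \<Longrightarrow> b \<in> arcs D \<Longrightarrow> fam (cofam \<xi>) b = \<xi> b"
  by (rule arrow_eqI[OF fam_arrow]) (auto simp: ent_fam cofam_def)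

lemma inner_arrow: "gr h \<Longrightarrow> af (\<lambda>b. h * A b - A b * h)"
  unfolding arrow_family_def
proof (intro ballI)
  fix b assume h: "gr h" and b: "b \<in> arcs D"
  note g = gradedD(1)[OF h]
  have "pr (S (head D b)) * (h * A b) = h * A b" by (simp add: mult.assoc[symmetric] g[OF ends_verts(1)[OF b], symmetric]) (simp add: mult.assoc qD(3)[OF b])
  moreover have "A b * h * pr (S (tail D b)) = A b * h" by (simp add: mult.assoc g[OF ends_verts(2)[OF b]]) (simp add: mult.assoc[symmetric] qD(4)[OF b])
  ultimately show "pr (S (head D b)) * (h * A b - A b * h) = h * A b - A b * h \<and> (h * A b - A b * h) * pr (S (tail D b)) = h * A b - A b * h"
    by (simp add: right_diff_distrib left_diff_distrib mult.assoc[symmetric] qD(3)[OF b]) (simp add: mult.assoc qD(4)[OF b])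
qed

text \<open>The two maps of the complex: the infinitesimal change of basis and the derivative of the relations.\<close>
definition "d0 x = cofam (\<lambda>b. mat x * A b - A b * mat x)"
definition "d1 y = cof (dprod A (fam y) bs)"

lemma mat_lin: "mat (x + y) = mat x + mat y" "mat (scl c x) = sc c * mat x"
  by (rule graded_eqI[OF mat_graded]; auto simp: ent_mat ent_lin graded_def distrib_left distrib_right gradedD[OF mat_graded]
     sc_left[of "pr _"] mult.assoc)+

lemma fam_lin: "b \<in> arcs D \<Longrightarrow> fam (x + y) b = fam x b + fam y b" "b \<in> arcs D \<Longrightarrow> fam (scl c x) b = sc c * fam x b"
  by (rule ent_eqI[OF rD(3)]; auto simp: ent_fam ent_lin distrib_left distrib_right arrow_pt[OF fam_arrow] sc_left[of "pt"] mult.assoc)+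

lemma d0_lin: "Vector_Spaces.linear scl scl d0"
  unfolding fv_linear d0_def mat_lin
proof (intro conjI allI ext)
  fix x y and p :: "'a darrow \<times> nat \<times> nat"
  obtain b i j where p: "p = (b, i, j)" by (metis prod_cases3)
  show "cofam (\<lambda>b. (mat x + mat y) * A b - A b * (mat x + mat y)) p = (cofam (\<lambda>b. mat x * A b - A b * mat x) + cofam (\<lambda>b. mat y * A b - A b * mat y)) p"
    by (simp add: p cofam_def distrib_left distrib_right ent_lin)
next
  fix c x and p :: "'a darrow \<times> nat \<times> nat"
  obtain b i j where p: "p = (b, i, j)" by (metis prod_cases3)
  have "sc c * mat x * A b - A b * (sc c * mat x) = sc c * (mat x * A b - A b * mat x)"
    by (simp add: sc_left[of "A b"] right_diff_distrib mult.assoc)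
  then show "cofam (\<lambda>b. sc c * mat x * A b - A b * (sc c * mat x)) p = c * cofam (\<lambda>b. mat x * A b - A b * mat x) p"
    by (simp add: p cofam_def ent_lin(5))
qed

lemma d1_lin: "Vector_Spaces.linear scl scl d1"
  unfolding fv_linear
proof (intro conjI allI ext)
  have bs: "set bs \<subseteq> arcs D" by (simp add: set_bs)
  fix x y :: "'a darrow \<times> nat \<times> nat \<Rightarrow> 'k" and p
  have "dprod A (fam (x + y)) bs = dprod A (fam x) bs + dprod A (fam y) bs"
    unfolding dprod_add[symmetric] by (rule dprod_cong[OF bs]) (rule fam_lin)
  then show "d1 (x + y) p = (d1 x + d1 y) p" by (cases p) (simp add: d1_def cof_def ent_lin)
next
  have bs: "set bs \<subseteq> arcs D" by (simp add: set_bs)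
  fix c and x :: "'a darrow \<times> nat \<times> nat \<Rightarrow> 'k" and p
  have "dprod A (fam (scl c x)) bs = sc c * dprod A (fam x) bs"
    unfolding dprod_scale[symmetric] by (rule dprod_cong[OF bs]) (rule fam_lin)
  then show "d1 (scl c x) p = c * d1 x p" by (cases p) (simp add: d1_def cof_def ent_lin)
qed

lemma deform_fam: "d1 y = 0 \<Longrightarrow> deform S A (fam y)"
proof -
  assume z: "d1 y = 0"
  have g: "gr (dprod A (fam y) bs)" by (rule dprod_graded[OF fam_arrow]) (simp add: set_bs)
  have "dprod A (fam y) bs = mat 0" using mat_cof[OF g] z by (simp add: d1_def)
  also have "mat 0 = 0" by (simp add: mat_def sc_simps)
  finally show ?thesis by (simp add: deform_def fam_arrow)
qed

lemma one_graded: "gr pt" by (simp add: graded_def pt_pr pt_pt)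

text \<open>The identity is a nonzero element of the kernel of the first map of the complex.\<close>
theorem rigid_form:
  assumes "rigid_rep S A" "tot S \<noteq> {}" shows "0 < form (dimv S) (dimv S)"
proof -
  have "card J < 2 * card I"
  proof (rule card_less_of_exact[OF finI finJ d0_lin d1_lin])
    show "d0 x \<in> supp_sp J" for x by (simp add: d0_def cofam_supp)
    show "d1 y \<in> supp_sp I" for y by (simp add: d1_def cof_supp)
    show "\<exists>x\<in>supp_sp I. y = d0 x" if y: "y \<in> supp_sp J" "d1 y = 0" for y
    proof -
      obtain h where h: "gr h" "\<forall>b\<in>arcs D. fam y b = h * A b - A b * h"
        using assms(1) deform_fam[OF y(2)] unfolding rigid_rep_def by blast
      have "y p = d0 (cof h) p" for p
      proof -
        obtain b i j where p: "p = (b, i, j)" by (metis prod_cases3)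
        have "y p = ent (fam y b) i j" if "p \<in> J" using ent_fam[of b y i j] that by (auto simp: p J_def)
        then show ?thesis using h(2) y(1) by (auto simp: d0_def cofam_def p mat_cof[OF h(1)] J_def supp_sp_def)
      qed
      then show ?thesis using cof_supp by (intro bexI[of _ "cof h"]) auto
    qed
    show "cof pt \<in> supp_sp I" by (rule cof_supp)
    obtain i where i: "i \<in> tot S" using assms(2) by blast
    have "cof pt (i, i) = 1" using i I_diag[OF i] by (simp add: cof_def ent_def unitv_def)
    then show "cof pt \<noteq> 0" by (metis zero_fun_apply zero_neq_one)
    show "d0 (cof pt) = 0"
      by (rule ext) (auto simp: d0_def mat_cof[OF one_graded] cofam_def J_def A_pt ent_lin split: prod.split)
  qed
  then show ?thesis unfolding form_card by linarith
qed

text \<open>Trace duality between the two maps of the complex. Writing the derivative of the product by the product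
  rule and rotating each summand under the trace, orthogonality of \<open>\<Theta>\<close> to all derivatives says that
  the maps \<open>Lo i\<close>, which are rotations of \<open>\<Theta>\<close>, intertwine the arrows. Consequently the conjugates \<open>Ps i\<close> of \<open>\<Psi>\<close> by
  the prefix products do not depend on \<open>i\<close>, so all equal \<open>\<Psi>\<close>, and \<open>\<Psi>\<close> commutes with the arrows.\<close>
lemma trace_endo:
  assumes Th: "gr (\<Theta> :: 'k endo)" and tr0: "\<And>\<xi>. af \<xi> \<Longrightarrow> tr (tot S) (\<Theta> * dprod A \<xi> bs) = 0"
    and b0: "b0 \<in> arcs D"
  shows "Qm * \<Theta> * A b0 = A b0 * (Qm * \<Theta>)"
proof -
  let ?n = "length bs" and ?tr = "tr (tot S)"
  note fT = rD(3)
  define \<Psi> where "\<Psi> = Qm * \<Theta>"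
  have bs: "set bs \<subseteq> arcs D" by (simp add: set_bs)
  have bi: "i < ?n \<Longrightarrow> bs ! i \<in> arcs D" for i using nth_mem[of i bs] set_bs by auto
  have tk: "set (take i bs) \<subseteq> arcs D" "set (drop i bs) \<subseteq> arcs D" for i
    using set_take_subset[of i bs] set_drop_subset[of i bs] set_bs by auto
  define Pre where "Pre i = PL (take i bs)" for i
  define Suf where "Suf i = PL (drop (Suc i) bs)" for i
  have Pre_unit: "isunit (Pre i)" for i unfolding Pre_def by (rule PL_unit[OF tk(1)])
  have Pre_Suc: "Pre (Suc i) = Pre i * G (bs ! i)" if "i < ?n" for i using that by (simp add: Pre_def take_Suc_conv_app_nth)
  have all: "Pre i * (G (bs ! i) * Suf i) = PL bs" if "i < ?n" for i
    using that unfolding Pre_def Suf_def by (subst (3) id_take_nth_drop[OF that]) simp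
  have Th_pt: "pt * \<Theta> = \<Theta>" "\<Theta> * pt = \<Theta>" using graded_pt[OF Th] gradedD(2)[OF Th] by auto
  have PLT: "PL bs * \<Theta> = \<Psi>"
  proof -
    have "PL bs * \<Theta> = PL bs * pt * \<Theta>" by (simp add: mult.assoc Th_pt)
    then show ?thesis by (simp add: PL_pt[OF bs] PL_Qm \<Psi>_def)
  qed
  have Psi_pt: "pt * \<Psi> = \<Psi>" "\<Psi> * pt = \<Psi>"
    unfolding PLT[symmetric] by (simp_all add: mult.assoc Th_pt) (simp add: mult.assoc[symmetric] PL_pt[OF bs, symmetric], simp add: mult.assoc Th_pt)
  have Psi_pr: "\<Psi> * pr (S v) = pr (S v) * \<Psi>" if "v \<in> verts Q" for v
    unfolding PLT[symmetric] by (simp add: mult.assoc gradedD(1)[OF Th that]) (simp add: mult.assoc[symmetric] PL_pr[OF bs that])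
  define Ps where "Ps i = uinv (Pre i) * \<Psi> * Pre i" for i
  have SufT: "Suf i * \<Theta> * Pre i = uinv (G (bs ! i)) * Ps i" if i: "i < ?n" for i
  proof -
    have "uinv (G (bs ! i)) * (uinv (Pre i) * (Pre i * (G (bs ! i) * Suf i))) = uinv (G (bs ! i)) * G (bs ! i) * Suf i"
      using uinv(2)[OF Pre_unit] by (simp add: mult.assoc[symmetric])
    then have "Suf i = uinv (G (bs ! i)) * (uinv (Pre i) * PL bs)" unfolding all[OF i] using uinv(2)[OF G_unit[OF bi[OF i]]] by simp
    then show ?thesis unfolding Ps_def by (simp add: mult.assoc PLT[symmetric])
  qed
  have Pre_pr: "Pre i * pr (S v) = pr (S v) * Pre i" if "v \<in> verts Q" for i v unfolding Pre_def by (rule PL_pr[OF tk(1) that])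
  have Ps_pr: "Ps i * pr (S v) = pr (S v) * Ps i" if "v \<in> verts Q" for i v
    unfolding Ps_def using Pre_pr[OF that] uinv_comm[OF Pre_unit Pre_pr[OF that, symmetric], of i] Psi_pr[OF that]
    by (simp add: mult.assoc) (simp add: mult.assoc[symmetric])
  have Ps_pt: "pt * Ps i = Ps i" "Ps i * pt = Ps i" for i
  proof -
    have c: "Pre i * pt = pt * Pre i" by (rule comm_pt) (rule Pre_pr)
    show "Ps i * pt = Ps i" unfolding Ps_def by (simp add: mult.assoc c) (simp add: mult.assoc[symmetric], simp add: mult.assoc Psi_pt(2) mult_chain[OF Psi_pt(2)])
    then show "pt * Ps i = Ps i" using comm_pt[of "Ps i"] Ps_pr by simp
  qed
  define gi where "gi b = uinv (1 + A b * A (star b))" for b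
  define Lo where "Lo i = (if eps (bs ! i) = 1 then gi (bs ! i) * Ps i else Ps i * gi (bs ! i))" for i
  have gG: "eps b = 1 \<Longrightarrow> uinv (G b) = gi b" "eps b \<noteq> 1 \<Longrightarrow> G b = gi b" for b by (simp_all add: gi_def rel_factor_def)
  have gi_pr: "gi b * pr (S v) = pr (S v) * gi b" if "b \<in> arcs D" "v \<in> verts Q" for b v
  proof (cases "eps b = 1")
    case True
    then have g: "gi b = uinv (G b)" using gG by simp
    show ?thesis unfolding g by (rule uinv_comm[OF G_unit[OF that(1)] G_pr[OF that, symmetric], symmetric])
  next
    case False then show ?thesis using gG(2)[OF False] G_pr[OF that] by simp
  qed
  have gi_pt: "gi b * pt = pt * gi b" if "b \<in> arcs D" for b by (rule comm_pt) (rule gi_pr[OF that])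
  have Lo_pr: "Lo i * pr (S v) = pr (S v) * Lo i" if "i < ?n" "v \<in> verts Q" for i v
    using Ps_pr[OF that(2)] gi_pr[OF bi[OF that(1)] that(2)] unfolding Lo_def
    by (simp add: mult.assoc) (simp add: mult.assoc[symmetric])
  have Lo_pt: "Lo i * pt = Lo i" "pt * Lo i = Lo i" if "i < ?n" for i
  proof -
    show "Lo i * pt = Lo i" using Ps_pt gi_pt[OF bi[OF that]] unfolding Lo_def
      by (simp add: mult.assoc) (simp add: mult.assoc[symmetric])
    then show "pt * Lo i = Lo i" using comm_pt[of "Lo i"] Lo_pr[OF that] by simp
  qed
  have trm: "?tr (\<Theta> * (Pre i * deta A \<xi> (bs ! i) * Suf i)) = of_int (eps (bs ! i)) * ?tr (Lo i * ddel A \<xi> (bs ! i))"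
    if \<xi>: "af \<xi>" and i: "i < ?n" for \<xi> i
  proof -
    let ?b = "bs ! i"
    let ?e = "deta A \<xi> ?b" and ?d = "ddel A \<xi> ?b"
    note ep = deta_pt[OF \<xi> bi[OF i]] and dp = ddel_pt[OF \<xi> bi[OF i]]
    have "?tr (\<Theta> * (Pre i * ?e * Suf i)) = ?tr (Pre i * (?e * (Suf i * \<Theta>)))"
      by (subst tr_comm[OF fT]) (simp_all add: Th_pt mult.assoc)
    also have "\<dots> = ?tr (?e * (Suf i * \<Theta> * Pre i))"
      by (subst tr_comm[OF fT]) (simp_all add: Th_pt mult.assoc mult_chain[OF ep(1)] )
    also have "\<dots> = ?tr (Suf i * \<Theta> * Pre i * ?e)"
      by (rule tr_comm[OF fT]) (simp_all add: ep)
    also have "\<dots> = ?tr (uinv (G ?b) * Ps i * ?e)" unfolding SufT[OF i] ..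
    also have "\<dots> = of_int (eps ?b) * ?tr (Lo i * ?d)"
    proof (cases "eps ?b = 1")
      case True
      then show ?thesis using gG(1)[OF True] by (simp add: deta_def Lo_def)
    next
      case False
      then have e: "eps ?b = -1" using eps_cases by metis
      let ?X = "uinv (G ?b) * Ps i"
      have Xp: "pt * ?X = ?X"
        using uinv_comm[OF G_unit[OF bi[OF i]] G_pt[OF bi[OF i], symmetric]]
        by (simp add: mult.assoc[symmetric]) (simp add: mult.assoc Ps_pt)
      have "?tr (?X * ?e) = - ?tr (?X * G ?b * ?d * G ?b)" using False by (simp add: deta_def tr_lin mult.assoc)
      also have "?tr (?X * G ?b * ?d * G ?b) = ?tr (G ?b * (?X * G ?b * ?d))"
        by (rule tr_comm[OF fT]) (simp_all only: mult.assoc dp mult_chain[OF Xp[unfolded mult.assoc]], simp_all add: mult.assoc[symmetric] Xp[unfolded mult.assoc[symmetric]])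
      also have "G ?b * (?X * G ?b * ?d) = (G ?b * uinv (G ?b)) * Ps i * G ?b * ?d" by (simp only: mult.assoc)
      also have "\<dots> = Ps i * gi ?b * ?d" using uinv(1)[OF G_unit[OF bi[OF i]]] gG(2)[OF False] by simp
      finally show ?thesis using e by (simp add: Lo_def)
    qed
    finally show ?thesis .
  qed
  have key: "A (star b) * Lo i = Lo i' * A (star b)"
    if i: "i < ?n" "bs ! i = b" and i': "i' < ?n" "bs ! i' = star b" for b i i'
  proof -
    have b: "b \<in> arcs D" using bi[OF i(1)] i(2) by simp
    note sb = star_arcs[OF b]
    define Z where "Z = A (star b) * Lo i - Lo i' * A (star b)"
    let ?h = "head D b" and ?t = "tail D b"
    have hv: "?h \<in> verts Q" and tv: "?t \<in> verts Q" using ends_verts[OF b] by auto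
    have Zl: "pr (S ?t) * Z = Z"
    proof -
      have "pr (S ?t) * (Lo i' * A (star b)) = Lo i' * (pr (S ?t) * A (star b))" by (simp only: mult.assoc[symmetric] Lo_pr[OF i'(1) tv])
      moreover have "pr (S ?t) * (A (star b) * Lo i) = A (star b) * Lo i" using qD(3)[OF sb] by (simp add: mult.assoc[symmetric])
      moreover have "Lo i' * (pr (S ?t) * A (star b)) = Lo i' * A (star b)" using qD(3)[OF sb] by simp
      ultimately show ?thesis by (simp only: Z_def right_diff_distrib)
    qed
    have Zr: "Z * pr (S ?h) = Z"
    proof -
      have "A (star b) * Lo i * pr (S ?h) = A (star b) * pr (S ?h) * Lo i" by (simp only: mult.assoc Lo_pr[OF i(1) hv])
      moreover have "A (star b) * pr (S ?h) * Lo i = A (star b) * Lo i" using qD(4)[OF sb] by simp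
      moreover have "Lo i' * A (star b) * pr (S ?h) = Lo i' * A (star b)" using qD(4)[OF sb] by (simp add: mult.assoc)
      ultimately show ?thesis by (simp only: Z_def left_diff_distrib)
    qed
    have Zp: "pt * Z = Z" by (rule mult_absorb(1)[OF pt_pr(1)[OF tv] Zl])
    have "ent Z l k = 0" if kl: "k \<in> S ?h" "l \<in> S ?t" for k l
    proof -
      \<comment> \<open>Testing with a single matrix unit isolates one entry of \<open>Z\<close>.\<close>
      define \<xi> where "\<xi> c = (if c = b then eu k l else (0 :: 'k endo))" for c
      have f: "af \<xi>" using kl by (auto simp: arrow_family_def \<xi>_def eu_pr)
      have kt: "k \<in> tot S" "l \<in> tot S" using kl hv tv by (auto simp: tot_def)
      have "0 = ?tr (\<Theta> * dprod A \<xi> bs)" using tr0[OF f] by simp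
      also have "\<dots> = (\<Sum>m<?n. of_int (eps (bs ! m)) * ?tr (Lo m * ddel A \<xi> (bs ! m)))"
        unfolding dprod_sum sum_distrib_left tr_lin by (rule sum.cong) (use trm[OF f] in \<open>simp_all add: Pre_def Suf_def\<close>)
      also have "\<dots> = (\<Sum>m<?n. (if m = i then of_int (eps b) * ?tr (Lo i * (eu k l * A (star b))) else 0)
          + (if m = i' then - of_int (eps b) * ?tr (Lo i' * (A (star b) * eu k l)) else 0))"
      proof (rule sum.cong)
        fix m assume "m \<in> {..<?n}"
        then have m: "m < ?n" by simp
        have e1: "m = i \<longleftrightarrow> bs ! m = b" using distinct_bs m i nth_eq_iff_index_eq by metis
        have e2: "m = i' \<longleftrightarrow> bs ! m = star b" using distinct_bs m i' nth_eq_iff_index_eq by metis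
        have n: "star b \<noteq> b" by (rule star_neq)
        show "of_int (eps (bs ! m)) * ?tr (Lo m * ddel A \<xi> (bs ! m)) = (if m = i then of_int (eps b) * ?tr (Lo i * (eu k l * A (star b))) else 0)
          + (if m = i' then - of_int (eps b) * ?tr (Lo i' * (A (star b) * eu k l)) else 0)"
        proof (cases "m = i \<or> m = i'")
          case True
          then show ?thesis
          proof
            assume "m = i"
            then show ?thesis using e1 e2 n by (simp add: ddel_def \<xi>_def)
          next
            assume "m = i'"
            then show ?thesis using e1 e2 n by (simp add: ddel_def \<xi>_def)
          qed
        next
          case False
          then have "bs ! m \<noteq> b" "bs ! m \<noteq> star b" using e1 e2 by auto
          then have "star (bs ! m) \<noteq> b" by (metis star_star)
          then have "\<xi> (bs ! m) = 0" "\<xi> (star (bs ! m)) = 0" using \<open>bs ! m \<noteq> b\<close> by (simp_all add: \<xi>_def)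
          then show ?thesis using False by (simp add: ddel_def tr_lin)
        qed
      qed simp
      also have "\<dots> = of_int (eps b) * ?tr (Lo i * (eu k l * A (star b))) - of_int (eps b) * ?tr (Lo i' * (A (star b) * eu k l))"
        using i i' by (simp add: sum.distrib)
      also have "?tr (Lo i * (eu k l * A (star b))) = ?tr (A (star b) * Lo i * eu k l)"
      proof -
        have "?tr ((Lo i * eu k l) * A (star b)) = ?tr (A (star b) * (Lo i * eu k l))"
          by (rule tr_comm[OF fT]) (simp_all add: A_pt[OF sb])
        then show ?thesis by (simp add: mult.assoc)
      qed
      also have "of_int (eps b) * ?tr (A (star b) * Lo i * eu k l) - of_int (eps b) * ?tr (Lo i' * (A (star b) * eu k l)) = of_int (eps b) * ?tr (Z * eu k l)"
        by (simp add: Z_def left_diff_distrib tr_lin mult.assoc right_diff_distrib)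
      also have "\<dots> = of_int (eps b) * ent Z l k" using tr_eu[OF fT kt Zp] by simp
      finally show ?thesis using eps_cases[of b] by auto
    qed
    then have e: "ent Z l k = 0" for k l
      using ent_pr(1)[of "S ?t" Z l k] ent_pr(2)[of Z "S ?h" l k] Zl Zr by (cases "k \<in> S ?h"; cases "l \<in> S ?t") auto
    have Zp2: "Z * pt = Z" by (rule mult_absorb(2)[OF Zr pt_pr(2)[OF hv]])
    have "Z = 0" by (rule ent_eqI[OF fT]) (simp_all add: Zp Zp2 e ent_lin)
    then show ?thesis by (simp add: Z_def)
  qed
  have pos: "\<exists>i<?n. bs ! i = b" if "b \<in> arcs D" for b using that set_bs by (metis in_set_conv_nth)
  have L_comm: "Lo i * (A (bs ! i) * A (star (bs ! i))) = A (bs ! i) * A (star (bs ! i)) * Lo i" if i: "i < ?n" for i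
  proof -
    let ?b = "bs ! i"
    obtain i' where i': "i' < ?n" "bs ! i' = star ?b" using pos[OF star_arcs[OF bi[OF i]]] by blast
    have k1: "A (star ?b) * Lo i = Lo i' * A (star ?b)" by (rule key[OF i refl i'])
    have k2: "A ?b * Lo i' = Lo i * A ?b" using key[OF i'(1,2) i, of] by simp
    have "Lo i * A ?b * A (star ?b) = A ?b * (Lo i' * A (star ?b))" unfolding k2[symmetric] by (simp only: mult.assoc)
    then show ?thesis unfolding k1[symmetric] by (simp only: mult.assoc)
  qed
  have gg: "(1 + A b * A (star b)) * gi b = 1" "gi b * (1 + A b * A (star b)) = 1" if "b \<in> arcs D" for b
    unfolding gi_def using uinv[OF rD(5)[OF that]] by auto
  have Ps_g: "Ps i * (1 + A (bs ! i) * A (star (bs ! i))) = (1 + A (bs ! i) * A (star (bs ! i))) * Ps i" if i: "i < ?n" for i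
  proof -
    let ?b = "bs ! i"
    let ?g = "1 + A ?b * A (star ?b)"
    have Lg: "Lo i * ?g = ?g * Lo i" using L_comm[OF i] by (simp add: distrib_left distrib_right)
    show ?thesis
    proof (cases "eps ?b = 1")
      case True
      have P: "Ps i = ?g * Lo i" using True gg(1)[OF bi[OF i]] by (simp add: Lo_def mult.assoc[symmetric])
      show ?thesis unfolding P by (simp only: mult.assoc Lg)
    next
      case False
      have P: "Ps i = Lo i * ?g" using False gg(2)[OF bi[OF i]] by (simp add: Lo_def mult.assoc)
      show ?thesis unfolding P Lg by (simp only: mult.assoc Lg)
    qed
  qed
  have Ps_gi: "Ps i * gi (bs ! i) = gi (bs ! i) * Ps i" if i: "i < ?n" for i
    unfolding gi_def by (rule uinv_comm[OF rD(5)[OF bi[OF i]] Ps_g[OF i]])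
  have Ps_const: "i \<le> ?n \<Longrightarrow> Ps i = \<Psi>" for i
  proof (induct i)
    case 0
    have "uinv 1 = (1 :: 'k endo)" by (rule uinv_unique) auto
    then show ?case by (simp add: Ps_def Pre_def)
  next
    case (Suc i)
    then have i: "i < ?n" by simp
    let ?b = "bs ! i"
    have PsG: "Ps i * G ?b = G ?b * Ps i" using Ps_g[OF i] Ps_gi[OF i] gG(2)[of ?b] by (cases "eps ?b = 1") (simp_all add: rel_factor_def)
    have uu: "uinv (Pre i * G ?b) = uinv (G ?b) * uinv (Pre i)"
    proof (rule uinv_unique)
      show "Pre i * G ?b * (uinv (G ?b) * uinv (Pre i)) = 1" "uinv (G ?b) * uinv (Pre i) * (Pre i * G ?b) = 1"
        using uinv[OF Pre_unit[of i]] uinv[OF G_unit[OF bi[OF i]]] by (simp_all only: mult.assoc mult_chain[OF uinv(1)[OF G_unit[OF bi[OF i]]]] mult_chain[OF uinv(2)[OF Pre_unit[of i]]], simp_all)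
    qed
    have "Ps (Suc i) = uinv (G ?b) * (Ps i * G ?b)" unfolding Ps_def Pre_Suc[OF i] uu by (simp only: mult.assoc)
    also have "\<dots> = Ps i" unfolding PsG using uinv(2)[OF G_unit[OF bi[OF i]]] by (simp add: mult.assoc[symmetric])
    finally show ?case using Suc by simp
  qed
  obtain i where i: "i < ?n" "bs ! i = b0" using pos[OF b0] by blast
  obtain i' where i': "i' < ?n" "bs ! i' = star b0" using pos[OF star_arcs[OF b0]] by blast
  have L1: "Lo i = gi b0 * \<Psi>" using Ps_gi[OF i(1)] Ps_const[of i] i by (simp add: Lo_def)
  have L2: "Lo i' = gi (star b0) * \<Psi>" using Ps_gi[OF i'(1)] Ps_const[of i'] i' by (simp add: Lo_def)
  have k2: "A b0 * Lo i' = Lo i * A b0" using key[OF i' i(1)] i(2) by simp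
  let ?g = "1 + A b0 * A (star b0)" and ?g' = "1 + A (star b0) * A b0"
  have "\<Psi> * A b0 = ?g * (Lo i * A b0)" unfolding L1 using gg(1)[OF b0] by (simp add: mult.assoc[symmetric])
  also have "\<dots> = A b0 * ?g' * Lo i'" unfolding k2[symmetric] by (simp add: algebra_simps)
  also have "\<dots> = A b0 * \<Psi>" unfolding L2 using gg(1)[OF star_arcs[OF b0]] by (simp add: mult.assoc mult_chain)
  finally show ?thesis unfolding \<Psi>_def .
qed

text \<open>The complex has endomorphisms as kernel on the left and, by \<open>trace_endo\<close>, as dual of the cokernel on the right.
  Both are scalars, so \<open>exact_of_card\<close> applies.\<close>
theorem brick_rigid:
  assumes br: "brick S A" and q0: "\<And>w. w \<in> verts Q \<Longrightarrow> q w \<noteq> 0" and f2: "form (dimv S) (dimv S) = 2"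
  shows "rigid_rep S A"
proof -
  define Qi where "Qi = (\<Sum>w\<in>verts Q. sc (inverse (q w)) * (pr (S w) :: 'k endo))"
  have prQ: "pr (S v) * Qm = sc (q v) * pr (S v)" if v: "v \<in> verts Q" for v
  proof -
    have "pr (S v) * Qm = (\<Sum>w\<in>verts Q. if w = v then sc (q v) * pr (S v) else 0)"
      unfolding Qm_def sum_distrib_left by (rule sum.cong) (use qD(1,2) v in \<open>auto simp: sc_left[of "pr _"]\<close>)
    then show ?thesis using v by simp
  qed
  have QiQ: "Qi * Qm = pt"
  proof -
    have "sc (inverse (q w)) * pr (S w) * Qm = pr (S w)" if w: "w \<in> verts Q" for w
    proof -
      have "sc (inverse (q w)) * pr (S w) * Qm = sc (inverse (q w)) * (sc (q w) * pr (S w))" by (simp only: mult.assoc prQ[OF w])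
      also have "\<dots> = sc (inverse (q w) * q w) * pr (S w)" by (simp add: sc_simps mult.assoc)
      finally show ?thesis using q0[OF w] by (simp add: sc_simps)
    qed
    then show ?thesis unfolding Qi_def sum_distrib_right rD(7) by simp
  qed
  have cnt: "card J + 2 = 2 * card I" using f2 unfolding form_card by linarith
  have brk: "\<exists>c. h = sc c * pt" if "gr h" "\<And>b. b \<in> arcs D \<Longrightarrow> h * A b = A b * h" for h
    using br that unfolding brick_def graded_def by blast
  \<comment> \<open>The functional of the trace pairing with \<open>Qi\<close>, the one for which \<open>Qm \<Theta>\<close> is the identity.\<close>
  define t0 where "t0 = (\<lambda>(i, j). cof Qi (j, i))"
  have c1: "d0 x \<in> supp_sp J" for x by (simp add: d0_def cofam_supp)
  have c2: "d1 y \<in> supp_sp I" for y by (simp add: d1_def cof_supp)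
  have c3: "d1 (d0 x) = 0" for x
  proof -
    let ?\<xi> = "\<lambda>b. mat x * A b - A b * mat x"
    have bs: "set bs \<subseteq> arcs D" by (simp add: set_bs)
    have 1: "dprod A (fam (d0 x)) bs = dprod A ?\<xi> bs"
      by (rule dprod_cong[OF bs]) (simp add: d0_def fam_cofam[OF inner_arrow[OF mat_graded]])
    have g: "gr (dprod A ?\<xi> bs)" by (rule dprod_graded[OF inner_arrow[OF mat_graded] bs])
    have "pr (S w) * dprod A ?\<xi> bs = 0" if w: "w \<in> verts Q" for w
    proof -
      have "pr (S w) * (mat x * PL bs) = mat x * (pr (S w) * PL bs)" by (simp only: mult.assoc[symmetric] gradedD(1)[OF mat_graded w])
      then have "pr (S w) * dprod A ?\<xi> bs = mat x * (sc (q w) * pr (S w)) - sc (q w) * pr (S w) * mat x"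
        unfolding dprod_inner[OF bs] right_diff_distrib by (simp only: rD(6)[OF w] mult.assoc[symmetric])
      then show ?thesis by (simp add: sc_left[of "mat x"] gradedD(1)[OF mat_graded w] mult.assoc)
    qed
    then have "pt * dprod A ?\<xi> bs = 0" unfolding rD(7) sum_distrib_right by simp
    then have "dprod A ?\<xi> bs = 0" using graded_pt[OF g] by simp
    then show ?thesis unfolding d1_def 1 by (auto simp: cof_def ent_lin fun_eq_iff)
  qed
  have c4: "\<exists>c. x = scl c (cof pt)" if x: "x \<in> supp_sp I" "d0 x = 0" for x
  proof -
    have "mat x * A b = A b * mat x" if b: "b \<in> arcs D" for b
    proof -
      have "fam (cofam (\<lambda>b. mat x * A b - A b * mat x)) b = mat x * A b - A b * mat x"
        by (rule fam_cofam[OF inner_arrow[OF mat_graded] b])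
      moreover have "fam 0 b = 0" by (simp add: fam_def sc_simps)
      ultimately show ?thesis using x(2) by (simp add: d0_def)
    qed
    then obtain c where "mat x = sc c * pt" using brk[OF mat_graded] by blast
    then have "x = cof (sc c * pt)" using cof_mat[OF x(1)] by simp
    also have "\<dots> = scl c (cof pt)" by (auto simp: cof_def ent_lin fun_eq_iff)
    finally show ?thesis by blast
  qed
  have c5: "\<exists>c. t = scl c t0" if t: "t \<in> supp_sp I" "\<And>y. y \<in> supp_sp J \<Longrightarrow> (\<Sum>i\<in>I. t i * d1 y i) = 0" for t :: "_ \<Rightarrow> 'k"
  proof -
    define \<Theta> where "\<Theta> = mat (\<lambda>(i, j). t (j, i))"
    have g: "gr \<Theta>" unfolding \<Theta>_def by (rule mat_graded)
    have tr: "tr (tot S) (\<Theta> * h) = (\<Sum>p\<in>I. t p * ent h (fst p) (snd p))" if h: "gr h" for h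
    proof -
      have "tr (tot S) (\<Theta> * h) = (\<Sum>i\<in>tot S. \<Sum>j\<in>tot S. ent \<Theta> i j * ent h j i)"
        unfolding tr_def by (simp only: ent_mult[OF rD(3) disjI1[OF gradedD(2)[OF g]]])
      also have "\<dots> = (\<Sum>j\<in>tot S. \<Sum>i\<in>tot S. t (j, i) * ent h j i)"
        by (subst sum.swap) (intro sum.cong refl, use t(1) I_sym in \<open>auto simp: \<Theta>_def ent_mat supp_sp_def\<close>)
      also have "\<dots> = (\<Sum>p\<in>tot S \<times> tot S. t p * ent h (fst p) (snd p))"
        by (simp add: sum.cartesian_product split_beta)
      also have "\<dots> = (\<Sum>p\<in>I. t p * ent h (fst p) (snd p))"
        by (rule sum.mono_neutral_right) (use rD(3) t(1) in \<open>auto simp: supp_sp_def dest: I_tot\<close>)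
      finally show ?thesis .
    qed
    have z: "tr (tot S) (\<Theta> * dprod A \<xi> bs) = 0" if \<xi>: "af \<xi>" for \<xi>
    proof -
      have bs: "set bs \<subseteq> arcs D" by (simp add: set_bs)
      have "dprod A \<xi> bs = dprod A (fam (cofam \<xi>)) bs" by (rule dprod_cong[OF bs]) (simp add: fam_cofam[OF \<xi>])
      then have "d1 (cofam \<xi>) p = ent (dprod A \<xi> bs) (fst p) (snd p)" if "p \<in> I" for p
        using that by (cases p) (simp add: d1_def cof_def)
      then have "(\<Sum>p\<in>I. t p * ent (dprod A \<xi> bs) (fst p) (snd p)) = (\<Sum>p\<in>I. t p * d1 (cofam \<xi>) p)" by simp
      then show ?thesis using t(2)[OF cofam_supp] tr[OF dprod_graded[OF \<xi> bs]] by simp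
    qed
    have gQ: "gr (Qm * \<Theta>)"
      unfolding graded_def
    proof (intro conjI ballI)
      fix v assume v: "v \<in> verts Q"
      have "Qm * pr (S v) = pr (S v) * Qm"
        unfolding Qm_def sum_distrib_left sum_distrib_right by (rule sum.cong) (simp_all add: sc_left[of "pr _"] mult.assoc pr_mult Int_commute)
      then show "Qm * \<Theta> * pr (S v) = pr (S v) * (Qm * \<Theta>)"
        by (simp add: mult.assoc gradedD(1)[OF g v]) (simp add: mult.assoc[symmetric])
    next
      show "Qm * \<Theta> * pt = Qm * \<Theta>" by (simp add: mult.assoc gradedD(2)[OF g])
    qed
    obtain c where c: "Qm * \<Theta> = sc c * pt" using brk[OF gQ trace_endo[OF g z]] by blast
    have "\<Theta> = Qi * (Qm * \<Theta>)" by (simp add: mult.assoc[symmetric] QiQ graded_pt[OF g])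
    also have "\<dots> = sc c * (Qi * pt)" unfolding c by (rule sc_left)
    also have "Qi * pt = Qi" unfolding Qi_def sum_distrib_right by (rule sum.cong) (simp_all add: mult.assoc pt_pr)
    finally have Th: "\<Theta> = sc c * Qi" .
    have "t p = c * t0 p" for p
    proof (cases p)
      case (Pair i j)
      show ?thesis
      proof (cases "(i, j) \<in> I")
        case True
        have "t (i, j) = ent \<Theta> j i" using I_sym[OF True] by (simp add: \<Theta>_def ent_mat)
        then show ?thesis using I_sym[OF True] by (simp add: Th ent_lin Pair t0_def cof_def)
      next
        case False
        then have "(j, i) \<notin> I" using I_sym by blast
        then show ?thesis using t(1) False by (simp add: Pair t0_def cof_def supp_sp_def)
      qed
    qed
    then show ?thesis by blast
  qed
  have ex: "\<exists>x\<in>supp_sp I. y = d0 x" if "y \<in> supp_sp J" "d1 y = 0" for y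
    by (rule exact_of_card[of I J d0 d1 "cof pt" t0, OF finI finJ d0_lin d1_lin c1 c2 c3 c4 c5 cnt that])
  show ?thesis
    unfolding rigid_rep_def
  proof (intro allI impI)
    fix \<xi> assume d: "deform S A \<xi>"
    then have \<xi>: "af \<xi>" by (simp add: deform_def)
    have bs: "set bs \<subseteq> arcs D" by (simp add: set_bs)
    have "dprod A \<xi> bs = pt * dprod A \<xi> bs" using graded_pt[OF dprod_graded[OF \<xi> bs]] by simp
    also have "\<dots> = 0" unfolding rD(7) sum_distrib_right using d by (simp add: deform_def)
    finally have "dprod A (fam (cofam \<xi>)) bs = 0" using dprod_cong[OF bs fam_cofam[OF \<xi>]] by simp
    then have "d1 (cofam \<xi>) = 0" by (auto simp: d1_def cof_def ent_lin fun_eq_iff)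
    then obtain x where x: "cofam \<xi> = d0 x" using ex[OF cofam_supp] by blast
    have "\<xi> b = mat x * A b - A b * mat x" if b: "b \<in> arcs D" for b
    proof -
      have "\<xi> b = fam (cofam (\<lambda>b. mat x * A b - A b * mat x)) b" using fam_cofam[OF \<xi> b] x by (simp add: d0_def)
      then show ?thesis using fam_cofam[OF inner_arrow[OF mat_graded] b] by simp
    qed
    then show "\<exists>h. gr h \<and> (\<forall>b\<in>arcs D. \<xi> b = h * A b - A b * h)" using mat_graded by blast
  qed
qed

end

section \<open>Corner algebras\<close>

text \<open>The corner \<open>u R u\<close> intersected with a subring \<open>P\<close>. The latter allows for the stabiliser of a subspace,
  to prove that subrepresentations are stable under the whole algebra.\<close>
definition corner :: "('k::field \<Rightarrow> 'r::ring_1) \<Rightarrow> 'r \<Rightarrow> 'r set \<Rightarrow> ('k, 'r) module" where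
  "corner sm u P = \<lparr>carrier = {x \<in> P. u * x = x \<and> x * u = x}, mult = (*), one = u, zero = 0, add = (+),
     smult = (\<lambda>c x. sm c * x)\<rparr>"

locale corner_alg =
  fixes sm :: "'k::field \<Rightarrow> 'r::ring_1" and u :: 'r and P :: "'r set"
  assumes sm: "sm (c + d) = sm c + sm d" "sm (c * d) = sm c * sm d" "sm 1 = 1" "x * sm c = sm c * x"
    and uu: "u * u = u"
    and P: "u \<in> P" "0 \<in> P" "x \<in> P \<Longrightarrow> y \<in> P \<Longrightarrow> x + y \<in> P" "x \<in> P \<Longrightarrow> y \<in> P \<Longrightarrow> x * y \<in> P" "x \<in> P \<Longrightarrow> sm c * x \<in> P"
begin

abbreviation "C \<equiv> corner sm u P"

lemma sm0: "sm 0 = 0" using sm(1)[of 0 0] by simp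
lemma sm_neg: "sm (- 1) * x = - x" 
proof -
  have "sm (- 1) + sm 1 = 0" using sm(1)[of "- 1" 1] sm0 by simp
  then have "sm (- 1) = - 1" unfolding sm(3) by (rule eq_neg_iff_add_eq_0[THEN iffD2])
  then show ?thesis by simp
qed
lemma sm_swap: "x * (sm c * y) = sm c * (x * y)" by (metis sm(4) mult.assoc)

lemma C_simps [simp]: "x \<otimes>\<^bsub>C\<^esub> y = x * y" "\<one>\<^bsub>C\<^esub> = u" "\<zero>\<^bsub>C\<^esub> = 0" "x \<oplus>\<^bsub>C\<^esub> y = x + y" "c \<odot>\<^bsub>C\<^esub> x = sm c * x"
  by (simp_all add: corner_def)
lemma C_carrier: "x \<in> carrier C \<longleftrightarrow> x \<in> P \<and> u * x = x \<and> x * u = x" by (simp add: corner_def)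

lemma C_neg: "x \<in> carrier C \<Longrightarrow> - x \<in> carrier C"
  using P(5)[of x "- 1"] by (simp add: C_carrier sm_neg)

lemma corner_K: "K_algebra C"
proof (rule K_algebraI)
  show "ring C"
  proof (rule ringI)
    show "abelian_group C"
    proof (rule abelian_groupI)
      show "\<exists>y\<in>carrier C. y \<oplus>\<^bsub>C\<^esub> x = \<zero>\<^bsub>C\<^esub>" if "x \<in> carrier C" for x
        using C_neg[OF that] by (intro bexI[of _ "- x"]) auto
    qed (auto simp: C_carrier P distrib_left distrib_right)
    show "Group.monoid C"
    proof (rule Group.monoidI)
      show "x \<otimes>\<^bsub>C\<^esub> y \<in> carrier C" if "x \<in> carrier C" "y \<in> carrier C" for x y
        using that P(4)[of x y] by (auto simp: C_carrier mult.assoc) (simp add: mult.assoc[symmetric])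
    qed (auto simp: C_carrier P uu mult.assoc)
  qed (auto simp: distrib_left distrib_right)
  show "c \<odot>\<^bsub>C\<^esub> x \<in> carrier C" if "x \<in> carrier C" for c x
    using that P(5)[of x c] by (simp add: C_carrier sm_swap[of u] mult.assoc)
  show "x \<otimes>\<^bsub>C\<^esub> (c \<odot>\<^bsub>C\<^esub> y) = c \<odot>\<^bsub>C\<^esub> (x \<otimes>\<^bsub>C\<^esub> y)" for c x y
    by (simp add: sm_swap[of x])
qed (auto simp: sm(1-3) mult.assoc distrib_left distrib_right)

lemma corner_ring: "ring C" by (rule K_algebra.axioms(1)[OF corner_K])

lemma C_hom_sum:
  fixes h :: "('x, 'y, 'k) path_sum \<Rightarrow> 'r"
  assumes h: "h \<in> algebra_hom (path_algebra G) C" and c: "\<And>i. i \<in> I \<Longrightarrow> y i \<in> carrier (path_algebra G)"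
  shows "h (\<Sum>i\<in>I. y i) = (\<Sum>i\<in>I. h (y i))"
proof -
  note D = algebra_homD[OF h]
  have z: "0 \<in> carrier (path_algebra G :: ('k, ('x, 'y, 'k) path_sum) module)" by (simp add: pa_carrier)
  have h0: "h 0 = 0" using D(3)[OF z z] by (simp add: pa_add)
  have "(\<Sum>i\<in>I. y i) \<in> carrier (path_algebra G) \<and> h (\<Sum>i\<in>I. y i) = (\<Sum>i\<in>I. h (y i))"
    using c
  proof (induct I rule: infinite_finite_induct)
    case (insert i I)
    then have a: "y i \<in> carrier (path_algebra G)" "(\<Sum>i\<in>I. y i) \<in> carrier (path_algebra G)"
      "h (\<Sum>i\<in>I. y i) = (\<Sum>i\<in>I. h (y i))" by auto
    have "h (y i + (\<Sum>i\<in>I. y i)) = h (y i) + h (\<Sum>i\<in>I. y i)" using D(3)[OF a(1,2)] by (simp add: pa_add)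
    moreover have "y i + (\<Sum>i\<in>I. y i) \<in> carrier (path_algebra G)"
      using a(1,2) Poly_Mapping.keys_add[of "y i" "\<Sum>i\<in>I. y i"] by (auto simp: pa_carrier)
    ultimately show ?case using insert a by simp
  qed (simp_all add: h0 z)
  then show ?thesis by blast
qed

text \<open>Invertibility of \<open>u + x\<close> in the corner, where \<open>u\<close> is the identity, corresponds to that of \<open>1 + x\<close> in the
  ambient ring by adding or removing \<open>1 - u\<close>.\<close>
lemma corner_unitD:
  assumes x: "u * x = x" "x * u = x" and U: "u + x \<in> Units C"
  shows "isunit (1 + x)" "inv\<^bsub>C\<^esub> (u + x) = u * uinv (1 + x)"
proof -
  interpret ring C by (rule corner_ring)
  define y where "y = inv\<^bsub>C\<^esub> (u + x)"
  have y: "y * (u + x) = u" "(u + x) * y = u" "u * y = y" "y * u = y"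
    using Units_l_inv[OF U] Units_r_inv[OF U] Units_inv_closed[OF U] by (simp_all add: y_def C_carrier)
  have 1: "(1 + x) * (y + 1 - u) = 1" using y x by (simp add: algebra_simps)
  have 2: "(y + 1 - u) * (1 + x) = 1" using y x by (simp add: algebra_simps)
  show "isunit (1 + x)" by (rule isunitI[OF 1 2])
  show "inv\<^bsub>C\<^esub> (u + x) = u * uinv (1 + x)" unfolding uinv_unique[OF 1 2] using y uu by (simp add: y_def[symmetric] distrib_left right_diff_distrib)
qed

lemma corner_unitI:
  assumes x: "x \<in> carrier C" and v: "isunit (1 + x)" "u * uinv (1 + x) \<in> P"
  shows "u + x \<in> Units C"
proof -
  have ux: "u * x = x" "x * u = x" "x \<in> P" using x by (auto simp: C_carrier)
  have c: "u * uinv (1 + x) = uinv (1 + x) * u" by (rule uinv_comm[OF v(1)]) (simp add: ux distrib_left distrib_right)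
  have 1: "(u + x) * (u * uinv (1 + x)) = u" 
  proof -
    have "(u + x) * (u * uinv (1 + x)) = u * ((1 + x) * uinv (1 + x))"
      using ux uu by (simp add: mult.assoc[symmetric] distrib_left distrib_right)
    then show ?thesis using uinv(1)[OF v(1)] by simp
  qed
  have 2: "(u * uinv (1 + x)) * (u + x) = u"
  proof -
    have "(uinv (1 + x) * u) * (u + x) = (uinv (1 + x) * (1 + x)) * u"
      using ux uu by (simp add: mult.assoc distrib_left distrib_right)
    then show ?thesis using uinv(2)[OF v(1)] c by simp
  qed
  have k: "u * uinv (1 + x) \<in> carrier C" using v(2) uu c by (simp add: C_carrier mult.assoc[symmetric]) (metis mult.assoc uu)
  moreover have "u + x \<in> carrier C" using x uu P by (simp add: C_carrier distrib_left distrib_right)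
  ultimately show ?thesis unfolding Units_def using 1 2 by auto
qed

end

section \<open>Homomorphisms from the path algebra of the double\<close>

locale preproj_corner = mult_preproj Q lt + corner_alg sm u P for Q :: "('v, 'a) pre_digraph" and lt and sm :: "'k::field \<Rightarrow> 'r::ring_1" and u P
begin

abbreviation "AA \<equiv> (double_algebra Q :: ('k, ('v, 'a darrow, 'k) path_sum) module)"
abbreviation "ve v \<equiv> (vertex_elem v :: ('v, 'a darrow, 'k) path_sum)"
abbreviation "ae b \<equiv> (arrow_elem D b :: ('v, 'a darrow, 'k) path_sum)"

lemma Q_fin: "fin_digraph Q" by unfold_locales
lemmas QL = Q_fin lt
lemmas D_wf = double_wf[OF QL]
lemma AA_ring: "ring AA" by (rule K_algebra.axioms(1)[OF path_algebra[OF D_wf(2,1)]])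

lemma ve_closed: "v \<in> verts Q \<Longrightarrow> ve v \<in> carrier AA" by (auto simp: pa_carrier vertex_elem_def paths_def)
lemmas ae_closed = arrow_closed[OF QL]

lemma ve_mult: "ve v \<otimes>\<^bsub>AA\<^esub> ve w = (if v = w then ve v else \<zero>\<^bsub>AA\<^esub>)"
  by (simp add: vertex_elem_def pa_single path_mult_def path_tail_def pa_zero)
lemma ve_ae: "ve (head D b) \<otimes>\<^bsub>AA\<^esub> ae b = ae b" "ae b \<otimes>\<^bsub>AA\<^esub> ve (tail D b) = ae b"
  by (simp_all add: vertex_elem_def arrow_elem_def pa_single path_mult_def path_tail_def)
lemma one_ve: "\<one>\<^bsub>AA\<^esub> = (\<Sum>v\<in>verts Q. ve v)" by (simp add: pa_one vertex_elem_def)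
lemma rhs_ve: "mpa_rhs Q q = (\<Sum>v\<in>verts Q. q v \<odot>\<^bsub>AA\<^esub> ve v)"
  unfolding mpa_rhs_def pa_smult vertex_elem_def by (rule sum.cong) (auto intro!: poly_mapping_eqI simp: lookup_smult lookup_single when_def)

lemma hom_0: "h \<in> algebra_hom AA C \<Longrightarrow> h \<zero>\<^bsub>AA\<^esub> = 0"
  using C_hom_sum[of h D "{}"] by (simp add: pa_zero)

lemma quiver_rep_of_hom:
  assumes "h \<in> algebra_hom AA C"
  shows "quiver_rep (\<lambda>v. h (ve v)) (\<lambda>b. h (ae b))" "(\<Sum>v\<in>verts Q. h (ve v)) = u" "h (mpa_rhs Q q) = (\<Sum>v\<in>verts Q. sm (q v) * h (ve v))"
proof -
  note H = algebra_homD[OF assms]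
  show "quiver_rep (\<lambda>v. h (ve v)) (\<lambda>b. h (ae b))"
    unfolding quiver_rep_def
  proof (intro conjI ballI)
    fix v w assume "v \<in> verts Q" "w \<in> verts Q"
    then show "h (ve v) * h (ve w) = (if v = w then h (ve v) else 0)"
      using H(4)[OF ve_closed ve_closed, of v w] by (cases "v = w") (simp_all add: ve_mult hom_0[OF assms])
  next
    fix b assume b: "b \<in> arcs D"
    show "h (ve (head D b)) * h (ae b) = h (ae b)" "h (ae b) * h (ve (tail D b)) = h (ae b)"
      using H(4)[OF ve_closed[OF ends_verts(1)[OF b]] ae_closed[OF b]] H(4)[OF ae_closed[OF b] ve_closed[OF ends_verts(2)[OF b]]]
      by (simp_all add: ve_ae)
  qed
  show "(\<Sum>v\<in>verts Q. h (ve v)) = u"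
    using C_hom_sum[OF assms, of "verts Q" ve] ve_closed H(5) by (simp add: one_ve)
  have k: "q v \<odot>\<^bsub>AA\<^esub> ve v \<in> carrier AA" if "v \<in> verts Q" for v
    by (rule K_algebra.smult_closed'[OF path_algebra[OF D_wf(2,1)] ve_closed[OF that]])
  show "h (mpa_rhs Q q) = (\<Sum>v\<in>verts Q. sm (q v) * h (ve v))"
    unfolding rhs_ve using C_hom_sum[OF assms, of "verts Q" "\<lambda>v. q v \<odot>\<^bsub>AA\<^esub> ve v"] k H(6)[OF ve_closed] by simp
qed

context
  fixes R :: "('k, 'b) module" and f :: "('v, 'a darrow, 'k) path_sum \<Rightarrow> 'b" and g :: "'b \<Rightarrow> 'r"
  assumes R: "ring R" and f: "f \<in> algebra_hom AA R" "\<And>a. a \<in> arcs D \<Longrightarrow> f (one_plus Q a) \<in> Units R"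
    and g: "g \<in> algebra_hom R C"
begin

private abbreviation "A \<equiv> \<lambda>b. g (f (ae b))"

lemma comp_hom: "(\<lambda>x. g (f x)) \<in> algebra_hom AA C"
  unfolding algebra_hom_def Ring.ring_hom_def
  by (auto simp: algebra_homD[OF f(1)] algebra_homD[OF g] simp del: C_simps)

lemma one_plus_image:
  assumes b: "b \<in> arcs D"
  shows "g (f (one_plus Q b)) = u + A b * A (star b)" "isunit (1 + A b * A (star b))"
    "u * (A b * A (star b)) = A b * A (star b)" "A b * A (star b) * u = A b * A (star b)"
    "g (f (one_plus Q b) [^]\<^bsub>R\<^esub> eps b) = u * rel_factor A b"
proof -
  interpret A: ring AA by (rule AA_ring)
  interpret C: ring C by (rule corner_ring)
  note H = algebra_homD[OF comp_hom]
  note c = ae_closed[OF b] ae_closed[OF star_arcs[OF b]]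
  show 1: "g (f (one_plus Q b)) = u + A b * A (star b)"
    unfolding one_plus_def using H(3)[OF A.one_closed A.m_closed[OF c]] H(4)[OF c] H(5) by simp
  have k: "A b * A (star b) \<in> carrier C" using C.m_closed[OF H(2)[OF c(1)] H(2)[OF c(2)]] by simp
  then show ua: "u * (A b * A (star b)) = A b * A (star b)" "A b * A (star b) * u = A b * A (star b)" by (simp_all add: C_carrier)
  have U: "u + A b * A (star b) \<in> Units C" using alg_hom_units(1)[OF g R corner_ring f(2)[OF b]] 1 by simp
  show "isunit (1 + A b * A (star b))" by (rule corner_unitD(1)[OF ua U])
  have "g (f (one_plus Q b) [^]\<^bsub>R\<^esub> eps b) = (u + A b * A (star b)) [^]\<^bsub>C\<^esub> eps b"
    using alg_hom_units(2)[OF g R corner_ring f(2)[OF b], of b] 1 by simp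
  also have "\<dots> = u * rel_factor A b"
  proof (cases b)
    case (Orig x)
    have "u + A b * A (star b) \<in> carrier C" using U by auto
    then show ?thesis using Orig ua uu by (simp add: rel_factor_def int_pow_def2 distrib_left C_carrier)
  next
    case (Rev x)
    have "inv\<^bsub>C\<^esub> (u + A b * A (star b)) \<in> carrier C" using U by auto
    moreover have "u * (u + A b * A (star b)) = u + A b * A (star b)" using ua uu by (simp add: distrib_left)
    ultimately show ?thesis using Rev corner_unitD(2)[OF ua U] by (simp add: rel_factor_def int_pow_def2 C_carrier)
  qed
  finally show "g (f (one_plus Q b) [^]\<^bsub>R\<^esub> eps b) = u * rel_factor A b" .
qed

lemma rel_factor_corner: assumes b: "b \<in> arcs D" shows "rel_factor A b * u = u * rel_factor A b"
proof -
  note o = one_plus_image[OF b]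
  have c: "u * (1 + A b * A (star b)) = (1 + A b * A (star b)) * u" using o(3,4) by (simp add: distrib_left distrib_right)
  then show ?thesis using uinv_comm[OF o(2) c] by (simp add: rel_factor_def)
qed

text \<open>Products of relation factors in the corner and in the ambient ring agree up to the identity \<open>u\<close> of the corner.\<close>
lemma lhs_image: "g (mpa_lhs Q lt R f) = u * prod_list (map (rel_factor A) bs)"
proof -
  interpret R: ring R by (rule R)
  have id: "(\<lambda>x. x) \<in> algebra_hom R R" by (auto simp: algebra_hom_def Ring.ring_hom_def)
  note pc = alg_hom_units(3)[OF id R R f(2)]
  have "foldr (\<lambda>a x. (f (one_plus Q a) [^]\<^bsub>R\<^esub> eps a) \<otimes>\<^bsub>R\<^esub> x) as \<one>\<^bsub>R\<^esub> \<in> carrier R \<and>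
    g (foldr (\<lambda>a x. (f (one_plus Q a) [^]\<^bsub>R\<^esub> eps a) \<otimes>\<^bsub>R\<^esub> x) as \<one>\<^bsub>R\<^esub>) = u * prod_list (map (rel_factor A) as)" if "set as \<subseteq> arcs D" for as
    using that
  proof (induct as)
    case Nil
    then show ?case using algebra_homD(5)[OF g] by simp
  next
    case (Cons b as)
    then have b: "b \<in> arcs D" by simp
    have "u * rel_factor A b * (u * prod_list (map (rel_factor A) as)) = u * (rel_factor A b * u) * prod_list (map (rel_factor A) as)" by (simp only: mult.assoc)
    also have "\<dots> = u * rel_factor A b * prod_list (map (rel_factor A) as)" unfolding rel_factor_corner[OF b] by (simp add: mult.assoc[symmetric] uu)
    finally have e: "u * rel_factor A b * (u * prod_list (map (rel_factor A) as)) = u * (rel_factor A b * prod_list (map (rel_factor A) as))" by (simp add: mult.assoc)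
    let ?F = "foldr (\<lambda>a x. (f (one_plus Q a) [^]\<^bsub>R\<^esub> eps a) \<otimes>\<^bsub>R\<^esub> x) as \<one>\<^bsub>R\<^esub>"
    have F: "?F \<in> carrier R" "g ?F = u * prod_list (map (rel_factor A) as)" using Cons by auto
    have "g (f (one_plus Q b) [^]\<^bsub>R\<^esub> eps b \<otimes>\<^bsub>R\<^esub> ?F) = u * (rel_factor A b * prod_list (map (rel_factor A) as))"
      using algebra_homD(4)[OF g pc[OF b, of b] F(1)] unfolding F(2) one_plus_image(5)[OF b] by (simp add: e)
    then show ?case using R.m_closed[OF pc[OF b, of b] F(1)] by simp
  qed
  then show ?thesis using set_bs by (simp add: mpa_lhs_def bs_def)
qed

end

lemma mpa_rep_of_hom:
  assumes g: "g \<in> algebra_hom (mpa Q lt q) C"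
  shows "mpa_rep sm q (\<lambda>v. g (mpa_map Q lt q (ve v))) (\<lambda>b. g (mpa_map Q lt q (ae b)))"
    "(\<Sum>v\<in>verts Q. g (mpa_map Q lt q (ve v))) = u"
proof -
  note h = mpa_hom_mpa[OF QL, of q, unfolded mpa_hom_def]
  have R: "ring (mpa Q lt q)" by (rule K_algebra.axioms(1)[OF mpa_K[OF QL]])
  have f: "mpa_map Q lt q \<in> algebra_hom AA (mpa Q lt q)" "\<And>a. a \<in> arcs D \<Longrightarrow> mpa_map Q lt q (one_plus Q a) \<in> Units (mpa Q lt q)"
    using h by auto
  let ?E = "\<lambda>v. g (mpa_map Q lt q (ve v))" and ?A = "\<lambda>b. g (mpa_map Q lt q (ae b))"
  note c = comp_hom[OF R f g] and l = lhs_image[OF R f g]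
  note qr = quiver_rep_of_hom[OF c]
  show "(\<Sum>v\<in>verts Q. ?E v) = u" by (rule qr(2))
  have rel: "u * prod_list (map (rel_factor ?A) bs) = (\<Sum>v\<in>verts Q. sm (q v) * ?E v)" using l qr(3)[of q] h by simp
  have "?E w * prod_list (map (rel_factor ?A) bs) = sm (q w) * ?E w" if w: "w \<in> verts Q" for w
  proof -
    have "?E w * u = ?E w" using algebra_homD(2)[OF c ve_closed[OF w]] by (simp add: C_carrier)
    then have "?E w * prod_list (map (rel_factor ?A) bs) = ?E w * (\<Sum>v\<in>verts Q. sm (q v) * ?E v)" unfolding rel[symmetric] by (simp add: mult.assoc[symmetric])
    also have "\<dots> = (\<Sum>v\<in>verts Q. if v = w then sm (q w) * ?E w else 0)"
      unfolding sum_distrib_left by (rule sum.cong) (use qr(1) w in \<open>auto simp: quiver_rep_def sm_swap[of "g _"]\<close>)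
    finally show ?thesis using w by simp
  qed
  then show "mpa_rep sm q ?E ?A" unfolding mpa_rep_def using qr(1) one_plus_image(2)[OF R f g] by auto
qed

context
  fixes E :: "'v \<Rightarrow> 'r" and A :: "'a darrow \<Rightarrow> 'r"
  assumes qr: "quiver_rep E A" and Eu: "(\<Sum>v\<in>verts Q. E v) = u"
    and inP: "\<And>v. v \<in> verts Q \<Longrightarrow> E v \<in> P" "\<And>b. b \<in> arcs D \<Longrightarrow> A b \<in> P"
begin

private definition wt :: "('v, 'a darrow) path \<Rightarrow> 'r" where "wt p = E (fst p) * prod_list (map A (snd p))"
private definition ext :: "('v, 'a darrow, 'k) path_sum \<Rightarrow> 'r" where
  "ext x = (\<Sum>p\<in>Poly_Mapping.keys x. sm (Poly_Mapping.lookup x p) * wt p)"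

private lemma uE: "v \<in> verts Q \<Longrightarrow> u * E v = E v" "v \<in> verts Q \<Longrightarrow> E v * u = E v"
proof -
  assume v: "v \<in> verts Q"
  have "u * E v = (\<Sum>w\<in>verts Q. if w = v then E v else 0)" unfolding Eu[symmetric] sum_distrib_right
    by (rule sum.cong) (use qr v in \<open>auto simp: quiver_rep_def\<close>)
  then show "u * E v = E v" using v by simp
  have "E v * u = (\<Sum>w\<in>verts Q. if w = v then E v else 0)" unfolding Eu[symmetric] sum_distrib_left
    by (rule sum.cong) (use qr v in \<open>auto simp: quiver_rep_def\<close>)
  then show "E v * u = E v" using v by simp
qed

private lemma wt_tail: "p \<in> paths D \<Longrightarrow> wt p * E (path_tail D p) = wt p"
proof (cases p)
  case (Pair v as)
  assume p: "p \<in> paths D"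
  show ?thesis
  proof (cases as rule: rev_cases)
    case Nil
    then show ?thesis using Pair p qr by (simp add: wt_def path_tail_def paths_def quiver_rep_def)
  next
    case (snoc bs b)
    then have "A b * E (tail D b) = A b" using quiver_repD(4)[OF qr, of b] Pair p by (simp add: paths_def)
    then show ?thesis using Pair snoc by (simp add: wt_def path_tail_def mult.assoc)
  qed
qed

private lemma tail_verts: "p \<in> paths D \<Longrightarrow> path_tail D p \<in> verts Q"
  by (cases p) (auto simp: path_tail_def paths_def intro!: ends_verts)
private lemma fst_verts: "p \<in> paths D \<Longrightarrow> fst p \<in> verts Q"
  by (cases p) (auto simp: paths_def)

private lemma wt_mult: "p \<in> paths D \<Longrightarrow> r \<in> paths D \<Longrightarrow>
   wt p * wt r = (if path_tail D p = fst r then wt (fst p, snd p @ snd r) else 0)"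
proof -
  assume p: "p \<in> paths D" and r: "r \<in> paths D"
  have "wt p * wt r = wt p * (E (path_tail D p) * E (fst r)) * prod_list (map A (snd r))"
    using wt_tail[OF p] by (simp add: mult.assoc[symmetric]) (simp add: wt_def mult.assoc)
  moreover have "E (path_tail D p) * E (fst r) = (if path_tail D p = fst r then E (path_tail D p) else 0)"
    using qr tail_verts[OF p] fst_verts[OF r] by (auto simp: quiver_rep_def)
  moreover have "wt p * E (path_tail D p) * prod_list (map A (snd r)) = wt (fst p, snd p @ snd r)"
    unfolding wt_tail[OF p] by (simp add: wt_def mult.assoc)
  ultimately show ?thesis by (auto split: if_splits)
qed

private lemma wt_C: "p \<in> paths D \<Longrightarrow> wt p \<in> carrier C"
proof -
  assume p: "p \<in> paths D"
  have "set as \<subseteq> arcs D \<Longrightarrow> x \<in> P \<Longrightarrow> x * prod_list (map A as) \<in> P" for as x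
    by (induct as arbitrary: x) (auto simp: mult.assoc[symmetric] P inP)
  then have 1: "wt p \<in> P" unfolding wt_def using inP fst_verts[OF p] p by (auto simp: paths_def)
  have 2: "u * wt p = wt p" unfolding wt_def by (simp add: mult.assoc[symmetric] uE fst_verts[OF p])
  have "wt p * E (path_tail D p) * u = wt p * E (path_tail D p)" unfolding mult.assoc uE(2)[OF tail_verts[OF p]] ..
  then have "wt p * u = wt p" unfolding wt_tail[OF p] .
  then show ?thesis using 1 2 by (simp add: C_carrier)
qed

private lemma ext_super: "finite F \<Longrightarrow> Poly_Mapping.keys x \<subseteq> F \<Longrightarrow> ext x = (\<Sum>p\<in>F. sm (Poly_Mapping.lookup x p) * wt p)"
  unfolding ext_def by (rule sum.mono_neutral_left) (auto simp: in_keys_iff sm0)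
private lemma ext_add: "ext (x + y) = ext x + ext y"
proof -
  let ?F = "Poly_Mapping.keys x \<union> Poly_Mapping.keys y"
  have f: "finite ?F" by simp
  show ?thesis
    unfolding ext_super[OF f Poly_Mapping.keys_add] ext_super[OF f Un_upper1] ext_super[OF f Un_upper2]
    by (simp add: lookup_add sm(1) distrib_right sum.distrib)
qed
private lemma ext_single: "ext (Poly_Mapping.single p c) = sm c * wt p"
  using ext_super[of "{p}" "Poly_Mapping.single p c"] by simp
private lemma ext_0: "ext 0 = 0" by (simp add: ext_def)
private lemma ext_sum: "ext (\<Sum>i\<in>I. y i) = (\<Sum>i\<in>I. ext (y i))"
  by (induct I rule: infinite_finite_induct) (auto simp: ext_0 ext_add)

private lemma ext_mult:
  assumes "x \<in> carrier AA" "y \<in> carrier AA" shows "ext (x \<otimes>\<^bsub>AA\<^esub> y) = ext x * ext y"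
proof -
  have "ext (path_mult D p r (c * d)) = sm c * wt p * (sm d * wt r)" if "p \<in> paths D" "r \<in> paths D" for p r c d
  proof -
    have "sm c * wt p * (sm d * wt r) = sm (c * d) * (wt p * wt r)" by (simp add: sm(2) mult.assoc sm_swap[of "wt p"])
    then show ?thesis unfolding wt_mult[OF that] by (simp add: path_mult_def ext_single ext_0)
  qed
  moreover have "p \<in> paths D" if "p \<in> Poly_Mapping.keys x \<or> p \<in> Poly_Mapping.keys y" for p using that assms by (auto simp: pa_carrier)
  ultimately show ?thesis
    unfolding pa_mult ext_sum ext_def[of x] ext_def[of y] sum_product
    by (intro sum.cong refl) (simp add: path_mult_def)
qed

private lemma ext_hom: "ext \<in> algebra_hom AA C"
proof -
  interpret C: ring C by (rule corner_ring)
  have cl: "ext x \<in> carrier C" if x: "x \<in> carrier AA" for x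
  proof -
    have "F \<subseteq> paths D \<Longrightarrow> (\<Sum>p\<in>F. sm (Poly_Mapping.lookup x p) * wt p) \<in> carrier C" for F
    proof (induct F rule: infinite_finite_induct)
      case (insert p F)
      then have "sm (Poly_Mapping.lookup x p) * wt p \<in> carrier C"
        using K_algebra.smult_closed'[OF corner_K wt_C[of p]] by simp
      then show ?case using insert C.a_closed by simp
    qed (use C.zero_closed in simp_all)
    then show ?thesis using x unfolding ext_def pa_carrier by blast
  qed
  have one: "ext \<one>\<^bsub>AA\<^esub> = u"
    unfolding one_ve ext_sum vertex_elem_def ext_single by (simp add: wt_def sm(3) Eu)
  have sc: "ext (c \<odot>\<^bsub>AA\<^esub> x) = sm c * ext x" for c x
  proof -
    have "Poly_Mapping.keys (Poly_Mapping.map ((*) c) x) \<subseteq> Poly_Mapping.keys x" by (auto simp: in_keys_iff lookup_smult)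
    then show ?thesis unfolding pa_smult using ext_super[OF finite_keys, of "Poly_Mapping.map ((*) c) x" x]
      by (simp add: lookup_smult sm(2) ext_def sum_distrib_left mult.assoc)
  qed
  show ?thesis unfolding algebra_hom_def Ring.ring_hom_def using cl one sc by (auto simp: ext_mult pa_add ext_add)
qed

private lemma ext_gen: "v \<in> verts Q \<Longrightarrow> ext (ve v) = E v" "b \<in> arcs D \<Longrightarrow> ext (ae b) = A b"
  using quiver_repD(3)[OF qr] by (simp_all add: vertex_elem_def arrow_elem_def ext_single wt_def sm(3))

text \<open>The linear extension of \<open>wt\<close>, which multiplies the arrows of a path, is a homomorphism on the path
  algebra of the double; the relations let it pass to the multiplicative preprojective algebra.\<close>
lemma hom_of_mpa_rep:
  assumes m: "mpa_rep sm q E A" and inv: "\<And>b. b \<in> arcs D \<Longrightarrow> u * uinv (1 + A b * A (star b)) \<in> P"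
  shows "\<exists>g. g \<in> algebra_hom (mpa Q lt q) C \<and> (\<forall>v\<in>verts Q. g (mpa_map Q lt q (ve v)) = E v) \<and>
    (\<forall>b\<in>arcs D. g (mpa_map Q lt q (ae b)) = A b)"
proof -
  interpret A: ring AA by (rule AA_ring)
  interpret C: ring C by (rule corner_ring)
  note H = algebra_homD[OF ext_hom]
  have unit: "ext (one_plus Q b) \<in> Units C" if b: "b \<in> arcs D" for b
  proof -
    note c = ae_closed[OF b] ae_closed[OF star_arcs[OF b]]
    have 1: "ext (one_plus Q b) = u + A b * A (star b)"
      unfolding one_plus_def using H(3)[OF A.one_closed A.m_closed[OF c]] H(4)[OF c] H(5) ext_gen(2) b star_arcs[OF b] by simp
    have "A b * A (star b) \<in> carrier C" using C.m_closed[OF H(2)[OF c(1)] H(2)[OF c(2)]] ext_gen(2) b star_arcs[OF b] by simp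
    then show ?thesis unfolding 1 by (rule corner_unitI) (use m b inv in \<open>auto simp: mpa_rep_def\<close>)
  qed
  have id: "(\<lambda>x. x) \<in> algebra_hom C C" by (auto simp: algebra_hom_def Ring.ring_hom_def)
  have "rel_factor (\<lambda>b. ext (ae b)) b = rel_factor A b" if "b \<in> arcs D" for b using that star_arcs[OF that] by (simp add: rel_factor_def ext_gen)
  then have pl: "map (rel_factor (\<lambda>b. ext (ae b))) bs = map (rel_factor A) bs" using set_bs by simp
  have "mpa_lhs Q lt C ext = u * prod_list (map (rel_factor A) bs)"
    using lhs_image[OF corner_ring ext_hom unit id] pl by simp
  also have "\<dots> = (\<Sum>v\<in>verts Q. sm (q v) * E v)" unfolding Eu[symmetric] sum_distrib_right by (rule sum.cong) (use m in \<open>auto simp: mpa_rep_def\<close>)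
  also have "\<dots> = ext (mpa_rhs Q q)" using quiver_rep_of_hom(3)[OF ext_hom, of q] ext_gen(1) by simp
  finally have "mpa_hom Q lt q C ext" unfolding mpa_hom_def using ext_hom unit by blast
  then obtain g where "g \<in> algebra_hom (mpa Q lt q) C" "\<And>x. x \<in> carrier AA \<Longrightarrow> g (mpa_map Q lt q x) = ext x"
    using mpa_universal[OF QL corner_K] by blast
  then show ?thesis by (intro exI[of _ g]) (simp add: ve_closed ae_closed ext_gen)
qed

end

text \<open>A homomorphism is determined on the path algebra by vertices and arrows, and beyond it by the universal property.\<close>
lemma mpa_hom_eq:
  assumes g: "g \<in> algebra_hom (mpa Q lt q) C" "g' \<in> algebra_hom (mpa Q lt q) C"
    and v: "\<And>v. v \<in> verts Q \<Longrightarrow> g (mpa_map Q lt q (ve v)) = g' (mpa_map Q lt q (ve v))"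
    and b: "\<And>b. b \<in> arcs D \<Longrightarrow> g (mpa_map Q lt q (ae b)) = g' (mpa_map Q lt q (ae b))"
    and X: "X \<in> carrier (mpa Q lt q)"
  shows "g X = g' X"
proof (rule mpa_unique[OF QL corner_K g _ X])
  have comp: "(\<lambda>x. k (mpa_map Q lt q x)) \<in> algebra_hom AA C" if "k \<in> algebra_hom (mpa Q lt q) C" for k
    unfolding algebra_hom_def Ring.ring_hom_def
    by (auto simp: algebra_homD[OF mpa_map_hom[OF QL]] algebra_homD[OF that] simp del: C_simps)
  let ?h = "\<lambda>x. g (mpa_map Q lt q x)" and ?h' = "\<lambda>x. g' (mpa_map Q lt q x)"
  note h = comp[OF g(1)] and h' = comp[OF g(2)]
  have e1: "?h (Poly_Mapping.single p 1) = ?h' (Poly_Mapping.single p 1)" if "p \<in> paths D" for p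
    using that
  proof (induct "snd p" arbitrary: p)
    case Nil
    then show ?case using v[of "fst p"] by (cases p) (auto simp: vertex_elem_def paths_def)
  next
    case (Cons b as)
    let ?r = "(tail D b, as)"
    obtain w where p: "p = (w, b # as)" using Cons by (cases p) auto
    have bD: "b \<in> arcs D" and w: "w = head D b" and r: "?r \<in> paths D"
      using Cons(3) by (auto simp: p paths_def successively_Cons intro!: ends_verts)
    have "ae b \<otimes>\<^bsub>AA\<^esub> Poly_Mapping.single ?r 1 = Poly_Mapping.single p 1"
      by (simp add: arrow_elem_def pa_single path_mult_def path_tail_def p w)
    moreover have "Poly_Mapping.single ?r 1 \<in> carrier AA" using r by (simp add: pa_carrier)
    moreover have "?h (ae b) = ?h' (ae b)" by (rule b[OF bD])
    moreover have "?h (Poly_Mapping.single ?r 1) = ?h' (Poly_Mapping.single ?r 1)" by (rule Cons(1)) (use Cons(2) p r in auto)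
    ultimately show ?case
      using algebra_homD(4)[OF h ae_closed[OF bD], of "Poly_Mapping.single ?r 1"] algebra_homD(4)[OF h' ae_closed[OF bD], of "Poly_Mapping.single ?r 1"] by simp
  qed
  fix x :: "('v, 'a darrow, 'k) path_sum" assume x: "x \<in> carrier AA"
  have xs: "x = (\<Sum>p\<in>Poly_Mapping.keys x. Poly_Mapping.lookup x p \<odot>\<^bsub>AA\<^esub> Poly_Mapping.single p 1)"
  proof -
    have "c \<odot>\<^bsub>AA\<^esub> Poly_Mapping.single p 1 = Poly_Mapping.single p c" for c p
      unfolding pa_smult by (rule poly_mapping_eqI) (simp add: lookup_smult lookup_single when_def)
    then show ?thesis using pm_sum[of x] by simp
  qed
  have k: "Poly_Mapping.single p 1 \<in> carrier AA" if "p \<in> Poly_Mapping.keys x" for p using that x by (auto simp: pa_carrier)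
  have k': "c \<odot>\<^bsub>AA\<^esub> Poly_Mapping.single p 1 \<in> carrier AA" if "p \<in> Poly_Mapping.keys x" for p c
    by (rule K_algebra.smult_closed'[OF path_algebra[OF D_wf(2,1)] k[OF that]])
  have "?h x = (\<Sum>p\<in>Poly_Mapping.keys x. sm (Poly_Mapping.lookup x p) * ?h (Poly_Mapping.single p 1))"
    by (subst xs, subst C_hom_sum[OF h k']) (use algebra_homD(6)[OF h k] in auto)
  also have "\<dots> = (\<Sum>p\<in>Poly_Mapping.keys x. sm (Poly_Mapping.lookup x p) * ?h' (Poly_Mapping.single p 1))"
    by (rule sum.cong) (use e1 x in \<open>auto simp: pa_carrier\<close>)
  also have "\<dots> = ?h' x"
    by (subst (2) xs, subst C_hom_sum[OF h' k']) (use algebra_homD(6)[OF h' k] in auto)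
  finally show "?h x = ?h' x" .
qed

end

section \<open>Finite-dimensional spaces have coordinates\<close>

lemma supp_sp_closed: "x \<in> supp_sp S \<Longrightarrow> y \<in> supp_sp S \<Longrightarrow> x + y \<in> supp_sp S" "x \<in> supp_sp S \<Longrightarrow> scl c x \<in> supp_sp S"
  "0 \<in> supp_sp S" "x \<in> supp_sp S \<Longrightarrow> - x \<in> supp_sp S" "S \<subseteq> T \<Longrightarrow> x \<in> supp_sp S \<Longrightarrow> x \<in> supp_sp T"
  for x :: "'x \<Rightarrow> 'k::field"
  by (auto simp: supp_sp_def)

text \<open>The unit vectors are mapped to a basis.\<close>
lemma dim_of_coord_iso:
  fixes V :: "('k::field, 'm) module" and \<Psi> :: "(nat \<Rightarrow> 'k) \<Rightarrow> 'm"
  assumes V: "vectorspace (class_ring :: 'k ring) V" and I: "finite I"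
    and bij: "bij_betw \<Psi> (supp_sp I) (carrier V)"
    and add: "\<And>x y. x \<in> supp_sp I \<Longrightarrow> y \<in> supp_sp I \<Longrightarrow> \<Psi> (x + y) = \<Psi> x \<oplus>\<^bsub>V\<^esub> \<Psi> y"
    and scale: "\<And>c x. x \<in> supp_sp I \<Longrightarrow> \<Psi> (scl c x) = c \<odot>\<^bsub>V\<^esub> \<Psi> x"
  shows "vectorspace.fin_dim (class_ring :: 'k ring) V" "vectorspace.dim (class_ring :: 'k ring) V = card I"
proof -
  interpret V: vectorspace "class_ring :: 'k ring" V by (rule V)
  let ?u = "\<lambda>i. \<Psi> (unitv i)"
  have inj: "x = y" if "\<Psi> x = \<Psi> y" "x \<in> supp_sp I" "y \<in> supp_sp I" for x y
    using bij that by (auto simp: bij_betw_def inj_on_def)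
  have cl: "\<Psi> x \<in> carrier V" if "x \<in> supp_sp I" for x using bij that by (auto simp: bij_betw_def)
  have uI: "inj_on ?u I"
  proof (rule inj_onI)
    fix i j assume ij: "i \<in> I" "j \<in> I" "?u i = ?u j"
    have "(unitv i :: nat \<Rightarrow> 'k) = unitv j" by (rule inj[OF ij(3) unitv_in[OF ij(1)] unitv_in[OF ij(2)]])
    then have "(unitv i :: nat \<Rightarrow> 'k) i = unitv j i" by simp
    then show "i = j" by (simp add: unitv_def split: if_splits)
  qed
  have \<Psi>0: "\<Psi> 0 = \<zero>\<^bsub>V\<^esub>"
  proof -
    have z: "(0 :: nat \<Rightarrow> 'k) \<in> supp_sp I" by (rule supp_sp_closed(3))
    have "0 \<odot>\<^bsub>V\<^esub> \<Psi> 0 = \<zero>\<^bsub>V\<^esub>" using V.lmult_0[OF cl[OF z]] by (simp add: class_ring_simps)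
    moreover have "scl 0 (0 :: nat \<Rightarrow> 'k) = 0" by (simp add: fun_eq_iff)
    ultimately show ?thesis using scale[OF z, of 0] by simp
  qed
  let ?x = "\<lambda>F a i. if i \<in> F then a (?u i) else (0 :: 'k)"
  have lc: "V.lincomb a (?u ` F) = \<Psi> (?x F a)" if F: "F \<subseteq> I" for F a
    using finite_subset[OF F I] F
  proof (induct F rule: finite_induct)
    case empty
    have "V.lincomb a {} = \<zero>\<^bsub>V\<^esub>" by (simp add: V.lincomb_def)
    then show ?case using \<Psi>0 by (simp add: zero_fun_def)
  next
    case (insert i F)
    have n: "?u i \<notin> ?u ` F" using insert uI by (auto simp: inj_on_def)
    have sF: "?u ` F \<subseteq> carrier V" "?u i \<in> carrier V" using insert(4) by (auto intro!: cl unitv_in)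
    have "V.lincomb a (?u ` insert i F) = V.lincomb a (?u ` F \<union> {?u i})" by simp
    also have "\<dots> = a (?u i) \<odot>\<^bsub>V\<^esub> ?u i \<oplus>\<^bsub>V\<^esub> V.lincomb a (?u ` F)"
      by (rule V.lincomb_insert) (use insert sF n in auto)
    also have "\<dots> = \<Psi> (scl (a (?u i)) (unitv i)) \<oplus>\<^bsub>V\<^esub> \<Psi> (?x F a)"
      using insert scale[OF unitv_in] by simp
    also have "\<dots> = \<Psi> (scl (a (?u i)) (unitv i) + ?x F a)"
      by (rule add[symmetric]) (use insert in \<open>auto simp: supp_sp_def unitv_def\<close>)
    also have "scl (a (?u i)) (unitv i) + ?x F a = ?x (insert i F) a"
      using insert by (auto simp: unitv_def fun_eq_iff)
    finally show ?case .
  qed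
  have B: "finite (?u ` I)" "?u ` I \<subseteq> carrier V" using I by (auto intro!: cl unitv_in)
  have "V.basis (?u ` I)"
    unfolding V.basis_criterion[OF B]
  proof (intro allI impI)
    fix v assume "v \<in> carrier V"
    then obtain x where x: "x \<in> supp_sp I" "v = \<Psi> x" using bij by (auto simp: bij_betw_def)
    let ?a = "restrict (\<lambda>w. x (inv_into I ?u w)) (?u ` I)"
    have xa: "?x I ?a = x" using x(1) by (auto simp: fun_eq_iff supp_sp_def inv_into_f_f[OF uI])
    show "\<exists>!a. a \<in> ?u ` I \<rightarrow>\<^sub>E carrier (class_ring :: 'k ring) \<and> V.lincomb a (?u ` I) = v"
    proof (rule ex1I[of _ ?a])
      show "?a \<in> ?u ` I \<rightarrow>\<^sub>E carrier (class_ring :: 'k ring) \<and> V.lincomb ?a (?u ` I) = v"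
        unfolding lc[OF order.refl] xa using x(2) by (auto simp: class_ring_simps)
      fix a assume a: "a \<in> ?u ` I \<rightarrow>\<^sub>E carrier (class_ring :: 'k ring) \<and> V.lincomb a (?u ` I) = v"
      then have "\<Psi> (?x I a) = \<Psi> x" unfolding lc[OF order.refl] using x(2) by simp
      then have e: "?x I a = x" by (rule inj[OF _ _ x(1)]) (auto simp: supp_sp_def)
      show "a = ?a"
      proof (rule extensionalityI[of _ "?u ` I"])
        show "a \<in> extensional (?u ` I)" using a by (auto simp: PiE_def)
        show "a w = ?a w" if "w \<in> ?u ` I" for w
        proof -
          obtain i where "i \<in> I" "w = ?u i" using \<open>w \<in> ?u ` I\<close> by blast
          then show ?thesis using fun_cong[OF e, of i] by (simp add: inv_into_f_f[OF uI])
        qed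
      qed simp
    qed
  qed
  then show "V.fin_dim" "V.dim = card I"
    using B V.dim_basis[OF B(1)] card_image[OF uI] by (auto simp: V.basis_def V.fin_dim_def)
qed

lemma coord_space_iso:
  fixes V :: "('k::field, 'm) module"
  assumes V: "vectorspace (class_ring :: 'k ring) V" and fd: "vectorspace.fin_dim (class_ring :: 'k ring) V"
  shows "\<exists>n (\<Psi> :: (nat \<Rightarrow> 'k) \<Rightarrow> 'm). bij_betw \<Psi> (supp_sp {..<n}) (carrier V) \<and>
    (\<forall>x y. \<Psi> (x + y) = \<Psi> x \<oplus>\<^bsub>V\<^esub> \<Psi> y) \<and> (\<forall>c x. \<Psi> (scl c x) = c \<odot>\<^bsub>V\<^esub> \<Psi> x)"
proof -
  interpret V: vectorspace "class_ring :: 'k ring" V by (rule V)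
  obtain \<beta> where \<beta>: "finite \<beta>" "V.basis \<beta>" using V.finite_basis_exists[OF fd] by blast
  have \<beta>V: "\<beta> \<subseteq> carrier V" using \<beta>(2) by (simp add: V.basis_def)
  have crit: "\<And>v. v \<in> carrier V \<Longrightarrow> \<exists>!a. a \<in> \<beta> \<rightarrow>\<^sub>E carrier (class_ring :: 'k ring) \<and> V.lincomb a \<beta> = v"
    using V.basis_criterion[OF \<beta>(1) \<beta>V] \<beta>(2) by blast
  obtain e where e: "bij_betw e {..<card \<beta>} \<beta>" using ex_bij_betw_nat_finite[OF \<beta>(1)] by (auto simp: atLeast0LessThan)
  let ?I = "{..<card \<beta>}"
  define r where "r x = restrict (\<lambda>w. x (inv_into ?I e w)) \<beta>" for x :: "nat \<Rightarrow> 'k"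
  define \<Psi> where "\<Psi> x = V.lincomb (r x) \<beta>" for x
  have re: "r x (e i) = x i" if "i \<in> ?I" for x i using that e by (auto simp: r_def bij_betw_def)
  have rP: "r x \<in> \<beta> \<rightarrow> carrier (class_ring :: 'k ring)" "r x \<in> \<beta> \<rightarrow>\<^sub>E carrier (class_ring :: 'k ring)" for x
    by (auto simp: r_def class_ring_simps)
  have \<Psi>c: "\<Psi> x \<in> carrier V" for x unfolding \<Psi>_def by (rule V.lincomb_closed[OF \<beta>V rP(1)])
  have "bij_betw \<Psi> (supp_sp ?I) (carrier V)"
    unfolding bij_betw_def
  proof (intro conjI inj_onI)
    fix x y :: "nat \<Rightarrow> 'k" assume xy: "x \<in> supp_sp ?I" "y \<in> supp_sp ?I" "\<Psi> x = \<Psi> y"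
    then have "r x = r y" using crit[OF \<Psi>c[of x]] rP(2) unfolding \<Psi>_def by metis
    then have "x i = y i" if "i \<in> ?I" for i using re[OF that, of x] re[OF that, of y] by simp
    then show "x = y" using xy(1,2) by (auto simp: supp_sp_def fun_eq_iff) (metis lessThan_iff)
  next
    have "v \<in> \<Psi> ` supp_sp ?I" if v: "v \<in> carrier V" for v
    proof -
      obtain a where a: "a \<in> \<beta> \<rightarrow>\<^sub>E carrier (class_ring :: 'k ring)" "V.lincomb a \<beta> = v" using crit[OF v] by blast
      let ?x = "\<lambda>i. if i \<in> ?I then a (e i) else 0"
      have "r ?x = a"
      proof (rule extensionalityI[of _ \<beta>])
        show "r ?x w = a w" if w: "w \<in> \<beta>" for w
        proof -
          obtain i where "i \<in> ?I" "w = e i" using w e by (auto simp: bij_betw_def image_iff)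
          then show ?thesis using re[of i ?x] by simp
        qed
      qed (use a(1) in \<open>auto simp: PiE_def r_def\<close>)
      then have "\<Psi> ?x = v" using a(2) by (simp add: \<Psi>_def)
      moreover have "?x \<in> supp_sp ?I" by (auto simp: supp_sp_def)
      ultimately show ?thesis by blast
    qed
    then show "\<Psi> ` supp_sp ?I = carrier V" using \<Psi>c by auto
  qed
  moreover have "\<Psi> (x + y) = \<Psi> x \<oplus>\<^bsub>V\<^esub> \<Psi> y" for x y
  proof -
    have "\<Psi> (x + y) = V.lincomb (\<lambda>w. r x w \<oplus>\<^bsub>class_ring\<^esub> r y w) \<beta>"
      unfolding \<Psi>_def by (rule V.lincomb_cong[OF refl \<beta>V]) (auto simp: r_def class_ring_simps)
    then show ?thesis unfolding \<Psi>_def using V.lincomb_sum[OF \<beta>(1) \<beta>V rP(1) rP(1)] by simp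
  qed
  moreover have "\<Psi> (scl c x) = c \<odot>\<^bsub>V\<^esub> \<Psi> x" for c x
  proof -
    have "\<Psi> (scl c x) = V.lincomb (\<lambda>w. c \<otimes>\<^bsub>class_ring\<^esub> r x w) \<beta>"
      unfolding \<Psi>_def by (rule V.lincomb_cong[OF refl \<beta>V]) (auto simp: r_def class_ring_simps)
    then show ?thesis unfolding \<Psi>_def using V.lincomb_smult[OF \<beta>V rP(1), of c x] by (simp add: class_ring_simps)
  qed
  ultimately show ?thesis by blast
qed

section \<open>Modules over an algebra\<close>

locale alg_module = fixes \<Lambda> :: "('k::field, 'r) module" and X :: "('r, 'm) module"
  assumes K: "K_algebra \<Lambda>" and X: "left_module \<Lambda> X"
begin

sublocale L: K_algebra \<Lambda> by (rule K)
sublocale X: left_module \<Lambda> X by (rule X)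

abbreviation act :: "'k \<Rightarrow> 'm \<Rightarrow> 'm" where "act c x \<equiv> (c \<odot>\<^bsub>\<Lambda>\<^esub> \<one>\<^bsub>\<Lambda>\<^esub>) \<odot>\<^bsub>X\<^esub> x"

lemma sc1: "c \<odot>\<^bsub>\<Lambda>\<^esub> \<one>\<^bsub>\<Lambda>\<^esub> \<in> carrier \<Lambda>" by (simp add: L.smult_closed')

lemma act_simps:
  assumes "x \<in> carrier X"
  shows "act c x \<in> carrier X" "act (c + d) x = act c x \<oplus>\<^bsub>X\<^esub> act d x" "act (c * d) x = act c (act d x)" "act 1 x = x"
    "y \<in> carrier X \<Longrightarrow> act c (x \<oplus>\<^bsub>X\<^esub> y) = act c x \<oplus>\<^bsub>X\<^esub> act c y"
    "a \<in> carrier \<Lambda> \<Longrightarrow> act c (a \<odot>\<^bsub>X\<^esub> x) = (c \<odot>\<^bsub>\<Lambda>\<^esub> a) \<odot>\<^bsub>X\<^esub> x"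
    "a \<in> carrier \<Lambda> \<Longrightarrow> a \<odot>\<^bsub>X\<^esub> act c x = act c (a \<odot>\<^bsub>X\<^esub> x)"
proof -
  show "act c x \<in> carrier X" "act 1 x = x" "y \<in> carrier X \<Longrightarrow> act c (x \<oplus>\<^bsub>X\<^esub> y) = act c x \<oplus>\<^bsub>X\<^esub> act c y"
    using assms sc1 by (auto simp: X.smult_closed X.smult_r_distr L.smult_one' X.smult_one)
  show "act (c + d) x = act c x \<oplus>\<^bsub>X\<^esub> act d x" using assms sc1 by (simp add: L.smult_l_distr' X.smult_l_distr)
  have "(c * d) \<odot>\<^bsub>\<Lambda>\<^esub> \<one>\<^bsub>\<Lambda>\<^esub> = (c \<odot>\<^bsub>\<Lambda>\<^esub> \<one>\<^bsub>\<Lambda>\<^esub>) \<otimes>\<^bsub>\<Lambda>\<^esub> (d \<odot>\<^bsub>\<Lambda>\<^esub> \<one>\<^bsub>\<Lambda>\<^esub>)"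
    using L.smult_via_one[OF sc1[of d], of c] by (simp add: L.smult_assoc')
  then show "act (c * d) x = act c (act d x)" using assms sc1 by (simp add: X.smult_assoc)
  assume a: "a \<in> carrier \<Lambda>"
  show 1: "act c (a \<odot>\<^bsub>X\<^esub> x) = (c \<odot>\<^bsub>\<Lambda>\<^esub> a) \<odot>\<^bsub>X\<^esub> x"
    unfolding L.smult_via_one[OF a, of c] using a assms sc1 by (simp add: X.smult_assoc)
  have "a \<otimes>\<^bsub>\<Lambda>\<^esub> (c \<odot>\<^bsub>\<Lambda>\<^esub> \<one>\<^bsub>\<Lambda>\<^esub>) = c \<odot>\<^bsub>\<Lambda>\<^esub> a" using L.smult_mult_right[OF a L.one_closed] a by simp
  then show "a \<odot>\<^bsub>X\<^esub> act c x = act c (a \<odot>\<^bsub>X\<^esub> x)" unfolding 1 using X.smult_assoc[OF a sc1 assms, of c] by simp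
qed

lemma zero_unique: "x \<in> carrier X \<Longrightarrow> x \<oplus>\<^bsub>X\<^esub> x = x \<Longrightarrow> x = \<zero>\<^bsub>X\<^esub>"
  using X.M.add.l_cancel_one[of x x] by simp

lemma act_zero: "x \<in> carrier X \<Longrightarrow> act 0 x = \<zero>\<^bsub>X\<^esub>"
  using act_simps(2)[of x 0 0] by (intro zero_unique) (auto simp: act_simps(1))

lemma act_neg: "x \<in> carrier X \<Longrightarrow> act (- 1) x \<oplus>\<^bsub>X\<^esub> x = \<zero>\<^bsub>X\<^esub>" "x \<in> carrier X \<Longrightarrow> \<ominus>\<^bsub>X\<^esub> x = act (- 1) x"
proof -
  assume x: "x \<in> carrier X"
  show 1: "act (- 1) x \<oplus>\<^bsub>X\<^esub> x = \<zero>\<^bsub>X\<^esub>" using act_simps(2)[OF x, of "- 1" 1] act_zero[OF x] act_simps(4)[OF x] by simp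
  show "\<ominus>\<^bsub>X\<^esub> x = act (- 1) x" by (rule X.M.minus_equality[OF 1 x act_simps(1)[OF x]])
qed

lemma bfs_simps: "carrier (base_field_space \<Lambda> X) = carrier X" "\<zero>\<^bsub>base_field_space \<Lambda> X\<^esub> = \<zero>\<^bsub>X\<^esub>"
  "x \<oplus>\<^bsub>base_field_space \<Lambda> X\<^esub> y = x \<oplus>\<^bsub>X\<^esub> y" "c \<odot>\<^bsub>base_field_space \<Lambda> X\<^esub> x = act c x"
  by (simp_all add: base_field_space_def ring.extend_def ring.truncate_def module.fields_def)

lemma subspace_vectorspace:
  assumes N: "N \<subseteq> carrier X" "\<zero>\<^bsub>X\<^esub> \<in> N" "\<And>x y. x \<in> N \<Longrightarrow> y \<in> N \<Longrightarrow> x \<oplus>\<^bsub>X\<^esub> y \<in> N" "\<And>c x. x \<in> N \<Longrightarrow> act c x \<in> N"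
  shows "vectorspace (class_ring :: 'k ring) ((base_field_space \<Lambda> X) \<lparr>carrier := N\<rparr>)"
proof -
  let ?V = "(base_field_space \<Lambda> X) \<lparr>carrier := N\<rparr>"
  have NX: "x \<in> carrier X" if "x \<in> N" for x using N(1) that by blast
  have "abelian_group ?V"
  proof (rule abelian_groupI)
    show "\<exists>y\<in>carrier ?V. y \<oplus>\<^bsub>?V\<^esub> x = \<zero>\<^bsub>?V\<^esub>" if "x \<in> carrier ?V" for x
      using that N(4)[of x "- 1"] act_neg(1)[OF NX[of x]] by (intro bexI[of _ "act (- 1) x"]) (auto simp: bfs_simps)
  qed (use N(2,3) NX in \<open>auto simp: bfs_simps X.M.a_ac\<close>)
  then show ?thesis
    by (intro vectorspace.intro Module.moduleI)
      (use N(4) NX class_field.field_axioms class_cring.cring_axioms in \<open>auto simp: bfs_simps act_simps(1-5) class_ring_simps\<close>)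
qed

lemma bfs_vectorspace: "vectorspace (class_ring :: 'k ring) (base_field_space \<Lambda> X)"
proof -
  have "(base_field_space \<Lambda> X) \<lparr>carrier := carrier X\<rparr> = base_field_space \<Lambda> X"
    unfolding bfs_simps(1)[symmetric] by simp
  then show ?thesis using subspace_vectorspace[of "carrier X"] by (auto simp: act_simps)
qed

lemma submoduleI:
  assumes N: "N \<subseteq> carrier X" "\<zero>\<^bsub>X\<^esub> \<in> N" "\<And>x y. x \<in> N \<Longrightarrow> y \<in> N \<Longrightarrow> x \<oplus>\<^bsub>X\<^esub> y \<in> N"
    "\<And>a x. a \<in> carrier \<Lambda> \<Longrightarrow> x \<in> N \<Longrightarrow> a \<odot>\<^bsub>X\<^esub> x \<in> N"
  shows "Module.submodule N \<Lambda> X"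
proof (intro Module.submodule.intro Module.submodule_axioms.intro subgroup.intro)
  show "inv\<^bsub>add_monoid X\<^esub> x \<in> N" if "x \<in> N" for x
    using act_neg(2)[of x] N(4)[OF sc1 that, of "- 1"] N(1) that by (auto simp: a_inv_def)
qed (use N in auto)

lemma submoduleD:
  assumes "Module.submodule N \<Lambda> X"
  shows "N \<subseteq> carrier X" "\<zero>\<^bsub>X\<^esub> \<in> N" "x \<in> N \<Longrightarrow> y \<in> N \<Longrightarrow> x \<oplus>\<^bsub>X\<^esub> y \<in> N" "a \<in> carrier \<Lambda> \<Longrightarrow> x \<in> N \<Longrightarrow> a \<odot>\<^bsub>X\<^esub> x \<in> N"
  using assms subgroup.subset[of N "add_monoid X"] subgroup.one_closed[of N "add_monoid X"] subgroup.m_closed[of N "add_monoid X" x y]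
  by (auto simp: Module.submodule_def Module.submodule_axioms_def)

text \<open>A system of coordinates on a module turns its action into a homomorphism to a corner of the endomorphism
  ring, the corner being cut out by the projection to the coordinates used.\<close>
lemma coordinate_hom:
  fixes \<Phi> :: "(nat \<Rightarrow> 'k) \<Rightarrow> 'm"
  assumes bij: "bij_betw \<Phi> (supp_sp T) (carrier X)"
    and add: "\<And>x y. x \<in> supp_sp T \<Longrightarrow> y \<in> supp_sp T \<Longrightarrow> \<Phi> (x + y) = \<Phi> x \<oplus>\<^bsub>X\<^esub> \<Phi> y"
    and scale: "\<And>c x. x \<in> supp_sp T \<Longrightarrow> \<Phi> (scl c x) = act c (\<Phi> x)"
  shows "\<exists>g. g \<in> algebra_hom \<Lambda> (corner sc (pr T :: 'k endo) UNIV) \<and>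
    (\<forall>a\<in>carrier \<Lambda>. \<forall>x\<in>supp_sp T. \<Phi> (app (g a) x) = a \<odot>\<^bsub>X\<^esub> \<Phi> x)"
proof -
  define \<Psi> where "\<Psi> = inv_into (supp_sp T) \<Phi>"
  have \<Phi>c: "\<Phi> x \<in> carrier X" if "x \<in> supp_sp T" for x using bij that by (auto simp: bij_betw_def)
  have \<Psi>: "\<Psi> m \<in> supp_sp T" "\<Phi> (\<Psi> m) = m" if "m \<in> carrier X" for m
    using bij that unfolding \<Psi>_def by (auto simp: bij_betw_def inv_into_into f_inv_into_f)
  have inj: "x = y" if "\<Phi> x = \<Phi> y" "x \<in> supp_sp T" "y \<in> supp_sp T" for x y
    using bij that by (auto simp: bij_betw_def inj_on_def)
  define G where "G a x = \<Psi> (a \<odot>\<^bsub>X\<^esub> \<Phi> (app (pr T) x))" for a x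
  note pT = pr_in[of T]
  have G: "G a x \<in> supp_sp T" "\<Phi> (G a x) = a \<odot>\<^bsub>X\<^esub> \<Phi> (app (pr T) x)" if "a \<in> carrier \<Lambda>" for a x
    unfolding G_def using \<Psi>[OF X.smult_closed[OF that \<Phi>c[OF pT]]] by auto
  have lin: "Vector_Spaces.linear scl scl (G a)" if a: "a \<in> carrier \<Lambda>" for a
  proof -
    have "G a (x + y) = G a x + G a y" for x y
      by (rule inj) (simp_all add: G[OF a] supp_sp_closed add app_vec(1) pT X.smult_r_distr[OF a] \<Phi>c del: app_pr)
    moreover have "G a (scl c x) = scl c (G a x)" for c x
      by (rule inj) (simp_all add: G[OF a] supp_sp_closed scale app_vec(2) pT act_simps(7)[OF _ a] \<Phi>c del: app_pr)
    ultimately show ?thesis unfolding fv_linear by blast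
  qed
  define g where "g a = Endo (G a)" for a
  have g: "app (g a) = G a" if "a \<in> carrier \<Lambda>" for a unfolding g_def using lin[OF that] by (simp add: Endo_inverse)
  have c1: "pr T * g a = g a" if a: "a \<in> carrier \<Lambda>" for a
    by (rule endo_eqI) (simp add: g[OF a] pr_supp[THEN iffD2, OF G(1)[OF a]] del: app_pr)
  have pp: "app (pr T) (app (pr T) x) = app (pr T) x" for x :: "nat \<Rightarrow> 'k" using pT pr_supp by blast
  have c2: "g a * pr T = g a" if a: "a \<in> carrier \<Lambda>" for a
    by (rule endo_eqI) (simp add: g[OF a] G_def pp del: app_pr)
  have eq: "f = f'" if "pr T * f = f" "pr T * f' = f'" "\<And>x. \<Phi> (app f x) = \<Phi> (app f' x)" for f f' :: "'k endo"
  proof (rule endo_eqI)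
    fix x
    have "app f x \<in> supp_sp T" "app f' x \<in> supp_sp T" using that(1,2) pr_supp by (metis app_simps(6))+
    then show "app f x = app f' x" using that(3) inj by blast
  qed
  have \<Phi>g: "\<Phi> (app (g a) x) = a \<odot>\<^bsub>X\<^esub> \<Phi> (app (pr T) x)" if "a \<in> carrier \<Lambda>" for a x using G[OF that] g[OF that] by simp
  have gs: "app (g a) x \<in> supp_sp T" if "a \<in> carrier \<Lambda>" for a x using G[OF that] g[OF that] by simp
  have prg: "app (pr T) (app (g a) x) = app (g a) x" if "a \<in> carrier \<Lambda>" for a x using gs[OF that] pr_supp by blast
  have "g (a \<otimes>\<^bsub>\<Lambda>\<^esub> b) = g a * g b" if "a \<in> carrier \<Lambda>" "b \<in> carrier \<Lambda>" for a b
    by (rule eq) (simp_all add: c1 that mult.assoc[symmetric] \<Phi>g prg X.smult_assoc \<Phi>c pT del: app_pr)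
  moreover have "g (a \<oplus>\<^bsub>\<Lambda>\<^esub> b) = g a + g b" if "a \<in> carrier \<Lambda>" "b \<in> carrier \<Lambda>" for a b
    by (rule eq) (simp_all add: c1 that distrib_left \<Phi>g add gs X.smult_l_distr \<Phi>c pT del: app_pr)
  moreover have "g \<one>\<^bsub>\<Lambda>\<^esub> = pr T"
    by (rule eq) (simp_all add: c1 pr_mult \<Phi>g X.smult_one \<Phi>c pT del: app_pr)
  moreover have "g (c \<odot>\<^bsub>\<Lambda>\<^esub> a) = sc c * g a" if a: "a \<in> carrier \<Lambda>" for a c
    by (rule eq) (simp_all add: c1 a sc_left[of "pr T"] L.smult_closed' \<Phi>g scale[OF gs[OF a]] act_simps(6) \<Phi>c pT del: app_pr)
  ultimately have "g \<in> algebra_hom \<Lambda> (corner sc (pr T) UNIV)"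
    unfolding algebra_hom_def Ring.ring_hom_def corner_def using c1 c2 by auto
  moreover have "\<Phi> (app (g a) x) = a \<odot>\<^bsub>X\<^esub> \<Phi> x" if "a \<in> carrier \<Lambda>" "x \<in> supp_sp T" for a x
    using \<Phi>g[OF that(1), of x] that(2) pr_supp by metis
  ultimately show ?thesis by blast
qed

end

section \<open>Vanishing of the first extension group\<close>

text \<open>An extension is equivalent to the split one if and only if it has a section.\<close>
lemma Ext1_trivial_iff:
  assumes M: "left_module R M" and N: "left_module R N"
  shows "Ext1 R M N = {Ext1_zero R M N} \<longleftrightarrow>
    (\<forall>E i p. (E, i, p) \<in> extensions R M N \<longrightarrow> (\<exists>s\<in>left_module_hom R M E. \<forall>x\<in>carrier M. p (s x) = x))"
proof -
  interpret M: left_module R M by (rule M)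
  interpret N: left_module R N by (rule N)
  let ?Z = "(direct_sum N M, \<lambda>y. (y, \<zero>\<^bsub>M\<^esub>), snd)"
  note ze = split_extension[OF M N] and eq = equiv_ext_equiv[of R M N]
  have cls: "(?Z, (E, i, p)) \<in> ext_equiv R M N \<longleftrightarrow> (\<exists>s\<in>left_module_hom R M E. \<forall>x\<in>carrier M. p (s x) = x)"
    if e: "(E, i, p) \<in> extensions R M N" for E i p
  proof -
    interpret E: left_module R E using e by (auto simp: extensions_def)
    have i: "i y \<in> carrier E" "i (y \<oplus>\<^bsub>N\<^esub> y') = i y \<oplus>\<^bsub>E\<^esub> i y'" "a \<in> carrier R \<Longrightarrow> i (a \<odot>\<^bsub>N\<^esub> y) = a \<odot>\<^bsub>E\<^esub> i y" "p (i y) = \<zero>\<^bsub>M\<^esub>"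
      if "y \<in> carrier N" "y' \<in> carrier N" for y y' a using e that by (auto simp: extensions_def left_module_hom_def Pi_iff)
    have p: "p x \<in> carrier M" "p (x \<oplus>\<^bsub>E\<^esub> x') = p x \<oplus>\<^bsub>M\<^esub> p x'" "a \<in> carrier R \<Longrightarrow> p (a \<odot>\<^bsub>E\<^esub> x) = a \<odot>\<^bsub>M\<^esub> p x"
      if "x \<in> carrier E" "x' \<in> carrier E" for x x' a using e that by (auto simp: extensions_def left_module_hom_def Pi_iff)
    have ii: "inj_on i (carrier N)" and ker: "i ` carrier N = {x \<in> carrier E. p x = \<zero>\<^bsub>M\<^esub>}" using e by (auto simp: extensions_def)
    have i0: "i \<zero>\<^bsub>N\<^esub> = \<zero>\<^bsub>E\<^esub>" using i(1,2)[of "\<zero>\<^bsub>N\<^esub>" "\<zero>\<^bsub>N\<^esub>"] E.M.add.l_cancel_one[of "i \<zero>\<^bsub>N\<^esub>" "i \<zero>\<^bsub>N\<^esub>"] by simp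
    show ?thesis
    proof
      assume "(?Z, (E, i, p)) \<in> ext_equiv R M N"
      then obtain f where f: "f \<in> left_module_hom R (direct_sum N M) E" "\<And>x. x \<in> carrier (direct_sum N M) \<Longrightarrow> p (f x) = snd x"
        by (auto simp: ext_equiv_def)
      have "(\<lambda>m. f (\<zero>\<^bsub>N\<^esub>, m)) \<in> left_module_hom R M E"
      proof -
        have fd: "f (z \<oplus>\<^bsub>direct_sum N M\<^esub> z') = f z \<oplus>\<^bsub>E\<^esub> f z'" "a \<in> carrier R \<Longrightarrow> f (a \<odot>\<^bsub>direct_sum N M\<^esub> z) = a \<odot>\<^bsub>E\<^esub> f z"
          "f z \<in> carrier E" if "z \<in> carrier (direct_sum N M)" "z' \<in> carrier (direct_sum N M)" for z z' a
          using f(1) that unfolding left_module_hom_def by blast+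
        have "f (\<zero>\<^bsub>N\<^esub>, m \<oplus>\<^bsub>M\<^esub> m') = f (\<zero>\<^bsub>N\<^esub>, m) \<oplus>\<^bsub>E\<^esub> f (\<zero>\<^bsub>N\<^esub>, m')" if "m \<in> carrier M" "m' \<in> carrier M" for m m'
        proof -
          have "f ((\<zero>\<^bsub>N\<^esub>, m) \<oplus>\<^bsub>direct_sum N M\<^esub> (\<zero>\<^bsub>N\<^esub>, m')) = f (\<zero>\<^bsub>N\<^esub>, m) \<oplus>\<^bsub>E\<^esub> f (\<zero>\<^bsub>N\<^esub>, m')"
            by (rule fd(1)) (use that in \<open>simp_all add: direct_sum_def\<close>)
          then show ?thesis by (simp add: direct_sum_def)
        qed
        moreover have "f (\<zero>\<^bsub>N\<^esub>, a \<odot>\<^bsub>M\<^esub> m) = a \<odot>\<^bsub>E\<^esub> f (\<zero>\<^bsub>N\<^esub>, m)" if "m \<in> carrier M" "a \<in> carrier R" for m a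
        proof -
          have "f (a \<odot>\<^bsub>direct_sum N M\<^esub> (\<zero>\<^bsub>N\<^esub>, m)) = a \<odot>\<^bsub>E\<^esub> f (\<zero>\<^bsub>N\<^esub>, m)"
            by (rule fd(2)[of "(\<zero>\<^bsub>N\<^esub>, m)" "(\<zero>\<^bsub>N\<^esub>, m)" a]) (use that in \<open>simp_all add: direct_sum_def\<close>)
          then show ?thesis using smult_zero_right[OF N that(2)] by (simp add: direct_sum_def)
        qed
        moreover have "f (\<zero>\<^bsub>N\<^esub>, m) \<in> carrier E" if "m \<in> carrier M" for m
          by (rule fd(3)[of "(\<zero>\<^bsub>N\<^esub>, m)" "(\<zero>\<^bsub>N\<^esub>, m)"]) (use that in \<open>simp_all add: direct_sum_def\<close>)
        ultimately show ?thesis unfolding left_module_hom_def by auto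
      qed
      then show "\<exists>s\<in>left_module_hom R M E. \<forall>x\<in>carrier M. p (s x) = x"
        by (rule bexI[rotated]) (use f(2) in \<open>auto simp: direct_sum_def\<close>)
    next
      assume "\<exists>s\<in>left_module_hom R M E. \<forall>x\<in>carrier M. p (s x) = x"
      then obtain s where s: "s \<in> left_module_hom R M E" "\<And>x. x \<in> carrier M \<Longrightarrow> p (s x) = x" by blast
      have sd: "s m \<in> carrier E" "s (m \<oplus>\<^bsub>M\<^esub> m') = s m \<oplus>\<^bsub>E\<^esub> s m'" "a \<in> carrier R \<Longrightarrow> s (a \<odot>\<^bsub>M\<^esub> m) = a \<odot>\<^bsub>E\<^esub> s m"
        if "m \<in> carrier M" "m' \<in> carrier M" for m m' a using s(1) that by (auto simp: left_module_hom_def)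
      have s0: "s \<zero>\<^bsub>M\<^esub> = \<zero>\<^bsub>E\<^esub>" using sd(1,2)[of "\<zero>\<^bsub>M\<^esub>" "\<zero>\<^bsub>M\<^esub>"] E.M.add.l_cancel_one[of "s \<zero>\<^bsub>M\<^esub>" "s \<zero>\<^bsub>M\<^esub>"] by simp
      define f where "f = (\<lambda>(y, m). i y \<oplus>\<^bsub>E\<^esub> s m)"
      have pf: "p (f (y, m)) = m" if "y \<in> carrier N" "m \<in> carrier M" for y m
        using that by (simp add: f_def p(2) i sd(1) s(2))
      have "f \<in> left_module_hom R (direct_sum N M) E"
        unfolding left_module_hom_def f_def direct_sum_def
        by (auto simp: i sd E.smult_r_distr E.M.a_ac)
      moreover have "bij_betw f (carrier (direct_sum N M)) (carrier E)"
        unfolding bij_betw_def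
      proof (intro conjI inj_onI equalityI subsetI)
        fix z z' assume "z \<in> carrier (direct_sum N M)" "z' \<in> carrier (direct_sum N M)" and e: "f z = f z'"
        then obtain y m y' m' where z: "z = (y, m)" "z' = (y', m')" "y \<in> carrier N" "y' \<in> carrier N" "m \<in> carrier M" "m' \<in> carrier M"
          by (auto simp: direct_sum_def)
        then have m: "m = m'" using pf[of y m] pf[of y' m'] e by simp
        then have "i y = i y'" using e z sd(1) i(1) by (simp add: f_def)
        then show "z = z'" using ii z m by (auto simp: inj_on_def)
      next
        fix x assume "x \<in> f ` carrier (direct_sum N M)"
        then show "x \<in> carrier E" using i(1) sd(1) by (auto simp: direct_sum_def f_def)
      next
        fix x assume x: "x \<in> carrier E"
        let ?s = "s (p x)"
        have sc: "?s \<in> carrier E" using sd(1) p(1) x by blast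
        have d: "x \<ominus>\<^bsub>E\<^esub> ?s \<in> carrier E" using x sc by simp
        have xs: "(x \<ominus>\<^bsub>E\<^esub> ?s) \<oplus>\<^bsub>E\<^esub> ?s = x" using x sc by (simp add: a_minus_def E.M.a_assoc E.M.l_neg)
        have "p (x \<ominus>\<^bsub>E\<^esub> ?s) \<oplus>\<^bsub>M\<^esub> p x = p x" using p(2)[OF d sc] xs s(2) p(1)[OF x x] by simp
        then have "p (x \<ominus>\<^bsub>E\<^esub> ?s) = \<zero>\<^bsub>M\<^esub>" using p(1)[OF d d] p(1)[OF x x] M.M.add.r_cancel_one by blast
        then obtain y where y: "y \<in> carrier N" "i y = x \<ominus>\<^bsub>E\<^esub> ?s" using ker d by (metis (mono_tags, lifting) image_iff mem_Collect_eq)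
        have "f (y, p x) = x" using xs y by (simp add: f_def)
        then show "x \<in> f ` carrier (direct_sum N M)" using y(1) p(1)[OF x x] by (force simp: direct_sum_def)
      qed
      moreover have "\<forall>y\<in>carrier N. f (y, \<zero>\<^bsub>M\<^esub>) = i y" using s0 i(1) by (simp add: f_def)
      moreover have "\<forall>z\<in>carrier (direct_sum N M). p (f z) = snd z" using pf by (auto simp: direct_sum_def)
      ultimately show "(?Z, (E, i, p)) \<in> ext_equiv R M N" unfolding ext_equiv_def using e ze by blast
    qed
  qed
  have "Ext1 R M N = {Ext1_zero R M N} \<longleftrightarrow> (\<forall>e\<in>extensions R M N. (?Z, e) \<in> ext_equiv R M N)"
  proof
    assume a: "Ext1 R M N = {Ext1_zero R M N}"
    show "\<forall>e\<in>extensions R M N. (?Z, e) \<in> ext_equiv R M N"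
    proof
      fix e assume e: "e \<in> extensions R M N"
      then have "ext_equiv R M N `` {e} \<in> Ext1 R M N" unfolding Ext1_def by (rule quotientI)
      then have "ext_equiv R M N `` {e} = ext_equiv R M N `` {?Z}" using a by (simp add: Ext1_zero_def)
      then show "(?Z, e) \<in> ext_equiv R M N" using eq_equiv_class_iff[OF eq ze e] by simp
    qed
  next
    assume a: "\<forall>e\<in>extensions R M N. (?Z, e) \<in> ext_equiv R M N"
    have "ext_equiv R M N `` {e} = Ext1_zero R M N" if "e \<in> extensions R M N" for e
      using equiv_class_eq[OF eq] a that unfolding Ext1_zero_def by blast
    moreover have "Ext1_zero R M N \<in> Ext1 R M N" unfolding Ext1_def Ext1_zero_def by (rule quotientI[OF ze])
    ultimately show "Ext1 R M N = {Ext1_zero R M N}" unfolding Ext1_def quotient_def by blast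
  qed
  then show ?thesis using cls by (auto simp: split_paired_all)
qed

section \<open>Modules in coordinates\<close>

context mult_preproj begin

lemma mpa_rep_cong: "mpa_rep sm q E A \<Longrightarrow> (\<And>v. v \<in> verts Q \<Longrightarrow> E v = E' v) \<Longrightarrow> (\<And>b. b \<in> arcs D \<Longrightarrow> A b = A' b) \<Longrightarrow> mpa_rep sm q E' A'"
proof -
  assume m: "mpa_rep sm q E A" and e: "\<And>v. v \<in> verts Q \<Longrightarrow> E v = E' v" and a: "\<And>b. b \<in> arcs D \<Longrightarrow> A b = A' b"
  have "map (rel_factor A') bs = map (rel_factor A) bs" using set_bs by (auto simp: rel_factor_def a star_arcs)
  then have pl: "prod_list (map (rel_factor A') bs) = prod_list (map (rel_factor A) bs)" by (rule arg_cong)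
  have "quiver_rep E' A'" using m by (auto simp: mpa_rep_def quiver_rep_def e[symmetric] a[symmetric] ends_verts)
  moreover have "\<forall>b\<in>arcs D. isunit (1 + A' b * A' (star b))" using m by (simp add: mpa_rep_def a[symmetric] star_arcs)
  ultimately show ?thesis using m unfolding mpa_rep_def pl by (simp add: e[symmetric])
qed

lemma sc_corner: "corner_alg sc (pr T :: 'k::field endo) UNIV"
proof unfold_locales
  show "x * sc c = sc c * x" for x :: "'k endo" and c by (rule sc_comm)
qed (simp_all add: sc_simps pr_mult)

lemma dual_corner: "corner_alg (\<lambda>c. Dual (sc c) 0) (Dual (pr T :: 'k::field endo) 0) UNIV"
proof unfold_locales
  show "x * Dual (sc c) 0 = Dual (sc c) 0 * x" for x c by (cases x) (auto simp: dual_mult intro: sc_comm)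
qed (simp_all add: sc_simps pr_mult dual_mult dual_add one_dual_def)

end

text \<open>A module \<open>X\<close> over the algebra together with coordinates \<open>\<Phi>\<close> adapted to the vertices, and the homomorphism \<open>g\<close> by which
  the algebra acts on these coordinates.\<close>
locale coord_mod = mult_preproj Q lt for Q :: "('v, 'a) pre_digraph" and lt +
  fixes q :: "'v \<Rightarrow> 'k::field" and X :: "(('v, 'a, 'k) mpa_elem, 'm) module" and S :: "'v \<Rightarrow> nat set"
    and \<Phi> :: "(nat \<Rightarrow> 'k) \<Rightarrow> 'm" and g :: "('v, 'a, 'k) mpa_elem \<Rightarrow> 'k endo"
  assumes modX: "left_module (mpa Q lt q) X"
    and finS: "\<And>v. v \<in> verts Q \<Longrightarrow> finite (S v)" and disj: "disjoint_family_on S (verts Q)"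
    and bij: "bij_betw \<Phi> (supp_sp (tot S)) (carrier X)"
    and add: "\<And>x y. x \<in> supp_sp (tot S) \<Longrightarrow> y \<in> supp_sp (tot S) \<Longrightarrow> \<Phi> (x + y) = \<Phi> x \<oplus>\<^bsub>X\<^esub> \<Phi> y"
    and g: "g \<in> algebra_hom (mpa Q lt q) (corner sc (pr (tot S)) UNIV)"
    and gE: "\<And>v. v \<in> verts Q \<Longrightarrow> g (mpa_map Q lt q (vertex_elem v)) = pr (S v)"
    and \<Phi>g: "\<And>a x. a \<in> carrier (mpa Q lt q) \<Longrightarrow> x \<in> supp_sp (tot S) \<Longrightarrow> \<Phi> (app (g a) x) = a \<odot>\<^bsub>X\<^esub> \<Phi> x"
begin

abbreviation "\<Lambda> \<equiv> mpa Q lt q"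
abbreviation "SP \<equiv> (supp_sp (tot S) :: (nat \<Rightarrow> 'k) set)"
abbreviation "pt \<equiv> (pr (tot S) :: 'k endo)"

sublocale C0: preproj_corner Q lt sc pt UNIV
  by (intro preproj_corner.intro mult_preproj_axioms sc_corner)
sublocale C1: preproj_corner Q lt "\<lambda>c. Dual (sc c) 0" "Dual pt 0" UNIV
  by (intro preproj_corner.intro mult_preproj_axioms dual_corner)

lemma K\<Lambda>: "K_algebra \<Lambda>" by (rule mpa_K[OF C0.QL])
sublocale M: alg_module \<Lambda> X by (intro alg_module.intro K\<Lambda> modX)

abbreviation "ev v \<equiv> mpa_map Q lt q (vertex_elem v)"
abbreviation "eb b \<equiv> mpa_map Q lt q (arrow_elem D b)"
abbreviation "A \<equiv> \<lambda>b. g (eb b)"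

lemmas G = algebra_homD[OF g]
lemma ev_in: "v \<in> verts Q \<Longrightarrow> ev v \<in> carrier \<Lambda>" by (rule algebra_homD(2)[OF mpa_map_hom[OF C0.QL] C0.ve_closed])
lemma eb_in: "b \<in> arcs D \<Longrightarrow> eb b \<in> carrier \<Lambda>" by (rule algebra_homD(2)[OF mpa_map_hom[OF C0.QL] C0.ae_closed])

lemma g_pt: "a \<in> carrier \<Lambda> \<Longrightarrow> pt * g a = g a" "a \<in> carrier \<Lambda> \<Longrightarrow> g a * pt = g a"
  using G(2)[of a] by (auto simp: C0.C_carrier)

lemma coord_repA: "coord_rep q S A"
  unfolding coord_rep_def using finS disj mpa_rep_cong[OF C0.mpa_rep_of_hom(1)[OF g], of "\<lambda>v. pr (S v)" A] gE by blast

lemmas rD = coord_repD[OF coord_repA]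
lemmas qD = quiver_repD[OF rD(4)]

lemma \<Phi>c: "x \<in> SP \<Longrightarrow> \<Phi> x \<in> carrier X" using bij by (auto simp: bij_betw_def)
lemma \<Phi>inj: "\<Phi> x = \<Phi> y \<Longrightarrow> x \<in> SP \<Longrightarrow> y \<in> SP \<Longrightarrow> x = y" using bij by (auto simp: bij_betw_def inj_on_def)
lemma \<Phi>surj: "m \<in> carrier X \<Longrightarrow> \<exists>x\<in>SP. m = \<Phi> x" using bij by (auto simp: bij_betw_def)
lemma gS: "a \<in> carrier \<Lambda> \<Longrightarrow> app (g a) x \<in> SP"
proof -
  assume a: "a \<in> carrier \<Lambda>"
  have "app pt (app (g a) x) = app (g a) x" using arg_cong[OF g_pt(1)[OF a], of "\<lambda>f. app f x"] by (simp del: app_pr)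
  then show ?thesis using pr_supp by blast
qed
lemma ptS: "x \<in> SP \<Longrightarrow> app pt x = x" using pr_supp by blast
lemma prS: "v \<in> verts Q \<Longrightarrow> app (pr (S v)) x \<in> SP" using gS[OF ev_in, of v x] by (simp add: gE del: app_pr)

lemma scale: "x \<in> SP \<Longrightarrow> \<Phi> (scl c x) = M.act c (\<Phi> x)"
proof -
  assume x: "x \<in> SP"
  have "g (c \<odot>\<^bsub>\<Lambda>\<^esub> \<one>\<^bsub>\<Lambda>\<^esub>) = sc c * pt" using G(6)[OF M.L.one_closed] G(5) by simp
  then have "app (g (c \<odot>\<^bsub>\<Lambda>\<^esub> \<one>\<^bsub>\<Lambda>\<^esub>)) x = scl c x" using ptS[OF x] by (simp del: app_pr)
  then show ?thesis using \<Phi>g[OF M.sc1 x, of c] by simp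
qed

lemma \<Phi>0: "\<Phi> 0 = \<zero>\<^bsub>X\<^esub>"
proof (rule M.zero_unique)
  have z: "0 \<in> SP" by (rule supp_sp_closed(3))
  show "\<Phi> 0 \<in> carrier X" by (rule \<Phi>c[OF z])
  show "\<Phi> 0 \<oplus>\<^bsub>X\<^esub> \<Phi> 0 = \<Phi> 0" using add[OF z z] by simp
qed

lemma fin_dim: "finite_dim_module \<Lambda> X"
proof -
  have "vectorspace.fin_dim (class_ring :: 'k ring) (base_field_space \<Lambda> X)"
    by (rule dim_of_coord_iso(1)[OF M.bfs_vectorspace rD(3), of \<Phi>]) (simp_all add: M.bfs_simps add scale bij)
  then show ?thesis using modX by (simp add: finite_dim_module_def)
qed

lemma dimension: "dimension_vector Q lt q X = dimv S"
proof
  fix v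
  show "dimension_vector Q lt q X v = dimv S v"
  proof (cases "v \<in> verts Q")
    case True
    note e = ev_in[OF True]
    let ?N = "(\<lambda>x. ev v \<odot>\<^bsub>X\<^esub> x) ` carrier X"
    have SS: "supp_sp (S v) \<subseteq> SP" using tot_sub[OF True, of S] by (auto simp: supp_sp_def)
    have SSD: "x \<in> SP" if "x \<in> supp_sp (S v)" for x using SS that by blast
    have \<Phi>e: "ev v \<odot>\<^bsub>X\<^esub> \<Phi> x = \<Phi> (app (pr (S v)) x)" if "x \<in> SP" for x using \<Phi>g[OF e that] by (simp add: gE[OF True] del: app_pr)
    have img: "\<Phi> ` supp_sp (S v) = ?N"
    proof
      show "\<Phi> ` supp_sp (S v) \<subseteq> ?N"
      proof
        fix m assume "m \<in> \<Phi> ` supp_sp (S v)"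
        then obtain x where x: "x \<in> supp_sp (S v)" "m = \<Phi> x" by blast
        then have "m = ev v \<odot>\<^bsub>X\<^esub> \<Phi> x" using \<Phi>e[of x] SS pr_supp[of "S v" x] by auto
        then show "m \<in> ?N" using \<Phi>c[of x] x SS by blast
      qed
      show "?N \<subseteq> \<Phi> ` supp_sp (S v)" using \<Phi>surj \<Phi>e pr_in[of "S v"] by fastforce
    qed
    have VN: "vectorspace (class_ring :: 'k ring) ((base_field_space \<Lambda> X) \<lparr>carrier := ?N\<rparr>)"
    proof (rule M.subspace_vectorspace; unfold img[symmetric])
      show "\<Phi> ` supp_sp (S v) \<subseteq> carrier X" using \<Phi>c SS by auto
      show "\<zero>\<^bsub>X\<^esub> \<in> \<Phi> ` supp_sp (S v)" using \<Phi>0 supp_sp_closed(3)[of "S v"] by (metis image_eqI)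
      show "m \<oplus>\<^bsub>X\<^esub> m' \<in> \<Phi> ` supp_sp (S v)" if mm: "m \<in> \<Phi> ` supp_sp (S v)" "m' \<in> \<Phi> ` supp_sp (S v)" for m m'
      proof -
        obtain x y where x: "x \<in> supp_sp (S v)" "m = \<Phi> x" "y \<in> supp_sp (S v)" "m' = \<Phi> y" using mm by blast
        then have "m \<oplus>\<^bsub>X\<^esub> m' = \<Phi> (x + y)" using add[OF SSD SSD] by simp
        then show ?thesis using supp_sp_closed(1)[OF x(1,3)] by blast
      qed
      show "M.act c m \<in> \<Phi> ` supp_sp (S v)" if mm: "m \<in> \<Phi> ` supp_sp (S v)" for c m
      proof -
        obtain x where x: "x \<in> supp_sp (S v)" "m = \<Phi> x" using mm by blast
        then have "M.act c m = \<Phi> (scl c x)" using scale[OF SSD] by simp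
        then show ?thesis using supp_sp_closed(2)[OF x(1)] by blast
      qed
    qed
    have "vectorspace.dim (class_ring :: 'k ring) ((base_field_space \<Lambda> X) \<lparr>carrier := ?N\<rparr>) = card (S v)"
    proof (rule dim_of_coord_iso(2)[OF VN finS[OF True]])
      show "bij_betw \<Phi> (supp_sp (S v)) (carrier ((base_field_space \<Lambda> X) \<lparr>carrier := ?N\<rparr>))"
        using bij SS img by (auto simp: bij_betw_def intro: inj_on_subset)
    qed (simp_all add: M.bfs_simps add scale SSD)
    then show ?thesis using True by (simp add: dimension_vector_def dimv_def)
  qed (simp add: dimension_vector_def dimv_def)
qed

text \<open>The stabiliser of \<open>U\<close> is a subring to which the universal property applies; inverses stay in it by \<open>uinv_invariant\<close>.\<close>
lemma subrep_stable:
  assumes U: "subrep S A U" and a: "a \<in> carrier \<Lambda>" and x: "x \<in> U"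
  shows "app (g a) x \<in> U"
proof -
  define P where "P = {f :: 'k endo. \<forall>x\<in>U. app f x \<in> U}"
  have sU: "fv.subspace U" and US: "U \<subseteq> SP" using U by (auto simp: subrep_def)
  have uP: "pt \<in> P" using US ptS by (auto simp: P_def simp del: app_pr)
  interpret CP: preproj_corner Q lt sc pt P
  proof (intro preproj_corner.intro mult_preproj_axioms corner_alg.intro)
    show "x + y \<in> P" if "x \<in> P" "y \<in> P" for x y using that fv.subspace_add[OF sU] by (auto simp: P_def)
    show "sc c * x \<in> P" if "x \<in> P" for x c using that fv.subspace_scale[OF sU] by (auto simp: P_def)
    show "0 \<in> P" using fv.subspace_0[OF sU] by (auto simp: P_def)
    show "x * y \<in> P" if "x \<in> P" "y \<in> P" for x y using that by (auto simp: P_def)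
    show "x * sc c = sc c * x" for x :: "'k endo" and c by (rule sc_comm)
  qed (simp_all add: sc_simps pr_mult uP)
  have m: "mpa_rep sc q (\<lambda>v. pr (S v)) A" using coord_repA by (simp add: coord_rep_def)
  have AP: "A b \<in> P" if "b \<in> arcs D" for b using U that by (auto simp: subrep_def P_def)
  have inv: "pt * uinv (1 + A b * A (star b)) \<in> P" if b: "b \<in> arcs D" for b
  proof -
    have 1: "app (1 + A b * A (star b)) x \<in> U" if "x \<in> U" for x
      using AP[OF b] AP[OF star_arcs[OF b]] that fv.subspace_add[OF sU] by (auto simp: P_def)
    have "app (uinv (1 + A b * A (star b))) x \<in> U" if "x \<in> U" for x
      by (rule uinv_invariant[OF rD(3) sU US rD(5)[OF b] 1 that])
    then show ?thesis using uP by (auto simp: P_def simp del: app_pr)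
  qed
  have EP: "pr (S v) \<in> P" if "v \<in> verts Q" for v using U that by (auto simp: subrep_def P_def simp del: app_pr)
  have "\<exists>g'. g' \<in> algebra_hom \<Lambda> CP.C \<and> (\<forall>v\<in>verts Q. g' (ev v) = pr (S v)) \<and> (\<forall>b\<in>arcs D. g' (eb b) = A b)"
    by (rule CP.hom_of_mpa_rep[OF rD(4) rD(7)[symmetric] EP AP m inv])
  then obtain g' where g': "g' \<in> algebra_hom \<Lambda> CP.C" "\<And>v. v \<in> verts Q \<Longrightarrow> g' (ev v) = pr (S v)" "\<And>b. b \<in> arcs D \<Longrightarrow> g' (eb b) = A b"
    by blast
  have "g' \<in> algebra_hom \<Lambda> C0.C" using g'(1) by (auto simp: algebra_hom_def Ring.ring_hom_def corner_def)
  then have "g' a = g a" by (rule C0.mpa_hom_eq[OF _ g _ _ a]) (use g' gE in auto)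
  moreover have "g' a \<in> P" using algebra_homD(2)[OF g'(1) a] by (simp add: CP.C_carrier)
  ultimately show ?thesis using x by (simp add: P_def)
qed

theorem simple_iff: "simple_module \<Lambda> X \<longleftrightarrow> simple_rep S A"
proof -
  have ne: "carrier X \<noteq> {\<zero>\<^bsub>X\<^esub>} \<longleftrightarrow> tot S \<noteq> {}"
  proof
    assume a: "carrier X \<noteq> {\<zero>\<^bsub>X\<^esub>}"
    show "tot S \<noteq> {}"
    proof
      assume "tot S = {}"
      then have "SP = {0}" by (auto simp: supp_sp_def fun_eq_iff)
      then show False using a bij \<Phi>0 by (simp add: bij_betw_def)
    qed
  next
    assume "tot S \<noteq> {}"
    then obtain j where "j \<in> tot S" by blast
    then have j: "(unitv j :: nat \<Rightarrow> 'k) \<in> SP" by (rule unitv_in)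
    have "(unitv j :: nat \<Rightarrow> 'k) \<noteq> 0" by (auto simp: unitv_def fun_eq_iff)
    then have "\<Phi> (unitv j) \<noteq> \<zero>\<^bsub>X\<^esub>" using \<Phi>inj[OF _ j supp_sp_closed(3)] \<Phi>0 by metis
    then show "carrier X \<noteq> {\<zero>\<^bsub>X\<^esub>}" using \<Phi>c[OF j] by blast
  qed
  have 1: "Module.submodule (\<Phi> ` U) \<Lambda> X" if U: "subrep S A U" for U
  proof -
    have sU: "fv.subspace U" and US: "U \<subseteq> SP" using U by (auto simp: subrep_def)
    show ?thesis
    proof (rule M.submoduleI)
      show "\<Phi> ` U \<subseteq> carrier X" using US \<Phi>c by auto
      show "\<zero>\<^bsub>X\<^esub> \<in> \<Phi> ` U" using fv.subspace_0[OF sU] \<Phi>0 by (metis image_eqI)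
      show "m \<oplus>\<^bsub>X\<^esub> m' \<in> \<Phi> ` U" if mm: "m \<in> \<Phi> ` U" "m' \<in> \<Phi> ` U" for m m'
      proof -
        obtain x y where x: "x \<in> U" "m = \<Phi> x" "y \<in> U" "m' = \<Phi> y" using mm by blast
        then have "m \<oplus>\<^bsub>X\<^esub> m' = \<Phi> (x + y)" using add[of x y] subsetD[OF US] by simp
        then show ?thesis using fv.subspace_add[OF sU x(1,3)] by blast
      qed
      show "a \<odot>\<^bsub>X\<^esub> m \<in> \<Phi> ` U" if a: "a \<in> carrier \<Lambda>" "m \<in> \<Phi> ` U" for a m
      proof -
        obtain x where x: "x \<in> U" "m = \<Phi> x" using a(2) by blast
        then have "a \<odot>\<^bsub>X\<^esub> m = \<Phi> (app (g a) x)" using \<Phi>g[OF a(1), of x] subsetD[OF US] by simp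
        then show ?thesis using subrep_stable[OF U a(1) x(1)] by blast
      qed
    qed
  qed
  have 2: "subrep S A {x \<in> SP. \<Phi> x \<in> N}" if N: "Module.submodule N \<Lambda> X" for N
  proof -
    note n = M.submoduleD[OF N]
    have ag: "app (g a) x \<in> {x \<in> SP. \<Phi> x \<in> N}" if "a \<in> carrier \<Lambda>" "x \<in> {x \<in> SP. \<Phi> x \<in> N}" for a x
      using n(4)[OF that(1)] \<Phi>g[OF that(1), of x] that(2) gS[OF that(1)] by simp
    have "fv.subspace {x \<in> SP. \<Phi> x \<in> N}"
    proof (rule fv.subspaceI)
      show "0 \<in> {x \<in> SP. \<Phi> x \<in> N}" using n(2) \<Phi>0 supp_sp_closed(3) by auto
      show "x + y \<in> {x \<in> SP. \<Phi> x \<in> N}" if "x \<in> {x \<in> SP. \<Phi> x \<in> N}" "y \<in> {x \<in> SP. \<Phi> x \<in> N}" for x y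
        using that n(3) add supp_sp_closed(1) by auto
      show "scl c x \<in> {x \<in> SP. \<Phi> x \<in> N}" if "x \<in> {x \<in> SP. \<Phi> x \<in> N}" for c x
        using that n(4)[OF M.sc1, of "\<Phi> x" c] scale[of x c] supp_sp_closed(2)[of x "tot S" c] by simp
    qed
    moreover have "app (pr (S v)) x \<in> {x \<in> SP. \<Phi> x \<in> N}" if "v \<in> verts Q" "x \<in> {x \<in> SP. \<Phi> x \<in> N}" for v x
      using ag[OF ev_in[OF that(1)] that(2)] by (simp only: gE[OF that(1)])
    ultimately show ?thesis unfolding subrep_def using ag[OF eb_in] by blast
  qed
  have sub0: "U = {0}" if "\<Phi> ` U = {\<zero>\<^bsub>X\<^esub>}" "U \<subseteq> SP" for U
  proof -
    have "x = 0" if x: "x \<in> U" for x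
    proof (rule \<Phi>inj)
      have "\<Phi> x \<in> \<Phi> ` U" using x by (rule imageI)
      then show "\<Phi> x = \<Phi> 0" unfolding \<open>\<Phi> ` U = {\<zero>\<^bsub>X\<^esub>}\<close> using \<Phi>0 by simp
      show "x \<in> SP" using x \<open>U \<subseteq> SP\<close> by blast
    qed (rule supp_sp_closed(3))
    moreover have "U \<noteq> {}" using that by auto
    ultimately show ?thesis by blast
  qed
  show ?thesis
  proof
    assume s: "simple_module \<Lambda> X"
    show "simple_rep S A"
      unfolding simple_rep_def
    proof (intro conjI allI impI)
      show "tot S \<noteq> {}" using s ne by (auto simp: simple_module_def)
      fix U assume U: "subrep S A U"
      then have US: "U \<subseteq> SP" by (simp add: subrep_def)
      have "\<Phi> ` U = {\<zero>\<^bsub>X\<^esub>} \<or> \<Phi> ` U = carrier X" using s 1[OF U] by (simp add: simple_module_def)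
      then show "U = {0} \<or> U = SP"
      proof
        assume "\<Phi> ` U = carrier X"
        then have "x \<in> U" if "x \<in> SP" for x
          using \<Phi>c[OF that] \<Phi>inj[OF _ that] US by (metis (no_types, opaque_lifting) imageE subsetD)
        then show ?thesis using US by blast
      qed (use sub0 US in blast)
    qed
  next
    assume s: "simple_rep S A"
    show "simple_module \<Lambda> X"
      unfolding simple_module_def
    proof (intro conjI allI impI)
      show "carrier X \<noteq> {\<zero>\<^bsub>X\<^esub>}" using s ne by (auto simp: simple_rep_def)
      fix N assume N: "Module.submodule N \<Lambda> X"
      let ?U = "{x \<in> SP. \<Phi> x \<in> N}"
      have N\<Phi>: "N = \<Phi> ` ?U" using M.submoduleD(1)[OF N] \<Phi>surj by blast
      have "?U = {0} \<or> ?U = SP" using s 2[OF N] by (simp add: simple_rep_def)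
      then show "N = {\<zero>\<^bsub>X\<^esub>} \<or> N = carrier X"
      proof
        assume "?U = {0}"
        then show ?thesis using N\<Phi> \<Phi>0 by simp
      next
        assume "?U = SP"
        then show ?thesis using N\<Phi> bij by (simp add: bij_betw_def)
      qed
    qed (rule modX)
  qed
qed

end

section \<open>Rigidity and self-extensions\<close>

lemma dual_sum: "(\<Sum>v\<in>V. Dual (f v) 0) = Dual (\<Sum>v\<in>V. f v) (0 :: 'r::ring_1)"
  by (induct V rule: infinite_finite_induct) (simp_all add: dual_defs)

context coord_mod begin

definition "\<Psi> = inv_into SP \<Phi>"

lemma \<Psi>: "m \<in> carrier X \<Longrightarrow> \<Psi> m \<in> SP" "m \<in> carrier X \<Longrightarrow> \<Phi> (\<Psi> m) = m" "x \<in> SP \<Longrightarrow> \<Psi> (\<Phi> x) = x"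
  using bij unfolding \<Psi>_def by (auto simp: bij_betw_def inv_into_into f_inv_into_f)

lemma absorb_app: "f * pt = f \<Longrightarrow> app f (app pt x) = app f x" "pt * f = f \<Longrightarrow> app f x \<in> SP"
proof -
  show "app f (app pt x) = app f x" if "f * pt = f" using arg_cong[OF that, of "\<lambda>f. app f x"] by (simp del: app_pr)
  show "app f x \<in> SP" if "pt * f = f" using arg_cong[OF that, of "\<lambda>f. app f x"] pr_supp[of "tot S" "app f x"] by (simp del: app_pr)
qed

lemma ring\<Lambda>: "ring \<Lambda>" by (rule K_algebra.axioms(1)[OF K\<Lambda>])
lemma \<Lambda>_closed: "a \<in> carrier \<Lambda> \<Longrightarrow> b \<in> carrier \<Lambda> \<Longrightarrow> a \<otimes>\<^bsub>\<Lambda>\<^esub> b \<in> carrier \<Lambda>" "a \<in> carrier \<Lambda> \<Longrightarrow> b \<in> carrier \<Lambda> \<Longrightarrow> a \<oplus>\<^bsub>\<Lambda>\<^esub> b \<in> carrier \<Lambda>"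
  "\<one>\<^bsub>\<Lambda>\<^esub> \<in> carrier \<Lambda>"
proof -
  interpret R: ring \<Lambda> by (rule ring\<Lambda>)
  show "a \<in> carrier \<Lambda> \<Longrightarrow> b \<in> carrier \<Lambda> \<Longrightarrow> a \<otimes>\<^bsub>\<Lambda>\<^esub> b \<in> carrier \<Lambda>" "a \<in> carrier \<Lambda> \<Longrightarrow> b \<in> carrier \<Lambda> \<Longrightarrow> a \<oplus>\<^bsub>\<Lambda>\<^esub> b \<in> carrier \<Lambda>"
    "\<one>\<^bsub>\<Lambda>\<^esub> \<in> carrier \<Lambda>" by auto
qed

text \<open>A homomorphism to the dual numbers over \<open>g\<close> is the same as a derivation \<open>d\<close>, and on the arrows it is a deformation.\<close>
lemma dual_hom_deform:
  assumes H: "(\<lambda>a. Dual (g a) (d a)) \<in> algebra_hom \<Lambda> C1.C" and v: "\<And>v. v \<in> verts Q \<Longrightarrow> d (ev v) = 0"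
  shows "deform S A (\<lambda>b. d (eb b))"
proof -
  have "mpa_rep (\<lambda>c. Dual (sc c) 0) q (\<lambda>v. Dual (pr (S v)) 0) (\<lambda>b. Dual (A b) (d (eb b)))"
    by (rule mpa_rep_cong[OF C1.mpa_rep_of_hom(1)[OF H]]) (simp_all add: v gE)
  then show ?thesis using deform_dual[OF coord_repA] by blast
qed

lemma inner_dual_hom:
  assumes h: "graded S h"
  shows "(\<lambda>a. Dual (g a) (h * g a - g a * h)) \<in> algebra_hom \<Lambda> C1.C"
proof -
  have hp: "h * pt = h" "pt * h = h" 
  proof -
    show 1: "h * pt = h" by (rule gradedD(2)[OF h])
    have "h * pt = pt * h" unfolding rD(7) sum_distrib_left sum_distrib_right by (rule sum.cong) (use gradedD(1)[OF h] in auto)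
    then show "pt * h = h" using 1 by simp
  qed
  have "pt * (h * g a - g a * h) = h * g a - g a * h" "(h * g a - g a * h) * pt = h * g a - g a * h" if a: "a \<in> carrier \<Lambda>" for a
    by (simp_all add: right_diff_distrib left_diff_distrib mult.assoc g_pt[OF a] hp)
      (simp add: mult.assoc[symmetric] g_pt[OF a] hp)
  moreover have "h * sc c * f = sc c * (h * f)" for c f by (simp add: sc_comm[of h] mult.assoc)
  ultimately show ?thesis
    unfolding algebra_hom_def Ring.ring_hom_def corner_def
    by (auto simp: dual_mult dual_add g_pt G C0.C_simps hp algebra_simps sc_left[of h] sc_left[of "g _"])
qed

text \<open>A deformation extends to a derivation \<open>d\<close> of the whole algebra, which defines an extension of \<open>X\<close> by itself on
  \<open>X \<times> X\<close>. A section \<open>m \<mapsto> (\<theta> m, m)\<close> exhibits \<open>d\<close> as the inner derivation given by \<open>\<theta>\<close>.\<close>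
theorem split_imp_rigid:
  assumes sp: "\<And>E i p. (E, i, p) \<in> extensions \<Lambda> X X \<Longrightarrow> \<exists>s\<in>left_module_hom \<Lambda> X E. \<forall>x\<in>carrier X. p (s x) = x"
  shows "rigid_rep S A"
  unfolding rigid_rep_def
proof (intro allI impI)
  fix \<xi> assume "deform S A \<xi>"
  then have m: "mpa_rep (\<lambda>c. Dual (sc c) 0) q (\<lambda>v. Dual (pr (S v)) 0) (\<lambda>b. Dual (A b) (\<xi> b))" using deform_dual[OF coord_repA] by blast
  have qr: "quiver_rep (\<lambda>v. Dual (pr (S v)) 0) (\<lambda>b. Dual (A b) (\<xi> b))" using m by (simp add: mpa_rep_def)
  have su: "(\<Sum>v\<in>verts Q. Dual (pr (S v)) 0) = Dual pt 0" unfolding dual_sum rD(7) ..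
  have "\<exists>H. H \<in> algebra_hom \<Lambda> C1.C \<and> (\<forall>v\<in>verts Q. H (ev v) = Dual (pr (S v)) 0) \<and> (\<forall>b\<in>arcs D. H (eb b) = Dual (A b) (\<xi> b))"
    by (rule C1.hom_of_mpa_rep[OF qr su UNIV_I UNIV_I m UNIV_I])
  then obtain H where H: "H \<in> algebra_hom \<Lambda> C1.C" "\<And>v. v \<in> verts Q \<Longrightarrow> H (ev v) = Dual (pr (S v)) 0" "\<And>b. b \<in> arcs D \<Longrightarrow> H (eb b) = Dual (A b) (\<xi> b)" by blast
  note HD = algebra_homD[OF H(1)]
  have Hp: "Dual pt 0 * H a = H a" "H a * Dual pt 0 = H a" if "a \<in> carrier \<Lambda>" for a using HD(2)[OF that] by (simp_all add: C1.C_carrier)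
  have Hp': "pt * dre (H a) = dre (H a)" "dre (H a) * pt = dre (H a)" "pt * dep (H a) = dep (H a)" "dep (H a) * pt = dep (H a)" if "a \<in> carrier \<Lambda>" for a
    using Hp[OF that] by (cases "H a"; simp add: dual_mult)+
  have hm: "H (a \<otimes>\<^bsub>\<Lambda>\<^esub> b) = H a * H b" "H (a \<oplus>\<^bsub>\<Lambda>\<^esub> b) = H a + H b" if "a \<in> carrier \<Lambda>" "b \<in> carrier \<Lambda>" for a b
    using HD(3,4)[OF that] by simp_all
  have h1: "H \<one>\<^bsub>\<Lambda>\<^esub> = Dual pt 0" using HD(5) by simp
  have hs: "H (c \<odot>\<^bsub>\<Lambda>\<^esub> a) = Dual (sc c) 0 * H a" if "a \<in> carrier \<Lambda>" for a c using HD(6)[OF that] by simp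
  have "(\<lambda>a. dre (H a)) \<in> algebra_hom \<Lambda> C0.C"
    unfolding algebra_hom_def Ring.ring_hom_def by (auto simp: C0.C_carrier Hp' hm h1 hs times_dual_def plus_dual_def)
  then have re: "dre (H a) = g a" if "a \<in> carrier \<Lambda>" for a
    by (rule C0.mpa_hom_eq[OF _ g _ _ that]) (simp_all add: H gE)
  define d where "d a = dep (H a)" for a
  have d: "d (a \<otimes>\<^bsub>\<Lambda>\<^esub> b) = g a * d b + d a * g b" "d (a \<oplus>\<^bsub>\<Lambda>\<^esub> b) = d a + d b" if "a \<in> carrier \<Lambda>" "b \<in> carrier \<Lambda>" for a b
    using that by (simp_all add: d_def hm times_dual_def plus_dual_def re)
  have d1: "d \<one>\<^bsub>\<Lambda>\<^esub> = 0" by (simp add: d_def h1)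
  have ds: "d (c \<odot>\<^bsub>\<Lambda>\<^esub> \<one>\<^bsub>\<Lambda>\<^esub>) = 0" for c by (simp add: d_def hs h1 dual_mult)
  have dp: "pt * d a = d a" "d a * pt = d a" if "a \<in> carrier \<Lambda>" for a using Hp'[OF that] by (simp_all add: d_def)
  define Dm where "Dm a m = \<Phi> (app (d a) (\<Psi> m))" for a m
  have dS: "app (d a) x \<in> SP" if "a \<in> carrier \<Lambda>" for a x by (rule absorb_app(2)[OF dp(1)[OF that]])
  have Dm\<Phi>: "Dm a (\<Phi> x) = \<Phi> (app (d a) x)" if "x \<in> SP" for a x by (simp add: Dm_def \<Psi>(3)[OF that])
  have Dmc: "Dm a m \<in> carrier X" if "a \<in> carrier \<Lambda>" for a m unfolding Dm_def by (rule \<Phi>c[OF dS[OF that]])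
  have Dm1: "Dm a (m \<oplus>\<^bsub>X\<^esub> m') = Dm a m \<oplus>\<^bsub>X\<^esub> Dm a m'" if a: "a \<in> carrier \<Lambda>" and m: "m \<in> carrier X" "m' \<in> carrier X" for a m m'
  proof -
    obtain x y where x: "x \<in> SP" "m = \<Phi> x" "y \<in> SP" "m' = \<Phi> y" using \<Phi>surj m by blast
    have "m \<oplus>\<^bsub>X\<^esub> m' = \<Phi> (x + y)" using x add by simp
    then show ?thesis using Dm\<Phi>[OF supp_sp_closed(1)[OF x(1,3)], of a] by (simp add: app_vec(1) add[OF dS[OF a] dS[OF a]] x Dm\<Phi>)
  qed
  have Dm2: "Dm (a \<oplus>\<^bsub>\<Lambda>\<^esub> b) m = Dm a m \<oplus>\<^bsub>X\<^esub> Dm b m" if "a \<in> carrier \<Lambda>" "b \<in> carrier \<Lambda>" for a b m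
    unfolding Dm_def d(2)[OF that] by (simp add: add dS that)
  have Dm3: "Dm (a \<otimes>\<^bsub>\<Lambda>\<^esub> b) m = a \<odot>\<^bsub>X\<^esub> Dm b m \<oplus>\<^bsub>X\<^esub> Dm a (b \<odot>\<^bsub>X\<^esub> m)" if ab: "a \<in> carrier \<Lambda>" "b \<in> carrier \<Lambda>" and m: "m \<in> carrier X" for a b m
  proof -
    obtain x where x: "x \<in> SP" "m = \<Phi> x" using \<Phi>surj m by blast
    have e: "b \<odot>\<^bsub>X\<^esub> \<Phi> x = \<Phi> (app (g b) x)" using \<Phi>g[OF ab(2) x(1)] by simp
    show ?thesis unfolding x(2) e by (simp add: Dm\<Phi> x(1) gS ab d(1) add dS \<Phi>g[OF ab(1) dS[OF ab(2)]])
  qed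
  have Dm4: "Dm \<one>\<^bsub>\<Lambda>\<^esub> m = \<zero>\<^bsub>X\<^esub>" "Dm (c \<odot>\<^bsub>\<Lambda>\<^esub> \<one>\<^bsub>\<Lambda>\<^esub>) m = \<zero>\<^bsub>X\<^esub>" for m c by (simp_all add: Dm_def d1 ds \<Phi>0)
  \<comment> \<open>The extension with the action twisted by the derivation.\<close>
  define E where "E = (direct_sum X X) \<lparr>smult := \<lambda>a (n, m). (a \<odot>\<^bsub>X\<^esub> n \<oplus>\<^bsub>X\<^esub> Dm a m, a \<odot>\<^bsub>X\<^esub> m)\<rparr>"
  have Es: "carrier E = carrier X \<times> carrier X" "(n, m) \<oplus>\<^bsub>E\<^esub> (n', m') = (n \<oplus>\<^bsub>X\<^esub> n', m \<oplus>\<^bsub>X\<^esub> m')" "\<zero>\<^bsub>E\<^esub> = (\<zero>\<^bsub>X\<^esub>, \<zero>\<^bsub>X\<^esub>)"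
    "a \<odot>\<^bsub>E\<^esub> (n, m) = (a \<odot>\<^bsub>X\<^esub> n \<oplus>\<^bsub>X\<^esub> Dm a m, a \<odot>\<^bsub>X\<^esub> m)" for n m n' m' a
    by (simp_all add: E_def direct_sum_def)
  have "abelian_group (direct_sum X X)" using direct_sum_module[OF modX modX] by (simp add: left_module_def)
  then have "abelian_group E" unfolding E_def abelian_group_def abelian_monoid_def abelian_group_axioms_def by simp
  then have lE: "left_module \<Lambda> E"
    unfolding left_module_def left_module_axioms_def
    by (auto simp: ring\<Lambda> Es M.X.smult_closed M.X.smult_l_distr M.X.smult_r_distr M.X.smult_assoc M.X.smult_one Dmc Dm1 Dm2 Dm3 Dm4 M.X.M.a_ac)
  have "(E, \<lambda>n. (n, \<zero>\<^bsub>X\<^esub>), snd) \<in> extensions \<Lambda> X X"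
  proof -
    have "Dm a \<zero>\<^bsub>X\<^esub> = \<zero>\<^bsub>X\<^esub>" if "a \<in> carrier \<Lambda>" for a using Dm\<Phi>[OF supp_sp_closed(3), of a] \<Phi>0 by (simp add: app_vec(3))
    then show ?thesis using lE smult_zero_right[OF modX] by (auto simp: extensions_def left_module_hom_def Es inj_on_def M.X.smult_closed image_iff)
  qed
  then obtain s where s: "s \<in> left_module_hom \<Lambda> X E" "\<And>x. x \<in> carrier X \<Longrightarrow> snd (s x) = x" using sp by blast
  define \<theta> where "\<theta> x = fst (s x)" for x
  have s\<theta>: "s x = (\<theta> x, x)" if "x \<in> carrier X" for x using s(2)[OF that] by (simp add: \<theta>_def prod_eq_iff)
  have \<theta>c: "\<theta> x \<in> carrier X" if "x \<in> carrier X" for x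
    using s(1) s\<theta>[OF that] that by (auto simp: left_module_hom_def Es Pi_iff)
  have \<theta>a: "\<theta> (x \<oplus>\<^bsub>X\<^esub> y) = \<theta> x \<oplus>\<^bsub>X\<^esub> \<theta> y" if "x \<in> carrier X" "y \<in> carrier X" for x y
  proof -
    have "s (x \<oplus>\<^bsub>X\<^esub> y) = s x \<oplus>\<^bsub>E\<^esub> s y" using s(1) that by (auto simp: left_module_hom_def)
    then show ?thesis using that by (simp add: s\<theta> Es)
  qed
  have \<theta>s: "\<theta> (a \<odot>\<^bsub>X\<^esub> x) = a \<odot>\<^bsub>X\<^esub> \<theta> x \<oplus>\<^bsub>X\<^esub> Dm a x" if "a \<in> carrier \<Lambda>" "x \<in> carrier X" for a x
  proof -
    have "s (a \<odot>\<^bsub>X\<^esub> x) = a \<odot>\<^bsub>E\<^esub> s x" using s(1) that by (auto simp: left_module_hom_def)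
    then show ?thesis using that by (simp add: s\<theta> Es M.X.smult_closed)
  qed
  have \<theta>sc: "\<theta> (M.act c x) = M.act c (\<theta> x)" if "x \<in> carrier X" for c x
    using \<theta>s[OF M.sc1 that, of c] M.act_simps(1)[OF \<theta>c[OF that]] by (simp add: Dm4)
  define T0 where "T0 x = \<Psi> (\<theta> (\<Phi> (app pt x)))" for x
  note ptin = pr_in[of "tot S"]
  have T0: "T0 x \<in> SP" "\<Phi> (T0 x) = \<theta> (\<Phi> (app pt x))" for x
    unfolding T0_def using \<Psi>(1,2)[OF \<theta>c[OF \<Phi>c[OF ptin]]] by auto
  have "T0 (x + y) = T0 x + T0 y" for x y
    by (rule \<Phi>inj) (simp_all add: T0 add supp_sp_closed app_vec(1) ptin \<theta>a \<Phi>c del: app_pr)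
  moreover have "T0 (scl c x) = scl c (T0 x)" for c x
    by (rule \<Phi>inj) (simp_all add: T0 scale supp_sp_closed app_vec(2) ptin \<theta>sc \<Phi>c del: app_pr)
  ultimately have "Vector_Spaces.linear scl scl T0" unfolding fv_linear by blast
  then have aT: "app (Endo T0) = T0" by (simp add: Endo_inverse)
  define T where "T = Endo T0"
  have key: "d a = T * g a - g a * T" if a: "a \<in> carrier \<Lambda>" for a
  proof -
    have "d a + g a * T = T * g a"
    proof (rule endo_eqI, rule \<Phi>inj)
      fix x
      let ?y = "app pt x"
      have e: "app (d a) x = app (d a) ?y" "app (g a) x = app (g a) ?y" using absorb_app(1) dp(2)[OF a] g_pt(2)[OF a] by metis+
      have "\<Phi> (app (d a) x + app (g a) (T0 x)) = Dm a (\<Phi> ?y) \<oplus>\<^bsub>X\<^esub> a \<odot>\<^bsub>X\<^esub> \<theta> (\<Phi> ?y)"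
        unfolding add[OF dS[OF a] gS[OF a]] \<Phi>g[OF a T0(1)] T0(2) Dm\<Phi>[OF ptin] e(1) ..
      also have "\<dots> = \<theta> (a \<odot>\<^bsub>X\<^esub> \<Phi> ?y)" using \<theta>s[OF a \<Phi>c[OF ptin]] M.X.M.a_comm Dmc[OF a] M.X.smult_closed[OF a \<theta>c[OF \<Phi>c[OF ptin]]] by simp
      also have "\<dots> = \<theta> (\<Phi> (app (g a) x))" unfolding e(2) \<Phi>g[OF a ptin] ..
      also have "\<dots> = \<Phi> (T0 (app (g a) x))" unfolding T0(2) ptS[OF gS[OF a]] ..
      finally show "\<Phi> (app (d a + g a * T) x) = \<Phi> (app (T * g a) x)" by (simp add: T_def aT)
      show "app (d a + g a * T) x \<in> SP" "app (T * g a) x \<in> SP"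
        using supp_sp_closed(1)[OF dS[OF a] gS[OF a]] T0(1) by (simp_all add: T_def aT)
    qed
    then show ?thesis by (simp add: eq_diff_eq)
  qed
  have gT: "graded S T"
    unfolding graded_def
  proof (intro conjI ballI)
    show "T * pr (S v) = pr (S v) * T" if "v \<in> verts Q" for v
      using key[OF ev_in[OF that]] H(2)[OF that] by (simp add: d_def gE that)
    have pp: "app pt (app pt x) = app pt x" for x using ptS[OF ptin] .
    show "T * pt = T" by (rule endo_eqI) (simp add: T_def aT T0_def pp del: app_pr)
  qed
  have "\<xi> b = T * A b - A b * T" if "b \<in> arcs D" for b using key[OF eb_in[OF that]] H(3)[OF that] by (simp add: d_def)
  then show "\<exists>h. graded S h \<and> (\<forall>b\<in>arcs D. \<xi> b = h * A b - A b * h)" using gT by blast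
qed

text \<open>A linear section that respects the vertices: preimages of the unit vectors are first projected by the
  idempotent of their vertex, then extended linearly.\<close>
lemma graded_section:
  assumes e: "(E, i, p) \<in> extensions \<Lambda> X X"
  shows "\<exists>\<sigma>. (\<forall>x. \<sigma> x \<in> carrier E) \<and> (\<forall>x\<in>SP. p (\<sigma> x) = \<Phi> x) \<and>
    (\<forall>x y. \<sigma> (x + y) = \<sigma> x \<oplus>\<^bsub>E\<^esub> \<sigma> y) \<and> (\<forall>c x. \<sigma> (scl c x) = (c \<odot>\<^bsub>\<Lambda>\<^esub> \<one>\<^bsub>\<Lambda>\<^esub>) \<odot>\<^bsub>E\<^esub> \<sigma> x) \<and>
    (\<forall>v\<in>verts Q. \<forall>x. ev v \<odot>\<^bsub>E\<^esub> \<sigma> x = \<sigma> (app (pr (S v)) x))"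
proof -
  have lE: "left_module \<Lambda> E" using e by (auto simp: extensions_def)
  interpret E: alg_module \<Lambda> E by (intro alg_module.intro K\<Lambda> lE)
  have p: "p x \<in> carrier X" "p (x \<oplus>\<^bsub>E\<^esub> x') = p x \<oplus>\<^bsub>X\<^esub> p x'" "a \<in> carrier \<Lambda> \<Longrightarrow> p (a \<odot>\<^bsub>E\<^esub> x) = a \<odot>\<^bsub>X\<^esub> p x"
    if "x \<in> carrier E" "x' \<in> carrier E" for x x' a using e that by (auto simp: extensions_def left_module_hom_def Pi_iff)
  have ps: "p ` carrier E = carrier X" using e by (auto simp: extensions_def)
  have evm: "ev v \<otimes>\<^bsub>\<Lambda>\<^esub> ev w = (if v = w then ev v else \<zero>\<^bsub>\<Lambda>\<^esub>)" if "v \<in> verts Q" "w \<in> verts Q" for v w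
  proof -
    note mh = mpa_map_hom[OF C0.QL, of q]
    have "ev v \<otimes>\<^bsub>\<Lambda>\<^esub> ev w = mpa_map Q lt q (C0.ve v \<otimes>\<^bsub>C0.AA\<^esub> C0.ve w)" by (rule algebra_homD(4)[OF mh C0.ve_closed C0.ve_closed, symmetric]) (use that in auto)
    then show ?thesis unfolding C0.ve_mult using algebra_hom_minus(2)[OF mh C0.AA_ring ring\<Lambda> C0.ve_closed C0.ve_closed] that by (cases "v = w") auto
  qed
  have z0: "\<zero>\<^bsub>\<Lambda>\<^esub> \<odot>\<^bsub>E\<^esub> z = \<zero>\<^bsub>E\<^esub>" if z: "z \<in> carrier E" for z
    by (rule E.zero_unique) (use E.X.smult_l_distr[of "\<zero>\<^bsub>\<Lambda>\<^esub>" "\<zero>\<^bsub>\<Lambda>\<^esub>" z] E.X.smult_closed z in auto)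
  have "\<exists>w. w \<in> carrier E \<and> p w = \<Phi> (unitv j) \<and> (\<forall>v\<in>verts Q. ev v \<odot>\<^bsub>E\<^esub> w = (if j \<in> S v then w else \<zero>\<^bsub>E\<^esub>))" if j: "j \<in> tot S" for j
  proof -
    obtain u where u: "u \<in> verts Q" "j \<in> S u" using j by (auto simp: tot_def)
    have js: "(unitv j :: nat \<Rightarrow> 'k) \<in> SP" by (rule unitv_in[OF j])
    then obtain z where z: "z \<in> carrier E" "p z = \<Phi> (unitv j)" using ps \<Phi>c by (metis imageE)
    let ?w = "ev u \<odot>\<^bsub>E\<^esub> z"
    have w: "?w \<in> carrier E" using E.X.smult_closed[OF ev_in[OF u(1)] z(1)] .
    have "p ?w = \<Phi> (app (g (ev u)) (unitv j))" using p(3)[OF z(1) z(1) ev_in[OF u(1)]] z(2) \<Phi>g[OF ev_in[OF u(1)] js] by simp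
    also have "app (g (ev u)) (unitv j) = (unitv j :: nat \<Rightarrow> 'k)" unfolding gE[OF u(1)] using pr_supp[of "S u" "unitv j"] unitv_in[OF u(2)] by blast
    finally have pw: "p ?w = \<Phi> (unitv j)" .
    have "ev v \<odot>\<^bsub>E\<^esub> ?w = (if j \<in> S v then ?w else \<zero>\<^bsub>E\<^esub>)" if v: "v \<in> verts Q" for v
    proof -
      have "j \<in> S v \<longleftrightarrow> v = u" using disj u v by (auto simp: disjoint_family_on_def)
      moreover have "ev v \<odot>\<^bsub>E\<^esub> ?w = (ev v \<otimes>\<^bsub>\<Lambda>\<^esub> ev u) \<odot>\<^bsub>E\<^esub> z" using E.X.smult_assoc[OF ev_in[OF v] ev_in[OF u(1)] z(1)] by simp
      ultimately show ?thesis using evm[OF v u(1)] z0[OF z(1)] by auto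
    qed
    then show ?thesis using w pw by blast
  qed
  then obtain w where w: "\<And>j. j \<in> tot S \<Longrightarrow> w j \<in> carrier E" "\<And>j. j \<in> tot S \<Longrightarrow> p (w j) = \<Phi> (unitv j)"
    "\<And>j v. j \<in> tot S \<Longrightarrow> v \<in> verts Q \<Longrightarrow> ev v \<odot>\<^bsub>E\<^esub> w j = (if j \<in> S v then w j else \<zero>\<^bsub>E\<^esub>)" by metis
  obtain js where js: "set js = tot S" "distinct js" using finite_distinct_list[OF rD(3)] by blast
  define sg where "sg ks x = foldr (\<lambda>j e. E.act (x j) (w j) \<oplus>\<^bsub>E\<^esub> e) ks \<zero>\<^bsub>E\<^esub>" for ks and x :: "nat \<Rightarrow> 'k"
  have sgs: "sg [] x = \<zero>\<^bsub>E\<^esub>" "sg (j # ks) x = E.act (x j) (w j) \<oplus>\<^bsub>E\<^esub> sg ks x" for j ks x by (simp_all add: sg_def)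
  note ac = E.act_simps(1)[OF w(1)]
  have c: "sg ks x \<in> carrier E" if "set ks \<subseteq> tot S" for ks x using that by (induct ks) (auto simp: sgs ac)
  have a: "sg ks (x + y) = sg ks x \<oplus>\<^bsub>E\<^esub> sg ks y" if "set ks \<subseteq> tot S" for ks x y
    using that by (induct ks) (auto simp: sgs ac c E.act_simps(2)[OF w(1)] E.X.M.a_ac)
  have s: "sg ks (scl r x) = E.act r (sg ks x)" if "set ks \<subseteq> tot S" for ks x r
    using that by (induct ks) (auto simp: sgs ac c E.act_simps(3)[OF w(1)] E.act_simps(5) smult_zero_right[OF lE E.sc1])
  have pp: "p (sg ks x) = \<Phi> (\<lambda>i. if i \<in> set ks then x i else 0)" if "set ks \<subseteq> tot S" "distinct ks" for ks x
    using that
  proof (induct ks)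
    case Nil
    have "p \<zero>\<^bsub>E\<^esub> = \<zero>\<^bsub>X\<^esub>" using p(1,2)[of "\<zero>\<^bsub>E\<^esub>" "\<zero>\<^bsub>E\<^esub>"] by (intro M.zero_unique) auto
    then show ?case using \<Phi>0 by (simp add: sgs zero_fun_def)
  next
    case (Cons j ks)
    then have j: "j \<in> tot S" and ks: "set ks \<subseteq> tot S" by auto
    have "p (sg (j # ks) x) = M.act (x j) (\<Phi> (unitv j)) \<oplus>\<^bsub>X\<^esub> \<Phi> (\<lambda>i. if i \<in> set ks then x i else 0)"
      using Cons p(2)[OF ac[OF j] c[OF ks]] p(3)[OF w(1)[OF j] w(1)[OF j] E.sc1] by (simp add: sgs w(2)[OF j])
    also have "\<dots> = \<Phi> (scl (x j) (unitv j) + (\<lambda>i. if i \<in> set ks then x i else 0))"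
      unfolding scale[OF unitv_in[OF j], symmetric]
      by (rule add[symmetric]) (use j ks in \<open>auto simp: supp_sp_def unitv_def\<close>)
    also have "scl (x j) (unitv j) + (\<lambda>i. if i \<in> set ks then x i else 0) = (\<lambda>i. if i \<in> set (j # ks) then x i else 0)"
      using Cons(3) by (auto simp: fun_eq_iff unitv_def)
    finally show ?case .
  qed
  have gr: "ev v \<odot>\<^bsub>E\<^esub> sg ks x = sg ks (app (pr (S v)) x)" if v: "v \<in> verts Q" and "set ks \<subseteq> tot S" for v ks x
    using that(2)
  proof (induct ks)
    case Nil then show ?case using smult_zero_right[OF lE ev_in[OF v]] by (simp add: sgs)
  next
    case (Cons j ks)
    then have j: "j \<in> tot S" and ks: "set ks \<subseteq> tot S" by auto
    have "ev v \<odot>\<^bsub>E\<^esub> E.act (x j) (w j) = E.act (app (pr (S v)) x j) (w j)"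
      unfolding E.act_simps(7)[OF w(1)[OF j] ev_in[OF v]] w(3)[OF j v]
      using smult_zero_right[OF lE E.sc1] E.act_zero[OF w(1)[OF j]] by simp
    then show ?case using Cons(1)[OF ks] E.X.smult_r_distr[OF ev_in[OF v] ac[OF j] c[OF ks]] by (simp add: sgs del: app_pr)
  qed
  show ?thesis
  proof (intro exI[of _ "sg js"] conjI ballI allI)
    fix x :: "nat \<Rightarrow> 'k" assume x: "x \<in> SP"
    have "(\<lambda>i. if i \<in> set js then x i else 0) = x" using x js by (auto simp: supp_sp_def fun_eq_iff)
    then show "p (sg js x) = \<Phi> x" using pp[of js x] js by simp
  qed (simp_all only: js(1) order.refl c a s gr)
qed

end

context coord_mod begin

text \<open>The failure \<open>\<delta> a\<close> of a linear section \<open>\<sigma>\<close> to commute with \<open>a\<close> is a derivation. Rigidity makes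
  it inner on the arrows, hence everywhere, and adding the corresponding \<open>h\<close> to \<open>\<sigma>\<close> gives a section of modules.\<close>
theorem rigid_imp_split:
  assumes rig: "rigid_rep S A" and e: "(E, i, p) \<in> extensions \<Lambda> X X"
  shows "\<exists>s\<in>left_module_hom \<Lambda> X E. \<forall>x\<in>carrier X. p (s x) = x"
proof -
  have lE: "left_module \<Lambda> E" using e by (auto simp: extensions_def)
  interpret E: alg_module \<Lambda> E by (intro alg_module.intro K\<Lambda> lE)
  have i: "i y \<in> carrier E" "i (y \<oplus>\<^bsub>X\<^esub> y') = i y \<oplus>\<^bsub>E\<^esub> i y'" "a \<in> carrier \<Lambda> \<Longrightarrow> i (a \<odot>\<^bsub>X\<^esub> y) = a \<odot>\<^bsub>E\<^esub> i y" "p (i y) = \<zero>\<^bsub>X\<^esub>"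
    if "y \<in> carrier X" "y' \<in> carrier X" for y y' a using e that by (auto simp: extensions_def left_module_hom_def Pi_iff)
  have p: "p x \<in> carrier X" "p (x \<oplus>\<^bsub>E\<^esub> x') = p x \<oplus>\<^bsub>X\<^esub> p x'" "a \<in> carrier \<Lambda> \<Longrightarrow> p (a \<odot>\<^bsub>E\<^esub> x) = a \<odot>\<^bsub>X\<^esub> p x"
    if "x \<in> carrier E" "x' \<in> carrier E" for x x' a using e that by (auto simp: extensions_def left_module_hom_def Pi_iff)
  have ii: "inj_on i (carrier X)" and ker: "i ` carrier X = {x \<in> carrier E. p x = \<zero>\<^bsub>X\<^esub>}" using e by (auto simp: extensions_def)
  obtain \<sigma> where \<sigma>: "\<forall>x. \<sigma> x \<in> carrier E" "\<forall>x\<in>SP. p (\<sigma> x) = \<Phi> x" "\<forall>x y. \<sigma> (x + y) = \<sigma> x \<oplus>\<^bsub>E\<^esub> \<sigma> y"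
    "\<forall>c x. \<sigma> (scl c x) = E.act c (\<sigma> x)" "\<forall>v\<in>verts Q. \<forall>x. ev v \<odot>\<^bsub>E\<^esub> \<sigma> x = \<sigma> (app (pr (S v)) x)"
    using graded_section[OF e] by blast
  have \<sigma>c: "\<sigma> x \<in> carrier E" and \<sigma>p: "p (\<sigma> x) = \<Phi> x"
    and \<sigma>s: "\<sigma> (scl c x) = E.act c (\<sigma> x)" and \<sigma>e: "v \<in> verts Q \<Longrightarrow> ev v \<odot>\<^bsub>E\<^esub> \<sigma> x = \<sigma> (app (pr (S v)) x)" if "x \<in> SP" for x c v
    using \<sigma> that by blast+
  have \<sigma>a: "\<sigma> (x + y) = \<sigma> x \<oplus>\<^bsub>E\<^esub> \<sigma> y" if "x \<in> SP" "y \<in> SP" for x y using \<sigma>(3) by blast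
  \<comment> \<open>The inclusion of the submodule in coordinates; with \<open>\<sigma>\<close> it coordinatises the extension.\<close>
  define \<kappa> where "\<kappa> y = i (\<Phi> y)" for y
  have \<kappa>c: "\<kappa> y \<in> carrier E" if "y \<in> SP" for y unfolding \<kappa>_def using i(1) \<Phi>c that by blast
  have \<kappa>a: "\<kappa> (x + y) = \<kappa> x \<oplus>\<^bsub>E\<^esub> \<kappa> y" if "x \<in> SP" "y \<in> SP" for x y unfolding \<kappa>_def using that by (simp add: add i(2) \<Phi>c)
  have \<kappa>g: "\<kappa> (app (g a) y) = a \<odot>\<^bsub>E\<^esub> \<kappa> y" if "a \<in> carrier \<Lambda>" "y \<in> SP" for a y
    unfolding \<kappa>_def \<Phi>g[OF that] by (rule i(3)) (use that \<Phi>c in auto)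
  have \<kappa>s: "\<kappa> (scl c y) = E.act c (\<kappa> y)" if "y \<in> SP" for c y
    unfolding \<kappa>_def scale[OF that] by (rule i(3)) (use that \<Phi>c M.sc1 in auto)
  have \<kappa>0: "\<kappa> 0 = \<zero>\<^bsub>E\<^esub>" using \<kappa>a[OF supp_sp_closed(3) supp_sp_closed(3)] \<kappa>c[OF supp_sp_closed(3)] by (intro E.zero_unique) auto
  have \<kappa>i: "x = y" if "\<kappa> x = \<kappa> y" "x \<in> SP" "y \<in> SP" for x y
    using that ii \<Phi>c \<Phi>inj unfolding \<kappa>_def inj_on_def by metis
  have \<kappa>p: "p (\<kappa> y) = \<zero>\<^bsub>X\<^esub>" if "y \<in> SP" for y unfolding \<kappa>_def using i(4)[OF \<Phi>c \<Phi>c] that by blast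
  note ptin = pr_in[of "tot S"]
  have ex: "\<exists>y\<in>SP. \<kappa> y \<oplus>\<^bsub>E\<^esub> \<sigma> (app (g a) x) = a \<odot>\<^bsub>E\<^esub> \<sigma> (app pt x)" if a: "a \<in> carrier \<Lambda>" for a x
  proof -
    let ?s = "\<sigma> (app (g a) x)" and ?t = "a \<odot>\<^bsub>E\<^esub> \<sigma> (app pt x)"
    have gx: "app (g a) (app pt x) = app (g a) x" by (rule absorb_app(1)[OF g_pt(2)[OF a]])
    have s: "?s \<in> carrier E" "p ?s = \<Phi> (app (g a) x)" using \<sigma>c \<sigma>p gS[OF a] by auto
    have t: "?t \<in> carrier E" "p ?t = \<Phi> (app (g a) x)"
      using E.X.smult_closed[OF a \<sigma>c[OF ptin]] p(3)[OF \<sigma>c[OF ptin] \<sigma>c[OF ptin] a] \<sigma>p[OF ptin] \<Phi>g[OF a ptin, of x] gx by auto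
    let ?z = "?t \<oplus>\<^bsub>E\<^esub> E.act (- 1) ?s"
    have z: "?z \<in> carrier E" using t(1) E.act_simps(1)[OF s(1)] by simp
    have \<Phi>x: "\<Phi> (app (g a) x) \<in> carrier X" by (rule \<Phi>c[OF gS[OF a]])
    have "p ?z = \<Phi> (app (g a) x) \<oplus>\<^bsub>X\<^esub> M.act (- 1) (\<Phi> (app (g a) x))"
      using p(2)[OF t(1) E.act_simps(1)[OF s(1)]] p(3)[OF s(1) s(1) M.sc1] t(2) s(2) by simp
    also have "\<dots> = \<zero>\<^bsub>X\<^esub>" using M.act_neg(1)[OF \<Phi>x] M.X.M.a_comm[OF \<Phi>x M.act_simps(1)[OF \<Phi>x]] by simp
    finally have "?z \<in> i ` carrier X" using ker z by blast
    then obtain m where m: "m \<in> carrier X" "?z = i m" by blast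
    obtain y where "y \<in> SP" "m = \<Phi> y" using \<Phi>surj[OF m(1)] by blast
    then have y: "y \<in> SP" "\<kappa> y = ?z" using m(2) by (simp_all add: \<kappa>_def)
    have "\<kappa> y \<oplus>\<^bsub>E\<^esub> ?s = ?t" unfolding y(2) using t(1) s(1) E.act_simps(1)[OF s(1)] E.act_neg(1)[OF s(1)] by (simp add: E.X.M.a_assoc)
    then show ?thesis using y(1) by blast
  qed
  define \<delta> where "\<delta> a x = (SOME y. y \<in> SP \<and> \<kappa> y \<oplus>\<^bsub>E\<^esub> \<sigma> (app (g a) x) = a \<odot>\<^bsub>E\<^esub> \<sigma> (app pt x))" for a x
  have \<delta>: "\<delta> a x \<in> SP" "\<kappa> (\<delta> a x) \<oplus>\<^bsub>E\<^esub> \<sigma> (app (g a) x) = a \<odot>\<^bsub>E\<^esub> \<sigma> (app pt x)" if "a \<in> carrier \<Lambda>" for a x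
    using someI_ex[OF ex[OF that, of x, unfolded Bex_def]] unfolding \<delta>_def by blast+
  have \<delta>u: "\<delta> a x = y" if a: "a \<in> carrier \<Lambda>" and y: "y \<in> SP" "\<kappa> y \<oplus>\<^bsub>E\<^esub> \<sigma> (app (g a) x) = a \<odot>\<^bsub>E\<^esub> \<sigma> (app pt x)" for a x y
  proof (rule \<kappa>i[OF _ \<delta>(1)[OF a] y(1)])
    show "\<kappa> (\<delta> a x) = \<kappa> y" using y(2) \<delta>(2)[OF a, of x, symmetric] \<kappa>c[OF y(1)] \<kappa>c[OF \<delta>(1)[OF a]] \<sigma>c[OF gS[OF a]]
      by (simp add: E.X.M.add.right_cancel)
  qed
  have lin: "Vector_Spaces.linear scl scl (\<delta> a)" if a: "a \<in> carrier \<Lambda>" for a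
  proof -
    have "\<delta> a (x + y) = \<delta> a x + \<delta> a y" for x y
    proof (rule \<delta>u[OF a supp_sp_closed(1)[OF \<delta>(1)[OF a] \<delta>(1)[OF a]]])
      have "a \<odot>\<^bsub>E\<^esub> \<sigma> (app pt (x + y)) = a \<odot>\<^bsub>E\<^esub> \<sigma> (app pt x) \<oplus>\<^bsub>E\<^esub> a \<odot>\<^bsub>E\<^esub> \<sigma> (app pt y)"
        unfolding app_vec(1) \<sigma>a[OF ptin ptin] by (rule E.X.smult_r_distr[OF a \<sigma>c[OF ptin] \<sigma>c[OF ptin]])
      then show "\<kappa> (\<delta> a x + \<delta> a y) \<oplus>\<^bsub>E\<^esub> \<sigma> (app (g a) (x + y)) = a \<odot>\<^bsub>E\<^esub> \<sigma> (app pt (x + y))"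
        unfolding \<delta>(2)[OF a, symmetric] app_vec(1)
        by (simp add: \<kappa>a \<delta>(1)[OF a] \<sigma>a gS[OF a] \<kappa>c \<sigma>c E.X.M.a_ac)
    qed
    moreover have "\<delta> a (scl c x) = scl c (\<delta> a x)" for c x
    proof (rule \<delta>u[OF a supp_sp_closed(2)[OF \<delta>(1)[OF a]]])
      have "a \<odot>\<^bsub>E\<^esub> \<sigma> (app pt (scl c x)) = E.act c (a \<odot>\<^bsub>E\<^esub> \<sigma> (app pt x))"
        unfolding app_vec(2) \<sigma>s[OF ptin] by (rule E.act_simps(7)[OF \<sigma>c[OF ptin] a])
      then show "\<kappa> (scl c (\<delta> a x)) \<oplus>\<^bsub>E\<^esub> \<sigma> (app (g a) (scl c x)) = a \<odot>\<^bsub>E\<^esub> \<sigma> (app pt (scl c x))"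
        unfolding \<delta>(2)[OF a, symmetric] app_vec(2)
        by (simp add: \<kappa>s \<delta>(1)[OF a] \<sigma>s gS[OF a] \<kappa>c \<sigma>c E.act_simps(5))
    qed
    ultimately show ?thesis unfolding fv_linear by blast
  qed
  define d where "d a = Endo (\<delta> a)" for a
  have d: "app (d a) = \<delta> a" if "a \<in> carrier \<Lambda>" for a unfolding d_def using lin[OF that] by (simp add: Endo_inverse)
  have dp: "pt * d a = d a" "d a * pt = d a" if a: "a \<in> carrier \<Lambda>" for a
  proof -
    show "pt * d a = d a" by (rule endo_eqI) (simp add: d[OF a] ptS[OF \<delta>(1)[OF a]] del: app_pr)
    have "\<delta> a (app pt x) = \<delta> a x" for x
      by (rule \<delta>u[OF a \<delta>(1)[OF a]]) (simp add: \<delta>(2)[OF a] ptS[OF ptin] absorb_app(1)[OF g_pt(2)[OF a]] del: app_pr)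
    then show "d a * pt = d a" by (intro endo_eqI) (simp add: d[OF a] del: app_pr)
  qed
  have dm: "d (a \<otimes>\<^bsub>\<Lambda>\<^esub> b) = g a * d b + d a * g b" if a: "a \<in> carrier \<Lambda>" and b: "b \<in> carrier \<Lambda>" for a b
  proof (rule endo_eqI)
    fix x
    have ab: "a \<otimes>\<^bsub>\<Lambda>\<^esub> b \<in> carrier \<Lambda>" by (rule \<Lambda>_closed(1)[OF a b])
    have gab: "app (g (a \<otimes>\<^bsub>\<Lambda>\<^esub> b)) x = app (g a) (app (g b) x)" using G(4)[OF a b] by simp
    note cl = \<sigma>c[OF ptin] \<delta>(1)[OF a] \<delta>(1)[OF b] gS[OF a] gS[OF b]
    have "\<delta> (a \<otimes>\<^bsub>\<Lambda>\<^esub> b) x = app (g a) (\<delta> b x) + \<delta> a (app (g b) x)"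
    proof (rule \<delta>u[OF ab supp_sp_closed(1)[OF gS[OF a] \<delta>(1)[OF a]]])
      have "\<kappa> (app (g a) (\<delta> b x) + \<delta> a (app (g b) x)) \<oplus>\<^bsub>E\<^esub> \<sigma> (app (g (a \<otimes>\<^bsub>\<Lambda>\<^esub> b)) x)
          = a \<odot>\<^bsub>E\<^esub> \<kappa> (\<delta> b x) \<oplus>\<^bsub>E\<^esub> (\<kappa> (\<delta> a (app (g b) x)) \<oplus>\<^bsub>E\<^esub> \<sigma> (app (g a) (app (g b) x)))"
        unfolding gab \<kappa>a[OF gS[OF a] \<delta>(1)[OF a]] \<kappa>g[OF a \<delta>(1)[OF b]]
        by (rule E.X.M.a_assoc) (use E.X.smult_closed[OF a] \<kappa>c \<sigma>c cl in auto)
      also have "\<dots> = a \<odot>\<^bsub>E\<^esub> (\<kappa> (\<delta> b x) \<oplus>\<^bsub>E\<^esub> \<sigma> (app (g b) x))"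
        unfolding \<delta>(2)[OF a] ptS[OF gS[OF b]]
        by (rule E.X.smult_r_distr[OF a, symmetric]) (use \<kappa>c \<sigma>c cl in auto)
      also have "\<dots> = (a \<otimes>\<^bsub>\<Lambda>\<^esub> b) \<odot>\<^bsub>E\<^esub> \<sigma> (app pt x)"
        unfolding \<delta>(2)[OF b] by (rule E.X.smult_assoc[OF a b \<sigma>c[OF ptin], symmetric])
      finally show "\<kappa> (app (g a) (\<delta> b x) + \<delta> a (app (g b) x)) \<oplus>\<^bsub>E\<^esub> \<sigma> (app (g (a \<otimes>\<^bsub>\<Lambda>\<^esub> b)) x) = (a \<otimes>\<^bsub>\<Lambda>\<^esub> b) \<odot>\<^bsub>E\<^esub> \<sigma> (app pt x)" .
    qed
    then show "app (d (a \<otimes>\<^bsub>\<Lambda>\<^esub> b)) x = app (g a * d b + d a * g b) x" by (simp add: d[OF a] d[OF b] d[OF ab])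
  qed
  have da: "d (a \<oplus>\<^bsub>\<Lambda>\<^esub> b) = d a + d b" if a: "a \<in> carrier \<Lambda>" and b: "b \<in> carrier \<Lambda>" for a b
  proof (rule endo_eqI)
    fix x
    have ab: "a \<oplus>\<^bsub>\<Lambda>\<^esub> b \<in> carrier \<Lambda>" by (rule \<Lambda>_closed(2)[OF a b])
    have gab: "app (g (a \<oplus>\<^bsub>\<Lambda>\<^esub> b)) x = app (g a) x + app (g b) x" using G(3)[OF a b] by simp
    have "\<delta> (a \<oplus>\<^bsub>\<Lambda>\<^esub> b) x = \<delta> a x + \<delta> b x"
    proof (rule \<delta>u[OF ab supp_sp_closed(1)[OF \<delta>(1)[OF a] \<delta>(1)[OF b]]])
      show "\<kappa> (\<delta> a x + \<delta> b x) \<oplus>\<^bsub>E\<^esub> \<sigma> (app (g (a \<oplus>\<^bsub>\<Lambda>\<^esub> b)) x) = (a \<oplus>\<^bsub>\<Lambda>\<^esub> b) \<odot>\<^bsub>E\<^esub> \<sigma> (app pt x)"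
        unfolding E.X.smult_l_distr[OF a b \<sigma>c[OF ptin]] \<delta>(2)[OF a, symmetric] \<delta>(2)[OF b, symmetric] gab
        by (simp add: \<kappa>a \<delta>(1)[OF a] \<delta>(1)[OF b] \<sigma>a gS[OF a] gS[OF b] \<kappa>c \<sigma>c E.X.M.a_ac)
    qed
    then show "app (d (a \<oplus>\<^bsub>\<Lambda>\<^esub> b)) x = app (d a + d b) x" by (simp add: d[OF a] d[OF b] d[OF ab])
  qed
  have d1: "d \<one>\<^bsub>\<Lambda>\<^esub> = 0"
  proof (rule endo_eqI)
    fix x
    have "app (g \<one>\<^bsub>\<Lambda>\<^esub>) x = app pt x" using G(5) by simp
    then have "\<delta> \<one>\<^bsub>\<Lambda>\<^esub> x = 0" by (intro \<delta>u[OF \<Lambda>_closed(3) supp_sp_closed(3)]) (simp add: \<kappa>0 E.X.smult_one \<sigma>c[OF ptin] del: app_pr)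
    then show "app (d \<one>\<^bsub>\<Lambda>\<^esub>) x = app 0 x" by (simp add: d[OF \<Lambda>_closed(3)])
  qed
  have ds: "d (c \<odot>\<^bsub>\<Lambda>\<^esub> a) = sc c * d a" if a: "a \<in> carrier \<Lambda>" for a c
  proof (rule endo_eqI)
    fix x
    have ca: "c \<odot>\<^bsub>\<Lambda>\<^esub> a \<in> carrier \<Lambda>" by (rule M.L.smult_closed'[OF a])
    have gc: "app (g (c \<odot>\<^bsub>\<Lambda>\<^esub> a)) x = scl c (app (g a) x)" using G(6)[OF a, of c] by simp
    have "\<delta> (c \<odot>\<^bsub>\<Lambda>\<^esub> a) x = scl c (\<delta> a x)"
    proof (rule \<delta>u[OF ca supp_sp_closed(2)[OF \<delta>(1)[OF a]]])
      show "\<kappa> (scl c (\<delta> a x)) \<oplus>\<^bsub>E\<^esub> \<sigma> (app (g (c \<odot>\<^bsub>\<Lambda>\<^esub> a)) x) = (c \<odot>\<^bsub>\<Lambda>\<^esub> a) \<odot>\<^bsub>E\<^esub> \<sigma> (app pt x)"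
        unfolding E.act_simps(6)[OF \<sigma>c[OF ptin] a, symmetric] \<delta>(2)[OF a, symmetric] gc
        by (simp add: \<kappa>s \<delta>(1)[OF a] \<sigma>s gS[OF a] \<kappa>c \<sigma>c E.act_simps(5))
    qed
    then show "app (d (c \<odot>\<^bsub>\<Lambda>\<^esub> a)) x = app (sc c * d a) x" by (simp add: d[OF a] d[OF ca])
  qed
  have dv: "d (ev v) = 0" if v: "v \<in> verts Q" for v
  proof (rule endo_eqI)
    fix x
    note e = ev_in[OF v]
    have "app (g (ev v)) x = app (pr (S v)) (app pt x)" using absorb_app(1)[OF g_pt(2)[OF e], of x] by (simp only: gE[OF v])
    then have "\<delta> (ev v) x = 0" using \<sigma>c[OF gS[OF e, of x]] by (intro \<delta>u[OF e supp_sp_closed(3)]) (simp add: \<kappa>0 \<sigma>e[OF ptin v] del: app_pr)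
    then show "app (d (ev v)) x = app 0 x" by (simp add: d[OF e])
  qed
  have H: "(\<lambda>a. Dual (g a) (d a)) \<in> algebra_hom \<Lambda> C1.C"
    unfolding algebra_hom_def Ring.ring_hom_def
    by (auto simp: C1.C_carrier dual_mult dual_add g_pt dp dm da d1 ds G(3-6))
  obtain h where h: "graded S h" "\<And>b. b \<in> arcs D \<Longrightarrow> d (eb b) = h * A b - A b * h"
    using rig dual_hom_deform[OF H dv] unfolding rigid_rep_def by blast
  have "Dual (g a) (d a) = Dual (g a) (h * g a - g a * h)" if "a \<in> carrier \<Lambda>" for a
    by (rule C1.mpa_hom_eq[OF H inner_dual_hom[OF h(1)] _ _ that]) (simp_all add: dv gE h gradedD(1)[OF h(1)])
  then have dh: "d a + g a * h = h * g a" if "a \<in> carrier \<Lambda>" for a using that by simp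
  have hS: "app h x \<in> SP" for x
  proof (rule absorb_app(2))
    have "h * pt = pt * h" unfolding rD(7) sum_distrib_left sum_distrib_right by (rule sum.cong) (use gradedD(1)[OF h(1)] in auto)
    then show "pt * h = h" using gradedD(2)[OF h(1)] by simp
  qed
  define s where "s m = \<sigma> (\<Psi> m) \<oplus>\<^bsub>E\<^esub> \<kappa> (app h (\<Psi> m))" for m
  have s\<Phi>: "s (\<Phi> x) = \<sigma> x \<oplus>\<^bsub>E\<^esub> \<kappa> (app h x)" if "x \<in> SP" for x by (simp add: s_def \<Psi>(3)[OF that])
  have "s \<in> left_module_hom \<Lambda> X E"
    unfolding left_module_hom_def
  proof (intro CollectI conjI ballI funcsetI)
    fix m assume "m \<in> carrier X"
    then obtain x where x: "x \<in> SP" "m = \<Phi> x" using \<Phi>surj by blast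
    show "s m \<in> carrier E" using x \<sigma>c \<kappa>c hS by (simp add: s\<Phi>)
    fix n assume "n \<in> carrier X"
    then obtain y where y: "y \<in> SP" "n = \<Phi> y" using \<Phi>surj by blast
    have "m \<oplus>\<^bsub>X\<^esub> n = \<Phi> (x + y)" using x y add by simp
    then show "s (m \<oplus>\<^bsub>X\<^esub> n) = s m \<oplus>\<^bsub>E\<^esub> s n"
      using x y s\<Phi>[OF supp_sp_closed(1)[OF x(1) y(1)]] by (simp add: s\<Phi> app_vec(1) \<sigma>a \<kappa>a hS \<sigma>c \<kappa>c E.X.M.a_ac)
  next
    fix a m assume a: "a \<in> carrier \<Lambda>" and "m \<in> carrier X"
    then obtain x where x: "x \<in> SP" "m = \<Phi> x" using \<Phi>surj by blast
    have hg: "app h (app (g a) x) = \<delta> a x + app (g a) (app h x)"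
      using arg_cong[OF dh[OF a], of "\<lambda>f. app f x"] by (simp add: d[OF a])
    have "s (a \<odot>\<^bsub>X\<^esub> m) = s (\<Phi> (app (g a) x))" using \<Phi>g[OF a x(1)] x by simp
    also have "\<dots> = \<sigma> (app (g a) x) \<oplus>\<^bsub>E\<^esub> (\<kappa> (\<delta> a x) \<oplus>\<^bsub>E\<^esub> a \<odot>\<^bsub>E\<^esub> \<kappa> (app h x))"
      unfolding s\<Phi>[OF gS[OF a]] hg \<kappa>a[OF \<delta>(1)[OF a] gS[OF a]] \<kappa>g[OF a hS] ..
    also have "\<dots> = (\<kappa> (\<delta> a x) \<oplus>\<^bsub>E\<^esub> \<sigma> (app (g a) x)) \<oplus>\<^bsub>E\<^esub> a \<odot>\<^bsub>E\<^esub> \<kappa> (app h x)"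
      using \<sigma>c[OF gS[OF a]] \<kappa>c[OF \<delta>(1)[OF a]] E.X.smult_closed[OF a \<kappa>c[OF hS]] by (simp add: E.X.M.a_ac)
    also have "\<dots> = a \<odot>\<^bsub>E\<^esub> (\<sigma> x \<oplus>\<^bsub>E\<^esub> \<kappa> (app h x))"
      unfolding \<delta>(2)[OF a] ptS[OF x(1)] by (rule E.X.smult_r_distr[OF a \<sigma>c[OF x(1)] \<kappa>c[OF hS], symmetric])
    finally show "s (a \<odot>\<^bsub>X\<^esub> m) = a \<odot>\<^bsub>E\<^esub> s m" unfolding x(2) s\<Phi>[OF x(1)] .
  qed
  moreover have "p (s m) = m" if m: "m \<in> carrier X" for m
    using p(2)[OF \<sigma>c \<kappa>c[OF hS], of "\<Psi> m" "\<Psi> m"] \<sigma>p \<kappa>p[OF hS] \<Psi>(1,2)[OF m] m by (simp add: s_def)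
  ultimately show ?thesis by blast
qed

theorem rigid_iff: "Ext1 \<Lambda> X X = {Ext1_zero \<Lambda> X X} \<longleftrightarrow> rigid_rep S A"
  unfolding Ext1_trivial_iff[OF modX modX] using split_imp_rigid rigid_imp_split by blast

theorem rigid_simple_iff: "rigid_simple \<Lambda> X \<longleftrightarrow> simple_rep S A \<and> rigid_rep S A"
  unfolding rigid_simple_def simple_iff rigid_iff using fin_dim by blast

end

context mult_preproj begin

text \<open>Arbitrary coordinates of \<open>X\<close> are changed by \<open>J\<close> and \<open>R\<close> so that the idempotents of the vertices, which are
  orthogonal with sum one, become coordinate projections.\<close>
lemma module_coordinates:
  fixes q :: "'v \<Rightarrow> 'k::field" and X :: "(('v, 'a, 'k) mpa_elem, 'm) module"
  assumes "finite_dim_module (mpa Q lt q) X"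
  obtains S \<Phi> g where "coord_mod Q lt q X S \<Phi> g"
proof -
  let ?\<Lambda> = "mpa Q lt q"
  have Q_fin: "fin_digraph Q" by unfold_locales
  have K: "K_algebra ?\<Lambda>" by (rule mpa_K[OF Q_fin lt])
  have lX: "left_module ?\<Lambda> X" and fd: "vectorspace.fin_dim (class_ring :: 'k ring) (base_field_space ?\<Lambda> X)"
    using assms by (auto simp: finite_dim_module_def)
  interpret M: alg_module ?\<Lambda> X by (intro alg_module.intro K lX)
  obtain n and \<Phi>0 :: "(nat \<Rightarrow> 'k) \<Rightarrow> 'm" where \<Phi>b: "bij_betw \<Phi>0 (supp_sp {..<n}) (carrier X)"
    and \<Phi>l: "\<forall>x y. \<Phi>0 (x + y) = \<Phi>0 x \<oplus>\<^bsub>X\<^esub> \<Phi>0 y" "\<forall>c x. \<Phi>0 (scl c x) = M.act c (\<Phi>0 x)"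
    using coord_space_iso[OF M.bfs_vectorspace fd] unfolding M.bfs_simps by (elim exE conjE)
  note \<Phi>0 = \<Phi>b \<Phi>l(1)[rule_format] \<Phi>l(2)[rule_format]
  let ?T = "{..<n}"
  obtain g0 where g0: "g0 \<in> algebra_hom ?\<Lambda> (corner sc (pr ?T :: 'k endo) UNIV)"
    "\<And>a x. a \<in> carrier ?\<Lambda> \<Longrightarrow> x \<in> supp_sp ?T \<Longrightarrow> \<Phi>0 (app (g0 a) x) = a \<odot>\<^bsub>X\<^esub> \<Phi>0 x"
    using M.coordinate_hom[OF \<Phi>0] by blast
  interpret C0: preproj_corner Q lt sc "pr ?T :: 'k endo" UNIV by (intro preproj_corner.intro mult_preproj_axioms sc_corner)
  let ?ev = "\<lambda>v. mpa_map Q lt q (vertex_elem v)"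
  have ev: "?ev v \<in> carrier ?\<Lambda>" if "v \<in> verts Q" for v by (rule algebra_homD(2)[OF mpa_map_hom[OF C0.QL] C0.ve_closed[OF that]])
  define E where "E v = g0 (?ev v)" for v
  have Em: "E v * E w = (if v = w then E v else 0)" if "v \<in> verts Q" "w \<in> verts Q" for v w
    using C0.mpa_rep_of_hom(1)[OF g0(1)] that unfolding mpa_rep_def quiver_rep_def E_def by blast
  have Es: "(\<Sum>v\<in>verts Q. E v) = pr ?T" unfolding E_def by (rule C0.mpa_rep_of_hom(2)[OF g0(1)])
  have ET: "pr ?T * E v = E v" "E v * pr ?T = E v" if "v \<in> verts Q" for v
    using algebra_homD(2)[OF g0(1) ev[OF that]] by (simp_all add: E_def C0.C_carrier)
  have "\<exists>n. \<forall>S. finite S \<longrightarrow> card S = n \<longrightarrow> (\<exists>\<iota> \<rho>. \<iota> * \<rho> = E v \<and> \<rho> * \<iota> = pr S \<and> \<iota> * pr S = \<iota> \<and> pr S * \<rho> = \<rho>)" if v: "v \<in> verts Q" for v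
  proof -
    have "E v * E v = E v" using Em[OF v v] by simp
    from split_idempotent[OF finite_lessThan this ET(1)[OF v]] show ?thesis by metis
  qed
  then obtain N where N: "\<And>v S. v \<in> verts Q \<Longrightarrow> finite S \<Longrightarrow> card S = N v \<Longrightarrow>
      \<exists>\<iota> \<rho>. \<iota> * \<rho> = E v \<and> \<rho> * \<iota> = pr S \<and> \<iota> * pr S = \<iota> \<and> pr S * \<rho> = \<rho>" by metis
  \<comment> \<open>Disjoint coordinate sets of the prescribed sizes.\<close>
  obtain ix :: "'v \<Rightarrow> nat" where ix: "inj_on ix (verts Q)" using finite_imp_inj_to_nat_seg[OF finite_verts] by blast
  define S where "S v = prod_encode ` ({ix v} \<times> {..<N v})" for v
  have S: "finite (S v)" "card (S v) = N v" for v
    unfolding S_def by (simp_all add: card_image inj_on_def card_cartesian_product)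
  have disj: "disjoint_family_on S (verts Q)"
    using ix by (auto simp: disjoint_family_on_def S_def inj_on_def)
  obtain \<iota> \<rho> where \<iota>\<rho>: "\<And>v. v \<in> verts Q \<Longrightarrow> \<iota> v * \<rho> v = E v" "\<And>v. v \<in> verts Q \<Longrightarrow> \<rho> v * \<iota> v = pr (S v)"
    "\<And>v. v \<in> verts Q \<Longrightarrow> \<iota> v * pr (S v) = \<iota> v" "\<And>v. v \<in> verts Q \<Longrightarrow> pr (S v) * \<rho> v = \<rho> v"
    using N[OF _ S] by metis
  have \<iota>E: "E v * \<iota> v = \<iota> v" if "v \<in> verts Q" for v
    unfolding \<iota>\<rho>(1)[OF that, symmetric] mult.assoc \<iota>\<rho>(2)[OF that] by (rule \<iota>\<rho>(3)[OF that])
  have \<rho>E: "\<rho> v * E v = \<rho> v" if "v \<in> verts Q" for v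
    unfolding \<iota>\<rho>(1)[OF that, symmetric] mult.assoc[symmetric] \<iota>\<rho>(2)[OF that] by (rule \<iota>\<rho>(4)[OF that])
  have \<rho>\<iota>: "\<rho> v * \<iota> w = (if v = w then pr (S v) else 0)" if "v \<in> verts Q" "w \<in> verts Q" for v w
  proof (cases "v = w")
    case False
    have "E v * \<iota> w = 0" by (rule mult_mid_0(2)[of _ "E w"]) (use Em[OF that] False \<iota>E that in auto)
    then have "\<rho> v * \<iota> w = 0" by (rule mult_mid_0(1)[OF \<rho>E[OF that(1)]])
    then show ?thesis using False by simp
  qed (use \<iota>\<rho>(2) that in simp)
  have prS: "pr (S v) * pr (S w) = (0 :: 'k endo)" if "v \<in> verts Q" "w \<in> verts Q" "v \<noteq> w" for v w
    using disj that by (simp add: pr_mult disjoint_family_on_def pr_empty)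
  have \<iota>\<rho>': "\<iota> v * \<rho> w = (if v = w then E v else 0)" if "v \<in> verts Q" "w \<in> verts Q" for v w
  proof (cases "v = w")
    case False
    have "pr (S v) * \<rho> w = 0" by (rule mult_mid_0(2)[OF prS[OF that False] \<iota>\<rho>(4)[OF that(2)]])
    then have "\<iota> v * \<rho> w = 0" by (rule mult_mid_0(1)[OF \<iota>\<rho>(3)[OF that(1)]])
    then show ?thesis using False by simp
  qed (use \<iota>\<rho>(1) that in simp)
  define J where "J = (\<Sum>v\<in>verts Q. \<iota> v)"
  define R where "R = (\<Sum>v\<in>verts Q. \<rho> v)"
  have ptot: "pr (tot S) = (\<Sum>v\<in>verts Q. pr (S v) :: 'k endo)" unfolding tot_def by (rule pr_UN[OF finite_verts disj])
  have \<rho>J: "\<rho> v * J = pr (S v)" if v: "v \<in> verts Q" for v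
    unfolding J_def sum_distrib_left by (simp add: \<rho>\<iota>[OF v] v cong: sum.cong)
  have \<iota>R: "\<iota> v * R = E v" if v: "v \<in> verts Q" for v
    unfolding R_def sum_distrib_left by (simp add: \<iota>\<rho>'[OF v] v cong: sum.cong)
  have RJ: "R * J = pr (tot S)" unfolding ptot R_def sum_distrib_right by (rule sum.cong) (simp_all add: \<rho>J)
  have JR: "J * R = pr ?T" unfolding Es[symmetric] J_def sum_distrib_right by (rule sum.cong) (simp_all add: \<iota>R)
  have TJ: "pr ?T * J = J" unfolding J_def sum_distrib_left
    by (rule sum.cong) (simp_all add: mult_absorb(1)[OF ET(1) \<iota>E])
  have "pr (tot S) * \<rho> v = \<rho> v" if v: "v \<in> verts Q" for v by (rule mult_absorb(1)[OF pr_tot(1)[OF v, of S] \<iota>\<rho>(4)[OF v]])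
  then have SR: "pr (tot S) * R = R" unfolding R_def sum_distrib_left by simp
  have JS: "J * pr (S v) = E v * J" if v: "v \<in> verts Q" for v
  proof -
    have "E v * J = \<iota> v * (\<rho> v * J)" by (simp only: \<iota>\<rho>(1)[OF v, symmetric] mult.assoc)
    then have 1: "E v * J = \<iota> v" using \<rho>J[OF v] \<iota>\<rho>(3)[OF v] by simp
    have "\<iota> w * pr (S v) = (if w = v then \<iota> v else 0)" if w: "w \<in> verts Q" for w
      using mult_mid_0(1)[OF \<iota>\<rho>(3)[OF w] prS[OF w v]] \<iota>\<rho>(3)[OF v] by (cases "w = v") auto
    then have "J * pr (S v) = \<iota> v" unfolding J_def sum_distrib_right using v by (simp cong: sum.cong)
    then show ?thesis using 1 by simp
  qed
  have supp: "app f x \<in> supp_sp Z" if "pr Z * f = f" for f :: "'k endo" and x Z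
    using arg_cong[OF that, of "\<lambda>f. app f x"] pr_supp[of Z "app f x"] by (simp del: app_pr)
  have JRx: "app J (app R x) = x" if "x \<in> supp_sp ?T" for x
    using arg_cong[OF JR, of "\<lambda>f. app f x"] pr_supp[of ?T x] that by (simp del: app_pr)
  have RJx: "app R (app J x) = x" if "x \<in> supp_sp (tot S)" for x
    using arg_cong[OF RJ, of "\<lambda>f. app f x"] pr_supp[of "tot S" x] that by (simp del: app_pr)
  note Jin = supp[OF TJ] and Rin = supp[OF SR]
  define \<Phi> where "\<Phi> x = \<Phi>0 (app J x)" for x
  have bijJ: "bij_betw (app J) (supp_sp (tot S)) (supp_sp ?T)"
    by (rule bij_betw_byWitness[where f' = "app R"]) (use JRx RJx Jin Rin in auto)
  have bij: "bij_betw \<Phi> (supp_sp (tot S)) (carrier X)" using bij_betw_trans[OF bijJ \<Phi>0(1)] by (simp add: \<Phi>_def[abs_def] comp_def)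
  have add: "\<Phi> (x + y) = \<Phi> x \<oplus>\<^bsub>X\<^esub> \<Phi> y" for x y unfolding \<Phi>_def app_vec(1) by (rule \<Phi>0(2))
  have scale: "\<Phi> (scl c x) = M.act c (\<Phi> x)" for c x unfolding \<Phi>_def app_vec(2) by (rule \<Phi>0(3))
  obtain g where g: "g \<in> algebra_hom ?\<Lambda> (corner sc (pr (tot S) :: 'k endo) UNIV)"
    "\<And>a x. a \<in> carrier ?\<Lambda> \<Longrightarrow> x \<in> supp_sp (tot S) \<Longrightarrow> \<Phi> (app (g a) x) = a \<odot>\<^bsub>X\<^esub> \<Phi> x"
    using M.coordinate_hom[OF bij add scale] by blast
  have gE: "g (?ev v) = pr (S v)" if v: "v \<in> verts Q" for v
  proof -
    note e = ev[OF v]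
    have gp: "pr (tot S) * g (?ev v) = g (?ev v)" "g (?ev v) * pr (tot S) = g (?ev v)"
      using algebra_homD(2)[OF g(1) e] by (simp_all add: corner_def)
    have "g (?ev v) * pr (tot S) = pr (S v) * pr (tot S)"
    proof (rule endo_eqI)
      fix x :: "nat \<Rightarrow> 'k"
      let ?y = "app (pr (tot S)) x"
      have y: "?y \<in> supp_sp (tot S)" by (rule pr_in)
      have "\<Phi> (app (g (?ev v)) ?y) = ?ev v \<odot>\<^bsub>X\<^esub> \<Phi>0 (app J ?y)" using g(2)[OF e y] by (simp add: \<Phi>_def del: app_pr)
      also have "\<dots> = \<Phi>0 (app (E v * J) ?y)" using g0(2)[OF e Jin, of ?y] by (simp add: E_def del: app_pr)
      also have "\<dots> = \<Phi> (app (pr (S v)) ?y)" unfolding JS[OF v, symmetric] by (simp add: \<Phi>_def del: app_pr)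
      finally have "\<Phi> (app (g (?ev v)) ?y) = \<Phi> (app (pr (S v)) ?y)" .
      then have "app (g (?ev v)) ?y = app (pr (S v)) ?y"
        using bij supp[OF gp(1), of ?y] supp[OF pr_tot(1)[OF v, of S], of ?y] unfolding bij_betw_def inj_on_def by blast
      then show "app (g (?ev v) * pr (tot S)) x = app (pr (S v) * pr (tot S)) x" by (simp del: app_pr)
    qed
    then show ?thesis unfolding gp(2) pr_tot(2)[OF v] .
  qed
  have "coord_mod Q lt q X S \<Phi> g"
    by (intro coord_mod.intro coord_mod_axioms.intro mult_preproj_axioms lX S(1) disj bij add g gE)
  then show ?thesis by (rule that)
qed

text \<open>Here the space is its own system of coordinates.\<close>
lemma representation_module:
  fixes q :: "'v \<Rightarrow> 'k::field" and A :: "'a darrow \<Rightarrow> 'k endo"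
  assumes "coord_rep q S A"
  obtains X :: "(('v, 'a, 'k) mpa_elem, nat \<Rightarrow> 'k) module" and g where "coord_mod Q lt q X S (\<lambda>x. x) g"
    "\<And>b. b \<in> arcs D \<Longrightarrow> g (mpa_map Q lt q (arrow_elem D b)) = A b"
proof -
  note r = coord_repD[OF assms]
  let ?\<Lambda> = "mpa Q lt q"
  have Q_fin: "fin_digraph Q" by unfold_locales
  have R: "ring ?\<Lambda>" by (rule K_algebra.axioms(1)[OF mpa_K[OF Q_fin lt]])
  let ?pt = "pr (tot S) :: 'k endo"
  interpret C0: preproj_corner Q lt sc ?pt UNIV by (intro preproj_corner.intro mult_preproj_axioms sc_corner)
  have m: "mpa_rep sc q (\<lambda>v. pr (S v)) A" using assms by (simp add: coord_rep_def)
  have "\<exists>g. g \<in> algebra_hom ?\<Lambda> C0.C \<and> (\<forall>v\<in>verts Q. g (mpa_map Q lt q (vertex_elem v)) = pr (S v)) \<and> (\<forall>b\<in>arcs D. g (mpa_map Q lt q (arrow_elem D b)) = A b)"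
    by (rule C0.hom_of_mpa_rep[OF r(4) r(7)[symmetric] UNIV_I UNIV_I m UNIV_I])
  then obtain g where g: "g \<in> algebra_hom ?\<Lambda> C0.C" "\<And>v. v \<in> verts Q \<Longrightarrow> g (mpa_map Q lt q (vertex_elem v)) = pr (S v)"
    "\<And>b. b \<in> arcs D \<Longrightarrow> g (mpa_map Q lt q (arrow_elem D b)) = A b" by blast
  note G = algebra_homD[OF g(1)]
  have gS: "app (g a) x \<in> supp_sp (tot S)" if "a \<in> carrier ?\<Lambda>" for a x
  proof -
    have "?pt * g a = g a" using G(2)[OF that] by (simp add: C0.C_carrier)
    from arg_cong[OF this, of "\<lambda>f. app f x"] show ?thesis using pr_supp[of "tot S" "app (g a) x"] by (simp del: app_pr)
  qed
  define X :: "(('v, 'a, 'k) mpa_elem, nat \<Rightarrow> 'k) module" where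
    "X = \<lparr>carrier = supp_sp (tot S), mult = undefined, one = undefined, zero = 0, add = (+), smult = \<lambda>a x. app (g a) x\<rparr>"
  have Xs: "carrier X = supp_sp (tot S)" "x \<oplus>\<^bsub>X\<^esub> y = x + y" "\<zero>\<^bsub>X\<^esub> = 0" "a \<odot>\<^bsub>X\<^esub> x = app (g a) x" for x y a by (simp_all add: X_def)
  have "abelian_group X"
  proof (rule abelian_groupI)
    show "\<exists>y\<in>carrier X. y \<oplus>\<^bsub>X\<^esub> x = \<zero>\<^bsub>X\<^esub>" if "x \<in> carrier X" for x
      using supp_sp_closed(4)[of x "tot S"] that by (intro bexI[of _ "- x"]) (simp_all add: Xs)
  qed (simp_all add: Xs supp_sp_closed add.assoc add.commute)
  moreover have "app (g \<one>\<^bsub>?\<Lambda>\<^esub>) x = x" if "x \<in> supp_sp (tot S)" for x using G(5) that pr_supp[of "tot S" x] by (simp del: app_pr)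
  ultimately have lX: "left_module ?\<Lambda> X"
    unfolding left_module_def left_module_axioms_def using R G(3,4) by (simp add: Xs gS app_vec(1))
  have "coord_mod Q lt q X S (\<lambda>x. x) g"
    by (intro coord_mod.intro coord_mod_axioms.intro mult_preproj_axioms lX r(1,2) g(1,2)) (simp_all add: Xs bij_betw_def)
  then show ?thesis using g(3) by (rule that)
qed

theorem rigid_simple_exists_iff:
  fixes q :: "'v \<Rightarrow> 'k::field"
  assumes q: "\<And>v. v \<in> verts Q \<Longrightarrow> q v \<noteq> 0" and \<alpha>: "\<alpha> \<in> root_lattice Q"
  shows "(\<exists>X :: (('v, 'a, 'k) mpa_elem, nat \<Rightarrow> 'k) module. rigid_simple (mpa Q lt q) X \<and> dimension_vector Q lt q X = \<alpha>) \<longleftrightarrow>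
    \<alpha> \<in> real_roots Q \<and> positive Q \<alpha> \<and> q_power Q q \<alpha> = 1 \<and> \<not> decomp q \<alpha>"
proof
  assume "\<exists>X :: (('v, 'a, 'k) mpa_elem, nat \<Rightarrow> 'k) module. rigid_simple (mpa Q lt q) X \<and> dimension_vector Q lt q X = \<alpha>"
  then obtain X :: "(('v, 'a, 'k) mpa_elem, nat \<Rightarrow> 'k) module" where X: "rigid_simple (mpa Q lt q) X" "dimension_vector Q lt q X = \<alpha>" by blast
  have "finite_dim_module (mpa Q lt q) X" using X(1) by (simp add: rigid_simple_def)
  then obtain S \<Phi> g where "coord_mod Q lt q X S \<Phi> g" by (rule module_coordinates)
  then interpret c: coord_mod Q lt q X S \<Phi> g .
  have d: "dimv S = \<alpha>" using c.dimension X(2) by simp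
  have sr: "simple_rep S c.A" "rigid_rep S c.A" using c.rigid_simple_iff X(1) by auto
  interpret e: first_order Q lt q S c.A by unfold_locales (rule c.coord_repA)
  have "0 < form (dimv S) (dimv S)" by (rule e.rigid_form[OF sr(2)]) (use sr(1) in \<open>simp add: simple_rep_def\<close>)
  then show "\<alpha> \<in> real_roots Q \<and> positive Q \<alpha> \<and> q_power Q q \<alpha> = 1 \<and> \<not> decomp q \<alpha>"
    using simple_rep_root[OF q c.coord_repA sr(1)] dimv_lattice[of S] dimv_nonneg[of S] unfolding d by (auto simp: positive_def)
next
  assume a: "\<alpha> \<in> real_roots Q \<and> positive Q \<alpha> \<and> q_power Q q \<alpha> = 1 \<and> \<not> decomp q \<alpha>"
  have p: "0 \<le> \<alpha> x" for x using a \<alpha> by (cases "x \<in> verts Q") (auto simp: positive_def root_lattice_def)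
  obtain S and A :: "'a darrow \<Rightarrow> 'k endo" where A: "coord_rep q S A" "simple_rep S A" "brick S A" "dimv S = \<alpha>"
    using real_root_rep[of q \<alpha>] q a p by blast
  interpret e: first_order Q lt q S A by unfold_locales (rule A(1))
  have f2: "form (dimv S) (dimv S) = 2" unfolding A(4) using a real_root_form by blast
  have rig: "rigid_rep S A" by (rule e.brick_rigid[OF A(3) _ f2]) (rule q)
  obtain X :: "(('v, 'a, 'k) mpa_elem, nat \<Rightarrow> 'k) module" and g where X: "coord_mod Q lt q X S (\<lambda>x. x) g"
    "\<And>b. b \<in> arcs D \<Longrightarrow> g (mpa_map Q lt q (arrow_elem D b)) = A b"
    using representation_module[OF A(1)] by blast
  interpret c: coord_mod Q lt q X S "\<lambda>x. x" g by (rule X(1))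
  have "simple_rep S c.A" using A(2) by (simp add: simple_rep_def subrep_def X(2))
  moreover have "rigid_rep S c.A"
  proof -
    have "deform S c.A \<xi> \<longleftrightarrow> deform S A \<xi>" for \<xi>
    proof -
      have "mpa_rep (\<lambda>c. Dual (sc c) 0) q (\<lambda>v. Dual (pr (S v)) 0) (\<lambda>b. Dual (c.A b) (\<xi> b)) \<longleftrightarrow>
          mpa_rep (\<lambda>c. Dual (sc c) 0) q (\<lambda>v. Dual (pr (S v)) 0) (\<lambda>b. Dual (A b) (\<xi> b))"
        by (intro iffI; erule mpa_rep_cong) (simp_all add: X(2))
      then show ?thesis using deform_dual[OF c.coord_repA] deform_dual[OF A(1)] by blast
    qed
    then show ?thesis using rig by (simp add: rigid_rep_def X(2))
  qed
  ultimately have "rigid_simple (mpa Q lt q) X" using c.rigid_simple_iff by blast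
  then show "\<exists>X :: (('v, 'a, 'k) mpa_elem, nat \<Rightarrow> 'k) module. rigid_simple (mpa Q lt q) X \<and> dimension_vector Q lt q X = \<alpha>"
    using c.dimension A(4) by auto
qed

end

theorem theorem1p9:
  fixes Q :: "('v, 'a) pre_digraph"
    and lt :: "'a darrow rel"
    and q :: "'v \<Rightarrow> 'k::field"
    and \<alpha> :: "'v \<Rightarrow> int"
  assumes "fin_digraph Q"
    and "strict_linear_order_on (arcs (double Q)) lt"
    and "\<forall>v\<in>verts Q. q v \<noteq> 0"
    and "\<alpha> \<in> root_lattice Q"
  shows "(\<exists>X :: (('v, 'a, 'k) mpa_elem, nat \<Rightarrow> 'k) module.
            rigid_simple (mpa Q lt q) X \<and> dimension_vector Q lt q X = \<alpha>) \<longleftrightarrow>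
         \<alpha> \<in> real_roots Q \<and> positive Q \<alpha> \<and> q_power Q q \<alpha> = 1 \<and>
         \<not> (\<exists>\<beta>s. length \<beta>s \<ge> 2 \<and> \<alpha> = (\<lambda>v. \<Sum>\<beta>\<leftarrow>\<beta>s. \<beta> v) \<and>
              (\<forall>\<beta>\<in>set \<beta>s. \<beta> \<in> positive_roots Q \<and> q_power Q q \<beta> = 1))"
proof -
  interpret mult_preproj Q lt using assms(1,2) by (intro mult_preproj.intro quiver.intro mult_preproj_axioms.intro)
  show ?thesis using rigid_simple_exists_iff[OF _ assms(4), of q] assms(3) unfolding decomp_def by blast
qed

end
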